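(* Let $\mathcal L$ be a specification language among FO, BA, ABA, ETL or $\mu\mathrm{TL}$. Given a flat counter system $S$ of dimension $n$, a control state $q$ of $S$ and a specification $A$ in $\mathcal L$, one can effectively build an existential Presburger formula $\phi(z_1,\dots,z_n)$ such that for all $\mathbf v\in\mathbb{N}^n$, $\mathbf v\models\phi$ iff there is a run $\rho$ of $S$ starting at $\langle q,\mathbf v\rangle$ such that $\rho\models A$.
   Context: Counter systems. Let $\mathrm{AT}$ be a countably infinite set of propositional variables and $\mathtt{C}_n=\{x_1,\dots,x_n\}$ a set of counters (variables over $\mathbb{N}$). An atomic guard is a constraint $\sum_{i=1}^n a_i x_i\sim b$ with $a_i\in\mathbb{Z}$, $b\in\mathbb{N}$, $\sim\,\in\{=,\le,\ge,<,>\}$; $\mathtt{G}(\mathtt{C}_n)$ is the set of guards, i.e. Boolean combinations of atomic guards; $\mathbf v\in\mathbb{N}^n$ satisfies a guard $g$ ($\mathbf v\models g$) if $g$ holds when $x_i$ is replaced by $\mathbf v[i]$. A counter system of dimension $n$ is $S=\langle Q,\mathtt{C}_n,\Delta,\mathbf{l}\rangle$ with $Q$ a finite set of control states, $\mathbf{l}:Q\to 2^{\mathrm{AT}}$ a labeling, and $\Delta\subseteq Q\times\mathtt{G}(\mathtt{C}_n)\times\mathbb{Z}^n\times Q$ a finite set of transitions. Configurations are elements of $Q\times\mathbb{N}^n$; there is a step $\langle q,\mathbf v\rangle\to\langle q',\mathbf v'\rangle$ iff there is $\langle q,g,\mathbf u,q'\rangle\in\Delta$ with $\mathbf v\models g$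 and $\mathbf v'=\mathbf v+\mathbf u\in\mathbb{N}^n$. A run from a configuration $c_0$ is an infinite path $c_0\to c_1\to\cdots$. $S$ is flat if every node of its underlying graph belongs to at most one simple cycle (a cycle with no repeated edge). Constrained alphabets. A constrained alphabet is a triple $\langle at,ag_n,\Sigma\rangle$ with $at\subseteq\mathrm{AT}$ finite, $ag_n$ a finite set of atomic guards over $\mathtt{C}_n$, and $\Sigma\subseteq 2^{at\cup ag_n}$. A run $\rho=\langle q_0,\mathbf v_0\rangle\to\langle q_1,\mathbf v_1\rangle\to\cdots$ satisfies $w=a_0a_1\cdots\in\Sigma^\omega$, written $\rho\models w$, if for all $i\ge 0$: for every $p\in at$, $p\in a_i$ iff $p\in\mathbf l(q_i)$; and for every $g\in ag_n$, $g\in a_i$ iff $\mathbf v_i\models g$. A specification $A$ over $\langle at,ag_n,\Sigma\rangle$ defines a language $\mathrm{L}(A)\subseteq\Sigma^\omega$; $\rho\models A$ means $\rho\models w$ for some $w\in\mathrm{L}(A)$. Specification languages. $\mathbb{B}(X)$ (resp. $\mathbb{B}^+(X)$) denotes the Boolean (resp. positive Boolean) combinations over $X$; a letter $a\subseteq at\cup ag_n$ is read as the propositional valuation making exactly the atoms in $a$ true. BA: $A=\langle Q,E,q_0,F\rangle$ with $Q$ finite, $q_0\in Q$, $F\subseteq Q$, $E$ a finite subset of $Q\times\mathbb{B}(at\cup ag_n)\times Q$; it represents the Büchi automaton with a transition $q\xrightarrow{a}q'$ iff there is $\langle q,\psi,q'\rangle\in E$ with $a\models\psi$, and $\mathrm{L}(A)$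 is its language. ABA: as BA but $E$ is a finite subset of $Q\times\mathbb{B}(at\cup ag_n)\times\mathbb{B}^+(Q)$; it represents the alternating Büchi automaton with $\delta(q,a)=\bigvee_{\langle q,\psi,\psi'\rangle\in E,\ a\models\psi}\psi'$, and $\mathrm{L}(A)$ is its language. A BA or ABA specification is over $\langle at,ag_n,\Sigma\rangle$ if each $\psi$ occurring in $E$ is satisfied at most by letters of $\Sigma$. For the logics, specifications are sentences/closed formulas $\phi$, over $\langle at,ag_n,2^{at\cup ag_n}\rangle$; an atom $p\in at$ or $g\in ag_n$ holds at position $i$ of an $\omega$-word $w$ over $2^{at\cup ag_n}$ iff it belongs to $w(i)$; $\mathrm{L}(\phi)$ is the set of $\omega$-words satisfying $\phi$ (at position $0$ for temporal logics). FO: $\phi::=p(z)\mid g(z)\mid S(z,z')\mid z<z'\mid z=z'\mid\neg\phi\mid\phi\wedge\phi\mid\exists z\,\phi$, variables ranging over positions in $\mathbb{N}$, $S(z,z')$ meaning $z'=z+1$. $\mu\mathrm{TL}$ (linear $\mu$-calculus): $\phi::=p\mid g\mid z\mid\neg\phi\mid\phi\wedge\phi\mid\mathsf X\phi\mid\mathsf X^{-1}\phi\mid\mu z.\phi$, $z$ occurring only positively in $\phi$ in $\mu z.\phi$ (least fixed point over sets of positions; $\mathsf X$ next, $\mathsf X^{-1}$ previous). ETL: $\phi::=p\mid g\mid\neg\phi\mid\phi\wedge\phi\mid\mathcal A(\phi_1,\dots,\phi_m)$, where $\mathcal A$ is a finite-state automaton over $\{b_1,\dots,b_m\}$; $\mathcal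 A(\phi_1,\dots,\phi_m)$ holds at position $i$ iff there is a finite word $b_{k_0}\cdots b_{k_{r-1}}$ accepted by $\mathcal A$ such that $\phi_{k_j}$ holds at position $i+j$ for all $0\le j<r$. *)

theory Defs
  imports Main "HOL-Library.Nat_Bijection"
begin

section \<open>Boolean combinations\<close>

datatype (bf_atoms: 'a) bform =
  BTrue | BAtom 'a | BNot "'a bform" | BAnd "'a bform" "'a bform" | BOr "'a bform" "'a bform"

primrec bf_sat :: "('a \<Rightarrow> bool) \<Rightarrow> 'a bform \<Rightarrow> bool" where
  "bf_sat V BTrue \<longleftrightarrow> True"
| "bf_sat V (BAtom x) \<longleftrightarrow> V x"
| "bf_sat V (BNot f) \<longleftrightarrow> \<not> bf_sat V f"
| "bf_sat V (BAnd f g) \<longleftrightarrow> bf_sat V f \<and> bf_sat V g"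
| "bf_sat V (BOr f g) \<longleftrightarrow> bf_sat V f \<or> bf_sat V g"

datatype (pbf_atoms: 'a) pbform =
  PBTrue | PBFalse | PBAtom 'a | PBAnd "'a pbform" "'a pbform" | PBOr "'a pbform" "'a pbform"

primrec pbf_sat :: "('a \<Rightarrow> bool) \<Rightarrow> 'a pbform \<Rightarrow> bool" where
  "pbf_sat V PBTrue \<longleftrightarrow> True"
| "pbf_sat V PBFalse \<longleftrightarrow> False"
| "pbf_sat V (PBAtom x) \<longleftrightarrow> V x"
| "pbf_sat V (PBAnd f g) \<longleftrightarrow> pbf_sat V f \<and> pbf_sat V g"
| "pbf_sat V (PBOr f g) \<longleftrightarrow> pbf_sat V f \<or> pbf_sat V g"


section \<open>Counter systems\<close>

text \<open>
  Propositional variables and control states are natural numbers, and the counters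
  \<open>x\<^sub>1, \<dots>, x\<^sub>n\<close> are the positions \<open>0, \<dots>, n - 1\<close> of lists of length \<open>n\<close>.
\<close>

datatype cmp = CEq | CLe | CGe | CLt | CGt

primrec cmp_sat :: "cmp \<Rightarrow> int \<Rightarrow> int \<Rightarrow> bool" where
  "cmp_sat CEq x y \<longleftrightarrow> x = y"
| "cmp_sat CLe x y \<longleftrightarrow> x \<le> y"
| "cmp_sat CGe x y \<longleftrightarrow> x \<ge> y"
| "cmp_sat CLt x y \<longleftrightarrow> x < y"
| "cmp_sat CGt x y \<longleftrightarrow> x > y"

datatype aguard = AGuard (coeffs: "int list") (rel: cmp) (bound: nat)

type_synonym guard = "aguard bform"

definition aguards :: "nat \<Rightarrow> aguard set" where
  "aguards n = {g. length (coeffs g) = n}"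

definition guards :: "nat \<Rightarrow> guard set" where
  "guards n = {g. bf_atoms g \<subseteq> aguards n}"

definition aguard_sat :: "nat list \<Rightarrow> aguard \<Rightarrow> bool" where
  "aguard_sat v g \<longleftrightarrow>
     cmp_sat (rel g) (\<Sum>i<length (coeffs g). coeffs g ! i * int (v ! i)) (int (bound g))"

definition guard_sat :: "nat list \<Rightarrow> guard \<Rightarrow> bool" where
  "guard_sat v g \<longleftrightarrow> bf_sat (aguard_sat v) g"

type_synonym transition = "nat \<times> guard \<times> int list \<times> nat"

abbreviation src :: "transition \<Rightarrow> nat" where "src t \<equiv> fst t"
abbreviation tgt :: "transition \<Rightarrow> nat" where "tgt t \<equiv> snd (snd (snd t))"

record counter_system =
  cs_states :: "nat set"
  cs_label :: "nat \<Rightarrow> nat set"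
  cs_trans :: "transition set"

definition is_counter_system :: "nat \<Rightarrow> counter_system \<Rightarrow> bool" where
  "is_counter_system n S \<longleftrightarrow>
     finite (cs_states S) \<and> finite (cs_trans S) \<and>
     (\<forall>(q, g, u, q') \<in> cs_trans S.
        q \<in> cs_states S \<and> g \<in> guards n \<and> length u = n \<and> q' \<in> cs_states S)"

type_synonym config = "nat \<times> nat list"

definition step :: "nat \<Rightarrow> counter_system \<Rightarrow> config \<Rightarrow> config \<Rightarrow> bool" where
  "step n S c c' \<longleftrightarrow>
     (case (c, c') of ((q, v), (q', v')) \<Rightarrow>
        length v = n \<and> length v' = n \<and>
        (\<exists>g u. (q, g, u, q') \<in> cs_trans S \<and> guard_sat v g \<and>
               (\<forall>i<n. int (v' ! i) = int (v ! i) + u ! i)))"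

definition is_run :: "nat \<Rightarrow> counter_system \<Rightarrow> config \<Rightarrow> (nat \<Rightarrow> config) \<Rightarrow> bool" where
  "is_run n S c \<rho> \<longleftrightarrow> \<rho> 0 = c \<and> (\<forall>i. step n S (\<rho> i) (\<rho> (Suc i)))"

text \<open>
  The underlying graph is the multigraph whose edges are the transitions, so parallel transitions
  yield different cycles. A cycle is given by its edges in order, from an arbitrary starting point;
  hence two edge lists denote the same cycle iff one is a rotation of the other.
\<close>

definition simple_cycle :: "counter_system \<Rightarrow> transition list \<Rightarrow> bool" where
  "simple_cycle S es \<longleftrightarrow>
     es \<noteq> [] \<and> set es \<subseteq> cs_trans S \<and> distinct es \<and>
     (\<forall>i<length es. tgt (es ! i) = src (es ! (Suc i mod length es)))"

definition flat :: "counter_system \<Rightarrow> bool" where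
  "flat S \<longleftrightarrow>
     (\<forall>q \<in> cs_states S. \<forall>es es'.
        simple_cycle S es \<and> q \<in> src ` set es \<and> simple_cycle S es' \<and> q \<in> src ` set es' \<longrightarrow>
        (\<exists>k. es' = rotate k es))"


section \<open>Constrained alphabets\<close>

datatype atom = Prop nat | Grd aguard

type_synonym letter = "atom set"

record calphabet =
  ca_props :: "nat set"
  ca_guards :: "aguard set"
  ca_letters :: "letter set"

definition ca_atoms :: "calphabet \<Rightarrow> atom set" where
  "ca_atoms Al = Prop ` ca_props Al \<union> Grd ` ca_guards Al"

definition is_calphabet :: "nat \<Rightarrow> calphabet \<Rightarrow> bool" where
  "is_calphabet n Al \<longleftrightarrow>
     finite (ca_props Al) \<and> finite (ca_guards Al) \<and> ca_guards Al \<subseteq> aguards n \<and>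
     ca_letters Al \<subseteq> Pow (ca_atoms Al)"

definition run_sat_word ::
    "counter_system \<Rightarrow> calphabet \<Rightarrow> (nat \<Rightarrow> config) \<Rightarrow> (nat \<Rightarrow> letter) \<Rightarrow> bool" where
  "run_sat_word S Al \<rho> w \<longleftrightarrow>
     (\<forall>i. (\<forall>p \<in> ca_props Al. Prop p \<in> w i \<longleftrightarrow> p \<in> cs_label S (fst (\<rho> i))) \<and>
          (\<forall>g \<in> ca_guards Al. Grd g \<in> w i \<longleftrightarrow> aguard_sat (snd (\<rho> i)) g))"

abbreviation letter_sat :: "letter \<Rightarrow> atom bform \<Rightarrow> bool" where
  "letter_sat a \<psi> \<equiv> bf_sat (\<lambda>x. x \<in> a) \<psi>"


section \<open>Automata specifications\<close>

text \<open>The type parameter is the type of edge targets: states for BA, and positive Boolean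
  combinations of states for ABA.\<close>

record 't automaton =
  au_states :: "nat set"
  au_edges :: "(nat \<times> atom bform \<times> 't) set"
  au_init :: nat
  au_final :: "nat set"

type_synonym ba = "nat automaton"
type_synonym aba = "nat pbform automaton"

definition is_automaton :: "calphabet \<Rightarrow> (nat set \<Rightarrow> 't set) \<Rightarrow> 't automaton \<Rightarrow> bool" where
  "is_automaton Al targets A \<longleftrightarrow>
     finite (au_states A) \<and> au_init A \<in> au_states A \<and> au_final A \<subseteq> au_states A \<and>
     finite (au_edges A) \<and>
     (\<forall>(q, \<psi>, t) \<in> au_edges A.
        q \<in> au_states A \<and> t \<in> targets (au_states A) \<and> bf_atoms \<psi> \<subseteq> ca_atoms Al \<and>
        (\<forall>a \<subseteq> ca_atoms Al. letter_sat a \<psi> \<longrightarrow> a \<in> ca_letters Al))"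

definition is_ba :: "calphabet \<Rightarrow> ba \<Rightarrow> bool" where
  "is_ba Al A \<longleftrightarrow> is_automaton Al (\<lambda>Q. Q) A"

definition is_aba :: "calphabet \<Rightarrow> aba \<Rightarrow> bool" where
  "is_aba Al A \<longleftrightarrow> is_automaton Al (\<lambda>Q. {\<psi>. pbf_atoms \<psi> \<subseteq> Q}) A"

definition ba_accepts :: "ba \<Rightarrow> (nat \<Rightarrow> letter) \<Rightarrow> bool" where
  "ba_accepts A w \<longleftrightarrow>
     (\<exists>r. r 0 = au_init A \<and>
          (\<forall>i. \<exists>\<psi>. (r i, \<psi>, r (Suc i)) \<in> au_edges A \<and> letter_sat (w i) \<psi>) \<and>
          (\<exists>\<^sub>\<infinity>i. r i \<in> au_final A))"

text \<open>Satisfaction, by a set of states, of the disjunction \<open>\<delta>(q, a)\<close> of the targets of all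
  edges leaving \<open>q\<close> that are enabled by \<open>a\<close>.\<close>

definition aba_delta_sat :: "aba \<Rightarrow> nat \<Rightarrow> letter \<Rightarrow> nat set \<Rightarrow> bool" where
  "aba_delta_sat A q a Y \<longleftrightarrow>
     (\<exists>\<psi> \<psi>'. (q, \<psi>, \<psi>') \<in> au_edges A \<and> letter_sat a \<psi> \<and> pbf_sat (\<lambda>y. y \<in> Y) \<psi>')"

text \<open>A run of an alternating automaton is a state-labelled tree: \<open>T\<close> is the set of nodes (a
  prefix-closed set of addresses) and \<open>r\<close> the labelling. It is accepting if every infinite branch
  \<open>\<beta>\<close> visits final states infinitely often; branches may be finite.\<close>

definition aba_run :: "aba \<Rightarrow> (nat \<Rightarrow> letter) \<Rightarrow> nat list set \<Rightarrow> (nat list \<Rightarrow> nat) \<Rightarrow> bool" where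
  "aba_run A w T r \<longleftrightarrow>
     [] \<in> T \<and> (\<forall>x k. x @ [k] \<in> T \<longrightarrow> x \<in> T) \<and>
     (\<forall>x \<in> T. r x \<in> au_states A) \<and> r [] = au_init A \<and>
     (\<forall>x \<in> T. aba_delta_sat A (r x) (w (length x)) {r (x @ [k]) | k. x @ [k] \<in> T})"

definition aba_accepts :: "aba \<Rightarrow> (nat \<Rightarrow> letter) \<Rightarrow> bool" where
  "aba_accepts A w \<longleftrightarrow>
     (\<exists>T r. aba_run A w T r \<and>
        (\<forall>\<beta> :: nat \<Rightarrow> nat. (\<forall>i. map \<beta> [0..<i] \<in> T) \<longrightarrow>
              (\<exists>\<^sub>\<infinity>i. r (map \<beta> [0..<i]) \<in> au_final A)))"


section \<open>First-order logic\<close>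

datatype (fo_atoms: 'a) fo =
  FAtom 'a nat | FSucc nat nat | FLess nat nat | FEq nat nat
| FNot "'a fo" | FAnd "'a fo" "'a fo" | FEx nat "'a fo"

primrec fo_fv :: "'a fo \<Rightarrow> nat set" where
  "fo_fv (FAtom x z) = {z}"
| "fo_fv (FSucc z z') = {z, z'}"
| "fo_fv (FLess z z') = {z, z'}"
| "fo_fv (FEq z z') = {z, z'}"
| "fo_fv (FNot \<phi>) = fo_fv \<phi>"
| "fo_fv (FAnd \<phi> \<psi>) = fo_fv \<phi> \<union> fo_fv \<psi>"
| "fo_fv (FEx z \<phi>) = fo_fv \<phi> - {z}"

primrec fo_sat :: "(nat \<Rightarrow> 'a set) \<Rightarrow> (nat \<Rightarrow> nat) \<Rightarrow> 'a fo \<Rightarrow> bool" where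
  "fo_sat w e (FAtom x z) \<longleftrightarrow> x \<in> w (e z)"
| "fo_sat w e (FSucc z z') \<longleftrightarrow> e z' = Suc (e z)"
| "fo_sat w e (FLess z z') \<longleftrightarrow> e z < e z'"
| "fo_sat w e (FEq z z') \<longleftrightarrow> e z = e z'"
| "fo_sat w e (FNot \<phi>) \<longleftrightarrow> \<not> fo_sat w e \<phi>"
| "fo_sat w e (FAnd \<phi> \<psi>) \<longleftrightarrow> fo_sat w e \<phi> \<and> fo_sat w e \<psi>"
| "fo_sat w e (FEx z \<phi>) \<longleftrightarrow> (\<exists>i. fo_sat w (e(z := i)) \<phi>)"


section \<open>Linear mu-calculus\<close>

datatype (mu_atoms: 'a) mutl =
  MAtom 'a | MVar nat | MNot "'a mutl" | MAnd "'a mutl" "'a mutl"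
| MNext "'a mutl" | MPrev "'a mutl" | MMu nat "'a mutl"

primrec mu_fv :: "'a mutl \<Rightarrow> nat set" where
  "mu_fv (MAtom x) = {}"
| "mu_fv (MVar z) = {z}"
| "mu_fv (MNot \<phi>) = mu_fv \<phi>"
| "mu_fv (MAnd \<phi> \<psi>) = mu_fv \<phi> \<union> mu_fv \<psi>"
| "mu_fv (MNext \<phi>) = mu_fv \<phi>"
| "mu_fv (MPrev \<phi>) = mu_fv \<phi>"
| "mu_fv (MMu z \<phi>) = mu_fv \<phi> - {z}"

text \<open>\<open>mu_polarity b z \<phi>\<close>: all free occurrences of \<open>z\<close> in \<open>\<phi>\<close> are positive (if \<open>b\<close>),
  respectively negative (if \<open>\<not> b\<close>).\<close>

primrec mu_polarity :: "bool \<Rightarrow> nat \<Rightarrow> 'a mutl \<Rightarrow> bool" where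
  "mu_polarity b z (MAtom x) \<longleftrightarrow> True"
| "mu_polarity b z (MVar y) \<longleftrightarrow> (y = z \<longrightarrow> b)"
| "mu_polarity b z (MNot \<phi>) \<longleftrightarrow> mu_polarity (\<not> b) z \<phi>"
| "mu_polarity b z (MAnd \<phi> \<psi>) \<longleftrightarrow> mu_polarity b z \<phi> \<and> mu_polarity b z \<psi>"
| "mu_polarity b z (MNext \<phi>) \<longleftrightarrow> mu_polarity b z \<phi>"
| "mu_polarity b z (MPrev \<phi>) \<longleftrightarrow> mu_polarity b z \<phi>"
| "mu_polarity b z (MMu y \<phi>) \<longleftrightarrow> (y = z \<or> mu_polarity b z \<phi>)"

primrec mu_wf :: "'a mutl \<Rightarrow> bool" where
  "mu_wf (MAtom x) \<longleftrightarrow> True"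
| "mu_wf (MVar z) \<longleftrightarrow> True"
| "mu_wf (MNot \<phi>) \<longleftrightarrow> mu_wf \<phi>"
| "mu_wf (MAnd \<phi> \<psi>) \<longleftrightarrow> mu_wf \<phi> \<and> mu_wf \<psi>"
| "mu_wf (MNext \<phi>) \<longleftrightarrow> mu_wf \<phi>"
| "mu_wf (MPrev \<phi>) \<longleftrightarrow> mu_wf \<phi>"
| "mu_wf (MMu z \<phi>) \<longleftrightarrow> mu_polarity True z \<phi> \<and> mu_wf \<phi>"

primrec mu_sem :: "(nat \<Rightarrow> 'a set) \<Rightarrow> (nat \<Rightarrow> nat set) \<Rightarrow> 'a mutl \<Rightarrow> nat set" where
  "mu_sem w e (MAtom x) = {i. x \<in> w i}"
| "mu_sem w e (MVar z) = e z"
| "mu_sem w e (MNot \<phi>) = - mu_sem w e \<phi>"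
| "mu_sem w e (MAnd \<phi> \<psi>) = mu_sem w e \<phi> \<inter> mu_sem w e \<psi>"
| "mu_sem w e (MNext \<phi>) = {i. Suc i \<in> mu_sem w e \<phi>}"
| "mu_sem w e (MPrev \<phi>) = {Suc i | i. i \<in> mu_sem w e \<phi>}"
| "mu_sem w e (MMu z \<phi>) = lfp (\<lambda>M. mu_sem w (e(z := M)) \<phi>)"


section \<open>Extended temporal logic\<close>

text \<open>Finite-state automata are nondeterministic; the letters \<open>b\<^sub>1, \<dots>, b\<^sub>m\<close> are
  represented by \<open>0, \<dots>, m - 1\<close>.\<close>

datatype nfa = NFA
  (nfa_states: "nat set") (nfa_trans: "(nat \<times> nat \<times> nat) set")
  (nfa_init: "nat set") (nfa_final: "nat set")

definition is_nfa :: "nat \<Rightarrow> nfa \<Rightarrow> bool" where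
  "is_nfa m M \<longleftrightarrow>
     finite (nfa_states M) \<and> nfa_init M \<subseteq> nfa_states M \<and> nfa_final M \<subseteq> nfa_states M \<and>
     nfa_trans M \<subseteq> nfa_states M \<times> {..<m} \<times> nfa_states M"

definition nfa_accepts :: "nfa \<Rightarrow> nat list \<Rightarrow> bool" where
  "nfa_accepts M ks \<longleftrightarrow>
     (\<exists>r. r 0 \<in> nfa_init M \<and> (\<forall>j<length ks. (r j, ks ! j, r (Suc j)) \<in> nfa_trans M) \<and>
          r (length ks) \<in> nfa_final M)"

datatype (etl_atoms: 'a) etl =
  EAtom 'a | ENot "'a etl" | EAnd "'a etl" "'a etl" | EAut nfa "'a etl list"

fun etl_wf :: "'a etl \<Rightarrow> bool" where
  "etl_wf (EAtom x) \<longleftrightarrow> True"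
| "etl_wf (ENot \<phi>) \<longleftrightarrow> etl_wf \<phi>"
| "etl_wf (EAnd \<phi> \<psi>) \<longleftrightarrow> etl_wf \<phi> \<and> etl_wf \<psi>"
| "etl_wf (EAut M \<phi>s) \<longleftrightarrow> is_nfa (length \<phi>s) M \<and> (\<forall>\<phi> \<in> set \<phi>s. etl_wf \<phi>)"

primrec etl_sat :: "'a etl \<Rightarrow> (nat \<Rightarrow> 'a set) \<Rightarrow> nat \<Rightarrow> bool" where
  "etl_sat (EAtom x) w i \<longleftrightarrow> x \<in> w i"
| "etl_sat (ENot \<phi>) w i \<longleftrightarrow> \<not> etl_sat \<phi> w i"
| "etl_sat (EAnd \<phi> \<psi>) w i \<longleftrightarrow> etl_sat \<phi> w i \<and> etl_sat \<psi> w i"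
| "etl_sat (EAut M \<phi>s) w i \<longleftrightarrow>
     (\<exists>ks. nfa_accepts M ks \<and> (\<forall>j<length ks. (map etl_sat \<phi>s ! (ks ! j)) w (i + j)))"


section \<open>Specifications\<close>

datatype language = FO | BA | ABA | ETL | MuTL

datatype spec =
  SpecFO "atom fo" | SpecBA ba | SpecABA aba | SpecETL "atom etl" | SpecMuTL "atom mutl"

fun specifications :: "language \<Rightarrow> calphabet \<Rightarrow> spec set" where
  "specifications FO Al = {SpecFO \<phi> | \<phi>.
     ca_letters Al = Pow (ca_atoms Al) \<and> fo_atoms \<phi> \<subseteq> ca_atoms Al \<and> fo_fv \<phi> = {}}"
| "specifications BA Al = {SpecBA A | A. is_ba Al A}"
| "specifications ABA Al = {SpecABA A | A. is_aba Al A}"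
| "specifications ETL Al = {SpecETL \<phi> | \<phi>.
     ca_letters Al = Pow (ca_atoms Al) \<and> etl_atoms \<phi> \<subseteq> ca_atoms Al \<and> etl_wf \<phi>}"
| "specifications MuTL Al = {SpecMuTL \<phi> | \<phi>.
     ca_letters Al = Pow (ca_atoms Al) \<and> mu_atoms \<phi> \<subseteq> ca_atoms Al \<and> mu_fv \<phi> = {} \<and> mu_wf \<phi>}"

text \<open>The valuations of the variables below are arbitrary, since the formulas are closed.\<close>

primrec spec_accepts :: "spec \<Rightarrow> (nat \<Rightarrow> letter) \<Rightarrow> bool" where
  "spec_accepts (SpecFO \<phi>) w \<longleftrightarrow> fo_sat w (\<lambda>_. 0) \<phi>"
| "spec_accepts (SpecBA A) w \<longleftrightarrow> ba_accepts A w"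
| "spec_accepts (SpecABA A) w \<longleftrightarrow> aba_accepts A w"
| "spec_accepts (SpecETL \<phi>) w \<longleftrightarrow> etl_sat \<phi> w 0"
| "spec_accepts (SpecMuTL \<phi>) w \<longleftrightarrow> 0 \<in> mu_sem w (\<lambda>_. {}) \<phi>"

definition lang :: "calphabet \<Rightarrow> spec \<Rightarrow> (nat \<Rightarrow> letter) set" where
  "lang Al A = {w. range w \<subseteq> ca_letters Al \<and> spec_accepts A w}"

definition run_sat :: "counter_system \<Rightarrow> calphabet \<Rightarrow> (nat \<Rightarrow> config) \<Rightarrow> spec \<Rightarrow> bool" where
  "run_sat S Al \<rho> A \<longleftrightarrow> (\<exists>w \<in> lang Al A. run_sat_word S Al \<rho> w)"


section \<open>Presburger arithmetic\<close>

datatype pterm = TVar nat | TZero | TOne | TAdd pterm pterm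

datatype pform =
  PEq pterm pterm | PLe pterm pterm | PNot pform | PAnd pform pform | POr pform pform
| PEx nat pform

primrec pt_val :: "(nat \<Rightarrow> nat) \<Rightarrow> pterm \<Rightarrow> nat" where
  "pt_val e (TVar x) = e x"
| "pt_val e TZero = 0"
| "pt_val e TOne = 1"
| "pt_val e (TAdd s t) = pt_val e s + pt_val e t"

primrec pf_sat :: "(nat \<Rightarrow> nat) \<Rightarrow> pform \<Rightarrow> bool" where
  "pf_sat e (PEq s t) \<longleftrightarrow> pt_val e s = pt_val e t"
| "pf_sat e (PLe s t) \<longleftrightarrow> pt_val e s \<le> pt_val e t"
| "pf_sat e (PNot \<phi>) \<longleftrightarrow> \<not> pf_sat e \<phi>"
| "pf_sat e (PAnd \<phi> \<psi>) \<longleftrightarrow> pf_sat e \<phi> \<and> pf_sat e \<psi>"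
| "pf_sat e (POr \<phi> \<psi>) \<longleftrightarrow> pf_sat e \<phi> \<or> pf_sat e \<psi>"
| "pf_sat e (PEx x \<phi>) \<longleftrightarrow> (\<exists>k. pf_sat (e(x := k)) \<phi>)"

primrec pt_vars :: "pterm \<Rightarrow> nat set" where
  "pt_vars (TVar x) = {x}"
| "pt_vars TZero = {}"
| "pt_vars TOne = {}"
| "pt_vars (TAdd s t) = pt_vars s \<union> pt_vars t"

primrec pf_fv :: "pform \<Rightarrow> nat set" where
  "pf_fv (PEq s t) = pt_vars s \<union> pt_vars t"
| "pf_fv (PLe s t) = pt_vars s \<union> pt_vars t"
| "pf_fv (PNot \<phi>) = pf_fv \<phi>"
| "pf_fv (PAnd \<phi> \<psi>) = pf_fv \<phi> \<union> pf_fv \<psi>"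
| "pf_fv (POr \<phi> \<psi>) = pf_fv \<phi> \<union> pf_fv \<psi>"
| "pf_fv (PEx x \<phi>) = pf_fv \<phi> - {x}"

primrec pf_qfree :: "pform \<Rightarrow> bool" where
  "pf_qfree (PEq s t) \<longleftrightarrow> True"
| "pf_qfree (PLe s t) \<longleftrightarrow> True"
| "pf_qfree (PNot \<phi>) \<longleftrightarrow> pf_qfree \<phi>"
| "pf_qfree (PAnd \<phi> \<psi>) \<longleftrightarrow> pf_qfree \<phi> \<and> pf_qfree \<psi>"
| "pf_qfree (POr \<phi> \<psi>) \<longleftrightarrow> pf_qfree \<phi> \<and> pf_qfree \<psi>"
| "pf_qfree (PEx x \<phi>) \<longleftrightarrow> False"

definition existential_presburger :: "pform \<Rightarrow> bool" where
  "existential_presburger \<phi> \<longleftrightarrow> (\<exists>xs \<psi>. pf_qfree \<psi> \<and> \<phi> = foldr PEx xs \<psi>)"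

text \<open>Satisfaction of a formula with free variables among \<open>z\<^sub>1, \<dots>, z\<^sub>n\<close>, represented by
  \<open>0, \<dots>, n - 1\<close>, by a vector of length \<open>n\<close>; the value at larger indices is irrelevant.\<close>

definition presburger_sat :: "nat list \<Rightarrow> pform \<Rightarrow> bool" where
  "presburger_sat v \<phi> \<longleftrightarrow> pf_sat (\<lambda>i. v ! i) \<phi>"


section \<open>General recursive functions\<close>

text \<open>
  \<open>general_recursive k f\<close>: on argument lists of length \<open>k\<close>, \<open>f\<close> is a total recursive
  function in the sense of Kleene. The last rule is minimisation, restricted as usual to functions
  for which it yields a total function.
\<close>

inductive general_recursive :: "nat \<Rightarrow> (nat list \<Rightarrow> nat) \<Rightarrow> bool" where
  zero: "general_recursive k (\<lambda>xs. 0)"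
| succ: "general_recursive 1 (\<lambda>xs. Suc (xs ! 0))"
| proj: "i < k \<Longrightarrow> general_recursive k (\<lambda>xs. xs ! i)"
| comp: "general_recursive (length gs) f \<Longrightarrow> (\<forall>g \<in> set gs. general_recursive k g) \<Longrightarrow>
    general_recursive k (\<lambda>xs. f (map (\<lambda>g. g xs) gs))"
| prim_rec: "general_recursive k f \<Longrightarrow> general_recursive (Suc (Suc k)) g \<Longrightarrow>
    general_recursive (Suc k) (\<lambda>xs. rec_nat (f (tl xs)) (\<lambda>m r. g (m # r # tl xs)) (hd xs))"
| minimisation: "general_recursive (Suc k) f \<Longrightarrow>
    (\<forall>xs. length xs = k \<longrightarrow> (\<exists>m. f (m # xs) = 0)) \<Longrightarrow>
    general_recursive k (\<lambda>xs. LEAST m. f (m # xs) = 0)"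


section \<open>Goedel numbering\<close>

text \<open>
  Constructor number \<open>c\<close> applied to arguments with codes \<open>k\<^sub>1, \<dots>, k\<^sub>r\<close> is coded as
  \<open>list_encode [c, k\<^sub>1, \<dots>, k\<^sub>r]\<close>; a finite set is coded as \<open>set_encode\<close> of the set of the codes
  of its elements.
\<close>

definition set_code :: "('a \<Rightarrow> nat) \<Rightarrow> 'a set \<Rightarrow> nat" where
  "set_code c A = set_encode (c ` A)"

primrec bform_code :: "('a \<Rightarrow> nat) \<Rightarrow> 'a bform \<Rightarrow> nat" where
  "bform_code c BTrue = list_encode [0]"
| "bform_code c (BAtom x) = list_encode [1, c x]"
| "bform_code c (BNot f) = list_encode [2, bform_code c f]"
| "bform_code c (BAnd f g) = list_encode [3, bform_code c f, bform_code c g]"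
| "bform_code c (BOr f g) = list_encode [4, bform_code c f, bform_code c g]"

primrec pbform_code :: "('a \<Rightarrow> nat) \<Rightarrow> 'a pbform \<Rightarrow> nat" where
  "pbform_code c PBTrue = list_encode [0]"
| "pbform_code c PBFalse = list_encode [1]"
| "pbform_code c (PBAtom x) = list_encode [2, c x]"
| "pbform_code c (PBAnd f g) = list_encode [3, pbform_code c f, pbform_code c g]"
| "pbform_code c (PBOr f g) = list_encode [4, pbform_code c f, pbform_code c g]"

primrec cmp_code :: "cmp \<Rightarrow> nat" where
  "cmp_code CEq = 0"
| "cmp_code CLe = 1"
| "cmp_code CGe = 2"
| "cmp_code CLt = 3"
| "cmp_code CGt = 4"

definition vec_code :: "int list \<Rightarrow> nat" where
  "vec_code u = list_encode (map int_encode u)"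

definition aguard_code :: "aguard \<Rightarrow> nat" where
  "aguard_code g = list_encode [vec_code (coeffs g), cmp_code (rel g), bound g]"

definition trans_code :: "transition \<Rightarrow> nat" where
  "trans_code t =
     (case t of (q, g, u, q') \<Rightarrow> list_encode [q, bform_code aguard_code g, vec_code u, q'])"

text \<open>Sets \<open>\<^bold>l(q)\<close> may be infinite; only the restriction of the labelling to the
  propositional variables of the alphabet is part of the (finite) input.\<close>

definition system_code :: "calphabet \<Rightarrow> counter_system \<Rightarrow> nat" where
  "system_code Al S = list_encode
     [set_code id (cs_states S),
      set_code prod_encode {(q, p). q \<in> cs_states S \<and> p \<in> cs_label S q \<inter> ca_props Al},
      set_code trans_code (cs_trans S)]"

primrec atom_code :: "atom \<Rightarrow> nat" where
  "atom_code (Prop p) = list_encode [0, p]"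
| "atom_code (Grd g) = list_encode [1, aguard_code g]"

definition calphabet_code :: "calphabet \<Rightarrow> nat" where
  "calphabet_code Al = list_encode
     [set_code id (ca_props Al), set_code aguard_code (ca_guards Al),
      set_code (set_code atom_code) (ca_letters Al)]"

definition automaton_code :: "('t \<Rightarrow> nat) \<Rightarrow> 't automaton \<Rightarrow> nat" where
  "automaton_code c A = list_encode
     [set_code id (au_states A),
      set_code (\<lambda>(q, \<psi>, t). list_encode [q, bform_code atom_code \<psi>, c t]) (au_edges A),
      au_init A, set_code id (au_final A)]"

primrec fo_code :: "('a \<Rightarrow> nat) \<Rightarrow> 'a fo \<Rightarrow> nat" where
  "fo_code c (FAtom x z) = list_encode [0, c x, z]"
| "fo_code c (FSucc z z') = list_encode [1, z, z']"
| "fo_code c (FLess z z') = list_encode [2, z, z']"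
| "fo_code c (FEq z z') = list_encode [3, z, z']"
| "fo_code c (FNot \<phi>) = list_encode [4, fo_code c \<phi>]"
| "fo_code c (FAnd \<phi> \<psi>) = list_encode [5, fo_code c \<phi>, fo_code c \<psi>]"
| "fo_code c (FEx z \<phi>) = list_encode [6, z, fo_code c \<phi>]"

primrec mu_code :: "('a \<Rightarrow> nat) \<Rightarrow> 'a mutl \<Rightarrow> nat" where
  "mu_code c (MAtom x) = list_encode [0, c x]"
| "mu_code c (MVar z) = list_encode [1, z]"
| "mu_code c (MNot \<phi>) = list_encode [2, mu_code c \<phi>]"
| "mu_code c (MAnd \<phi> \<psi>) = list_encode [3, mu_code c \<phi>, mu_code c \<psi>]"
| "mu_code c (MNext \<phi>) = list_encode [4, mu_code c \<phi>]"
| "mu_code c (MPrev \<phi>) = list_encode [5, mu_code c \<phi>]"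
| "mu_code c (MMu z \<phi>) = list_encode [6, z, mu_code c \<phi>]"

definition nfa_code :: "nfa \<Rightarrow> nat" where
  "nfa_code M = list_encode
     [set_code id (nfa_states M), set_code (\<lambda>(s, b, s'). list_encode [s, b, s']) (nfa_trans M),
      set_code id (nfa_init M), set_code id (nfa_final M)]"

primrec etl_code :: "('a \<Rightarrow> nat) \<Rightarrow> 'a etl \<Rightarrow> nat" where
  "etl_code c (EAtom x) = list_encode [0, c x]"
| "etl_code c (ENot \<phi>) = list_encode [1, etl_code c \<phi>]"
| "etl_code c (EAnd \<phi> \<psi>) = list_encode [2, etl_code c \<phi>, etl_code c \<psi>]"
| "etl_code c (EAut M \<phi>s) = list_encode [3, nfa_code M, list_encode (map (etl_code c) \<phi>s)]"

primrec spec_code :: "spec \<Rightarrow> nat" where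
  "spec_code (SpecFO \<phi>) = list_encode [0, fo_code atom_code \<phi>]"
| "spec_code (SpecBA A) = list_encode [1, automaton_code id A]"
| "spec_code (SpecABA A) = list_encode [2, automaton_code (pbform_code id) A]"
| "spec_code (SpecETL \<phi>) = list_encode [3, etl_code atom_code \<phi>]"
| "spec_code (SpecMuTL \<phi>) = list_encode [4, mu_code atom_code \<phi>]"

definition input_code :: "nat \<Rightarrow> counter_system \<Rightarrow> nat \<Rightarrow> calphabet \<Rightarrow> spec \<Rightarrow> nat" where
  "input_code n S q Al A =
     list_encode [n, system_code Al S, q, calphabet_code Al, spec_code A]"

primrec pterm_code :: "pterm \<Rightarrow> nat" where
  "pterm_code (TVar x) = list_encode [0, x]"
| "pterm_code TZero = list_encode [1]"
| "pterm_code TOne = list_encode [2]"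
| "pterm_code (TAdd s t) = list_encode [3, pterm_code s, pterm_code t]"

primrec pform_code :: "pform \<Rightarrow> nat" where
  "pform_code (PEq s t) = list_encode [0, pterm_code s, pterm_code t]"
| "pform_code (PLe s t) = list_encode [1, pterm_code s, pterm_code t]"
| "pform_code (PNot \<phi>) = list_encode [2, pform_code \<phi>]"
| "pform_code (PAnd \<phi> \<psi>) = list_encode [3, pform_code \<phi>, pform_code \<psi>]"
| "pform_code (POr \<phi> \<psi>) = list_encode [4, pform_code \<phi>, pform_code \<psi>]"
| "pform_code (PEx x \<phi>) = list_encode [5, x, pform_code \<phi>]"

lemma pterm_code_eq_iff: "pterm_code s = pterm_code t \<longleftrightarrow> s = t"
  by (induction s arbitrary: t; case_tac t) (auto simp: list_encode_eq simp del: list_encode.simps)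

lemma inj_pform_code: "inj pform_code"
proof -
  have "pform_code \<phi> = pform_code \<psi> \<longleftrightarrow> \<phi> = \<psi>" for \<phi> \<psi>
    by (induction \<phi> arbitrary: \<psi>; case_tac \<psi>)
      (auto simp: list_encode_eq pterm_code_eq_iff simp del: list_encode.simps)
  then show ?thesis
    by (simp add: inj_def)
qed

end

theory Submission
  imports Defs "HOL-Library.Ramsey"
begin

text \<open>
  Every specification translates into a monadic second-order formula over \<open>\<omega>\<close>-words. Such a formula
  is recognised by a finite congruence on blocks, so it can be decided on ultimately periodic words,
  and on \<open>u\<^sub>1\<^bsup>m\<^sub>1\<^esup> \<dots> u\<^sub>k\<^bsup>m\<^sub>k\<^esup> v\<^sup>\<omega>\<close> the exponents matter only below a computable threshold \<open>K\<close> and modulo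
  \<open>K!\<close> above it.

  In a flat system every run has this shape with \<open>k\<close> bounded. The counters change linearly along an
  iterated loop, so each guard changes its sign a bounded number of times there; splitting the
  loops at these changes, a run becomes a word over transitions annotated with the signs of all
  guards, still of the above shape with a computable bound on \<open>k\<close> and on the lengths of the blocks.
  The formula is the disjunction, over the finitely many choices of blocks and of residues for the
  exponents that are accepted by the decision procedure, of the linear constraints stating that the
  annotated signs are the actual ones. By convexity these need only be checked on the first and
  last iteration of each block, and for the final loop on the direction of its effect.
\<close>

section \<open>Primitive recursive functions on encoded data\<close>

text \<open>Congruences replace automata because negation leaves a congruence untouched and
  projection is a power set construction, so no omega-automaton has to be complemented. They are
  never computed: only a bound on the number of classes is, and it limits both the search for
  ultimately periodic witnesses of quantifiers and the exponents to be told apart. Effectiveness is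
  taken literally: a total recursive function has to map the code of the input to the code of the
  formula, so every construction has a counterpart on codes that is shown to be realised by a
  recursive function. The code \<open>x\<close> of the input doubles as a uniform bound. A coded set
  exceeds its elements and a coded term its subterms, so \<open>x\<close> bounds the numbers of
  states and transitions, the lengths of loops and the codes of all guards. Signs are recorded for
  every number below \<open>x\<close> read as a guard code, without collecting the guards that
  occur. Signs rather than truth values are recorded because the negative, the zero and the positive
  integers form convex sets, unlike the truth set of a negated equation.\<close>

definition recursive_fun :: "nat \<Rightarrow> (nat list \<Rightarrow> nat) \<Rightarrow> bool" where
  "recursive_fun k f \<longleftrightarrow> (\<exists>g. general_recursive k g \<and> (\<forall>xs. length xs = k \<longrightarrow> g xs = f xs))"

text \<open>\<open>general_recursive\<close> fixes a function on lists of all lengths, including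
  out-of-range uses of \<open>nth\<close>, so it is not closed under agreement on lists of length
  \<open>k\<close>. Closing it this way permits replacing a function by any expression with the same
  values.\<close>

lemma recursive_fun_cong:
  "recursive_fun k f \<Longrightarrow> (\<And>xs. length xs = k \<Longrightarrow> f xs = g xs) \<Longrightarrow> recursive_fun k g"
  unfolding recursive_fun_def by auto

lemma recursive_fun_proj: "i < k \<Longrightarrow> recursive_fun k (\<lambda>xs. xs ! i)"
  unfolding recursive_fun_def using general_recursive.proj by blast

lemma recursive_fun_comp:
  assumes "recursive_fun (length gs) f" "\<forall>g \<in> set gs. recursive_fun k g"
  shows "recursive_fun k (\<lambda>xs. f (map (\<lambda>g. g xs) gs))"
proof -
  obtain f' where f': "general_recursive (length gs) f'" "\<And>xs. length xs = length gs \<Longrightarrow> f' xs = f xs"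
    using assms(1) unfolding recursive_fun_def by blast
  obtain r where r: "\<And>g. g \<in> set gs \<Longrightarrow> general_recursive k (r g)"
    "\<And>g xs. g \<in> set gs \<Longrightarrow> length xs = k \<Longrightarrow> r g xs = g xs"
    using assms(2) unfolding recursive_fun_def by metis
  have "general_recursive k (\<lambda>xs. f' (map (\<lambda>g. g xs) (map r gs)))"
    by (rule general_recursive.comp) (use f' r in auto)
  moreover have "f' (map (\<lambda>g. g xs) (map r gs)) = f (map (\<lambda>g. g xs) gs)" if "length xs = k" for xs
  proof -
    have "map (\<lambda>g. g xs) (map r gs) = map (\<lambda>g. g xs) gs"
      using r(2) that by simp
    then show ?thesis
      using f'(2) by (metis length_map)
  qed
  ultimately show ?thesis
    unfolding recursive_fun_def by blast
qed

lemma recursive_fun_comp1: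
  "recursive_fun 1 f \<Longrightarrow> recursive_fun k a \<Longrightarrow> recursive_fun k (\<lambda>xs. f [a xs])"
  using recursive_fun_comp[of "[a]" f k] by simp

lemma recursive_fun_Suc: "recursive_fun k a \<Longrightarrow> recursive_fun k (\<lambda>xs. Suc (a xs))"
proof -
  have "recursive_fun 1 (\<lambda>xs. Suc (xs ! 0))"
    unfolding recursive_fun_def using general_recursive.succ by blast
  then show "recursive_fun k a \<Longrightarrow> ?thesis"
    using recursive_fun_comp1[of "\<lambda>xs. Suc (xs ! 0)" k a] by simp
qed

lemma recursive_fun_const: "recursive_fun k (\<lambda>xs. c)"
proof (induction c)
  case 0
  then show ?case
    unfolding recursive_fun_def using general_recursive.zero by blast
qed (rule recursive_fun_Suc)

lemma recursive_fun_rec_nat: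
  assumes "recursive_fun k a" "recursive_fun (Suc (Suc k)) g" "recursive_fun k b"
  shows "recursive_fun k (\<lambda>xs. rec_nat (a xs) (\<lambda>m r. g (m # r # xs)) (b xs))"
proof -
  obtain a' where a': "general_recursive k a'" "\<And>xs. length xs = k \<Longrightarrow> a' xs = a xs"
    using assms(1) unfolding recursive_fun_def by blast
  obtain g' where g': "general_recursive (Suc (Suc k)) g'"
    "\<And>xs. length xs = Suc (Suc k) \<Longrightarrow> g' xs = g xs"
    using assms(2) unfolding recursive_fun_def by blast
  let ?P = "\<lambda>xs. rec_nat (a' (tl xs)) (\<lambda>m r. g' (m # r # tl xs)) (hd xs)"
  \<comment> \<open>Feeding \<open>prim_rec\<close> the recursion argument together with all
    \<open>k\<close> projections rebuilds the list \<open>b xs # xs\<close>, so the parameters stay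
    available.\<close>
  let ?gs = "b # map (\<lambda>i xs. xs ! i) [0..<k]"
  have "recursive_fun (Suc k) ?P"
    unfolding recursive_fun_def using general_recursive.prim_rec[OF a'(1) g'(1)] by blast
  then have "recursive_fun (length ?gs) ?P"
    by simp
  then have "recursive_fun k (\<lambda>xs. ?P (map (\<lambda>g. g xs) ?gs))"
    by (rule recursive_fun_comp) (use assms(3) recursive_fun_proj in auto)
  then show ?thesis
  proof (rule recursive_fun_cong)
    fix xs :: "nat list"
    assume xs: "length xs = k"
    then have "map (\<lambda>g. g xs) ?gs = b xs # xs"
      by (auto intro: nth_equalityI)
    moreover have "rec_nat (a' xs) (\<lambda>m r. g' (m # r # xs)) n = rec_nat (a xs) (\<lambda>m r. g (m # r # xs)) n" for n
      using xs a'(2) g'(2) by (induction n) auto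
    ultimately show "?P (map (\<lambda>g. g xs) ?gs) = rec_nat (a xs) (\<lambda>m r. g (m # r # xs)) (b xs)"
      by simp
  qed
qed

lemma recursive_fun_add:
  assumes "recursive_fun k a" "recursive_fun k b"
  shows "recursive_fun k (\<lambda>xs. a xs + b xs)"
proof -
  have "recursive_fun (Suc (Suc k)) (\<lambda>ys. Suc (ys ! 1))"
    by (intro recursive_fun_Suc recursive_fun_proj) simp
  from recursive_fun_rec_nat[OF assms(1) this assms(2)] show ?thesis
  proof (rule recursive_fun_cong)
    have "rec_nat (a xs) (\<lambda>m r. Suc ((m # r # xs) ! 1)) n = a xs + n" for xs n
      by (induction n) auto
    then show "rec_nat (a xs) (\<lambda>m r. Suc ((m # r # xs) ! 1)) (b xs) = a xs + b xs" for xs .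
  qed
qed

lemma recursive_fun_pred:
  assumes "recursive_fun k a"
  shows "recursive_fun k (\<lambda>xs. a xs - 1)"
proof -
  have "recursive_fun (Suc (Suc k)) (\<lambda>ys. ys ! 0)"
    by (intro recursive_fun_proj) simp
  from recursive_fun_rec_nat[OF recursive_fun_const[of k 0] this assms] show ?thesis
    by (rule recursive_fun_cong) (case_tac "a xs", auto)
qed

lemma recursive_fun_diff:
  assumes "recursive_fun k a" "recursive_fun k b"
  shows "recursive_fun k (\<lambda>xs. a xs - b xs)"
proof -
  have "recursive_fun (Suc (Suc k)) (\<lambda>ys. ys ! 1 - 1)"
    by (intro recursive_fun_pred recursive_fun_proj) simp
  from recursive_fun_rec_nat[OF assms(1) this assms(2)] show ?thesis
  proof (rule recursive_fun_cong)
    have "rec_nat (a xs) (\<lambda>m r. (m # r # xs) ! 1 - 1) n = a xs - n" for xs n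
      by (induction n) auto
    then show "rec_nat (a xs) (\<lambda>m r. (m # r # xs) ! 1 - 1) (b xs) = a xs - b xs" for xs .
  qed
qed

lemma recursive_fun_if:
  assumes "recursive_fun k p" "recursive_fun k a" "recursive_fun k b"
  shows "recursive_fun k (\<lambda>xs. if p xs = 0 then a xs else b xs)"
proof -
  \<comment> \<open>Only the test for zero matters: the recursion step returns \<open>b\<close> and
    ignores counter and previous value, which the shift by 2 skips.\<close>
  let ?b = "\<lambda>ys. b (map (\<lambda>g. g ys) (map (\<lambda>i ys. ys ! (i + 2)) [0..<k]))"
  have "recursive_fun (Suc (Suc k)) ?b"
    by (rule recursive_fun_comp) (use assms(3) recursive_fun_proj in auto)
  from recursive_fun_rec_nat[OF assms(2) this assms(1)] show ?thesis
  proof (rule recursive_fun_cong)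
    fix xs :: "nat list"
    assume "length xs = k"
    then have "map (\<lambda>g. g (m # r # xs)) (map (\<lambda>i ys. ys ! (i + 2)) [0..<k]) = xs" for m r
      by (auto intro: nth_equalityI)
    then show "rec_nat (a xs) (\<lambda>m r. ?b (m # r # xs)) (p xs) = (if p xs = 0 then a xs else b xs)"
      by (cases "p xs") auto
  qed
qed

section \<open>The pairing function and its inverse\<close>

lemma recursive_fun_triangle:
  assumes "recursive_fun k a"
  shows "recursive_fun k (\<lambda>xs. triangle (a xs))"
proof -
  have "recursive_fun (Suc (Suc k)) (\<lambda>ys. ys ! 1 + Suc (ys ! 0))"
    by (intro recursive_fun_add recursive_fun_Suc recursive_fun_proj) auto
  from recursive_fun_rec_nat[OF recursive_fun_const[of k 0] this assms] show ?thesis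
  proof (rule recursive_fun_cong)
    have "rec_nat 0 (\<lambda>m r. (m # r # xs) ! 1 + Suc ((m # r # xs) ! 0)) n = triangle n" for xs n
      by (induction n) auto
    then show "rec_nat 0 (\<lambda>m r. (m # r # xs) ! 1 + Suc ((m # r # xs) ! 0)) (a xs) = triangle (a xs)" for xs .
  qed
qed

lemma recursive_fun_prod_encode:
  "recursive_fun k a \<Longrightarrow> recursive_fun k b \<Longrightarrow> recursive_fun k (\<lambda>xs. prod_encode (a xs, b xs))"
  unfolding prod_encode_def by (auto intro!: recursive_fun_add recursive_fun_triangle)

text \<open>The index of the diagonal of the pairing function that contains \<open>z\<close>.\<close>

definition diagonal :: "nat \<Rightarrow> nat" where
  "diagonal z = rec_nat 0 (\<lambda>z d. if triangle (Suc d) - Suc z = 0 then Suc d else d) z"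

lemma diagonal_bounds: "triangle (diagonal z) \<le> z \<and> z < triangle (Suc (diagonal z))"
  by (induction z) (auto simp: diagonal_def)

lemma triangle_mono: "m \<le> n \<Longrightarrow> triangle m \<le> triangle n"
  by (induction n) (auto simp: le_Suc_eq)

lemma diagonal_unique:
  assumes "triangle d \<le> z" "z < triangle (Suc d)"
  shows "diagonal z = d"
proof -
  have "\<not> diagonal z < d" "\<not> d < diagonal z"
    using assms diagonal_bounds[of z] triangle_mono[of "Suc (diagonal z)" d]
      triangle_mono[of "Suc d" "diagonal z"] by linarith+
  then show ?thesis
    by simp
qed

text \<open>\<open>prod_encode (m, n)\<close> is \<open>triangle (m + n) + m\<close>: the diagonal
  is \<open>m + n\<close>, and the offset on it is \<open>m\<close>.\<close>

lemma prod_decode_diagonal: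
  "fst (prod_decode z) = z - triangle (diagonal z)"
  "snd (prod_decode z) = diagonal z - (z - triangle (diagonal z))"
proof -
  obtain m n where z: "z = prod_encode (m, n)"
    by (metis prod_decode_inverse surj_pair)
  have "diagonal z = m + n"
    by (rule diagonal_unique) (auto simp: z prod_encode_def)
  then show "fst (prod_decode z) = z - triangle (diagonal z)"
    "snd (prod_decode z) = diagonal z - (z - triangle (diagonal z))"
    unfolding z prod_encode_inverse by (simp_all add: prod_encode_def)
qed

lemma recursive_fun_diagonal:
  assumes "recursive_fun k a"
  shows "recursive_fun k (\<lambda>xs. diagonal (a xs))"
proof -
  have "recursive_fun (Suc (Suc k))
      (\<lambda>ys. if triangle (Suc (ys ! 1)) - Suc (ys ! 0) = 0 then Suc (ys ! 1) else ys ! 1)"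
    by (intro recursive_fun_if recursive_fun_diff recursive_fun_triangle recursive_fun_Suc
        recursive_fun_proj) auto
  from recursive_fun_rec_nat[OF recursive_fun_const[of k 0] this assms] show ?thesis
    by (rule recursive_fun_cong) (simp only: diagonal_def nth_Cons_0 nth_Cons_Suc One_nat_def)
qed

lemma recursive_fun_fst: "recursive_fun k a \<Longrightarrow> recursive_fun k (\<lambda>xs. fst (prod_decode (a xs)))"
  unfolding prod_decode_diagonal
  by (intro recursive_fun_diff recursive_fun_triangle recursive_fun_diagonal)

lemma recursive_fun_snd: "recursive_fun k a \<Longrightarrow> recursive_fun k (\<lambda>xs. snd (prod_decode (a xs)))"
  unfolding prod_decode_diagonal
  by (intro recursive_fun_diff recursive_fun_triangle recursive_fun_diagonal)

subsection \<open>Computability with respect to encodings\<close>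

class enc =
  fixes enc :: "'a \<Rightarrow> nat"

instantiation nat :: enc begin
definition enc_nat :: "nat \<Rightarrow> nat" where "enc_nat n = n"
instance ..
end

instantiation bool :: enc begin
definition enc_bool :: "bool \<Rightarrow> nat" where "enc_bool b = (if b then 1 else 0)"
instance ..
end

instantiation int :: enc begin
definition enc_int :: "int \<Rightarrow> nat" where "enc_int = int_encode"
instance ..
end

instantiation prod :: (enc, enc) enc begin
definition enc_prod :: "'a \<times> 'b \<Rightarrow> nat" where "enc_prod p = prod_encode (enc (fst p), enc (snd p))"
instance ..
end

instantiation list :: (enc) enc begin
definition enc_list :: "'a list \<Rightarrow> nat" where "enc_list xs = list_encode (map enc xs)"
instance ..
end

text \<open>Realisation by a recursive function on codes; on numbers that code nothing the realiser
  is unconstrained. The rules collected in \<open>comp\<close> follow the structure of a term, so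
  computability of a definition is proved by applying them to its unfolded body.\<close>

definition computable :: "('a::enc \<Rightarrow> 'b::enc) \<Rightarrow> bool" where
  "computable f \<longleftrightarrow> (\<exists>g. recursive_fun 1 g \<and> (\<forall>x. g [enc x] = enc (f x)))"

named_theorems comp

lemma computable_realizer:
  assumes "computable a" "recursive_fun 1 g" "\<And>x. g [enc (a x)] = enc (f x)"
  shows "computable f"
proof -
  obtain g' where g': "recursive_fun 1 g'" "\<And>x. g' [enc x] = enc (a x)"
    using assms(1) unfolding computable_def by blast
  have "recursive_fun 1 (\<lambda>xs. g [g' xs])"
    by (rule recursive_fun_comp1) fact+
  then show ?thesis
    unfolding computable_def using g'(2) assms(3) by (intro exI[of _ "\<lambda>xs. g [g' xs]"]) auto
qed

text \<open>Functions with the same codes have the same realiser. This makes decoding functions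
  computable through the identity on codes, and later the constructors of the syntax types through
  \<open>list_encode\<close>.\<close>

lemma computable_same_enc:
  assumes "computable a" "\<And>x. enc (f x) = enc (a x)"
  shows "computable f"
  using assms unfolding computable_def by metis

lemma computable_const [comp]: "computable (\<lambda>x. c)"
  unfolding computable_def using recursive_fun_const by blast

lemma computable_id [comp]: "computable (\<lambda>x. x)"
  unfolding computable_def using recursive_fun_proj[of 0 1] by (intro exI[of _ "\<lambda>xs. xs ! 0"]) auto

text \<open>Kept out of \<open>comp\<close>, since its conclusion unifies with every goal. It is
  needed where a parameter is used below a binder.\<close>

lemma computable_compose: "computable f \<Longrightarrow> computable a \<Longrightarrow> computable (\<lambda>x. f (a x))"
proof -
  assume "computable f" "computable a"
  then obtain g where "recursive_fun 1 g" "\<And>x. g [enc x] = enc (f x)"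
    unfolding computable_def by blast
  then show ?thesis
    using computable_realizer[OF \<open>computable a\<close>, of g "\<lambda>x. f (a x)"] by blast
qed

lemma computable_pair [comp]: "computable a \<Longrightarrow> computable b \<Longrightarrow> computable (\<lambda>x. (a x, b x))"
proof -
  assume "computable a" "computable b"
  then obtain f g where "recursive_fun 1 f" "recursive_fun 1 g"
    "\<And>x. f [enc x] = enc (a x)" "\<And>x. g [enc x] = enc (b x)"
    unfolding computable_def by metis
  then show ?thesis
    unfolding computable_def
    by (intro exI[of _ "\<lambda>xs. prod_encode (f xs, g xs)"]) (auto simp: enc_prod_def intro: recursive_fun_prod_encode)
qed

lemma computable_fst [comp]: "computable a \<Longrightarrow> computable (\<lambda>x. fst (a x))"
  by (erule computable_realizer[where g = "\<lambda>xs. fst (prod_decode (xs ! 0))"])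
    (auto simp: enc_prod_def intro: recursive_fun_fst recursive_fun_proj)

lemma computable_snd [comp]: "computable a \<Longrightarrow> computable (\<lambda>x. snd (a x))"
  by (erule computable_realizer[where g = "\<lambda>xs. snd (prod_decode (xs ! 0))"])
    (auto simp: enc_prod_def intro: recursive_fun_snd recursive_fun_proj)

section \<open>Coding functions, arithmetic and Boolean operations\<close>

lemma computable_enc [comp]: "computable a \<Longrightarrow> computable (\<lambda>x. enc (a x))"
  by (erule computable_same_enc) (simp add: enc_nat_def)

lemma computable_list_decode [comp]: "computable a \<Longrightarrow> computable (\<lambda>x. list_decode (a x))"
  by (erule computable_same_enc) (simp add: enc_nat_def enc_list_def map_idI)

lemma computable_list_encode [comp]: "computable a \<Longrightarrow> computable (\<lambda>x. list_encode (a x))"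
  by (erule computable_same_enc) (simp add: enc_nat_def enc_list_def map_idI)

lemma computable_prod_encode [comp]: "computable a \<Longrightarrow> computable (\<lambda>x. prod_encode (a x))"
  by (erule computable_same_enc) (simp add: enc_nat_def enc_prod_def)

lemma computable_prod_decode [comp]: "computable a \<Longrightarrow> computable (\<lambda>x. prod_decode (a x))"
  by (erule computable_same_enc) (simp add: enc_nat_def enc_prod_def)

lemma computable_int_decode [comp]: "computable a \<Longrightarrow> computable (\<lambda>x. int_decode (a x))"
  by (erule computable_same_enc) (simp add: enc_nat_def enc_int_def)

lemma computable_Suc [comp]: "computable a \<Longrightarrow> computable (\<lambda>x. Suc (a x))"
  by (erule computable_realizer[where g = "\<lambda>xs. Suc (xs ! 0)"])
    (auto simp: enc_nat_def intro: recursive_fun_Suc recursive_fun_proj)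

lemma computable_realizer2:
  assumes "computable a" "computable b"
    and "\<And>k u v. recursive_fun k u \<Longrightarrow> recursive_fun k v \<Longrightarrow> recursive_fun k (\<lambda>xs. h (u xs) (v xs))"
    and "\<And>x. h (enc (a x)) (enc (b x)) = enc (f x)"
  shows "computable f"
proof (rule computable_realizer[OF computable_pair[OF assms(1,2)]])
  show "recursive_fun 1 (\<lambda>xs. h (fst (prod_decode (xs ! 0))) (snd (prod_decode (xs ! 0))))"
    by (intro assms(3) recursive_fun_fst recursive_fun_snd recursive_fun_proj) simp_all
qed (simp add: enc_prod_def assms(4))

lemma computable_plus_nat [comp]:
  fixes a b :: "'a::enc \<Rightarrow> nat"
  shows "computable a \<Longrightarrow> computable b \<Longrightarrow> computable (\<lambda>x. a x + b x)"
  by (erule (1) computable_realizer2[where h = "(+)"]) (auto simp: enc_nat_def intro: recursive_fun_add)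

lemma computable_minus_nat [comp]:
  fixes a b :: "'a::enc \<Rightarrow> nat"
  shows "computable a \<Longrightarrow> computable b \<Longrightarrow> computable (\<lambda>x. a x - b x)"
  by (erule (1) computable_realizer2[where h = "(-)"]) (auto simp: enc_nat_def intro: recursive_fun_diff)

lemma computable_if [comp]:
  assumes "computable p" "computable a" "computable b"
  shows "computable (\<lambda>x. if p x then a x else b x)"
proof (rule computable_realizer[OF computable_pair[OF assms(1) computable_pair[OF assms(2,3)]]])
  let ?z = "\<lambda>xs::nat list. prod_decode (xs ! 0)"
  show "recursive_fun 1 (\<lambda>xs. if fst (?z xs) = 0 then snd (prod_decode (snd (?z xs))) else fst (prod_decode (snd (?z xs))))"
    by (intro recursive_fun_if recursive_fun_fst recursive_fun_snd recursive_fun_proj) simp_all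
qed (auto simp: enc_prod_def enc_bool_def)

lemma computable_rec_nat [comp]:
  fixes g :: "'a::enc \<Rightarrow> nat \<Rightarrow> 'b::enc \<Rightarrow> 'b"
  assumes "computable (\<lambda>p. g (fst p) (fst (snd p)) (snd (snd p)))" "computable a" "computable b"
  shows "computable (\<lambda>x. rec_nat (a x) (\<lambda>m r. g x m r) (b x))"
proof -
  obtain g' where g': "recursive_fun 1 g'" "\<And>p. g' [enc p] = enc (g (fst p) (fst (snd p)) (snd (snd p)))"
    using assms(1) unfolding computable_def by blast
  obtain a' where a': "recursive_fun 1 a'" "\<And>x. a' [enc x] = enc (a x)"
    using assms(2) unfolding computable_def by blast
  obtain b' where b': "recursive_fun 1 b'" "\<And>x. b' [enc x] = enc (b x)"
    using assms(3) unfolding computable_def by blast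
  \<comment> \<open>The list \<open>ys\<close> consists of counter, previous value and parameter;
    the realiser \<open>g'\<close> expects the parameter first.\<close>
  let ?g = "\<lambda>ys. g' [prod_encode (ys ! 2, prod_encode (ys ! 0, ys ! 1))]"
  have "recursive_fun (Suc (Suc 1)) ?g"
    by (intro recursive_fun_comp1[OF g'(1)] recursive_fun_prod_encode recursive_fun_proj) simp_all
  from recursive_fun_rec_nat[OF a'(1) this b'(1)]
  have "recursive_fun 1 (\<lambda>xs. rec_nat (a' xs) (\<lambda>m r. ?g (m # r # xs)) (b' xs))" .
  moreover have "rec_nat (a' [enc x]) (\<lambda>m r. ?g (m # r # [enc x])) n = enc (rec_nat (a x) (\<lambda>m r. g x m r) n)" for x n
    using g'(2)[of "(x, m, r)" for m r] by (induction n) (auto simp: a'(2) enc_prod_def enc_nat_def)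
  ultimately show ?thesis
    unfolding computable_def
    by (intro exI[of _ "\<lambda>xs. rec_nat (a' xs) (\<lambda>m r. ?g (m # r # xs)) (b' xs)"]) (auto simp: b'(2) enc_nat_def)
qed

lemma computable_not [comp]: "computable p \<Longrightarrow> computable (\<lambda>x. \<not> p x)"
proof -
  assume *: "computable p"
  have "(\<lambda>x. \<not> p x) = (\<lambda>x. if p x then False else True)"
    by auto
  then show ?thesis
    by (simp only:) (intro computable_if computable_const *)
qed

lemma computable_conj [comp]: "computable p \<Longrightarrow> computable q \<Longrightarrow> computable (\<lambda>x. p x \<and> q x)"
proof -
  assume *: "computable p" "computable q"
  have "(\<lambda>x. p x \<and> q x) = (\<lambda>x. if p x then q x else False)"
    by auto
  then show ?thesis
    by (simp only:) (intro computable_if computable_const *)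
qed

lemma computable_disj [comp]: "computable p \<Longrightarrow> computable q \<Longrightarrow> computable (\<lambda>x. p x \<or> q x)"
proof -
  assume *: "computable p" "computable q"
  have "(\<lambda>x. p x \<or> q x) = (\<lambda>x. if p x then True else q x)"
    by auto
  then show ?thesis
    by (simp only:) (intro computable_if computable_const *)
qed

lemma computable_imp [comp]: "computable p \<Longrightarrow> computable q \<Longrightarrow> computable (\<lambda>x. p x \<longrightarrow> q x)"
proof -
  assume *: "computable p" "computable q"
  have "(\<lambda>x. p x \<longrightarrow> q x) = (\<lambda>x. if p x then q x else True)"
    by auto
  then show ?thesis
    by (simp only:) (intro computable_if computable_const *)
qed

lemma computable_iff [comp]: "computable p \<Longrightarrow> computable q \<Longrightarrow> computable (\<lambda>x. p x = (q x :: bool))"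
proof -
  assume *: "computable p" "computable q"
  have "(\<lambda>x. p x = (q x :: bool)) = (\<lambda>x. if p x then q x else \<not> q x)"
    by auto
  then show ?thesis
    by (simp only:) (intro computable_not computable_if computable_const *)
qed

lemma computable_is_0: 
  fixes a :: "'a::enc \<Rightarrow> nat"
  shows "computable a \<Longrightarrow> computable (\<lambda>x. a x = 0)"
  by (erule computable_realizer[where g = "\<lambda>xs. if xs ! 0 = 0 then 1 else 0"])
    (auto simp: enc_nat_def enc_bool_def intro: recursive_fun_if recursive_fun_proj recursive_fun_const)

lemma computable_le_nat [comp]:
  fixes a b :: "'a::enc \<Rightarrow> nat"
  shows "computable a \<Longrightarrow> computable b \<Longrightarrow> computable (\<lambda>x. a x \<le> b x)"
  using computable_is_0[OF computable_minus_nat, of a b] by simp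

lemma computable_less_nat [comp]:
  fixes a b :: "'a::enc \<Rightarrow> nat"
  shows "computable a \<Longrightarrow> computable b \<Longrightarrow> computable (\<lambda>x. a x < b x)"
  using computable_not[OF computable_le_nat[of b a]] by (simp add: not_le)

lemma computable_eq_nat [comp]:
  fixes a b :: "'a::enc \<Rightarrow> nat"
  shows "computable a \<Longrightarrow> computable b \<Longrightarrow> computable (\<lambda>x. a x = b x)"
  using computable_conj[OF computable_le_nat[of a b] computable_le_nat[of b a]] by (simp add: eq_iff)

lemma computable_times_nat [comp]:
  fixes a b :: "'a::enc \<Rightarrow> nat"
  assumes "computable a" "computable b"
  shows "computable (\<lambda>x. a x * b x)"
proof -
  have "(\<lambda>x. a x * b x) = (\<lambda>x. rec_nat 0 (\<lambda>m r. r + b x) (a x))"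
  proof
    have "n * b x = rec_nat 0 (\<lambda>m r. r + b x) n" for x n
      by (induction n) auto
    then show "a x * b x = rec_nat 0 (\<lambda>m r. r + b x) (a x)" for x .
  qed
  then show ?thesis
    by (simp only:) (intro comp assms computable_compose[OF assms(2)])
qed

lemma computable_power_nat [comp]:
  fixes a b :: "'a::enc \<Rightarrow> nat"
  assumes "computable a" "computable b"
  shows "computable (\<lambda>x. a x ^ b x)"
proof -
  have "(\<lambda>x. a x ^ b x) = (\<lambda>x. rec_nat 1 (\<lambda>m r. r * a x) (b x))"
  proof
    have "a x ^ n = rec_nat 1 (\<lambda>m r. r * a x) n" for x n
      by (induction n) auto
    then show "a x ^ b x = rec_nat 1 (\<lambda>m r. r * a x) (b x)" for x .
  qed
  then show ?thesis
    by (simp only:) (intro comp assms computable_compose[OF assms(1)])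
qed

lemma computable_fact [comp]:
  fixes a :: "'a::enc \<Rightarrow> nat"
  assumes "computable a"
  shows "computable (\<lambda>x. fact (a x) :: nat)"
proof -
  have "(\<lambda>x. fact (a x) :: nat) = (\<lambda>x. rec_nat 1 (\<lambda>m r. Suc m * r) (a x))"
  proof
    have "fact n = rec_nat (1::nat) (\<lambda>m r. Suc m * r) n" for n
      by (induction n) auto
    then show "fact (a x) = rec_nat 1 (\<lambda>m r. Suc m * r) (a x)" for x .
  qed
  then show ?thesis
    by (simp only:) (intro comp assms)
qed

definition halve :: "nat \<Rightarrow> nat" where "halve n = n div 2"

text \<open>The half is carried along together with the parity, which decides whether the next step
  increments it.\<close>

lemma computable_halve [comp]:
  assumes "computable a"
  shows "computable (\<lambda>x. halve (a x))"
proof -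
  have "rec_nat (0::nat, True) (\<lambda>m r. if snd r then (fst r, False) else (Suc (fst r), True)) n = (halve n, even n)" for n
    by (induction n) (auto simp: halve_def)
  then have "(\<lambda>x. halve (a x)) =
      (\<lambda>x. fst (rec_nat (0::nat, True) (\<lambda>m r. if snd r then (fst r, False) else (Suc (fst r), True)) (a x)))"
    by simp
  then show ?thesis
    by (simp only:) (intro comp assms)
qed

lemma computable_odd [comp]:
  fixes a :: "'a::enc \<Rightarrow> nat"
  assumes "computable a"
  shows "computable (\<lambda>x. odd (a x))"
proof -
  have "(\<lambda>x. odd (a x)) = (\<lambda>x. a x - (halve (a x) + halve (a x)) = 1)"
    by (auto simp: halve_def fun_eq_iff) presburger+
  then show ?thesis
    by (simp only:) (intro comp assms)
qed

lemma computable_set_decode [comp]: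
  assumes "computable a" "computable b"
  shows "computable (\<lambda>x. b x \<in> set_decode (a x))"
proof -
  have "rec_nat z (\<lambda>m r. halve r) n = z div 2 ^ n" for z n
    by (induction n) (auto simp: halve_def div_mult2_eq[symmetric] mult.commute)
  then have "(\<lambda>x. b x \<in> set_decode (a x)) = (\<lambda>x. odd (rec_nat (a x) (\<lambda>m r. halve r) (b x)))"
    by (simp add: set_decode_def)
  then show ?thesis
    by (simp only:) (intro comp assms)
qed

subsection \<open>Lists\<close>

lemma computable_Cons [comp]: "computable a \<Longrightarrow> computable l \<Longrightarrow> computable (\<lambda>x. a x # l x)"
  by (erule (1) computable_realizer2[where h = "\<lambda>u v. Suc (prod_encode (u, v))"])
    (auto simp: enc_list_def intro!: recursive_fun_Suc recursive_fun_prod_encode)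

lemma computable_is_Nil [comp]: "computable l \<Longrightarrow> computable (\<lambda>x. l x = [])"
proof (erule computable_realizer[where g = "\<lambda>xs. if xs ! 0 = 0 then 1 else 0"])
  show "(if [enc (l x)] ! 0 = 0 then 1 else 0) = enc (l x = [])" for x
    by (cases "l x") (auto simp: enc_list_def enc_bool_def)
qed (intro recursive_fun_if recursive_fun_proj recursive_fun_const, simp)

definition hd_opt :: "'a \<Rightarrow> 'a list \<Rightarrow> 'a" where
  "hd_opt d l = (if l = [] then d else hd l)"

lemma computable_hd_opt [comp]:
  assumes "computable d" "computable l"
  shows "computable (\<lambda>x. hd_opt (d x) (l x))"
proof (rule computable_realizer[OF computable_pair[OF assms]])
  let ?z = "\<lambda>xs::nat list. prod_decode (xs ! 0)"
  show "recursive_fun 1 (\<lambda>xs. if snd (?z xs) = 0 then fst (?z xs) else fst (prod_decode (snd (?z xs) - 1)))"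
    by (intro recursive_fun_if recursive_fun_pred recursive_fun_fst recursive_fun_snd recursive_fun_proj) simp_all
  show "(if snd (?z [enc (d x, l x)]) = 0 then fst (?z [enc (d x, l x)])
      else fst (prod_decode (snd (?z [enc (d x, l x)]) - 1))) = enc (hd_opt (d x) (l x))" for x
    by (cases "l x") (auto simp: enc_prod_def enc_list_def hd_opt_def)
qed

lemma computable_tl [comp]:
  assumes "computable l"
  shows "computable (\<lambda>x. tl (l x))"
proof (rule computable_realizer[OF assms])
  show "recursive_fun 1 (\<lambda>xs. if xs ! 0 = 0 then 0 else snd (prod_decode (xs ! 0 - 1)))"
    by (intro recursive_fun_if recursive_fun_pred recursive_fun_const recursive_fun_snd recursive_fun_proj) simp_all
  show "(if [enc (l x)] ! 0 = 0 then 0 else snd (prod_decode ([enc (l x)] ! 0 - 1))) = enc (tl (l x))" for x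
    by (cases "l x") (auto simp: enc_list_def)
qed

text \<open>Lets the code of a list serve as a number of rounds in \<open>computable_foldl\<close>,
  before \<open>length\<close> itself is known to be computable.\<close>

lemma length_le_enc: "length l \<le> enc l"
proof (induction l)
  case (Cons a l)
  then show ?case
    using le_prod_encode_2[of "enc l" "enc a"] by (simp add: enc_list_def)
qed simp

lemma computable_foldl [comp]:
  fixes f :: "'c::enc \<Rightarrow> 'b::enc \<Rightarrow> 'a::enc \<Rightarrow> 'b"
  assumes "computable (\<lambda>p. f (fst p) (fst (snd p)) (snd (snd p)))" "computable a" "computable l"
  shows "computable (\<lambda>x. foldl (f x) (a x) (l x))"
proof -
  \<comment> \<open>Each round consumes one element and an exhausted list stays put, so too many
    rounds do no harm.\<close>
  let ?step = "\<lambda>x p. if fst p = [] then p else (tl (fst p), f x (snd p) (hd_opt undefined (fst p)))"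
  have *: "snd (rec_nat (l, a) (\<lambda>m. ?step x) n) = foldl (f x) a l" if "length l \<le> n" for x l a n
  proof -
    have "rec_nat (l, a) (\<lambda>m. ?step x) n = (drop n l, foldl (f x) a (take n l))"
    proof (induction n)
      case (Suc n)
      show ?case
      proof (cases "n < length l")
        case True
        then show ?thesis
          by (simp add: Suc drop_Suc[of n l] tl_drop take_Suc_conv_app_nth hd_opt_def hd_drop_conv_nth)
      qed (simp add: Suc)
    qed simp
    then show ?thesis
      using that by simp
  qed
  have **: "(\<lambda>x. foldl (f x) (a x) (l x)) = (\<lambda>x. snd (rec_nat (l x, a x) (\<lambda>m. ?step x) (enc (l x))))"
    by (rule ext, rule *[OF length_le_enc, symmetric])
  have "computable (\<lambda>p::'c \<times> nat \<times> 'a list \<times> 'b. (fst p, snd (snd (snd p)), hd_opt undefined (fst (snd (snd p)))))"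
    by (intro comp)
  from computable_compose[OF assms(1) this]
  have ***: "computable (\<lambda>p::'c \<times> nat \<times> 'a list \<times> 'b. f (fst p) (snd (snd (snd p))) (hd_opt undefined (fst (snd (snd p)))))"
    by simp
  show ?thesis
    unfolding ** by (intro comp assms ***)
qed

lemma computable_rev [comp]: "computable l \<Longrightarrow> computable (\<lambda>x. rev (l x))"
proof -
  assume l: "computable l"
  have "foldl (\<lambda>r a. a # r) r xs = rev xs @ r" for r xs :: "'b list"
    by (induction xs arbitrary: r) auto
  then have "(\<lambda>x. rev (l x)) = (\<lambda>x. foldl (\<lambda>r a. a # r) [] (l x))"
    by simp
  then show ?thesis
    by (simp only:) (intro comp l)
qed

lemma computable_foldr [comp]:
  fixes f :: "'c::enc \<Rightarrow> 'a::enc \<Rightarrow> 'b::enc \<Rightarrow> 'b"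
  assumes "computable (\<lambda>p. f (fst p) (fst (snd p)) (snd (snd p)))" "computable l" "computable a"
  shows "computable (\<lambda>x. foldr (f x) (l x) (a x))"
proof -
  have *: "(\<lambda>x. foldr (f x) (l x) (a x)) = (\<lambda>x. foldl (\<lambda>r a. f x a r) (a x) (rev (l x)))"
    by (simp add: foldl_conv_foldr)
  have "computable (\<lambda>p::'c \<times> 'b \<times> 'a. f (fst p) (snd (snd p)) (fst (snd p)))"
    using computable_compose[OF assms(1), of "\<lambda>p::'c \<times> 'b \<times> 'a. (fst p, snd (snd p), fst (snd p))",
        OF computable_pair[OF computable_fst[OF computable_id] computable_pair]]
    by (simp add: comp)
  then show ?thesis
    unfolding * by (intro comp assms)
qed

lemma computable_append [comp]: "computable l \<Longrightarrow> computable l' \<Longrightarrow> computable (\<lambda>x. l x @ l' x)"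
proof -
  assume l: "computable l" "computable l'"
  have "foldr (\<lambda>a r. a # r) xs ys = xs @ ys" for xs ys :: "'b list"
    by (induction xs) auto
  then have "(\<lambda>x. l x @ l' x) = (\<lambda>x. foldr (\<lambda>a r. a # r) (l x) (l' x))"
    by simp
  then show ?thesis
    by (simp only:) (intro comp l)
qed

lemma computable_map [comp]:
  fixes f :: "'c::enc \<Rightarrow> 'a::enc \<Rightarrow> 'b::enc"
  assumes "computable (\<lambda>p. f (fst p) (snd p))" "computable l"
  shows "computable (\<lambda>x. map (\<lambda>y. f x y) (l x))"
proof -
  have "foldr (\<lambda>a r. g a # r) xs [] = map g xs" for xs and g :: "'a \<Rightarrow> 'b"
    by (induction xs) auto
  then have *: "(\<lambda>x. map (\<lambda>y. f x y) (l x)) = (\<lambda>x. foldr (\<lambda>a r. f x a # r) (l x) [])"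
    by simp
  have "computable (\<lambda>p::'c \<times> 'a \<times> 'b list. f (fst p) (fst (snd p)))"
    using computable_compose[OF assms(1), of "\<lambda>p::'c \<times> 'a \<times> 'b list. (fst p, fst (snd p))",
        OF computable_pair]
    by (simp add: comp)
  then show ?thesis
    unfolding * by (intro comp assms)
qed

lemma computable_filter [comp]:
  fixes P :: "'c::enc \<Rightarrow> 'a::enc \<Rightarrow> bool"
  assumes "computable (\<lambda>p. P (fst p) (snd p))" "computable l"
  shows "computable (\<lambda>x. filter (\<lambda>y. P x y) (l x))"
proof -
  have "foldr (\<lambda>a r. if Q a then a # r else r) xs [] = filter Q xs" for xs and Q :: "'a \<Rightarrow> bool"
    by (induction xs) auto
  then have *: "(\<lambda>x. filter (\<lambda>y. P x y) (l x)) = (\<lambda>x. foldr (\<lambda>a r. if P x a then a # r else r) (l x) [])"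
    by simp
  have "computable (\<lambda>p::'c \<times> 'a \<times> 'a list. P (fst p) (fst (snd p)))"
    using computable_compose[OF assms(1), of "\<lambda>p::'c \<times> 'a \<times> 'a list. (fst p, fst (snd p))",
        OF computable_pair]
    by (simp add: comp)
  then show ?thesis
    unfolding * by (intro comp assms)
qed

lemma computable_concat [comp]: "computable l \<Longrightarrow> computable (\<lambda>x. concat (l x))"
  unfolding concat_conv_foldr by (intro comp)

lemma computable_length [comp]: "computable l \<Longrightarrow> computable (\<lambda>x. length (l x))"
proof -
  assume l: "computable l"
  have "foldr (\<lambda>a. Suc) xs 0 = length xs" for xs :: "'b list"
    by (induction xs) auto
  then have "(\<lambda>x. length (l x)) = (\<lambda>x. foldr (\<lambda>a. Suc) (l x) 0)"
    by simp
  then show ?thesis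
    by (simp only:) (intro comp l)
qed

lemma computable_drop [comp]: "computable l \<Longrightarrow> computable n \<Longrightarrow> computable (\<lambda>x. drop (n x) (l x))"
proof -
  assume l: "computable l" "computable n"
  have "rec_nat xs (\<lambda>m. tl) k = drop k xs" for k and xs :: "'b list"
    by (induction k) (auto simp: drop_Suc tl_drop)
  then have "(\<lambda>x. drop (n x) (l x)) = (\<lambda>x. rec_nat (l x) (\<lambda>m. tl) (n x))"
    by simp
  then show ?thesis
    by (simp only:) (intro comp l)
qed

lemma computable_take [comp]: "computable l \<Longrightarrow> computable n \<Longrightarrow> computable (\<lambda>x. take (n x) (l x))"
proof -
  assume l: "computable l" "computable n"
  have "(\<lambda>x. take (n x) (l x)) = (\<lambda>x. rev (drop (length (l x) - n x) (rev (l x))))"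
  proof
    show "take (n x) (l x) = rev (drop (length (l x) - n x) (rev (l x)))" for x
      by (cases "n x \<le> length (l x)") (auto simp: drop_rev)
  qed
  then show ?thesis
    by (simp only:) (intro comp l)
qed

text \<open>Unlike \<open>nth\<close>, this is specified for indices out of range, hence computable.\<close>

definition nth_opt :: "'a \<Rightarrow> 'a list \<Rightarrow> nat \<Rightarrow> 'a" where
  "nth_opt d l i = (if i < length l then l ! i else d)"

lemma computable_nth_opt [comp]:
  "computable d \<Longrightarrow> computable l \<Longrightarrow> computable i \<Longrightarrow> computable (\<lambda>x. nth_opt (d x) (l x) (i x))"
proof -
  assume l: "computable d" "computable l" "computable i"
  have "(\<lambda>x. nth_opt (d x) (l x) (i x)) = (\<lambda>x. hd_opt (d x) (drop (i x) (l x)))"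
    by (auto simp: nth_opt_def hd_opt_def hd_drop_conv_nth fun_eq_iff)
  then show ?thesis
    by (simp only:) (intro comp l)
qed

lemma computable_Ball_set [comp]:
  fixes P :: "'c::enc \<Rightarrow> 'a::enc \<Rightarrow> bool"
  assumes "computable (\<lambda>p. P (fst p) (snd p))" "computable l"
  shows "computable (\<lambda>x. \<forall>y \<in> set (l x). P x y)"
proof -
  have "(\<lambda>x. \<forall>y \<in> set (l x). P x y) = (\<lambda>x. filter (\<lambda>y. \<not> P x y) (l x) = [])"
    by (auto simp: filter_empty_conv fun_eq_iff)
  then show ?thesis
    by (simp only:) (intro comp assms)
qed

lemma computable_Bex_set [comp]:
  fixes P :: "'c::enc \<Rightarrow> 'a::enc \<Rightarrow> bool"
  assumes "computable (\<lambda>p. P (fst p) (snd p))" "computable l"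
  shows "computable (\<lambda>x. \<exists>y \<in> set (l x). P x y)"
proof -
  have "(\<lambda>x. \<exists>y \<in> set (l x). P x y) = (\<lambda>x. \<not> filter (\<lambda>y. P x y) (l x) = [])"
    by (auto simp: filter_empty_conv fun_eq_iff)
  then show ?thesis
    by (simp only:) (intro comp assms)
qed

lemma computable_upt [comp]:
  assumes "computable a" "computable b"
  shows "computable (\<lambda>x. [a x..<b x])"
proof -
  have "rec_nat [] (\<lambda>m r. if i \<le> m then r @ [m] else r) n = [i..<n]" for i n
    by (induction n) auto
  then have *: "(\<lambda>x. [a x..<b x]) = (\<lambda>x. rec_nat [] (\<lambda>m r. if a x \<le> m then r @ [m] else r) (b x))"
    by simp
  show ?thesis
    unfolding * by (intro comp assms computable_compose[OF assms(1)])
qed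

lemma computable_replicate [comp]:
  assumes "computable n" "computable a"
  shows "computable (\<lambda>x. replicate (n x) (a x))"
proof -
  have "(\<lambda>x. replicate (n x) (a x)) = (\<lambda>x. map (\<lambda>_. a x) [0..<n x])"
    by (auto simp: map_replicate_trivial)
  then show ?thesis
    by (simp only:) (intro comp assms computable_compose[OF assms(2)])
qed

lemma computable_product [comp]:
  assumes "computable a" "computable b"
  shows "computable (\<lambda>x. List.product (a x) (b x))"
proof -
  have *: "(\<lambda>x. List.product (a x) (b x)) = (\<lambda>x. concat (map (\<lambda>y. map (\<lambda>z. (y, z)) (b x)) (a x)))"
    by (simp add: product_concat_map)
  show ?thesis
    unfolding * by (intro comp assms computable_compose[OF assms(2)])
qed

lemma computable_n_lists [comp]:
  assumes "computable n" "computable a"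
  shows "computable (\<lambda>x. List.n_lists (n x) (a x))"
proof -
  have "rec_nat [[]] (\<lambda>m r. concat (map (\<lambda>ys. map (\<lambda>y. y # ys) xs) r)) n = List.n_lists n xs" for n and xs :: "'b list"
    by (induction n) auto
  then have *: "(\<lambda>x. List.n_lists (n x) (a x)) =
      (\<lambda>x. rec_nat [[]] (\<lambda>m r. concat (map (\<lambda>ys. map (\<lambda>y. y # ys) (a x)) r)) (n x))"
    by simp
  show ?thesis
    unfolding * by (intro comp assms computable_compose[OF assms(2)])
qed

lemma computable_product_lists [comp]:
  assumes "computable l"
  shows "computable (\<lambda>x. product_lists (l x))"
proof -
  have "foldr (\<lambda>xs r. concat (map (\<lambda>x. map (\<lambda>y. x # y) r) xs)) xss [[]] = product_lists xss" for xss :: "'b list list"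
    by (induction xss) auto
  then have *: "(\<lambda>x. product_lists (l x)) =
      (\<lambda>x. foldr (\<lambda>xs r. concat (map (\<lambda>x. map (\<lambda>y. x # y) r) xs)) (l x) [[]])"
    by simp
  show ?thesis
    unfolding * by (intro comp assms)
qed

lemma computable_sum_list_nat [comp]:
  fixes l :: "'a::enc \<Rightarrow> nat list"
  shows "computable l \<Longrightarrow> computable (\<lambda>x. sum_list (l x))"
  unfolding sum_list.eq_foldr by (intro comp)

subsection \<open>Integers\<close>

text \<open>The gate from natural numbers to integers. Integer arithmetic is reduced to it by
  writing an integer as the difference of \<open>nat i\<close> and \<open>nat (- i)\<close>.\<close>

lemma computable_diff_int_nat:
  fixes a b :: "'a::enc \<Rightarrow> nat"
  assumes "computable a" "computable b"
  shows "computable (\<lambda>x. int (a x) - int (b x))"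
proof -
  have "(\<lambda>x. int (a x) - int (b x)) = (\<lambda>x. int_decode
      (if b x \<le> a x then (a x - b x) + (a x - b x) else Suc ((b x - a x - 1) + (b x - a x - 1))))"
    by (auto simp: fun_eq_iff int_decode_def sum_decode_def)
  then show ?thesis
    by (simp only:) (intro comp assms)
qed

lemma computable_int [comp]: "computable a \<Longrightarrow> computable (\<lambda>x. int (a x))"
  using computable_diff_int_nat[OF _ computable_const, of a 0] by simp

lemma computable_nat [comp]: 
  assumes "computable a"
  shows "computable (\<lambda>x. nat (a x))"
proof -
  have "nat i = (if odd (enc i) then 0 else halve (enc i))" for i
    by (auto simp: enc_int_def int_encode_def sum_encode_def halve_def)
  then show ?thesis
    by (simp only:) (intro comp assms)
qed

lemma computable_uminus_int [comp]:
  fixes a :: "'a::enc \<Rightarrow> int"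
  assumes "computable a"
  shows "computable (\<lambda>x. - a x)"
proof -
  have *: "nat (- i) = (if odd (enc i) then Suc (halve (enc i)) else 0)" for i :: int
    by (auto simp: enc_int_def int_encode_def sum_encode_def halve_def nat_eq_iff)
  have "(\<lambda>x. - a x) = (\<lambda>x. int (if odd (enc (a x)) then Suc (halve (enc (a x))) else 0) - int (nat (a x)))"
    unfolding *[symmetric] by auto
  then show ?thesis
    by (simp only:) (intro comp assms computable_diff_int_nat)
qed

lemma computable_plus_int [comp]:
  fixes a b :: "'a::enc \<Rightarrow> int"
  assumes "computable a" "computable b"
  shows "computable (\<lambda>x. a x + b x)"
proof -
  have "(\<lambda>x. a x + b x) = (\<lambda>x. int (nat (a x) + nat (b x)) - int (nat (- a x) + nat (- b x)))"
    by (auto simp: fun_eq_iff)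
  then show ?thesis
    by (simp only:) (intro comp assms computable_diff_int_nat)
qed

lemma computable_minus_int [comp]:
  fixes a b :: "'a::enc \<Rightarrow> int"
  assumes "computable a" "computable b"
  shows "computable (\<lambda>x. a x - b x)"
  using computable_plus_int[OF assms(1) computable_uminus_int[OF assms(2)]] by simp

lemma computable_times_int [comp]:
  fixes a b :: "'a::enc \<Rightarrow> int"
  assumes "computable a" "computable b"
  shows "computable (\<lambda>x. a x * b x)"
proof -
  have *: "a x * b x = int (nat (a x) * nat (b x) + nat (- a x) * nat (- b x))
      - int (nat (a x) * nat (- b x) + nat (- a x) * nat (b x))" for x
    by (cases "0 \<le> a x"; cases "0 \<le> b x") auto
  show ?thesis
    unfolding * by (intro comp assms computable_diff_int_nat)
qed

lemma computable_le_int [comp]: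
  fixes a b :: "'a::enc \<Rightarrow> int"
  assumes "computable a" "computable b"
  shows "computable (\<lambda>x. a x \<le> b x)"
proof -
  have "(\<lambda>x. a x \<le> b x) = (\<lambda>x. nat (a x - b x) = 0)"
    by auto
  then show ?thesis
    by (simp only:) (intro comp assms)
qed

lemma computable_sum_list_int [comp]:
  fixes l :: "'a::enc \<Rightarrow> int list"
  shows "computable l \<Longrightarrow> computable (\<lambda>x. sum_list (l x))"
  unfolding sum_list.eq_foldr by (intro comp)

subsection \<open>Recursion along a computable measure\<close>

primrec fuel_rec :: "('z \<Rightarrow> 'z list) \<Rightarrow> ('z \<Rightarrow> 'b list \<Rightarrow> 'b) \<Rightarrow> nat \<Rightarrow> 'z \<Rightarrow> 'b" where
  "fuel_rec q G 0 z = undefined"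
| "fuel_rec q G (Suc n) z = G z (map (fuel_rec q G n) (q z))"

definition layer :: "('z \<Rightarrow> 'z list) \<Rightarrow> 'z \<Rightarrow> nat \<Rightarrow> 'z list" where
  "layer q z n = rec_nat [z] (\<lambda>_ l. concat (map q l)) n"

text \<open>The values of the calls in one layer come as a single flat list; every call of the layer
  above takes off as many values as it has children.\<close>

definition collapse :: "('z \<Rightarrow> 'z list) \<Rightarrow> ('z \<Rightarrow> 'b list \<Rightarrow> 'b) \<Rightarrow> 'z list \<Rightarrow> 'b list \<Rightarrow> 'b list" where
  "collapse q G zs vs = fst (foldl (\<lambda>p z. (fst p @ [G z (take (length (q z)) (snd p))], drop (length (q z)) (snd p))) ([], vs) zs)"

lemma collapse_map:
  "collapse q G zs (map F (concat (map q zs))) = map (\<lambda>z. G z (map F (q z))) zs"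
proof -
  have "fst (foldl (\<lambda>p z. (fst p @ [G z (take (length (q z)) (snd p))], drop (length (q z)) (snd p)))
      (r, map F (concat (map q zs))) zs) = r @ map (\<lambda>z. G z (map F (q z))) zs" for r
    by (induction zs arbitrary: r) auto
  then show ?thesis
    unfolding collapse_def by simp
qed

text \<open>The tree of recursive calls is first expanded layer by layer and then collapsed, so that
  the recursion becomes two primitive recursions over lists.\<close>

lemma fuel_rec_layers:
  assumes "j \<le> n"
  shows "rec_nat (map (\<lambda>_. undefined) (layer q z n)) (\<lambda>i vs. collapse q G (layer q z (n - Suc i)) vs) j
    = map (fuel_rec q G j) (layer q z (n - j))"
  using assms
proof (induction j)
  case (Suc j)
  have "layer q z (n - j) = concat (map q (layer q z (n - Suc j)))"
    using Suc.prems Suc_diff_Suc[of j n, symmetric] by (simp add: layer_def del: Suc_diff_Suc)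
  then show ?case
    using Suc by (simp add: collapse_map)
qed simp

lemma computable_fuel_rec [comp]:
  fixes q :: "'c::enc \<Rightarrow> 'z::enc \<Rightarrow> 'z list" and G :: "'c \<Rightarrow> 'z \<Rightarrow> 'b::enc list \<Rightarrow> 'b"
  assumes q: "computable (\<lambda>p. q (fst p) (snd p))"
    and G: "computable (\<lambda>p. G (fst p) (fst (snd p)) (snd (snd p)))"
    and n: "computable n" and z: "computable z"
  shows "computable (\<lambda>x. fuel_rec (q x) (G x) (n x) (z x))"
proof -
  have *: "(\<lambda>x. fuel_rec (q x) (G x) (n x) (z x)) = (\<lambda>x. hd_opt undefined
      (rec_nat (map (\<lambda>_. undefined) (layer (q x) (z x) (n x)))
        (\<lambda>i vs. collapse (q x) (G x) (layer (q x) (z x) (n x - Suc i)) vs) (n x)))"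
    unfolding fuel_rec_layers[OF le_refl] by (simp add: layer_def hd_opt_def)
  have q': "computable (\<lambda>x. q (a x) (b x))" if "computable a" "computable b" for a :: "'d::enc \<Rightarrow> 'c" and b
    using computable_compose[OF q computable_pair[OF that]] by simp
  have G': "computable (\<lambda>x. G (a x) (b x) (c x))" if "computable a" "computable b" "computable c"
    for a :: "'d::enc \<Rightarrow> 'c" and b c
    using computable_compose[OF G computable_pair[OF that(1) computable_pair[OF that(2,3)]]] by simp
  have z': "computable (\<lambda>x. z (a x))" if "computable a" for a :: "'d::enc \<Rightarrow> 'c"
    by (rule computable_compose[OF z that])
  have n': "computable (\<lambda>x. n (a x))" if "computable a" for a :: "'d::enc \<Rightarrow> 'c"
    by (rule computable_compose[OF n that])
  show ?thesis
    unfolding * layer_def collapse_def by (intro comp q' G' z' n')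
qed

definition measure_rec where
  "measure_rec q G m z = fuel_rec q G (Suc (m z)) z"

lemma computable_measure_rec:
  fixes q :: "'z::enc \<Rightarrow> 'z list" and G :: "'z \<Rightarrow> 'b::enc list \<Rightarrow> 'b"
  assumes "computable q" "computable (\<lambda>p. G (fst p) (snd p))" "computable m" "computable z"
  shows "computable (\<lambda>x. measure_rec q G m (z x))"
proof -
  have "computable (\<lambda>p :: 'a \<times> 'z \<times> 'b list. G (fst (snd p)) (snd (snd p)))"
    using computable_compose[OF assms(2), of "\<lambda>p :: 'a \<times> 'z \<times> 'b list. snd p"] by (simp add: comp)
  moreover have "computable (\<lambda>p :: 'a \<times> 'z. q (snd p))"
    by (rule computable_compose[OF assms(1)]) (intro comp)
  moreover have "computable (\<lambda>x. m (z x))"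
    by (rule computable_compose[OF assms(3,4)])
  ultimately show ?thesis
    unfolding measure_rec_def using assms(4) by (intro computable_fuel_rec computable_Suc)
qed

text \<open>Turns structural recursion into recursion on codes: \<open>r\<close> codes the argument,
  \<open>ch\<close> lists its immediate subproblems and \<open>q\<close> computes their codes. In
  the applications the measure is the code of the syntax tree, which exceeds the codes of the
  subtrees.\<close>

lemma measure_rec_eq:
  assumes "\<And>d. ok d \<Longrightarrow> q (r d) = map r (ch d) \<and> (\<forall>e \<in> set (ch d). ok e \<and> m (r e) < m (r d)) \<and>
      F d = G (r d) (map F (ch d))"
    and "ok d"
  shows "measure_rec q G m (r d) = F d"
proof -
  have "fuel_rec q G n (r d) = F d" if "ok d" "m (r d) < n" for n d
    using that
  proof (induction n arbitrary: d)
    case (Suc n)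
    have "map (fuel_rec q G n) (q (r d)) = map F (ch d)"
      using assms(1)[OF Suc.prems(1)] Suc by (auto simp: less_Suc_eq_le)
    then show ?case
      using assms(1)[OF Suc.prems(1)] by (metis fuel_rec.simps(2))
  qed simp
  then show ?thesis
    using assms(2) unfolding measure_rec_def by blast
qed

section \<open>Recognition of languages of infinite words by finite congruences\<close>

lemma concat_in_lists: "set xss \<subseteq> lists A \<Longrightarrow> concat xss \<in> lists A"
  by (induction xss) auto

lemma upt_append: "i \<le> j \<Longrightarrow> j \<le> k \<Longrightarrow> [i..<j] @ [j..<k] = [i..<k]"
  by (metis le_add_diff_inverse upt_add_eq_append)

text \<open>For nonempty blocks the first \<open>Suc p\<close> of them cover position
  \<open>p\<close>, so no limit has to be taken.\<close>

definition glue :: "(nat \<Rightarrow> 'a list) \<Rightarrow> nat \<Rightarrow> 'a" where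
  "glue U p = concat (map U [0..<Suc p]) ! p"

lemma length_concat_blocks:
  assumes "\<And>i. U i \<noteq> []"
  shows "k \<le> length (concat (map U [0..<k]))"
proof (induction k)
  case (Suc k)
  have "1 \<le> length (U k)"
    using assms[of k] by (cases "U k") auto
  moreover have "length (concat (map U [0..<Suc k])) = length (concat (map U [0..<k])) + length (U k)"
    by simp
  ultimately show ?case
    using Suc by linarith
qed simp

lemma concat_blocks_prefix:
  assumes "k \<le> l"
  shows "concat (map U [0..<l]) = concat (map U [0..<k]) @ concat (map U [k..<l])"
  using assms by (metis concat_append le0 map_append upt_append)

lemma glue_eq:
  assumes U: "\<And>i. U i \<noteq> []" and p: "p < length (concat (map U [0..<k]))"
  shows "glue U p = concat (map U [0..<k]) ! p"
proof (cases "k \<le> Suc p")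
  case True
  show ?thesis
    unfolding glue_def concat_blocks_prefix[OF True, of U] using p by (simp add: nth_append)
next
  case False
  then have "Suc p \<le> k"
    by simp
  show ?thesis
    unfolding glue_def concat_blocks_prefix[OF \<open>Suc p \<le> k\<close>, of U]
    using length_concat_blocks[of U "Suc p", OF U] by (simp add: nth_append del: upt_Suc)
qed

lemma glue_unique:
  assumes U: "\<And>i. U i \<noteq> []"
    and w: "\<And>k. map w [0..<length (concat (map U [0..<k]))] = concat (map U [0..<k])"
  shows "glue U = w"
proof
  fix p
  have p: "p < length (concat (map U [0..<Suc p]))"
    using length_concat_blocks[of U "Suc p", OF U] by simp
  have "w p = map w [0..<length (concat (map U [0..<Suc p]))] ! p"
    using p by simp
  then show "glue U p = w p"
    by (simp only: w glue_def)
qed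

lemma glue_cuts:
  assumes "strict_mono c" "c 0 = 0"
  shows "glue (\<lambda>i. map w [c i..<c (Suc i)]) = w"
proof (rule glue_unique)
  show "map w [c i..<c (Suc i)] \<noteq> []" for i
    using strict_monoD[OF assms(1), of i "Suc i"] by simp
  have "concat (map (\<lambda>i. map w [c i..<c (Suc i)]) [0..<k]) = map w [0..<c k]" for k
  proof (induction k)
    case (Suc k)
    have "c k \<le> c (Suc k)"
      using assms(1) by (simp add: strict_mono_Suc_iff less_imp_le)
    then have "map w [0..<c (Suc k)] = map w [0..<c k] @ map w [c k..<c (Suc k)]"
      by (metis le0 map_append upt_append)
    then show ?case
      using Suc by simp
  qed (use assms in simp)
  then show "map w [0..<length (concat (map (\<lambda>i. map w [c i..<c (Suc i)]) [0..<k]))] =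
      concat (map (\<lambda>i. map w [c i..<c (Suc i)]) [0..<k])" for k
    by simp
qed

lemma list_all2_concat_blocks:
  "(\<And>i. list_all2 R (U i) (V i)) \<Longrightarrow> list_all2 R (concat (map U [0..<k])) (concat (map V [0..<k]))"
  by (induction k) (auto intro: list_all2_appendI)

lemma list_all2_glue:
  assumes "\<And>i. list_all2 R (U i) (V i)" "\<And>i. U i \<noteq> []"
  shows "R (glue U p) (glue V p)"
  unfolding glue_def
proof (rule list_all2_nthD)
  show "list_all2 R (concat (map U [0..<Suc p])) (concat (map V [0..<Suc p]))"
    by (rule list_all2_concat_blocks) (rule assms(1))
  have "Suc p \<le> length (concat (map U [0..<Suc p]))"
    by (rule length_concat_blocks) (rule assms(2))
  then show "p < length (concat (map U [0..<Suc p]))"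
    by simp
qed

text \<open>Recognition by a finite omega-semigroup: \<open>h\<close> is a morphism up to the choice
  of representatives, and membership of an infinite product depends only on the classes of its
  blocks. Saturation is required for all factorisations, not only for ultimately constant ones. This
  makes projection direct, and Ramsey's theorem is needed only to make witnesses ultimately
  periodic.\<close>

definition recognizes :: "'a set \<Rightarrow> nat \<Rightarrow> ('a list \<Rightarrow> nat) \<Rightarrow> ((nat \<Rightarrow> 'a) \<Rightarrow> bool) \<Rightarrow> bool" where
  "recognizes A K h L \<longleftrightarrow> (\<forall>u \<in> lists A. h u < K) \<and>
    (\<forall>u \<in> lists A. \<forall>u' \<in> lists A. \<forall>v \<in> lists A. \<forall>v' \<in> lists A.
      h u = h u' \<longrightarrow> h v = h v' \<longrightarrow> h (u @ v) = h (u' @ v')) \<and>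
    (\<forall>U U'. (\<forall>i. U i \<in> lists A \<and> U' i \<in> lists A \<and> U i \<noteq> [] \<and> U' i \<noteq> [] \<and> h (U i) = h (U' i)) \<longrightarrow>
      L (glue U) = L (glue U'))"

text \<open>Classes may be drawn from any finite set \<open>T\<close> and are renumbered by an
  injection. One implication suffices for saturation, since \<open>U\<close> and \<open>U'\<close>
  can be exchanged.\<close>

lemma recognizesI:
  fixes g :: "'a list \<Rightarrow> 'h"
  assumes T: "finite T" "card T \<le> K" "\<And>u. u \<in> lists A \<Longrightarrow> g u \<in> T"
    and cong: "\<And>u u' v v'. u \<in> lists A \<Longrightarrow> u' \<in> lists A \<Longrightarrow> v \<in> lists A \<Longrightarrow> v' \<in> lists A \<Longrightarrow>
      g u = g u' \<Longrightarrow> g v = g v' \<Longrightarrow> g (u @ v) = g (u' @ v')"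
    and L: "\<And>U U'. (\<And>i. U i \<in> lists A) \<Longrightarrow> (\<And>i. U' i \<in> lists A) \<Longrightarrow> (\<And>i. U i \<noteq> []) \<Longrightarrow>
      (\<And>i. U' i \<noteq> []) \<Longrightarrow> (\<And>i. g (U i) = g (U' i)) \<Longrightarrow> L (glue U) \<Longrightarrow> L (glue U')"
  shows "\<exists>h. recognizes A K h L"
proof -
  obtain f where f: "inj_on f T" "f ` T = {0..<card T}"
    using ex_bij_betw_finite_nat[OF T(1)] by (auto simp: bij_betw_def)
  have eq: "g u = g u'" if "u \<in> lists A" "u' \<in> lists A" "f (g u) = f (g u')" for u u'
    using that f(1) T(3) by (simp add: inj_on_eq_iff)
  have "f (g u) < K" if "u \<in> lists A" for u
    using f(2) T(2,3) that by (metis atLeastLessThan_iff image_eqI less_le_trans)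
  moreover have "f (g (u @ v)) = f (g (u' @ v'))" if "u \<in> lists A" "u' \<in> lists A" "v \<in> lists A" "v' \<in> lists A"
    "f (g u) = f (g u')" "f (g v) = f (g v')" for u u' v v'
    using cong[OF that(1-4)] eq that by simp
  moreover have "L (glue U) = L (glue U')"
    if "\<forall>i. U i \<in> lists A \<and> U' i \<in> lists A \<and> U i \<noteq> [] \<and> U' i \<noteq> [] \<and> f (g (U i)) = f (g (U' i))" for U U'
    using L[of U U'] L[of U' U] eq that by metis
  ultimately have "recognizes A K (\<lambda>u. f (g u)) L"
    unfolding recognizes_def by (intro conjI ballI allI impI)
  then show ?thesis
    by (rule exI[of _ "\<lambda>u. f (g u)"])
qed

lemma recognizes_less: "recognizes A K h L \<Longrightarrow> u \<in> lists A \<Longrightarrow> h u < K"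
  unfolding recognizes_def by blast

lemma recognizes_append:
  "recognizes A K h L \<Longrightarrow> u \<in> lists A \<Longrightarrow> u' \<in> lists A \<Longrightarrow> v \<in> lists A \<Longrightarrow> v' \<in> lists A \<Longrightarrow>
    h u = h u' \<Longrightarrow> h v = h v' \<Longrightarrow> h (u @ v) = h (u' @ v')"
  unfolding recognizes_def by (elim conjE, drule (1) bspec, drule (1) bspec, drule (1) bspec, drule (1) bspec, drule (1) mp, drule (1) mp)

lemma recognizes_glue:
  "recognizes A K h L \<Longrightarrow> (\<And>i. U i \<in> lists A) \<Longrightarrow> (\<And>i. U' i \<in> lists A) \<Longrightarrow> (\<And>i. U i \<noteq> []) \<Longrightarrow>
      (\<And>i. U' i \<noteq> []) \<Longrightarrow> (\<And>i. h (U i) = h (U' i)) \<Longrightarrow> L (glue U) = L (glue U')"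
  unfolding recognizes_def by (elim conjE, erule allE[of _ U], erule allE[of _ U'], erule mp) blast

lemma recognizes_not: "recognizes A K h L \<Longrightarrow> recognizes A K h (\<lambda>w. \<not> L w)"
  unfolding recognizes_def by (elim conjE, intro conjI) (assumption, assumption, simp only: not_not simp_thms)

lemma recognizes_conj:
  assumes "recognizes A K h L" "recognizes A K' h' L'"
  shows "\<exists>h''. recognizes A (K * K') h'' (\<lambda>w. L w \<and> L' w)"
proof (rule recognizesI[where g = "\<lambda>u. (h u, h' u)" and T = "{..<K} \<times> {..<K'}"])
  show "(h (u @ v), h' (u @ v)) = (h (u' @ v'), h' (u' @ v'))"
    if "u \<in> lists A" "u' \<in> lists A" "v \<in> lists A" "v' \<in> lists A"
      "(h u, h' u) = (h u', h' u')" "(h v, h' v) = (h v', h' v')" for u u' v v'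
    using recognizes_append[OF assms(1) that(1-4)] recognizes_append[OF assms(2) that(1-4)] that(5,6) by simp
  show "L (glue U') \<and> L' (glue U')"
    if "\<And>i. U i \<in> lists A" "\<And>i. U' i \<in> lists A" "\<And>i. U i \<noteq> []" "\<And>i. U' i \<noteq> []"
      "\<And>i. (h (U i), h' (U i)) = (h (U' i), h' (U' i))" "L (glue U) \<and> L' (glue U)" for U U'
    using recognizes_glue[OF assms(1), of U U'] recognizes_glue[OF assms(2), of U U'] that by blast
qed (use recognizes_less[OF assms(1)] recognizes_less[OF assms(2)] in \<open>auto simp: card_cartesian_product\<close>)

text \<open>Power set construction: a block is mapped to the set of classes of the blocks related to
  it. A witness over \<open>U\<close> is cut along the blocks of \<open>U\<close>, and each piece is
  replaced by one of the same class over the corresponding block of \<open>U'\<close>.\<close>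

lemma recognizes_ex:
  fixes R :: "'a \<Rightarrow> 'a \<Rightarrow> bool"
  assumes h: "recognizes A K h L"
  shows "\<exists>h'. recognizes A (2 ^ K) h' (\<lambda>w. \<exists>w'. (\<forall>i. w' i \<in> A \<and> R (w i) (w' i)) \<and> L w')"
proof (rule recognizesI[where g = "\<lambda>u. h ` {u' \<in> lists A. list_all2 R u u'}" and T = "Pow {..<K}"])
  show "h ` {z \<in> lists A. list_all2 R (u @ v) z} = h ` {z \<in> lists A. list_all2 R (u' @ v') z}"
    if *: "h ` {z \<in> lists A. list_all2 R u z} = h ` {z \<in> lists A. list_all2 R u' z}"
      "h ` {z \<in> lists A. list_all2 R v z} = h ` {z \<in> lists A. list_all2 R v' z}" for u u' v v'
  proof -
    have "h ` {z \<in> lists A. list_all2 R (u @ v) z} \<subseteq> h ` {z \<in> lists A. list_all2 R (u' @ v') z}"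
      if *: "h ` {z \<in> lists A. list_all2 R u z} = h ` {z \<in> lists A. list_all2 R u' z}"
        "h ` {z \<in> lists A. list_all2 R v z} = h ` {z \<in> lists A. list_all2 R v' z}" for u u' v v'
    proof
      fix c
      assume "c \<in> h ` {z \<in> lists A. list_all2 R (u @ v) z}"
      then obtain z where z: "z \<in> lists A" "list_all2 R (u @ v) z" "c = h z"
        by blast
      then obtain x y where xy: "z = x @ y" "list_all2 R u x" "list_all2 R v y"
        by (auto simp: list_all2_append1)
      then have xy_lists: "x \<in> lists A" "y \<in> lists A"
        using z(1) by simp_all
      have "h x \<in> h ` {z \<in> lists A. list_all2 R u' z}" "h y \<in> h ` {z \<in> lists A. list_all2 R v' z}"
        unfolding *[symmetric] using xy xy_lists by blast+
      then obtain x' y' where x': "x' \<in> lists A" "list_all2 R u' x'" "h x = h x'"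
        and y': "y' \<in> lists A" "list_all2 R v' y'" "h y = h y'"
        by blast
      have "c = h (x' @ y')"
        using recognizes_append[OF h xy_lists(1) x'(1) xy_lists(2) y'(1) x'(3) y'(3)] z(3) xy(1) by simp
      then show "c \<in> h ` {z \<in> lists A. list_all2 R (u' @ v') z}"
        using x' y' by (intro image_eqI[of _ _ "x' @ y'"]) (auto intro!: list_all2_appendI)
    qed
    from this[OF *] this[OF *[symmetric]] show ?thesis
      by blast
  qed
  show "\<exists>w'. (\<forall>i. w' i \<in> A \<and> R (glue U' i) (w' i)) \<and> L w'"
    if U: "\<And>i. U i \<noteq> []" and U': "\<And>i. U' i \<noteq> []"
      and eq: "\<And>i. h ` {z \<in> lists A. list_all2 R (U i) z} = h ` {z \<in> lists A. list_all2 R (U' i) z}"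
      and ex: "\<exists>w'. (\<forall>i. w' i \<in> A \<and> R (glue U i) (w' i)) \<and> L w'" for U U'
  proof -
    obtain w where w: "\<And>i. w i \<in> A" "\<And>i. R (glue U i) (w i)" "L w"
      using ex by blast
    \<comment> \<open>\<open>c i\<close> is where block \<open>i\<close> of \<open>U\<close> starts;
      \<open>V\<close> cuts the witness at these positions.\<close>
    define c where "c i = length (concat (map U [0..<i]))" for i
    define V where "V i = map w [c i..<c (Suc i)]" for i
    have c: "strict_mono c" "c 0 = 0"
      using U by (auto simp: c_def strict_mono_Suc_iff)
    have V: "glue V = w" "V i \<in> lists A" "V i \<noteq> []" for i
      using glue_cuts[OF c, of w] w(1) strict_monoD[OF c(1), of i "Suc i"] by (auto simp: V_def[abs_def])
    have "list_all2 R (U i) (V i)" for i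
    proof (rule list_all2_all_nthI)
      show "length (U i) = length (V i)"
        by (simp add: V_def c_def)
      fix n
      assume n: "n < length (U i)"
      then have "U i ! n = concat (map U [0..<Suc i]) ! (c i + n)"
        by (simp add: c_def)
      also have "\<dots> = glue U (c i + n)"
        by (rule glue_eq[OF U, symmetric]) (use n in \<open>simp add: c_def\<close>)
      finally show "R (U i ! n) (V i ! n)"
        using w(2)[of "c i + n"] n by (simp add: V_def c_def)
    qed
    then have "h (V i) \<in> h ` {z \<in> lists A. list_all2 R (U' i) z}" for i
      unfolding eq[symmetric] using V(2) by blast
    then have "\<forall>i. \<exists>z. z \<in> lists A \<and> list_all2 R (U' i) z \<and> h (V i) = h z"
      by blast
    then obtain V' where V': "\<And>i. V' i \<in> lists A" "\<And>i. list_all2 R (U' i) (V' i)" "\<And>i. h (V i) = h (V' i)"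
      by metis
    have ne: "V' i \<noteq> []" for i
      using V'(2)[of i] U'[of i] by auto
    have "L (glue V) = L (glue V')"
      by (rule recognizes_glue[OF h V(2) V'(1) V(3) ne V'(3)])
    then have "L (glue V')"
      using V(1) w(3) by simp
    moreover have "R (glue U' i) (glue V' i)" for i
      by (rule list_all2_glue[OF V'(2) U'])
    moreover have "glue V' i \<in> A" for i
      using list_all2_glue[of "\<lambda>_ y. y \<in> A" V' V' i] ne V'(1)
      by (auto simp: list_all2_same)
    ultimately show ?thesis
      by blast
  qed
qed (use recognizes_less[OF h] in \<open>auto simp: card_Pow\<close>)

text \<open>For a nonempty block it suffices to keep its first and last letter, whether it has
  length one, and whether its inner pairs are correct when it starts at position 0 and when it
  starts later: eight times the square of the alphabet size, plus one for the empty block. The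
  length matters because the pair at the junction of an initial block with the next one sits at
  position 0 exactly if the initial block is a single letter.\<close>

lemma recognizes_local:
  fixes P :: "bool \<Rightarrow> 'a \<Rightarrow> 'a \<Rightarrow> bool"
  assumes A: "finite A"
  shows "\<exists>h. recognizes A (Suc (8 * card A ^ 2)) h (\<lambda>w. \<forall>i. P (i = 0) (w i) (w (Suc i)))"
proof -
  define ok where "ok b u \<longleftrightarrow> (\<forall>i. Suc i < length u \<longrightarrow> P (b \<and> i = 0) (u ! i) (u ! Suc i))" for b u
  define g where "g u = (if u = [] then None else Some (length u = 1, hd u, last u, ok True u, ok False u))" for u
  have ok_append: "ok b (u @ v) \<longleftrightarrow> ok b u \<and> ok False v \<and> P (b \<and> length u = 1) (last u) (hd v)"
    if "u \<noteq> []" "v \<noteq> []" for b u v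
  proof -
    have "ok b (u @ v) \<longleftrightarrow> (\<forall>i. Suc i < length u \<longrightarrow> P (b \<and> i = 0) ((u @ v) ! i) ((u @ v) ! Suc i)) \<and>
        P (b \<and> length u - 1 = 0) ((u @ v) ! (length u - 1)) ((u @ v) ! Suc (length u - 1)) \<and>
        (\<forall>i. Suc i < length v \<longrightarrow> P (b \<and> length u + i = 0) ((u @ v) ! (length u + i)) ((u @ v) ! Suc (length u + i)))"
      (is "_ \<longleftrightarrow> ?A \<and> ?B \<and> ?C")
    proof (intro iffI conjI)
      assume "ok b (u @ v)"
      then have *: "P (b \<and> i = 0) ((u @ v) ! i) ((u @ v) ! Suc i)" if "Suc i < length u + length v" for i
        using that unfolding ok_def by simp
      have len: "0 < length u" "0 < length v"
        using that by auto
      show ?A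
        by (intro allI impI *) (use len in simp)
      show ?B
        using *[of "length u - 1"] len by simp
      show ?C
        by (intro allI impI *) (use len in simp)
    next
      assume *: "?A \<and> ?B \<and> ?C"
      show "ok b (u @ v)"
        unfolding ok_def
      proof (intro allI impI)
        fix i
        assume i: "Suc i < length (u @ v)"
        have "Suc i < length u \<or> i = length u - 1 \<or> (\<exists>j. i = length u + j \<and> Suc j < length v)"
          using i by (cases "Suc i < length u"; cases "i = length u - 1") (auto intro!: exI[of _ "i - length u"])
        then consider "Suc i < length u" | "i = length u - 1" | j where "i = length u + j" "Suc j < length v"
          by blast
        then show "P (b \<and> i = 0) ((u @ v) ! i) ((u @ v) ! Suc i)"
          using * by cases auto
      qed
    qed
    moreover have "?A \<longleftrightarrow> ok b u"
      unfolding ok_def by (auto simp: nth_append)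
    moreover have "(u @ v) ! (length u - 1) = last u" "(u @ v) ! Suc (length u - 1) = hd v"
      using that by (auto simp: nth_append last_conv_nth hd_conv_nth Suc_leI)
    moreover have "length u - 1 = 0 \<longleftrightarrow> length u = 1"
      using that by (cases u) auto
    moreover have "?C \<longleftrightarrow> ok False v"
      unfolding ok_def using that by (auto simp: nth_append)
    ultimately show ?thesis
      by auto
  qed
  have cong: "g (u @ v) = g (u' @ v')" if g: "g u = g u'" "g v = g v'" for u u' v v'
  proof (cases "u = [] \<or> v = []")
    case True
    then show ?thesis
      using g by (auto simp: g_def split: if_splits)
  next
    case False
    then have ne: "u \<noteq> []" "v \<noteq> []" "u' \<noteq> []" "v' \<noteq> []"
      using g by (auto simp: g_def split: if_splits)
    have one: "length (x @ y) \<noteq> 1" if "x \<noteq> []" "y \<noteq> []" for x y :: "'a list"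
      using that by (cases x; cases y) auto
    have "length u = 1 \<longleftrightarrow> length u' = 1" "hd u = hd u'" "last u = last u'" "ok b u \<longleftrightarrow> ok b u'"
      "hd v = hd v'" "last v = last v'" "ok b v \<longleftrightarrow> ok b v'" for b
      using g ne by (cases b; simp add: g_def)+
    then show ?thesis
      using ne one[OF ne(1,2)] one[OF ne(3,4)] ok_append[OF ne(1,2)] ok_append[OF ne(3,4)]
      unfolding g_def by simp
  qed
  have g_ok: "ok True x \<longleftrightarrow> ok True y" if "g x = g y" "x \<noteq> []" "y \<noteq> []" for x y
    using that by (simp add: g_def)
  let ?T = "insert None (Some ` ((UNIV :: bool set) \<times> A \<times> A \<times> (UNIV :: bool set) \<times> (UNIV :: bool set)))"
  show ?thesis
  proof (rule recognizesI[of ?T _ A g])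
    show "finite ?T"
      by (intro finite.insertI finite_imageI finite_cartesian_product A) simp_all
    show "card ?T \<le> Suc (8 * card A ^ 2)"
      using A by (simp add: card_insert_if card_image card_cartesian_product power2_eq_square UNIV_bool algebra_simps)
    show "g u \<in> ?T" if "u \<in> lists A" for u
      using that by (cases u) (auto simp: g_def)
    show "\<forall>i. P (i = 0) (glue U' i) (glue U' (Suc i))"
      if U: "\<And>i. U i \<noteq> []" and U': "\<And>i. U' i \<noteq> []" and eq: "\<And>i. g (U i) = g (U' i)"
        and ok: "\<forall>i. P (i = 0) (glue U i) (glue U (Suc i))" for U U'
    proof
      fix i
      \<comment> \<open>\<open>Suc (Suc i)\<close> nonempty blocks contain the positions
        \<open>i\<close> and \<open>Suc i\<close>.\<close>
      let ?c = "\<lambda>U. concat (map U [0..<Suc (Suc i)])"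
      have "g (concat (map U [0..<k])) = g (concat (map U' [0..<k]))" for k
        by (induction k) (auto intro: cong eq)
      then have "g (?c U) = g (?c U')" .
      moreover have "?c U \<noteq> []" "?c U' \<noteq> []"
        using length_concat_blocks[of U "Suc (Suc i)", OF U] length_concat_blocks[of U' "Suc (Suc i)", OF U']
        by (metis Zero_not_Suc le_zero_eq list.size(3))+
      ultimately have "ok True (?c U) \<longleftrightarrow> ok True (?c U')"
        by (rule g_ok)
      moreover have "ok True (?c U)"
        unfolding ok_def
      proof (intro allI impI)
        show "P (True \<and> j = 0) (?c U ! j) (?c U ! Suc j)" if "Suc j < length (?c U)" for j
          using ok that glue_eq[of U j "Suc (Suc i)", OF U] glue_eq[of U "Suc j" "Suc (Suc i)", OF U]
          by (simp del: upt_Suc) (metis Suc_lessD)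
      qed
      ultimately have "ok True (?c U')"
        by simp
      moreover have "Suc i < length (?c U')"
        using length_concat_blocks[of U' "Suc (Suc i)", OF U'] by simp
      ultimately show "P (i = 0) (glue U' i) (glue U' (Suc i))"
        unfolding ok_def using glue_eq[of U' i "Suc (Suc i)", OF U'] glue_eq[of U' "Suc i" "Suc (Suc i)", OF U']
        by (simp del: upt_Suc)
    qed
  qed (rule cong)
qed

subsection \<open>Powers\<close>

definition pow :: "nat \<Rightarrow> 'a list \<Rightarrow> 'a list" where
  "pow m u = concat (replicate m u)"

lemma pow_0 [simp]: "pow 0 u = []" and pow_Suc: "pow (Suc m) u = u @ pow m u"
  by (simp_all add: pow_def)

lemma pow_add: "pow (m + k) u = pow m u @ pow k u"
  by (simp add: pow_def replicate_add)

lemma pow_in_lists [intro]: "u \<in> lists A \<Longrightarrow> pow m u \<in> lists A"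
  by (induction m) (auto simp: pow_Suc)

lemma length_pow [simp]: "length (pow m u) = m * length u"
  by (induction m) (auto simp: pow_Suc)

text \<open>Pigeonhole on the powers of \<open>u\<close> with exponents up to \<open>K\<close> gives
  a preperiod and a period with sum at most \<open>K\<close>. The period divides
  \<open>fact K\<close> whatever it is, so one modulus works for all \<open>u\<close>.\<close>

lemma recognizes_pow:
  assumes h: "recognizes A K h L" and u: "u \<in> lists A" and m: "K \<le> m"
  shows "h (pow (m + fact K * j) u) = h (pow m u)"
proof -
  have "\<not> inj_on (\<lambda>i. h (pow i u)) {..K}"
  proof
    assume "inj_on (\<lambda>i. h (pow i u)) {..K}"
    then have "card {..K} \<le> card {..<K}"
      by (rule card_inj_on_le) (use recognizes_less[OF h pow_in_lists[OF u]] in auto)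
    then show False
      by simp
  qed
  then obtain i0 j0 where "i0 \<le> K" "j0 \<le> K" "i0 \<noteq> j0" "h (pow i0 u) = h (pow j0 u)"
    by (auto simp: inj_on_def)
  then obtain i d where i: "0 < d" "i + d \<le> K" "h (pow (i + d) u) = h (pow i u)"
    by (metis less_imp_add_positive linorder_neqE_nat)
  have step: "h (pow (n + d) u) = h (pow n u)" if n: "i \<le> n" for n
  proof -
    obtain r where r: "n = i + r"
      using n le_Suc_ex by blast
    have "h (pow (i + d) u @ pow r u) = h (pow i u @ pow r u)"
      by (rule recognizes_append[OF h]) (use i in \<open>simp_all only: pow_in_lists[OF u]\<close>)
    then show ?thesis
      by (simp add: r ac_simps flip: pow_add)
  qed
  have steps: "h (pow (n + d * r) u) = h (pow n u)" if "i \<le> n" for n r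
  proof (induction r)
    case (Suc r)
    have "h (pow (n + d * r + d) u) = h (pow (n + d * r) u)"
      by (rule step) (use that in simp)
    then show ?case
      using Suc by (simp add: ac_simps)
  qed simp
  have "d dvd fact K"
    using i by (intro dvd_fact) auto
  then obtain q where "fact K = d * q"
    by (auto elim: dvdE)
  then show ?thesis
    using steps[of m "q * j"] i m by (simp add: mult.assoc)
qed

text \<open>Among the prefixes formed with up to \<open>K\<close> blocks two have the same class,
  and the blocks between them can be cut out.\<close>

lemma recognizes_shorten:
  assumes h: "recognizes A K h L" and u: "u \<in> lists A" and "set bs \<subseteq> lists A"
  shows "\<exists>bs'. set bs' \<subseteq> set bs \<and> length bs' < K \<and> h (u @ concat bs') = h (u @ concat bs)"
  using assms(3)
proof (induction "length bs" arbitrary: bs rule: less_induct)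
  case less
  show ?case
  proof (cases "length bs < K")
    case False
    have in_lists: "concat bs' \<in> lists A" if "set bs' \<subseteq> set bs" for bs'
      by (metis concat_in_lists less.prems order.trans that)
    have less_K: "h (u @ concat (take i bs)) < K" for i
      by (rule recognizes_less[OF h])
        (simp only: append_in_lists_conv u in_lists[OF set_take_subset] simp_thms)
    have "\<not> inj_on (\<lambda>i. h (u @ concat (take i bs))) {..K}"
    proof
      assume "inj_on (\<lambda>i. h (u @ concat (take i bs))) {..K}"
      then have "card {..K} \<le> card {..<K}"
        by (rule card_inj_on_le) (use less_K in auto)
      then show False
        by simp
    qed
    then obtain i0 j0 where "i0 \<le> K" "j0 \<le> K" "i0 \<noteq> j0" "h (u @ concat (take i0 bs)) = h (u @ concat (take j0 bs))"
      by (auto simp: inj_on_def)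
    then obtain i j where i: "i < j" "j \<le> K" "h (u @ concat (take i bs)) = h (u @ concat (take j bs))"
      by (metis linorder_neqE_nat)
    let ?bs = "take i bs @ drop j bs"
    have "length ?bs < length bs" "set ?bs \<subseteq> set bs"
      using i False set_take_subset[of i bs] set_drop_subset[of j bs] by auto
    then obtain bs' where bs': "set bs' \<subseteq> set ?bs" "length bs' < K" "h (u @ concat bs') = h (u @ concat ?bs)"
      using less.hyps[of ?bs] less.prems by (meson order.trans)
    have "h ((u @ concat (take i bs)) @ concat (drop j bs)) = h ((u @ concat (take j bs)) @ concat (drop j bs))"
      by (rule recognizes_append[OF h])
        (use u in_lists i in \<open>auto simp: set_take_subset set_drop_subset\<close>)
    moreover have "concat (take j bs) @ concat (drop j bs) = concat bs"
      by (metis append_take_drop_id concat_append)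
    ultimately have "h (u @ concat bs') = h (u @ concat bs)"
      using bs'(3) by simp
    then show ?thesis
      using bs' \<open>set ?bs \<subseteq> set bs\<close> by blast
  qed auto
qed

subsection \<open>Ultimately periodic words\<close>

definition upword :: "'a list \<Rightarrow> 'a list \<Rightarrow> nat \<Rightarrow> 'a" where
  "upword u v i = (if i < length u then u ! i else v ! ((i - length u) mod length v))"

lemma nth_pow: "i < m * length v \<Longrightarrow> pow m v ! i = v ! (i mod length v)"
proof (induction m arbitrary: i)
  case (Suc m)
  then show ?case
    by (auto simp: pow_Suc nth_append le_mod_geq)
qed simp

text \<open>The first block is \<open>u\<close> with one copy of \<open>v\<close>, so that it is
  nonempty even if \<open>u\<close> is empty.\<close>

lemma glue_upword:
  assumes "v \<noteq> []"
  shows "glue (case_nat (u @ v) (\<lambda>_. v)) = upword u v"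
proof (rule glue_unique)
  show "case_nat (u @ v) (\<lambda>_. v) i \<noteq> []" for i
    using assms by (cases i) auto
  have *: "concat (map (case_nat (u @ v) (\<lambda>_. v)) [0..<Suc k]) = u @ pow (Suc k) v" for k
  proof (induction k)
    case (Suc k)
    then show ?case
      using pow_add[of "Suc k" 1 v] by (simp add: pow_def)
  qed (simp add: pow_def)
  show "map (upword u v) [0..<length (concat (map (case_nat (u @ v) (\<lambda>_. v)) [0..<k]))] =
      concat (map (case_nat (u @ v) (\<lambda>_. v)) [0..<k])" for k
  proof (cases k)
    case (Suc l)
    show ?thesis
      unfolding Suc * by (rule nth_equalityI) (auto simp: upword_def nth_append nth_pow simp del: upt_Suc)
  qed simp
qed

lemma recognizes_upword:
  assumes h: "recognizes A K h L" and "u \<in> lists A" "u' \<in> lists A" "v \<in> lists A" "v \<noteq> []" "h u = h u'"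
  shows "L (upword u v) = L (upword u' v)"
  unfolding glue_upword[OF \<open>v \<noteq> []\<close>, symmetric]
  by (rule recognizes_glue[OF h]) (use assms recognizes_append[OF h, of u u' v v] in \<open>auto split: nat.split\<close>)

text \<open>Cuts are made between copies of \<open>v\<close>. Ramsey's theorem selects infinitely
  many with all segments between them in one class; repeating one such segment forever does not
  affect membership in \<open>L\<close>, and \<open>recognizes_shorten\<close> bounds it and the
  part before it.\<close>

lemma upword_ex:
  fixes R :: "'a \<Rightarrow> 'a \<Rightarrow> bool"
  assumes h: "recognizes A K h L" and u: "v \<noteq> []"
    and w: "\<And>i. w i \<in> A" "\<And>i. R (upword u v i) (w i)" "L w"
  shows "\<exists>a < K. \<exists>b. 0 < b \<and> b \<le> K \<and> (\<exists>u' \<in> lists A. \<exists>v' \<in> lists A.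
    list_all2 R (u @ pow a v) u' \<and> list_all2 R (pow b v) v' \<and> L (upword u' v'))"
proof -
  define c where "c i = length u + i * length v" for i
  define e where "e i j = map w [c i..<c j]" for i j
  have c_mono: "c i < c j \<longleftrightarrow> i < j" for i j
    using u by (simp add: c_def)
  have e_lists: "e i j \<in> lists A" for i j
    using w(1) by (auto simp: e_def)
  have "\<exists>Y t. Y \<subseteq> UNIV \<and> infinite Y \<and> t < K \<and>
      (\<forall>x \<in> Y. \<forall>y \<in> Y. x \<noteq> y \<longrightarrow> h (e (Min {x, y}) (Max {x, y})) = t)"
    by (rule Ramsey2) (use recognizes_less[OF h e_lists] in auto)
  then obtain Y t where Y0: "infinite Y" "\<forall>x \<in> Y. \<forall>y \<in> Y. x \<noteq> y \<longrightarrow> h (e (Min {x, y}) (Max {x, y})) = t"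
    by blast
  have Y: "infinite Y" "x \<in> Y \<Longrightarrow> y \<in> Y \<Longrightarrow> x < y \<Longrightarrow> h (e x y) = t" for x y
    using Y0(1) Y0(2)[rule_format, of x y] by (simp_all add: min_def max_def)
  define y where "y = enumerate Y"
  have y: "y i \<in> Y" "y i < y (Suc i)" for i
    using Y(1) by (auto simp: y_def enumerate_in_set enumerate_step)
  have step_eq: "e i (Suc i) = map (\<lambda>j. w (c i + j)) [0..<length v]" for i
    unfolding e_def c_def by (rule nth_equalityI) auto
  have R_step: "list_all2 R v (e i (Suc i))" for i
  proof (rule list_all2_all_nthI)
    show "R (v ! n) (e i (Suc i) ! n)" if "n < length v" for n
      using w(2)[of "c i + n"] that unfolding step_eq by (simp add: upword_def c_def)
  qed (simp add: step_eq)
  have e_concat: "e i (i + k) = concat (map (\<lambda>j. e j (Suc j)) [i..<i + k])" for i k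
  proof (induction k)
    case (Suc k)
    have "e i (i + Suc k) = e i (i + k) @ e (i + k) (Suc (i + k))"
      unfolding e_def by (simp flip: map_append add: c_def upt_append)
    then show ?case
      using Suc by simp
  qed (simp add: e_def)
  let ?u0 = "map w [0..<length u]" and ?bs = "map (\<lambda>j. e j (Suc j)) [0..<y 0]"
  have "list_all2 R u ?u0"
    using w(2) by (auto intro!: list_all2_all_nthI simp: upword_def) (metis)
  have "\<exists>bs'. set bs' \<subseteq> set ?bs \<and> length bs' < K \<and> h (?u0 @ concat bs') = h (?u0 @ concat ?bs)"
    by (rule recognizes_shorten[OF h]) (use w(1) e_lists in auto)
  then obtain bs where bs: "set bs \<subseteq> set ?bs" "length bs < K" "h (?u0 @ concat bs) = h (?u0 @ concat ?bs)"
    by blast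
  \<comment> \<open>The first copy of the period is kept apart, so that shortening the rest leaves
    at least one copy and at most \<open>K\<close>.\<close>
  let ?ds = "map (\<lambda>j. e j (Suc j)) [Suc (y 0)..<y 1]"
  have "\<exists>bs'. set bs' \<subseteq> set ?ds \<and> length bs' < K \<and>
      h (e (y 0) (Suc (y 0)) @ concat bs') = h (e (y 0) (Suc (y 0)) @ concat ?ds)"
    by (rule recognizes_shorten[OF h]) (use w(1) e_lists in auto)
  then obtain ds where ds: "set ds \<subseteq> set ?ds" "length ds < K"
    "h (e (y 0) (Suc (y 0)) @ concat ds) = h (e (y 0) (Suc (y 0)) @ concat ?ds)"
    by blast
  have R_concat: "list_all2 R (pow (length zs) v) (concat zs)" if "\<forall>z \<in> set zs. \<exists>j. z = e j (Suc j)" for zs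
    using that by (induction zs) (auto simp: pow_Suc intro!: list_all2_appendI R_step)
  have lists_concat: "concat zs \<in> lists A" if "\<forall>z \<in> set zs. \<exists>j. z = e j (Suc j)" for zs
    using that e_lists by (metis (no_types, lifting) concat_in_lists subsetI)
  define u' where "u' = ?u0 @ concat bs"
  define v' where "v' = e (y 0) (Suc (y 0)) @ concat ds"
  have "list_all2 R (u @ pow (length bs) v) u'"
    unfolding u'_def using bs(1) by (intro list_all2_appendI \<open>list_all2 R u ?u0\<close> R_concat) auto
  moreover have "list_all2 R (pow (Suc (length ds)) v) v'"
    unfolding v'_def pow_Suc using ds(1) by (intro list_all2_appendI R_step R_concat) auto
  moreover have lists: "u' \<in> lists A" "v' \<in> lists A"
    unfolding u'_def v'_def using bs(1) ds(1) w(1) e_lists by (auto intro!: lists_concat)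
  moreover have "L (upword u' v')"
  proof -
    have v': "v' \<noteq> []"
      using u by (simp add: v'_def step_eq)
    have "h u' = h (map w [0..<c (y 0)])"
    proof -
      have "map w [0..<c (y 0)] = ?u0 @ e 0 (0 + y 0)"
        unfolding e_def by (simp flip: map_append add: c_def upt_append)
      then show ?thesis
        unfolding u'_def bs(3) e_concat by simp
    qed
    moreover have "h v' = h (e (y 0) (y 1))"
    proof -
      have "y 0 + (y 1 - y 0) = y 1"
        using y(2)[of 0] by simp
      then have "e (y 0) (y 1) = concat (map (\<lambda>j. e j (Suc j)) [y 0..<y 1])"
        using e_concat[of "y 0" "y 1 - y 0"] by simp
      then show ?thesis
        unfolding v'_def ds(3) using y(2)[of 0] by (simp add: upt_conv_Cons)
    qed
    ultimately have eq0: "h (u' @ v') = h (map w [0..<c (y 0)] @ e (y 0) (y 1))"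
      using lists e_lists w(1) by (intro recognizes_append[OF h]) auto
    have eq1: "h v' = h (e (y i) (y (Suc i)))" for i
      using \<open>h v' = h (e (y 0) (y 1))\<close> Y(2) y by (metis One_nat_def)
    \<comment> \<open>The cut at \<open>y 0\<close> is left out: the first block in
      \<open>glue_upword\<close> is the prefix together with the first period.\<close>
    define k where "k = case_nat 0 (\<lambda>i. c (y (Suc i)))"
    have k_less: "k i < k (Suc i)" for i
    proof (cases i)
      case 0
      have "c (y 0) < c (y 1)"
        using y(2)[of 0] by (simp add: c_mono)
      then show ?thesis
        using 0 by (simp add: k_def)
    qed (use y(2) in \<open>simp add: k_def c_mono\<close>)
    have k: "strict_mono k" "k 0 = 0"
      using k_less by (simp_all add: strict_mono_Suc_iff k_def)
    have "L (glue (case_nat (u' @ v') (\<lambda>_. v'))) = L (glue (\<lambda>i. map w [k i..<k (Suc i)]))"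
    proof (rule recognizes_glue[OF h])
      show "map w [k i..<k (Suc i)] \<noteq> []" for i
        using k_less[of i] by simp
      show "h (case_nat (u' @ v') (\<lambda>_. v') i) = h (map w [k i..<k (Suc i)])" for i
      proof (cases i)
        case 0
        have "c (y 0) \<le> c (y (Suc 0))"
          using y(2)[of 0] c_mono by (simp add: less_imp_le)
        then have "map w [0..<c (y (Suc 0))] = map w [0..<c (y 0)] @ e (y 0) (y 1)"
          unfolding e_def by (simp flip: map_append add: upt_append)
        then show ?thesis
          using 0 eq0 by (simp add: k_def)
      qed (use eq1 in \<open>simp add: k_def e_def\<close>)
    qed (use lists v' w(1) in \<open>auto split: nat.split\<close>)
    then show ?thesis
      using w(3) by (simp add: glue_cuts[OF k] glue_upword[OF v'])
  qed
  ultimately show ?thesis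
    using bs(2) ds(2)
    by (intro exI[of _ "length bs"] conjI exI[of _ "Suc (length ds)"] bexI[of _ u'] bexI[of _ v']) simp_all
qed

section \<open>Monadic second-order logic of one successor\<close>

text \<open>An atom of \<open>Glob\<close> is a triple of a tag and a set variable: tag \<open>0\<close> says that the current
  position is the first one, tag \<open>1\<close> that it belongs to the variable, and any other tag that the
  next position does. A set variable is a pair \<open>(k, i)\<close>, and \<open>MsEx k\<close> binds all variables whose
  first component is \<open>k\<close> at once.\<close>

datatype mso = Glob "(nat \<times> nat \<times> nat) bform" | MsNot mso | MsAnd mso mso | MsEx nat mso

abbreviation First :: "(nat \<times> nat \<times> nat) bform" where "First \<equiv> BAtom (0, 0, 0)"
abbreviation Now :: "nat \<Rightarrow> nat \<Rightarrow> (nat \<times> nat \<times> nat) bform" where "Now k i \<equiv> BAtom (1, k, i)"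
abbreviation Next :: "nat \<Rightarrow> nat \<Rightarrow> (nat \<times> nat \<times> nat) bform" where "Next k i \<equiv> BAtom (2, k, i)"
abbreviation BImp :: "'a bform \<Rightarrow> 'a bform \<Rightarrow> 'a bform" where "BImp f g \<equiv> BOr (BNot f) g"
abbreviation BIff :: "'a bform \<Rightarrow> 'a bform \<Rightarrow> 'a bform" where "BIff f g \<equiv> BAnd (BImp f g) (BImp g f)"

definition lit_holds :: "bool \<Rightarrow> (nat \<times> nat) set \<Rightarrow> (nat \<times> nat) set \<Rightarrow> nat \<times> nat \<times> nat \<Rightarrow> bool" where
  "lit_holds first a b l = (if fst l = 0 then first else if fst l = 1 then snd l \<in> a else snd l \<in> b)"

lemma lit_holds_simps [simp]:
  "lit_holds first a b (0, x) = first" "lit_holds first a b (Suc 0, x) = (x \<in> a)"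
  "lit_holds first a b (1, x) = (x \<in> a)" "lit_holds first a b (2, x) = (x \<in> b)"
  by (simp_all add: lit_holds_def)

primrec msat :: "(nat \<Rightarrow> (nat \<times> nat) set) \<Rightarrow> mso \<Rightarrow> bool" where
  "msat w (Glob \<psi>) \<longleftrightarrow> (\<forall>i. bf_sat (lit_holds (i = 0) (w i) (w (Suc i))) \<psi>)"
| "msat w (MsNot \<phi>) \<longleftrightarrow> \<not> msat w \<phi>"
| "msat w (MsAnd \<phi> \<psi>) \<longleftrightarrow> msat w \<phi> \<and> msat w \<psi>"
| "msat w (MsEx k \<phi>) \<longleftrightarrow> (\<exists>w'. (\<forall>i x. fst x \<noteq> k \<longrightarrow> (x \<in> w' i) = (x \<in> w i)) \<and> msat w' \<phi>)"

primrec mso_vars :: "mso \<Rightarrow> (nat \<times> nat) set" where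
  "mso_vars (Glob \<psi>) = snd ` bf_atoms \<psi>"
| "mso_vars (MsNot \<phi>) = mso_vars \<phi>"
| "mso_vars (MsAnd \<phi> \<psi>) = mso_vars \<phi> \<union> mso_vars \<psi>"
| "mso_vars (MsEx k \<phi>) = mso_vars \<phi>"

lemma bf_sat_cong: "(\<And>x. x \<in> bf_atoms f \<Longrightarrow> V x = V' x) \<Longrightarrow> bf_sat V f = bf_sat V' f"
  by (induction f) auto

lemma msat_cong:
  "(\<And>i x. x \<in> mso_vars \<phi> \<Longrightarrow> (x \<in> w i) = (x \<in> w' i)) \<Longrightarrow> msat w \<phi> = msat w' \<phi>"
proof (induction \<phi> arbitrary: w w')
  case (Glob \<psi>)
  have "bf_sat (lit_holds (i = 0) (w i) (w (Suc i))) \<psi> = bf_sat (lit_holds (i = 0) (w' i) (w' (Suc i))) \<psi>" for i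
    by (rule bf_sat_cong) (use Glob in \<open>auto simp: lit_holds_def\<close>)
  then show ?case
    by simp
next
  case (MsEx k \<phi>)
  have "msat w' (MsEx k \<phi>)"
    if "msat w (MsEx k \<phi>)" and eq: "\<And>i x. x \<in> mso_vars \<phi> \<Longrightarrow> (x \<in> w i) = (x \<in> w' i)" for w w'
  proof -
    obtain u where u: "\<And>i x. fst x \<noteq> k \<Longrightarrow> (x \<in> u i) = (x \<in> w i)" "msat u \<phi>"
      using \<open>msat w (MsEx k \<phi>)\<close> unfolding msat.simps by blast
    define u' where "u' i = {x. if fst x = k then x \<in> u i else x \<in> w' i}" for i
    have "msat u \<phi> = msat u' \<phi>"
      by (rule MsEx.IH) (use u(1) eq in \<open>auto simp: u'_def\<close>)
    then show ?thesis
      using u(2) by (auto simp: u'_def intro!: exI[of _ u'])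
  qed
  from this[of w w'] this[of w' w] show ?case
    using MsEx.prems by auto
next
  case (MsNot \<phi>)
  have "msat w \<phi> = msat w' \<phi>"
    by (rule MsNot.IH) (use MsNot.prems in simp)
  then show ?case
    by simp
next
  case (MsAnd \<phi> \<psi>)
  have "msat w \<phi> = msat w' \<phi>" "msat w \<psi> = msat w' \<psi>"
    by (rule MsAnd.IH; use MsAnd.prems in simp)+
  then show ?case
    by simp
qed

section \<open>Letters as codes of finite sets of variables\<close>

definition letter_vars :: "nat \<Rightarrow> (nat \<times> nat) set" where
  "letter_vars a = {x. prod_encode x \<in> set_decode a}"

definition agree :: "nat \<Rightarrow> nat \<Rightarrow> nat \<Rightarrow> nat \<Rightarrow> bool" where
  "agree V k a b \<longleftrightarrow> (\<forall>n \<in> set [0..<V]. fst (prod_decode n) \<noteq> k \<longrightarrow> (n \<in> set_decode b) = (n \<in> set_decode a))"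

text \<open>The number of classes produced by \<open>recognizes_local\<close>,
  \<open>recognizes_conj\<close> and \<open>recognizes_ex\<close> for an alphabet of
  \<open>c\<close> letters, obtained from the formula alone.\<close>

primrec mso_index :: "nat \<Rightarrow> mso \<Rightarrow> nat" where
  "mso_index c (Glob \<psi>) = Suc (8 * c ^ 2)"
| "mso_index c (MsNot \<phi>) = mso_index c \<phi>"
| "mso_index c (MsAnd \<phi> \<psi>) = mso_index c \<phi> * mso_index c \<psi>"
| "mso_index c (MsEx k \<phi>) = 2 ^ mso_index c \<phi>"

lemma set_encode_less: "A \<subseteq> {..<V} \<Longrightarrow> set_encode A < 2 ^ V"
proof -
  assume A: "A \<subseteq> {..<V}"
  have "set_encode {..<V} < 2 ^ V"
    by (induction V) (auto simp: lessThan_Suc)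
  moreover have "set_encode A \<le> set_encode {..<V}"
    unfolding set_encode_def by (rule sum_mono2) (use A in auto)
  ultimately show ?thesis
    by simp
qed

text \<open>Variables with codes from \<open>V\<close> on do not occur in \<open>\<phi>\<close>, so
  the witness can be truncated to the finite alphabet of codes below \<open>2 ^ V\<close>.\<close>

lemma msat_MsEx_letters:
  assumes V: "prod_encode ` mso_vars \<phi> \<subseteq> {..<V}"
  shows "msat (\<lambda>i. letter_vars (w i)) (MsEx k \<phi>) \<longleftrightarrow>
    (\<exists>w'. (\<forall>i. w' i \<in> {..<2 ^ V} \<and> agree V k (w i) (w' i)) \<and> msat (\<lambda>i. letter_vars (w' i)) \<phi>)"
proof
  assume "msat (\<lambda>i. letter_vars (w i)) (MsEx k \<phi>)"
  then obtain u where u: "\<And>i x. fst x \<noteq> k \<Longrightarrow> (x \<in> u i) = (x \<in> letter_vars (w i))" "msat u \<phi>"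
    unfolding msat.simps by blast
  define A where "A i = {n. n < V \<and> prod_decode n \<in> u i}" for i
  have A: "A i \<subseteq> {..<V}" "finite (A i)" for i
    by (auto simp: A_def)
  define w' where "w' i = set_encode (A i)" for i
  have dec: "set_decode (w' i) = A i" for i
    using A by (simp add: w'_def)
  have "agree V k (w i) (w' i)" for i
    unfolding agree_def dec using u(1) by (auto simp: A_def letter_vars_def)
  moreover have "w' i \<in> {..<2 ^ V}" for i
    using set_encode_less[OF A(1)] by (simp add: w'_def)
  moreover have "msat u \<phi> = msat (\<lambda>i. letter_vars (w' i)) \<phi>"
    by (rule msat_cong) (use V in \<open>auto simp: letter_vars_def dec A_def\<close>)
  ultimately show "\<exists>w'. (\<forall>i. w' i \<in> {..<2 ^ V} \<and> agree V k (w i) (w' i)) \<and> msat (\<lambda>i. letter_vars (w' i)) \<phi>"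
    using u(2) by blast
next
  assume "\<exists>w'. (\<forall>i. w' i \<in> {..<2 ^ V} \<and> agree V k (w i) (w' i)) \<and> msat (\<lambda>i. letter_vars (w' i)) \<phi>"
  then obtain w' where w': "\<And>i. agree V k (w i) (w' i)" "msat (\<lambda>i. letter_vars (w' i)) \<phi>"
    by blast
  define u where "u i = {x. if fst x = k then x \<in> letter_vars (w' i) else x \<in> letter_vars (w i)}" for i
  have "(x \<in> letter_vars (w' i)) = (x \<in> u i)" if "x \<in> mso_vars \<phi>" for i x
  proof -
    have "prod_encode x < V"
      using V that by auto
    then show ?thesis
      using w'(1)[of i] unfolding agree_def u_def letter_vars_def by (auto dest!: bspec[of _ _ "prod_encode x"])
  qed
  then have "msat (\<lambda>i. letter_vars (w' i)) \<phi> = msat u \<phi>"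
    by (rule msat_cong)
  then show "msat (\<lambda>i. letter_vars (w i)) (MsEx k \<phi>)"
    using w'(2) by (auto simp: u_def intro!: exI[of _ u])
qed

theorem mso_recognizable:
  "prod_encode ` mso_vars \<phi> \<subseteq> {..<V} \<Longrightarrow>
    \<exists>h. recognizes {..<2 ^ V} (mso_index (2 ^ V) \<phi>) h (\<lambda>w. msat (\<lambda>i. letter_vars (w i)) \<phi>)"
proof (induction \<phi>)
  case (Glob \<psi>)
  show ?case
    using recognizes_local[of "{..<2 ^ V :: nat}" "\<lambda>f a b. bf_sat (lit_holds f (letter_vars a) (letter_vars b)) \<psi>"]
    by simp
next
  case (MsNot \<phi>)
  then show ?case
    using recognizes_not by fastforce
next
  case (MsAnd \<phi> \<psi>)
  then obtain h h' where "recognizes {..<2 ^ V} (mso_index (2 ^ V) \<phi>) h (\<lambda>w. msat (\<lambda>i. letter_vars (w i)) \<phi>)"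
    "recognizes {..<2 ^ V} (mso_index (2 ^ V) \<psi>) h' (\<lambda>w. msat (\<lambda>i. letter_vars (w i)) \<psi>)"
    by auto
  from recognizes_conj[OF this] show ?case
    by simp
next
  case (MsEx k \<phi>)
  then obtain h where h: "recognizes {..<2 ^ V} (mso_index (2 ^ V) \<phi>) h (\<lambda>w. msat (\<lambda>i. letter_vars (w i)) \<phi>)"
    by auto
  have V: "prod_encode ` mso_vars \<phi> \<subseteq> {..<V}"
    using MsEx.prems by simp
  show ?case
    using recognizes_ex[OF h, of "agree V k"] unfolding msat_MsEx_letters[OF V] mso_index.simps .
qed

subsection \<open>Deciding ultimately periodic words\<close>

definition variants :: "nat \<Rightarrow> nat \<Rightarrow> nat list \<Rightarrow> nat list list" where
  "variants V k u = product_lists (map (\<lambda>a. filter (\<lambda>b. agree V k a b) [0..<2 ^ V]) u)"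

text \<open>The finite search space that \<open>upword_ex\<close> justifies: fewer than
  \<open>K\<close> copies of \<open>v\<close> move to the prefix, and between 1 and \<open>K\<close>
  copies form the period.\<close>

definition extensions :: "nat \<Rightarrow> nat \<Rightarrow> nat \<Rightarrow> nat list \<Rightarrow> nat list \<Rightarrow> (nat list \<times> nat list) list" where
  "extensions V K k u v = concat (map (\<lambda>a. concat (map (\<lambda>b.
     List.product (variants V k (u @ pow a v)) (variants V k (pow b v))) [1..<Suc K])) [0..<K])"

text \<open>Two periods are inspected for \<open>Glob\<close>: if \<open>u\<close> is empty, the
  first one contains position 0, which alone satisfies the tag 0, so only the second represents the
  later ones. The third copy of \<open>v\<close> supplies the successor of the last inspected
  position.\<close>

primrec mso_check :: "nat \<Rightarrow> mso \<Rightarrow> nat list \<Rightarrow> nat list \<Rightarrow> bool" where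
  "mso_check V (Glob \<psi>) u v \<longleftrightarrow> (\<forall>i \<in> set [0..<length u + 2 * length v].
     bf_sat (lit_holds (i = 0) (letter_vars (nth_opt 0 (u @ pow 3 v) i)) (letter_vars (nth_opt 0 (u @ pow 3 v) (Suc i)))) \<psi>)"
| "mso_check V (MsNot \<phi>) u v \<longleftrightarrow> \<not> mso_check V \<phi> u v"
| "mso_check V (MsAnd \<phi> \<psi>) u v \<longleftrightarrow> mso_check V \<phi> u v \<and> mso_check V \<psi> u v"
| "mso_check V (MsEx k \<phi>) u v \<longleftrightarrow>
     (\<exists>p \<in> set (extensions V (mso_index (2 ^ V) \<phi>) k u v). mso_check V \<phi> (fst p) (snd p))"

lemma set_variants: "set (variants V k u) = {u' \<in> lists {..<2 ^ V}. list_all2 (agree V k) u u'}"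
proof -
  have "list_all2 (\<lambda>x ys. x \<in> set ys) u' (map (\<lambda>a. filter (\<lambda>b. agree V k a b) [0..<2 ^ V]) u) \<longleftrightarrow>
    u' \<in> lists {..<2 ^ V} \<and> list_all2 (agree V k) u u'" for u'
  proof (induction u arbitrary: u')
    case (Cons a u)
    then show ?case
      by (cases u') auto
  qed auto
  then show ?thesis
    by (simp add: variants_def product_lists_set)
qed

lemma set_extensions:
  "(u', v') \<in> set (extensions V K k u v) \<longleftrightarrow> (\<exists>a < K. \<exists>b. 0 < b \<and> b \<le> K \<and> u' \<in> lists {..<2 ^ V} \<and> v' \<in> lists {..<2 ^ V} \<and>
    list_all2 (agree V k) (u @ pow a v) u' \<and> list_all2 (agree V k) (pow b v) v')"
proof -
  have "(u', v') \<in> set (extensions V K k u v) \<longleftrightarrow>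
    (\<exists>a \<in> {0..<K}. \<exists>b \<in> {1..<Suc K}. u' \<in> set (variants V k (u @ pow a v)) \<and> v' \<in> set (variants V k (pow b v)))"
    by (auto simp: extensions_def simp del: upt_Suc)
  then show ?thesis
    unfolding set_variants mem_Collect_eq Bex_def atLeastLessThan_iff by (auto simp: less_Suc_eq_le Suc_le_eq)
qed

lemma list_all2_upword:
  assumes u: "list_all2 R (u @ pow a v) u'" and v: "list_all2 R (pow b v) v'" and "v \<noteq> []" "0 < b"
  shows "R (upword u v i) (upword u' v' i)"
proof (cases "i < length u'")
  case True
  have "length u' = length u + a * length v"
    using list_all2_lengthD[OF u] by simp
  then have "upword u v i = (u @ pow a v) ! i"
    using True by (auto simp: upword_def nth_append nth_pow)
  then show ?thesis
    using list_all2_nthD2[OF u True] True by (simp add: upword_def)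
next
  case False
  have len: "length u' = length u + a * length v" "length v' = b * length v"
    using list_all2_lengthD[OF u] list_all2_lengthD[OF v] by simp_all
  let ?j = "(i - length u') mod length v'"
  have j: "?j < length v'"
    using assms by (simp add: len)
  have "?j mod length v = (i - length u') mod length v"
    by (simp add: len mod_mod_cancel)
  also have "\<dots> = (i - length u) mod length v"
  proof -
    have "i - length u = (i - length u') + a * length v"
      using False len by simp
    then show ?thesis
      by simp
  qed
  finally have "upword u v i = pow b v ! ?j"
    using j False len assms by (simp add: upword_def nth_pow)
  then show ?thesis
    using list_all2_nthD2[OF v j] False by (simp add: upword_def)
qed

theorem mso_check_correct:
  "prod_encode ` mso_vars \<phi> \<subseteq> {..<V} \<Longrightarrow> v \<noteq> [] \<Longrightarrow>
    mso_check V \<phi> u v \<longleftrightarrow> msat (\<lambda>i. letter_vars (upword u v i)) \<phi>"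
proof (induction \<phi> arbitrary: u v)
  case (Glob \<psi>)
  let ?P = "\<lambda>i. bf_sat (lit_holds (i = 0) (letter_vars (upword u v i)) (letter_vars (upword u v (Suc i)))) \<psi>"
  have nth: "nth_opt 0 (u @ pow 3 v) i = upword u v i" if "i < length u + 3 * length v" for i
    using that by (auto simp: nth_opt_def upword_def nth_append nth_pow)
  have "mso_check V (Glob \<psi>) u v \<longleftrightarrow> (\<forall>i < length u + 2 * length v. ?P i)"
  proof -
    have "0 < length v"
      using Glob.prems by simp
    then have "nth_opt 0 (u @ pow 3 v) i = upword u v i" "nth_opt 0 (u @ pow 3 v) (Suc i) = upword u v (Suc i)"
      if "i < length u + 2 * length v" for i
      using nth[of i] nth[of "Suc i"] that by linarith+
    then show ?thesis
      by (simp add: Ball_def)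
  qed
  moreover have "?P i" if "\<forall>i < length u + 2 * length v. ?P i" for i
  proof (cases "i < length u + length v")
    case False
    define j where "j = length u + length v + (i - length u) mod length v"
    have j: "0 < j" "0 < i" "j < length u + 2 * length v" "length u \<le> j" "length u \<le> i"
      using Glob.prems False by (auto simp: j_def)
    have "(j - length u) mod length v = (i - length u) mod length v"
      by (simp add: j_def)
    moreover have "(Suc k - length u) mod length v = Suc ((k - length u) mod length v) mod length v"
      if "length u \<le> k" for k
      using that by (simp add: Suc_diff_le mod_Suc_eq)
    ultimately have "upword u v j = upword u v i" "upword u v (Suc j) = upword u v (Suc i)"
      using j by (simp_all add: upword_def)
    then show ?thesis
      using that j by auto
  qed (use that in auto)
  ultimately show ?case
    by auto
next
  case (MsEx k \<phi>)
  have V: "prod_encode ` mso_vars \<phi> \<subseteq> {..<V}"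
    using MsEx.prems by simp
  let ?K = "mso_index (2 ^ V) \<phi>"
  obtain h where h: "recognizes {..<2 ^ V} ?K h (\<lambda>w. msat (\<lambda>i. letter_vars (w i)) \<phi>)"
    using mso_recognizable[OF V] by blast
  let ?W = "\<lambda>a b u' v'. 0 < b \<and> b \<le> ?K \<and> u' \<in> lists {..<2 ^ V} \<and> v' \<in> lists {..<2 ^ V} \<and>
    list_all2 (agree V k) (u @ pow a v) u' \<and> list_all2 (agree V k) (pow b v) v'"
  have "mso_check V (MsEx k \<phi>) u v \<longleftrightarrow> (\<exists>u' v'. (\<exists>a < ?K. \<exists>b. ?W a b u' v') \<and> mso_check V \<phi> u' v')"
    by (simp add: Bex_def split_paired_Ex set_extensions del: in_lists_conv_set)
  also have "\<dots> \<longleftrightarrow> (\<exists>u' v'. (\<exists>a < ?K. \<exists>b. ?W a b u' v') \<and> msat (\<lambda>i. letter_vars (upword u' v' i)) \<phi>)"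
    (is "_ \<longleftrightarrow> ?R")
  proof (intro ex_cong1 conj_cong refl)
    fix u' v'
    assume "\<exists>a < ?K. \<exists>b. ?W a b u' v'"
    then obtain b where b: "list_all2 (agree V k) (pow b v) v'" "0 < b"
      by blast
    have "v' \<noteq> []"
      using list_all2_lengthD[OF b(1)] b(2) MsEx.prems by auto
    then show "mso_check V \<phi> u' v' = msat (\<lambda>i. letter_vars (upword u' v' i)) \<phi>"
      by (rule MsEx.IH[OF V])
  qed
  also have "\<dots> \<longleftrightarrow> msat (\<lambda>i. letter_vars (upword u v i)) (MsEx k \<phi>)"
  proof
    assume ?R
    then obtain a b u' v' where b: "0 < b" and *: "list_all2 (agree V k) (u @ pow a v) u'" "list_all2 (agree V k) (pow b v) v'"
      "u' \<in> lists {..<2 ^ V}" "v' \<in> lists {..<2 ^ V}" "msat (\<lambda>i. letter_vars (upword u' v' i)) \<phi>"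
      by blast
    have ne: "v' \<noteq> []"
      using list_all2_lengthD[OF *(2)] b MsEx.prems by auto
    have "upword u' v' i \<in> {..<2 ^ V}" for i
      using *(3,4) ne by (auto simp: upword_def)
    moreover have "agree V k (upword u v i) (upword u' v' i)" for i
      by (rule list_all2_upword[OF *(1,2) MsEx.prems(2) b])
    ultimately show "msat (\<lambda>i. letter_vars (upword u v i)) (MsEx k \<phi>)"
      unfolding msat_MsEx_letters[OF V] using *(5) by blast
  next
    assume "msat (\<lambda>i. letter_vars (upword u v i)) (MsEx k \<phi>)"
    then obtain w where w: "\<And>i. w i \<in> {..<2 ^ V}" "\<And>i. agree V k (upword u v i) (w i)"
      "msat (\<lambda>i. letter_vars (w i)) \<phi>"
      unfolding msat_MsEx_letters[OF V] by blast
    have "\<exists>a < ?K. \<exists>b. 0 < b \<and> b \<le> ?K \<and> (\<exists>u' \<in> lists {..<2 ^ V}. \<exists>v' \<in> lists {..<2 ^ V}.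
        list_all2 (agree V k) (u @ pow a v) u' \<and> list_all2 (agree V k) (pow b v) v' \<and>
        msat (\<lambda>i. letter_vars (upword u' v' i)) \<phi>)"
      by (rule upword_ex[where R = "agree V k", OF h MsEx.prems(2)]) (fact w)+
    then obtain a b u' v' where "a < ?K" "?W a b u' v'" "msat (\<lambda>i. letter_vars (upword u' v' i)) \<phi>"
      by blast
    then show ?R
      by blast
  qed
  finally show ?case .
qed (auto simp: image_Un)

text \<open>Beyond the index of the formula, the exponents in a word \<open>u\<^sub>1\<^sup>m\<^sup>1 \<dots> u\<^sub>k\<^sup>m\<^sup>k v\<^sup>\<omega>\<close> matter only modulo the
  factorial of the index.\<close>

theorem msat_pow_segments:
  assumes V: "prod_encode ` mso_vars \<phi> \<subseteq> {..<V}"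
    and ss: "list_all2 (\<lambda>s s'. fst s' = fst s \<and> fst s \<in> lists {..<2 ^ V} \<and>
      (snd s' = snd s \<or> mso_index (2 ^ V) \<phi> \<le> snd s \<and> (\<exists>j. snd s' = snd s + fact (mso_index (2 ^ V) \<phi>) * j))) ss ss'"
    and v: "v \<in> lists {..<2 ^ V}" "v \<noteq> []"
  shows "msat (\<lambda>i. letter_vars (upword (concat (map (\<lambda>s. pow (snd s) (fst s)) ss)) v i)) \<phi> =
    msat (\<lambda>i. letter_vars (upword (concat (map (\<lambda>s. pow (snd s) (fst s)) ss')) v i)) \<phi>"
proof -
  obtain h where h: "recognizes {..<2 ^ V} (mso_index (2 ^ V) \<phi>) h (\<lambda>w. msat (\<lambda>i. letter_vars (w i)) \<phi>)"
    using mso_recognizable[OF V] by blast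
  have "concat (map (\<lambda>s. pow (snd s) (fst s)) ss) \<in> lists {..<2 ^ V} \<and>
    concat (map (\<lambda>s. pow (snd s) (fst s)) ss') \<in> lists {..<2 ^ V} \<and>
    h (concat (map (\<lambda>s. pow (snd s) (fst s)) ss)) = h (concat (map (\<lambda>s. pow (snd s) (fst s)) ss'))"
    using ss
  proof (induction rule: list_all2_induct)
    case (Cons s ss s' ss')
    have lists: "pow (snd s) (fst s) \<in> lists {..<2 ^ V}" "pow (snd s') (fst s') \<in> lists {..<2 ^ V}"
      using Cons.hyps by (simp_all only: pow_in_lists)
    have "h (pow (snd s) (fst s)) = h (pow (snd s') (fst s'))"
      using Cons.hyps recognizes_pow[OF h, of "fst s" "snd s"] by auto
    then have "h (pow (snd s) (fst s) @ concat (map (\<lambda>s. pow (snd s) (fst s)) ss)) =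
        h (pow (snd s') (fst s') @ concat (map (\<lambda>s. pow (snd s) (fst s)) ss'))"
      using Cons.IH lists by (intro recognizes_append[OF h]) auto
    then show ?case
      using lists Cons.IH by simp
  qed simp
  then show ?thesis
    by (intro recognizes_upword[OF h _ _ v]) auto
qed

subsection \<open>Computability of the decision procedure\<close>

instantiation bform :: (enc) enc begin
definition enc_bform :: "'a bform \<Rightarrow> nat" where "enc_bform = bform_code enc"
instance ..
end

primrec mso_code :: "mso \<Rightarrow> nat" where
  "mso_code (Glob \<psi>) = list_encode [0, enc \<psi>]"
| "mso_code (MsNot \<phi>) = list_encode [1, mso_code \<phi>]"
| "mso_code (MsAnd \<phi> \<psi>) = list_encode [2, mso_code \<phi>, mso_code \<psi>]"
| "mso_code (MsEx k \<phi>) = list_encode [3, k, mso_code \<phi>]"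

instantiation mso :: enc begin
definition enc_mso :: "mso \<Rightarrow> nat" where "enc_mso = mso_code"
instance ..
end

text \<open>Access to the fields of a code. For a constructor term, field 0 is the constructor
  number; a missing field reads as 0.\<close>

definition arg :: "nat \<Rightarrow> nat \<Rightarrow> nat" where
  "arg i c = nth_opt 0 (list_decode c) i"

lemma arg_list_encode [simp]: "arg i (list_encode xs) = nth_opt 0 xs i"
  by (simp add: arg_def)

lemma nth_opt_Cons [simp]: "nth_opt d (x # xs) 0 = x" "nth_opt d (x # xs) (Suc i) = nth_opt d xs i"
  "nth_opt d (x # xs) 1 = nth_opt d xs 0" "nth_opt d (x # xs) (numeral n) = nth_opt d xs (pred_numeral n)"
  by (auto simp: nth_opt_def)

lemma computable_arg [comp]: "computable i \<Longrightarrow> computable c \<Longrightarrow> computable (\<lambda>x. arg (i x) (c x))"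
  unfolding arg_def by (intro comp)

text \<open>The reason why recursion on codes terminates with the code as measure, and why the input
  code bounds the codes of its parts.\<close>

lemma less_list_encode: "x \<in> set xs \<Longrightarrow> x < list_encode xs"
proof (induction xs)
  case (Cons y xs)
  then show ?case
    using le_prod_encode_1[of y "list_encode xs"] le_prod_encode_2[of "list_encode xs" y]
    by (auto simp: less_Suc_eq_le)
qed simp

definition bform_subs :: "'p \<times> nat \<Rightarrow> ('p \<times> nat) list" where
  "bform_subs z = (if arg 0 (snd z) \<le> 1 then [] else if arg 0 (snd z) = 2 then [(fst z, arg 1 (snd z))]
     else [(fst z, arg 1 (snd z)), (fst z, arg 2 (snd z))])"

text \<open>The parameter travels unchanged to the atoms, so that the same evaluator serves for
  letters of words and for lists of signs.\<close>

definition bform_eval :: "('p \<times> nat \<Rightarrow> bool) \<Rightarrow> 'p \<times> nat \<Rightarrow> bool" where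
  "bform_eval T = measure_rec bform_subs (\<lambda>z vs. if arg 0 (snd z) = 0 then True
     else if arg 0 (snd z) = 1 then T (fst z, arg 1 (snd z))
     else if arg 0 (snd z) = 2 then \<not> nth_opt False vs 0
     else if arg 0 (snd z) = 3 then nth_opt False vs 0 \<and> nth_opt False vs 1
     else nth_opt False vs 0 \<or> nth_opt False vs 1) snd"

lemma computable_bform_eval:
  assumes "computable (T :: 'p::enc \<times> nat \<Rightarrow> bool)" "computable z"
  shows "computable (\<lambda>x. bform_eval T (z x))"
  unfolding bform_eval_def
  by (intro computable_measure_rec assms comp computable_compose[OF assms(1)])
    (unfold bform_subs_def, intro comp)

lemma bform_eval: "bform_eval T (p, bform_code c f) = bf_sat (\<lambda>x. T (p, c x)) f"
proof -
  let ?ch = "\<lambda>f. case f of BTrue \<Rightarrow> [] | BAtom x \<Rightarrow> [] | BNot f \<Rightarrow> [f] | BAnd f g \<Rightarrow> [f, g] | BOr f g \<Rightarrow> [f, g]"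
  show ?thesis
    unfolding bform_eval_def
    by (rule measure_rec_eq[where r = "\<lambda>f. (p, bform_code c f)" and ch = ?ch and ok = "\<lambda>_. True"])
      (auto simp: bform_subs_def less_list_encode simp del: list_encode.simps split: bform.split)
qed

definition mso_subs :: "nat \<Rightarrow> nat list" where
  "mso_subs c = (if arg 0 c = 0 then [] else if arg 0 c = 1 then [arg 1 c]
     else if arg 0 c = 2 then [arg 1 c, arg 2 c] else [arg 2 c])"

definition index_code :: "nat \<times> nat \<Rightarrow> nat" where
  "index_code = measure_rec (\<lambda>z. map (\<lambda>c. (fst z, c)) (mso_subs (snd z)))
     (\<lambda>z vs. if arg 0 (snd z) = 0 then Suc (8 * fst z ^ 2) else if arg 0 (snd z) = 1 then nth_opt 0 vs 0
        else if arg 0 (snd z) = 2 then nth_opt 0 vs 0 * nth_opt 0 vs 1 else 2 ^ nth_opt 0 vs 0) snd"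

lemma computable_index_code [comp]: "computable z \<Longrightarrow> computable (\<lambda>x. index_code (z x))"
  unfolding index_code_def mso_subs_def by (intro computable_measure_rec comp)

abbreviation "mso_children \<phi> \<equiv> case \<phi> of Glob \<psi> \<Rightarrow> [] | MsNot \<phi> \<Rightarrow> [\<phi>] | MsAnd \<phi> \<psi> \<Rightarrow> [\<phi>, \<psi>] | MsEx k \<phi> \<Rightarrow> [\<phi>]"

lemma index_code: "index_code (c, mso_code \<phi>) = mso_index c \<phi>"
  unfolding index_code_def
  by (rule measure_rec_eq[where r = "\<lambda>\<phi>. (c, mso_code \<phi>)" and ch = "\<lambda>\<phi>. mso_children \<phi>" and ok = "\<lambda>_. True"])
    (auto simp: mso_subs_def less_list_encode simp del: list_encode.simps split: mso.split)

lemma computable_pow [comp]: "computable m \<Longrightarrow> computable u \<Longrightarrow> computable (\<lambda>x. pow (m x) (u x))"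
  unfolding pow_def by (intro comp)

lemma computable_extensions [comp]:
  assumes "computable V" "computable K" "computable k" "computable u" "computable v"
  shows "computable (\<lambda>x. extensions (V x) (K x) (k x) (u x) (v x))"
  unfolding extensions_def variants_def agree_def by (intro comp assms assms[THEN computable_compose])

definition lit_eval :: "(bool \<times> nat \<times> nat) \<times> nat \<Rightarrow> bool" where
  "lit_eval z = (if fst (prod_decode (snd z)) = 0 then fst (fst z)
     else if fst (prod_decode (snd z)) = 1 then snd (prod_decode (snd z)) \<in> set_decode (fst (snd (fst z)))
     else snd (prod_decode (snd z)) \<in> set_decode (snd (snd (fst z))))"

text \<open>The counterpart of \<open>mso_check\<close> on codes. The words may grow in the calls
  for a quantifier, but the measure looks only at the formula.\<close>

definition mso_decide :: "nat \<times> nat \<times> nat list \<times> nat list \<Rightarrow> bool" where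
  "mso_decide = measure_rec
     (\<lambda>z. if arg 0 (fst (snd z)) = 3
        then map (\<lambda>p. (fst z, arg 2 (fst (snd z)), p))
          (extensions (fst z) (index_code (2 ^ fst z, arg 2 (fst (snd z)))) (arg 1 (fst (snd z))) (fst (snd (snd z))) (snd (snd (snd z))))
        else map (\<lambda>c. (fst z, c, snd (snd z))) (mso_subs (fst (snd z))))
     (\<lambda>z vs. if arg 0 (fst (snd z)) = 0
        then (\<forall>i \<in> set [0..<length (fst (snd (snd z))) + 2 * length (snd (snd (snd z)))].
          bform_eval lit_eval ((i = 0, nth_opt 0 (fst (snd (snd z)) @ pow 3 (snd (snd (snd z)))) i,
            nth_opt 0 (fst (snd (snd z)) @ pow 3 (snd (snd (snd z)))) (Suc i)), arg 1 (fst (snd z))))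
        else if arg 0 (fst (snd z)) = 1 then \<not> nth_opt False vs 0
        else if arg 0 (fst (snd z)) = 2 then nth_opt False vs 0 \<and> nth_opt False vs 1
        else (\<exists>b \<in> set vs. b)) (\<lambda>z. fst (snd z))"

lemma computable_mso_decide [comp]: "computable z \<Longrightarrow> computable (\<lambda>x. mso_decide (z x))"
  unfolding mso_decide_def mso_subs_def
  by (intro computable_measure_rec computable_bform_eval comp)
    (unfold lit_eval_def, intro comp)

lemma lit_eval: "lit_eval ((f, a, b), enc l) = lit_holds f (letter_vars a) (letter_vars b) l"
  by (cases l) (auto simp: lit_eval_def lit_holds_def letter_vars_def enc_prod_def enc_nat_def)

lemma mso_decide: "mso_decide (V, mso_code \<phi>, u, v) = mso_check V \<phi> u v"
proof -
  let ?r = "\<lambda>(\<phi>, u, v). (V, mso_code \<phi>, u, v)" and ?F = "\<lambda>(\<phi>, u, v). mso_check V \<phi> u v"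
  let ?ch = "\<lambda>(\<phi>, u, v). case \<phi> of MsEx k \<phi>' \<Rightarrow> map (Pair \<phi>') (extensions V (mso_index (2 ^ V) \<phi>') k u v)
     | _ \<Rightarrow> map (\<lambda>\<phi>'. (\<phi>', u, v)) (mso_children \<phi>)"
  have "mso_decide (?r (\<phi>, u, v)) = ?F (\<phi>, u, v)"
    unfolding mso_decide_def
  proof (rule measure_rec_eq[where r = ?r and ch = ?ch and F = ?F and ok = "\<lambda>_. True"], goal_cases)
    case (1 d)
    obtain \<chi> x y where d: "d = (\<chi>, x, y)"
      by (cases d)
    show ?case
      unfolding d by (cases \<chi>)
        (auto simp: mso_subs_def less_list_encode index_code bform_eval enc_bform_def lit_eval
          simp del: list_encode.simps set_upt intro: rev_bexI)
  qed simp
  then show ?thesis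
    by simp
qed

section \<open>Translation of the specification languages\<close>

lemma computable_BAtom [comp]: "computable a \<Longrightarrow> computable (\<lambda>x. BAtom (a x))"
  by (rule computable_same_enc[where a = "\<lambda>x. list_encode [1, enc (a x)]"])
    (intro comp, assumption, simp add: enc_bform_def enc_nat_def)

lemma computable_BNot [comp]: "computable f \<Longrightarrow> computable (\<lambda>x. BNot (f x))"
  by (rule computable_same_enc[where a = "\<lambda>x. list_encode [2, enc (f x)]"])
    (intro comp, assumption, simp add: enc_bform_def enc_nat_def)

lemma computable_BAnd [comp]: "computable f \<Longrightarrow> computable g \<Longrightarrow> computable (\<lambda>x. BAnd (f x) (g x))"
  by (rule computable_same_enc[where a = "\<lambda>x. list_encode [3, enc (f x), enc (g x)]"])
    (intro comp, assumption+, simp add: enc_bform_def enc_nat_def)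

lemma computable_BOr [comp]: "computable f \<Longrightarrow> computable g \<Longrightarrow> computable (\<lambda>x. BOr (f x) (g x))"
  by (rule computable_same_enc[where a = "\<lambda>x. list_encode [4, enc (f x), enc (g x)]"])
    (intro comp, assumption+, simp add: enc_bform_def enc_nat_def)

lemma computable_Glob [comp]: "computable f \<Longrightarrow> computable (\<lambda>x. Glob (f x))"
  by (rule computable_same_enc[where a = "\<lambda>x. list_encode [0, enc (f x)]"])
    (intro comp, assumption, simp add: enc_mso_def enc_nat_def)

lemma computable_MsNot [comp]: "computable f \<Longrightarrow> computable (\<lambda>x. MsNot (f x))"
  by (rule computable_same_enc[where a = "\<lambda>x. list_encode [1, enc (f x)]"])
    (intro comp, assumption, simp add: enc_mso_def enc_nat_def)

lemma computable_MsAnd [comp]: "computable f \<Longrightarrow> computable g \<Longrightarrow> computable (\<lambda>x. MsAnd (f x) (g x))"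
  by (rule computable_same_enc[where a = "\<lambda>x. list_encode [2, enc (f x), enc (g x)]"])
    (intro comp, assumption+, simp add: enc_mso_def enc_nat_def)

lemma computable_MsEx [comp]: "computable k \<Longrightarrow> computable f \<Longrightarrow> computable (\<lambda>x. MsEx (k x) (f x))"
  by (rule computable_same_enc[where a = "\<lambda>x. list_encode [3, k x, enc (f x)]"])
    (intro comp, assumption+, simp add: enc_mso_def enc_nat_def)

text \<open>Provides a bound on the alphabet without collecting the variables of a formula.\<close>

lemma mso_vars_less: "x \<in> mso_vars \<phi> \<Longrightarrow> prod_encode x < mso_code \<phi>"
proof (induction \<phi>)
  case (Glob \<psi>)
  then obtain t where t: "(t, x) \<in> bf_atoms \<psi>"
    by auto
  have "prod_encode x \<le> enc (t, x)"
    using le_prod_encode_2[of "prod_encode x" t] by (cases x) (simp add: enc_prod_def enc_nat_def)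
  also have "enc (t, x) < bform_code enc \<psi>"
    using t
  proof (induction \<psi>)
    case (BAtom y)
    then show ?case
      using less_list_encode[of "enc y" "[1, enc y]"] by simp
  next
    case (BNot f)
    then show ?case
      using less_list_encode[of "bform_code enc f" "[2, bform_code enc f]"] by (simp del: list_encode.simps)
  next
    case (BAnd f g)
    then show ?case
      using less_list_encode[of _ "[3, bform_code enc f, bform_code enc g]"]
      by (auto simp del: list_encode.simps intro: less_trans)
  next
    case (BOr f g)
    then show ?case
      using less_list_encode[of _ "[4, bform_code enc f, bform_code enc g]"]
      by (auto simp del: list_encode.simps intro: less_trans)
  qed simp
  also have "\<dots> < mso_code (Glob \<psi>)"
    using less_list_encode[of "enc \<psi>" "[0, enc \<psi>]"] by (simp add: enc_bform_def del: list_encode.simps)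
  finally show ?case .
next
  case (MsNot \<phi>)
  then show ?case
    using less_list_encode[of "mso_code \<phi>" "[1, mso_code \<phi>]"] by (simp del: list_encode.simps)
next
  case (MsAnd \<phi> \<psi>)
  then show ?case
    using less_list_encode[of _ "[2, mso_code \<phi>, mso_code \<psi>]"]
    by (auto simp del: list_encode.simps intro: less_trans)
next
  case (MsEx k \<phi>)
  then show ?case
    using less_list_encode[of "mso_code \<phi>" "[3, k, mso_code \<phi>]"] by (simp del: list_encode.simps)
qed

text \<open>Class 0 of the set variables is reserved for the atoms of the letters; all translations
  quantify over positive classes only.\<close>

definition represents :: "(nat \<Rightarrow> (nat \<times> nat) set) \<Rightarrow> (nat \<Rightarrow> letter) \<Rightarrow> bool" where
  "represents W w \<longleftrightarrow> (\<forall>i x. (0, atom_code x) \<in> W i \<longleftrightarrow> x \<in> w i)"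

definition track :: "(nat \<Rightarrow> (nat \<times> nat) set) \<Rightarrow> nat \<Rightarrow> nat \<Rightarrow> nat set" where
  "track W k j = {i. (k, j) \<in> W i}"

definition upd_class :: "nat \<Rightarrow> (nat \<Rightarrow> nat set) \<Rightarrow> (nat \<Rightarrow> (nat \<times> nat) set) \<Rightarrow> nat \<Rightarrow> (nat \<times> nat) set" where
  "upd_class k X W i = {x. if fst x = k then i \<in> X (snd x) else x \<in> W i}"

lemma track_upd_class [simp]: "track (upd_class k X W) k' j = (if k' = k then X j else track W k' j)"
  by (auto simp: track_def upd_class_def)

lemma represents_upd_class [simp]: "0 < k \<Longrightarrow> represents (upd_class k X W) w = represents W w"
  by (simp add: represents_def upd_class_def)

text \<open>A quantifier over words becomes one over families of sets of positions, indexed by the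
  second component of the variables.\<close>

lemma msat_MsEx_upd_class: "msat W (MsEx k \<phi>) \<longleftrightarrow> (\<exists>X. msat (upd_class k X W) \<phi>)"
proof
  assume "msat W (MsEx k \<phi>)"
  then obtain W' where W': "\<And>i x. fst x \<noteq> k \<Longrightarrow> (x \<in> W' i) = (x \<in> W i)" "msat W' \<phi>"
    unfolding msat.simps by blast
  have "x \<in> W' i \<longleftrightarrow> x \<in> upd_class k (track W' k) W i" for i x
    by (cases x) (auto simp: upd_class_def track_def W'(1))
  then have "W' = upd_class k (track W' k) W"
    by blast
  then show "\<exists>X. msat (upd_class k X W) \<phi>"
    using W'(2) by metis
next
  assume "\<exists>X. msat (upd_class k X W) \<phi>"
  then obtain X where X: "msat (upd_class k X W) \<phi>" ..
  have "\<forall>i x. fst x \<noteq> k \<longrightarrow> (x \<in> upd_class k X W i) = (x \<in> W i)"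
    by (simp add: upd_class_def)
  with X show "msat W (MsEx k \<phi>)"
    unfolding msat.simps by blast
qed

lemma mem_track: "(k, j) \<in> W i \<longleftrightarrow> i \<in> track W k j"
  by (simp add: track_def)

subsection \<open>First-order logic\<close>

text \<open>The variable \<open>z\<close> is a singleton set variable of class \<open>z + 2\<close>; class \<open>1\<close> holds the set of
  all positions strictly after the ones in class \<open>k\<close>.\<close>

definition after :: "nat \<Rightarrow> (nat \<times> nat \<times> nat) bform" where
  "after k = BAnd (BImp First (BNot (Now 1 0))) (BIff (Next 1 0) (BOr (Now 1 0) (Now k 0)))"

definition singleton :: "nat \<Rightarrow> mso" where
  "singleton k = MsAnd (MsNot (Glob (BNot (Now k 0)))) (MsEx 1 (Glob (BAnd (after k) (BNot (BAnd (Now k 0) (Now 1 0))))))"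

definition fo_less :: "nat \<Rightarrow> nat \<Rightarrow> mso" where
  "fo_less k k' = MsEx 1 (Glob (BAnd (after k) (BImp (Now k' 0) (Now 1 0))))"

lemma after:
  "(\<forall>i. bf_sat (lit_holds (i = 0) (W i) (W (Suc i))) (after k)) \<longleftrightarrow>
    (\<forall>i. i \<in> track W 1 0 \<longleftrightarrow> (\<exists>j < i. j \<in> track W k 0))" (is "?L \<longleftrightarrow> ?R")
proof
  assume L: ?L
  have "i \<in> track W 1 0 \<longleftrightarrow> (\<exists>j < i. j \<in> track W k 0)" for i
  proof (induction i)
    case 0
    then show ?case
      using L[rule_format, of 0] by (simp add: after_def mem_track)
  next
    case (Suc i)
    have "Suc i \<in> track W 1 0 \<longleftrightarrow> i \<in> track W 1 0 \<or> i \<in> track W k 0"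
      using L[rule_format, of i] by (auto simp: after_def mem_track)
    then show ?case
      unfolding Suc by (auto simp: less_Suc_eq)
  qed
  then show ?R ..
next
  assume ?R
  then show ?L
    by (auto simp: after_def mem_track less_Suc_eq)
qed

text \<open>Class 1 is bound existentially, but \<open>after\<close> determines its set, so the
  quantifier acts as a definition.\<close>

lemma msat_after:
  assumes "k \<noteq> 1"
    and P: "\<And>X i. bf_sat (lit_holds (i = 0) (upd_class 1 X W i) (upd_class 1 X W (Suc i))) \<psi> \<longleftrightarrow> P i (i \<in> X 0)"
  shows "msat W (MsEx 1 (Glob (BAnd (after k) \<psi>))) \<longleftrightarrow> (\<forall>i. P i (\<exists>j < i. j \<in> track W k 0))"
proof -
  define A where "A = {i. \<exists>j < i. j \<in> track W k 0}"
  have "msat W (MsEx 1 (Glob (BAnd (after k) \<psi>))) \<longleftrightarrow> (\<exists>X :: nat \<Rightarrow> nat set. (\<forall>i. i \<in> X 0 \<longleftrightarrow> i \<in> A) \<and> (\<forall>i. P i (i \<in> X 0)))"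
    unfolding msat_MsEx_upd_class msat.simps bf_sat.simps all_conj_distrib after P
    using assms(1) by (simp add: A_def) 
  also have "\<dots> \<longleftrightarrow> (\<exists>X :: nat \<Rightarrow> nat set. X 0 = A \<and> (\<forall>i. P i (i \<in> X 0)))"
    unfolding set_eq_iff ..
  also have "\<dots> \<longleftrightarrow> (\<forall>i. P i (i \<in> A))"
  proof
    assume "\<forall>i. P i (i \<in> A)"
    then show "\<exists>X :: nat \<Rightarrow> nat set. X 0 = A \<and> (\<forall>i. P i (i \<in> X 0))"
      by (intro exI[of _ "\<lambda>_. A"]) simp
  qed blast
  finally show ?thesis
    by (simp add: A_def)
qed

lemma msat_singleton:
  assumes "k \<noteq> 1"
  shows "msat W (singleton k) \<longleftrightarrow> (\<exists>n. track W k 0 = {n})"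
proof -
  have "msat W (MsEx 1 (Glob (BAnd (after k) (BNot (BAnd (Now k 0) (Now 1 0)))))) \<longleftrightarrow>
      (\<forall>i. \<not> (i \<in> track W k 0 \<and> (\<exists>j < i. j \<in> track W k 0)))"
    by (rule msat_after) (use assms in \<open>simp_all add: mem_track\<close>)
  then have "msat W (singleton k) \<longleftrightarrow> track W k 0 \<noteq> {} \<and> (\<forall>i. \<not> (i \<in> track W k 0 \<and> (\<exists>j < i. j \<in> track W k 0)))"
    by (simp add: singleton_def mem_track del: msat.simps(4))
  also have "\<dots> \<longleftrightarrow> (\<exists>n. track W k 0 = {n})"
  proof
    assume *: "track W k 0 \<noteq> {} \<and> (\<forall>i. \<not> (i \<in> track W k 0 \<and> (\<exists>j < i. j \<in> track W k 0)))"
    then obtain n where n: "n \<in> track W k 0"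
      by blast
    have "m = n" if "m \<in> track W k 0" for m
      using * n that by (metis linorder_neqE_nat)
    then show "\<exists>n. track W k 0 = {n}"
      using n by blast
  qed auto
  finally show ?thesis .
qed

lemma msat_fo_less:
  assumes "k \<noteq> 1" "k' \<noteq> 1" "track W k 0 = {m}" "track W k' 0 = {n}"
  shows "msat W (fo_less k k') \<longleftrightarrow> m < n"
proof -
  have "msat W (fo_less k k') \<longleftrightarrow> (\<forall>i. i \<in> track W k' 0 \<longrightarrow> (\<exists>j < i. j \<in> track W k 0))"
    unfolding fo_less_def by (rule msat_after) (use assms(1,2) in \<open>auto simp: mem_track\<close>)
  then show ?thesis
    using assms(3,4) by simp
qed

text \<open>On a singleton, holding at some element and holding at all elements coincide, so atomic
  formulas become implications under \<open>Glob\<close>.\<close>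

primrec fo_mso :: "atom fo \<Rightarrow> mso" where
  "fo_mso (FAtom x z) = Glob (BImp (Now (z + 2) 0) (Now 0 (atom_code x)))"
| "fo_mso (FSucc z z') = Glob (BImp (Now (z + 2) 0) (Next (z' + 2) 0))"
| "fo_mso (FLess z z') = fo_less (z + 2) (z' + 2)"
| "fo_mso (FEq z z') = Glob (BImp (Now (z + 2) 0) (Now (z' + 2) 0))"
| "fo_mso (FNot \<phi>) = MsNot (fo_mso \<phi>)"
| "fo_mso (FAnd \<phi> \<psi>) = MsAnd (fo_mso \<phi>) (fo_mso \<psi>)"
| "fo_mso (FEx z \<phi>) = MsEx (z + 2) (MsAnd (singleton (z + 2)) (fo_mso \<phi>))"

lemma fo_mso:
  "represents W w \<Longrightarrow> (\<And>z. z \<in> fo_fv \<phi> \<Longrightarrow> track W (z + 2) 0 = {e z}) \<Longrightarrow>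
    msat W (fo_mso \<phi>) \<longleftrightarrow> fo_sat w e \<phi>"
proof (induction \<phi> arbitrary: W e)
  case (FAtom x z)
  then show ?case
    by (auto simp: mem_track) (auto simp: represents_def track_def)
next
  case (FLess z z')
  then show ?case
    using msat_fo_less[of "z + 2" "z' + 2" W "e z" "e z'"] by simp
next
  case (FAnd \<phi> \<psi>)
  then show ?case
    by (metis UnCI fo_fv.simps(6) fo_mso.simps(6) fo_sat.simps(6) msat.simps(3))
next
  case (FEx z \<phi>)
  have IH: "msat (upd_class (z + 2) X W) (fo_mso \<phi>) \<longleftrightarrow> fo_sat w (e(z := n)) \<phi>" if "X 0 = {n}" for X n
    by (rule FEx.IH) (use FEx.prems that in auto)
  have "msat W (fo_mso (FEx z \<phi>)) \<longleftrightarrow> (\<exists>X n. X 0 = {n} \<and> msat (upd_class (z + 2) X W) (fo_mso \<phi>))"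
    unfolding fo_mso.simps msat_MsEx_upd_class msat.simps by (simp add: msat_singleton)
  also have "\<dots> \<longleftrightarrow> (\<exists>n. fo_sat w (e(z := n)) \<phi>)"
  proof
    assume "\<exists>n. fo_sat w (e(z := n)) \<phi>"
    then obtain n where "fo_sat w (e(z := n)) \<phi>" ..
    then show "\<exists>X n. X 0 = {n} \<and> msat (upd_class (z + 2) X W) (fo_mso \<phi>)"
      using IH[of "\<lambda>_. {n}" n] by (intro exI[of _ "\<lambda>_. {n}"] exI[of _ n]) simp
  qed (use IH in blast)
  finally show ?case
    by simp
qed (auto simp: mem_track)

definition fo_mso_code :: "nat \<Rightarrow> mso" where
  "fo_mso_code = measure_rec
    (\<lambda>c. if arg 0 c \<le> 3 then [] else if arg 0 c = 4 then [arg 1 c] else if arg 0 c = 5 then [arg 1 c, arg 2 c] else [arg 2 c])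
    (\<lambda>c vs. if arg 0 c = 0 then Glob (BImp (Now (arg 2 c + 2) 0) (Now 0 (arg 1 c)))
      else if arg 0 c = 1 then Glob (BImp (Now (arg 1 c + 2) 0) (Next (arg 2 c + 2) 0))
      else if arg 0 c = 2 then fo_less (arg 1 c + 2) (arg 2 c + 2)
      else if arg 0 c = 3 then Glob (BImp (Now (arg 1 c + 2) 0) (Now (arg 2 c + 2) 0))
      else if arg 0 c = 4 then MsNot (nth_opt undefined vs 0)
      else if arg 0 c = 5 then MsAnd (nth_opt undefined vs 0) (nth_opt undefined vs 1)
      else MsEx (arg 1 c + 2) (MsAnd (singleton (arg 1 c + 2)) (nth_opt undefined vs 0))) (\<lambda>c. c)"

lemma computable_fo_mso_code [comp]: "computable c \<Longrightarrow> computable (\<lambda>x. fo_mso_code (c x))"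
  unfolding fo_mso_code_def singleton_def fo_less_def after_def by (intro computable_measure_rec comp)

lemma fo_mso_code: "fo_mso_code (fo_code atom_code \<phi>) = fo_mso \<phi>"
  unfolding fo_mso_code_def
  by (rule measure_rec_eq[where r = "fo_code atom_code" and ok = "\<lambda>_. True"
        and ch = "\<lambda>\<phi>. case \<phi> of FNot \<phi> \<Rightarrow> [\<phi>] | FAnd \<phi> \<psi> \<Rightarrow> [\<phi>, \<psi>] | FEx z \<phi> \<Rightarrow> [\<phi>] | _ \<Rightarrow> []"])
    (auto simp: less_list_encode simp del: list_encode.simps split: fo.split)

subsection \<open>Linear mu-calculus\<close>

text \<open>The fixed-point variable \<open>z\<close> becomes class \<open>2 z + 1\<close>. The translation of \<open>\<phi>\<close> states that
  class \<open>sub_class\<close> of the code of \<open>\<phi>\<close> is the denotation of \<open>\<phi>\<close>.\<close>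

definition sub_class :: "nat \<Rightarrow> nat" where "sub_class c = 2 * c + 2"
definition mu_class :: "nat \<Rightarrow> nat" where "mu_class z = 2 * z + 1"

abbreviation mu_atom_code :: "atom mutl \<Rightarrow> nat" where "mu_atom_code \<equiv> mu_code atom_code"

text \<open>Knaster-Tarski: class \<open>s\<close> is a fixed point and lies below every set that
  the operator maps into itself. The formula \<open>\<phi>\<close> is meant to say that class
  \<open>s'\<close> is the value of the operator at class \<open>z\<close>.\<close>

definition mso_mu :: "nat \<Rightarrow> nat \<Rightarrow> nat \<Rightarrow> mso \<Rightarrow> mso" where
  "mso_mu s z s' \<phi> = MsAnd
     (MsEx z (MsAnd (Glob (BIff (Now z 0) (Now s 0))) (MsEx s' (MsAnd \<phi> (Glob (BIff (Now s' 0) (Now s 0)))))))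
     (MsNot (MsEx z (MsEx s' (MsAnd \<phi> (MsAnd (Glob (BImp (Now s' 0) (Now z 0))) (MsNot (Glob (BImp (Now s 0) (Now z 0)))))))))"

primrec mu_mso :: "atom mutl \<Rightarrow> mso" where
  "mu_mso (MAtom x) = Glob (BIff (Now (sub_class (mu_atom_code (MAtom x))) 0) (Now 0 (atom_code x)))"
| "mu_mso (MVar z) = Glob (BIff (Now (sub_class (mu_atom_code (MVar z))) 0) (Now (mu_class z) 0))"
| "mu_mso (MNot \<phi>) = MsEx (sub_class (mu_atom_code \<phi>)) (MsAnd (mu_mso \<phi>)
     (Glob (BIff (Now (sub_class (mu_atom_code (MNot \<phi>))) 0) (BNot (Now (sub_class (mu_atom_code \<phi>)) 0)))))"
| "mu_mso (MAnd \<phi> \<psi>) = MsEx (sub_class (mu_atom_code \<phi>)) (MsEx (sub_class (mu_atom_code \<psi>)) (MsAnd (mu_mso \<phi>) (MsAnd (mu_mso \<psi>)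
     (Glob (BIff (Now (sub_class (mu_atom_code (MAnd \<phi> \<psi>))) 0)
       (BAnd (Now (sub_class (mu_atom_code \<phi>)) 0) (Now (sub_class (mu_atom_code \<psi>)) 0)))))))"
| "mu_mso (MNext \<phi>) = MsEx (sub_class (mu_atom_code \<phi>)) (MsAnd (mu_mso \<phi>)
     (Glob (BIff (Now (sub_class (mu_atom_code (MNext \<phi>))) 0) (Next (sub_class (mu_atom_code \<phi>)) 0))))"
| "mu_mso (MPrev \<phi>) = MsEx (sub_class (mu_atom_code \<phi>)) (MsAnd (mu_mso \<phi>)
     (Glob (BAnd (BImp First (BNot (Now (sub_class (mu_atom_code (MPrev \<phi>))) 0)))
       (BIff (Next (sub_class (mu_atom_code (MPrev \<phi>))) 0) (Now (sub_class (mu_atom_code \<phi>)) 0)))))"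
| "mu_mso (MMu z \<phi>) = mso_mu (sub_class (mu_atom_code (MMu z \<phi>))) (mu_class z) (sub_class (mu_atom_code \<phi>)) (mu_mso \<phi>)"

text \<open>Both polarities are treated together because negation exchanges them.\<close>

lemma mu_sem_mono:
  "M \<subseteq> M' \<Longrightarrow> mu_polarity b z \<phi> \<Longrightarrow>
    (if b then mu_sem w (e(z := M)) \<phi> \<subseteq> mu_sem w (e(z := M')) \<phi> else mu_sem w (e(z := M')) \<phi> \<subseteq> mu_sem w (e(z := M)) \<phi>)"
proof (induction \<phi> arbitrary: b e)
  case (MNot \<phi>)
  show ?case
    using MNot.IH[of "\<not> b" e] MNot.prems by (cases b) simp_all
next
  case (MMu y \<phi>)
  show ?case
  proof (cases "y = z")
    case False
    then have "(if b then mu_sem w (e(z := M, y := N)) \<phi> \<subseteq> mu_sem w (e(z := M', y := N)) \<phi>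
        else mu_sem w (e(z := M', y := N)) \<phi> \<subseteq> mu_sem w (e(z := M, y := N)) \<phi>)" for N
      using MMu.IH[of b "e(y := N)"] MMu.prems by (simp add: fun_upd_twist)
    then show ?thesis
      by (cases b) (auto intro!: lfp_mono)
  next
    case True
    then show ?thesis
      by (cases b) (simp_all only: mu_sem.simps fun_upd_upd simp_thms if_True if_False subset_refl)
  qed
next
  case (MAnd \<phi> \<psi>)
  show ?case
    using MAnd.IH[of b e] MAnd.prems by (cases b) auto
next
  case (MNext \<phi>)
  show ?case
    using MNext.IH[of b e] MNext.prems by (cases b) auto
next
  case (MPrev \<phi>)
  show ?case
    using MPrev.IH[of b e] MPrev.prems by (cases b) auto
qed (auto split: if_splits)

lemma sub_class_neq [simp]:
  "sub_class c \<noteq> mu_class z" "mu_class z \<noteq> sub_class c" "sub_class c \<noteq> 0" "mu_class z \<noteq> 0"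
  "sub_class c = sub_class c' \<longleftrightarrow> c = c'" "mu_class z = mu_class z' \<longleftrightarrow> z = z'" "0 < sub_class c" "0 < mu_class z"
  "0 \<noteq> sub_class c" "0 \<noteq> mu_class z"
  by (auto simp: sub_class_def mu_class_def) presburger+

lemma Glob_iff_track:
  "msat W (Glob (BIff (Now k j) (Now k' j'))) \<longleftrightarrow> track W k j = track W k' j'"
  "msat W (Glob (BImp (Now k j) (Now k' j'))) \<longleftrightarrow> track W k j \<subseteq> track W k' j'"
  by (auto simp: track_def)

lemma msat_mso_mu:
  assumes s: "s \<noteq> z" "s' \<noteq> z" "s \<noteq> s'"
    and F: "\<And>X Y. msat (upd_class s' Y (upd_class z X W)) \<phi> \<longleftrightarrow> Y 0 = F (X 0)"
    and "mono F"
  shows "msat W (mso_mu s z s' \<phi>) \<longleftrightarrow> track W s 0 = lfp F"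
proof -
  have "msat W (mso_mu s z s' \<phi>) \<longleftrightarrow> F (track W s 0) = track W s 0 \<and> (\<forall>M. F M \<subseteq> M \<longrightarrow> track W s 0 \<subseteq> M)"
  proof -
    have "msat W (MsEx z (MsAnd (Glob (BIff (Now z 0) (Now s 0))) (MsEx s' (MsAnd \<phi> (Glob (BIff (Now s' 0) (Now s 0))))))) \<longleftrightarrow>
      (\<exists>(X :: nat \<Rightarrow> nat set) (Y :: nat \<Rightarrow> nat set). X 0 = track W s 0 \<and> Y 0 = F (X 0) \<and> Y 0 = track W s 0)"
      unfolding msat_MsEx_upd_class msat.simps(3) F Glob_iff_track using s by auto
    also have "\<dots> \<longleftrightarrow> F (track W s 0) = track W s 0"
      by (auto intro!: exI[of _ "\<lambda>_. track W s 0"])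
    moreover have "msat W (MsEx z (MsEx s' (MsAnd \<phi> (MsAnd (Glob (BImp (Now s' 0) (Now z 0))) (MsNot (Glob (BImp (Now s 0) (Now z 0)))))))) \<longleftrightarrow>
      (\<exists>(X :: nat \<Rightarrow> nat set) (Y :: nat \<Rightarrow> nat set). Y 0 = F (X 0) \<and> Y 0 \<subseteq> X 0 \<and> \<not> track W s 0 \<subseteq> X 0)"
      unfolding msat_MsEx_upd_class msat.simps(2,3) F Glob_iff_track using s by auto
    moreover have "\<dots> \<longleftrightarrow> (\<exists>M. F M \<subseteq> M \<and> \<not> track W s 0 \<subseteq> M)"
    proof
      assume "\<exists>M. F M \<subseteq> M \<and> \<not> track W s 0 \<subseteq> M"
      then obtain M where "F M \<subseteq> M \<and> \<not> track W s 0 \<subseteq> M" ..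
      then show "\<exists>(X :: nat \<Rightarrow> nat set) (Y :: nat \<Rightarrow> nat set). Y 0 = F (X 0) \<and> Y 0 \<subseteq> X 0 \<and> \<not> track W s 0 \<subseteq> X 0"
        by (intro exI[of _ "\<lambda>_. M"] exI[of _ "\<lambda>_. F M"]) simp
    next
      assume "\<exists>(X :: nat \<Rightarrow> nat set) (Y :: nat \<Rightarrow> nat set). Y 0 = F (X 0) \<and> Y 0 \<subseteq> X 0 \<and> \<not> track W s 0 \<subseteq> X 0"
      then obtain X Y :: "nat \<Rightarrow> nat set" where "Y 0 = F (X 0)" "Y 0 \<subseteq> X 0" "\<not> track W s 0 \<subseteq> X 0"
        by blast
      then show "\<exists>M. F M \<subseteq> M \<and> \<not> track W s 0 \<subseteq> M"
        by (intro exI[of _ "X 0"]) simp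
    qed
    ultimately show ?thesis
      unfolding mso_mu_def by auto
  qed
  also have "\<dots> \<longleftrightarrow> track W s 0 = lfp F"
    using lfp_unfold[OF \<open>mono F\<close>] by (metis lfp_greatest lfp_lowerbound subset_antisym order_refl)
  finally show ?thesis .
qed

lemma mu_code_less [simp]:
  "mu_code c \<phi> < mu_code c (MNot \<phi>)" "mu_code c \<phi> < mu_code c (MAnd \<phi> \<psi>)" "mu_code c \<psi> < mu_code c (MAnd \<phi> \<psi>)"
  "mu_code c \<phi> < mu_code c (MNext \<phi>)" "mu_code c \<phi> < mu_code c (MPrev \<phi>)" "mu_code c \<phi> < mu_code c (MMu z \<phi>)"
  by (simp_all add: less_list_encode del: list_encode.simps)

lemma atom_code_eq_iff: "atom_code x = atom_code y \<longleftrightarrow> x = y"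
proof -
  have cmp: "cmp_code r = cmp_code r' \<longleftrightarrow> r = r'" for r r'
    by (cases r; cases r') auto
  have vec: "vec_code u = vec_code u' \<longleftrightarrow> u = u'" for u u'
    by (simp add: vec_code_def list_encode_eq inj_map_eq_map inj_int_encode)
  have "aguard_code g = aguard_code g' \<longleftrightarrow> g = g'" for g g'
    by (cases g; cases g') (simp add: aguard_code_def list_encode_eq cmp vec del: list_encode.simps)
  then show ?thesis
    by (cases x; cases y) (simp_all add: list_encode_eq del: list_encode.simps)
qed

lemma mu_atom_code_eq_iff: "mu_atom_code \<phi> = mu_atom_code \<psi> \<longleftrightarrow> \<phi> = \<psi>"
  by (induction \<phi> arbitrary: \<psi>; case_tac \<psi>)
    (auto simp: list_encode_eq atom_code_eq_iff simp del: list_encode.simps)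

lemma mu_mso:
  "represents W w \<Longrightarrow> mu_wf \<phi> \<Longrightarrow> msat W (mu_mso \<phi>) \<longleftrightarrow>
    track W (sub_class (mu_atom_code \<phi>)) 0 = mu_sem w (\<lambda>z. track W (mu_class z) 0) \<phi>"
proof (induction \<phi> arbitrary: W)
  case (MAtom x)
  then show ?case
    unfolding mu_mso.simps Glob_iff_track by (simp add: represents_def track_def del: mu_code.simps)
next
  case (MVar z)
  then show ?case
    unfolding mu_mso.simps Glob_iff_track by simp
next
  case (MNot \<phi>)
  let ?s = "sub_class (mu_atom_code (MNot \<phi>))" and ?s' = "sub_class (mu_atom_code \<phi>)"
  have ne: "?s \<noteq> ?s'"
    using mu_code_less(1)[of atom_code \<phi>] by (simp del: mu_code_less mu_code.simps)
  have IH: "msat (upd_class ?s' X W) (mu_mso \<phi>) \<longleftrightarrow> X 0 = mu_sem w (\<lambda>z. track W (mu_class z) 0) \<phi>" for X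
    using MNot.IH[of "upd_class ?s' X W"] MNot.prems by (simp del: mu_code.simps)
  have G: "msat (upd_class ?s' X W) (Glob (BIff (Now ?s 0) (BNot (Now ?s' 0)))) \<longleftrightarrow> track W ?s 0 = - X 0" for X
    using ne by (auto simp: mem_track simp del: mu_code.simps)
  show ?case
    unfolding mu_mso.simps msat_MsEx_upd_class msat.simps(3) IH G
    by (auto intro!: exI[of _ "\<lambda>_. mu_sem w (\<lambda>z. track W (mu_class z) 0) \<phi>"])
next
  case (MAnd \<phi> \<psi>)
  let ?s = "sub_class (mu_atom_code (MAnd \<phi> \<psi>))" and ?s1 = "sub_class (mu_atom_code \<phi>)" and ?s2 = "sub_class (mu_atom_code \<psi>)"
  let ?M = "mu_sem w (\<lambda>z. track W (mu_class z) 0)"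
  have ne: "?s \<noteq> ?s1" "?s \<noteq> ?s2"
    using mu_code_less(2,3)[of atom_code \<phi> \<psi>] mu_code_less(3)[of atom_code \<psi> \<phi>] by (simp_all del: mu_code_less mu_code.simps)
  let ?G = "Glob (BIff (Now ?s 0) (BAnd (Now ?s1 0) (Now ?s2 0)))"
  have IH: "msat (upd_class ?s2 Y (upd_class ?s1 X W)) (mu_mso \<phi>) \<longleftrightarrow>
      track (upd_class ?s2 Y (upd_class ?s1 X W)) ?s1 0 = ?M \<phi>" for X Y
    using MAnd.IH(1)[of "upd_class ?s2 Y (upd_class ?s1 X W)"] MAnd.prems by (simp del: mu_code.simps)
  have IH2: "msat (upd_class ?s2 Y (upd_class ?s1 X W)) (mu_mso \<psi>) \<longleftrightarrow>
      track (upd_class ?s2 Y (upd_class ?s1 X W)) ?s2 0 = ?M \<psi>" for X Y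
    using MAnd.IH(2)[of "upd_class ?s2 Y (upd_class ?s1 X W)"] MAnd.prems by (simp del: mu_code.simps)
  have G: "msat (upd_class ?s2 Y (upd_class ?s1 X W)) ?G \<longleftrightarrow> track W ?s 0 =
      track (upd_class ?s2 Y (upd_class ?s1 X W)) ?s1 0 \<inter> track (upd_class ?s2 Y (upd_class ?s1 X W)) ?s2 0" for X Y
    using ne by (auto simp: mem_track simp del: mu_code.simps)
  show ?case
  proof
    assume "msat W (mu_mso (MAnd \<phi> \<psi>))"
    then obtain X Y where *: "msat (upd_class ?s2 Y (upd_class ?s1 X W)) (mu_mso \<phi>)"
      "msat (upd_class ?s2 Y (upd_class ?s1 X W)) (mu_mso \<psi>)" "msat (upd_class ?s2 Y (upd_class ?s1 X W)) ?G"
      unfolding mu_mso.simps msat_MsEx_upd_class msat.simps(3) by blast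
    show "track W ?s 0 = ?M (MAnd \<phi> \<psi>)"
      using *(3)[unfolded G] *(1,2) unfolding IH IH2 by simp
  next
    assume *: "track W ?s 0 = ?M (MAnd \<phi> \<psi>)"
    let ?U = "upd_class ?s2 (\<lambda>_. ?M \<psi>) (upd_class ?s1 (\<lambda>_. ?M \<phi>) W)"
    \<comment> \<open>If both conjuncts have the same class they are the same formula, so the inner
      binding overwrites the outer one with the same set.\<close>
    have "?s1 = ?s2 \<Longrightarrow> \<phi> = \<psi>"
      by (simp add: mu_atom_code_eq_iff)
    then have t: "track ?U ?s1 0 = ?M \<phi>" "track ?U ?s2 0 = ?M \<psi>"
      by auto
    have "msat ?U (mu_mso \<phi>)" "msat ?U (mu_mso \<psi>)" "msat ?U ?G"
      unfolding IH IH2 G t using * by simp_all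
    then show "msat W (mu_mso (MAnd \<phi> \<psi>))"
      unfolding mu_mso.simps msat_MsEx_upd_class msat.simps(3) by blast
  qed
next
  case (MNext \<phi>)
  let ?s = "sub_class (mu_atom_code (MNext \<phi>))" and ?s' = "sub_class (mu_atom_code \<phi>)"
  have ne: "?s \<noteq> ?s'"
    using mu_code_less(4)[of atom_code \<phi>] by (simp del: mu_code_less mu_code.simps)
  have IH: "msat (upd_class ?s' X W) (mu_mso \<phi>) \<longleftrightarrow> X 0 = mu_sem w (\<lambda>z. track W (mu_class z) 0) \<phi>" for X
    using MNext.IH[of "upd_class ?s' X W"] MNext.prems by (simp del: mu_code.simps)
  have G: "msat (upd_class ?s' X W) (Glob (BIff (Now ?s 0) (Next ?s' 0))) \<longleftrightarrow> track W ?s 0 = {i. Suc i \<in> X 0}" for X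
    using ne by (auto simp: mem_track simp del: mu_code.simps)
  show ?case
    unfolding mu_mso.simps msat_MsEx_upd_class msat.simps(3) IH G
    by (auto intro!: exI[of _ "\<lambda>_. mu_sem w (\<lambda>z. track W (mu_class z) 0) \<phi>"])
next
  case (MPrev \<phi>)
  let ?s = "sub_class (mu_atom_code (MPrev \<phi>))" and ?s' = "sub_class (mu_atom_code \<phi>)"
  have ne: "?s \<noteq> ?s'"
    using mu_code_less(5)[of atom_code \<phi>] by (simp del: mu_code_less mu_code.simps)
  have prev: "(\<forall>i. (i = 0 \<longrightarrow> i \<notin> A) \<and> (Suc i \<in> A \<longleftrightarrow> i \<in> B)) \<longleftrightarrow> A = {Suc i | i. i \<in> B}" for A B :: "nat set"
  proof
    assume *: "\<forall>i. (i = 0 \<longrightarrow> i \<notin> A) \<and> (Suc i \<in> A \<longleftrightarrow> i \<in> B)"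
    have "j \<in> A \<longleftrightarrow> j \<in> {Suc i | i. i \<in> B}" for j
      using * by (cases j) auto
    then show "A = {Suc i | i. i \<in> B}"
      by blast
  qed auto
  have IH: "msat (upd_class ?s' X W) (mu_mso \<phi>) \<longleftrightarrow> X 0 = mu_sem w (\<lambda>z. track W (mu_class z) 0) \<phi>" for X
    using MPrev.IH[of "upd_class ?s' X W"] MPrev.prems by (simp del: mu_code.simps)
  have G: "msat (upd_class ?s' X W) (Glob (BAnd (BImp First (BNot (Now ?s 0))) (BIff (Next ?s 0) (Now ?s' 0)))) \<longleftrightarrow> track W ?s 0 = {Suc i | i. i \<in> X 0}" for X
    unfolding prev[symmetric] using ne by (auto simp: mem_track simp del: mu_code.simps)
  show ?case
    unfolding mu_mso.simps msat_MsEx_upd_class msat.simps(3) IH G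
    by (auto intro!: exI[of _ "\<lambda>_. mu_sem w (\<lambda>z. track W (mu_class z) 0) \<phi>"])
next
  case (MMu z \<phi>)
  let ?e = "\<lambda>z. track W (mu_class z) 0"
  have "msat W (mu_mso (MMu z \<phi>)) \<longleftrightarrow> track W (sub_class (mu_atom_code (MMu z \<phi>))) 0 = lfp (\<lambda>M. mu_sem w (?e(z := M)) \<phi>)"
    unfolding mu_mso.simps
  proof (rule msat_mso_mu)
    show "sub_class (mu_atom_code (MMu z \<phi>)) \<noteq> sub_class (mu_atom_code \<phi>)"
      using mu_code_less(6)[of atom_code \<phi> z] by (simp del: mu_code_less mu_code.simps)
    have "(\<lambda>y. if y = z then X 0 else ?e y) = ?e(z := X 0)" for X :: "nat \<Rightarrow> nat set"
      by auto
    then show "msat (upd_class (sub_class (mu_atom_code \<phi>)) Y (upd_class (mu_class z) X W)) (mu_mso \<phi>) \<longleftrightarrow>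
        Y 0 = mu_sem w (?e(z := X 0)) \<phi>" for X Y
      using MMu by (simp del: mu_code.simps)
    show "mono (\<lambda>M. mu_sem w (?e(z := M)) \<phi>)"
      using mu_sem_mono[of _ _ True z \<phi> w ?e] MMu.prems by (auto intro!: monoI)
  qed simp_all
  then show ?case
    by simp
qed

definition mu_mso_code :: "nat \<Rightarrow> mso" where
  "mu_mso_code = measure_rec
    (\<lambda>c. if arg 0 c \<le> 1 then [] else if arg 0 c = 3 then [arg 1 c, arg 2 c] else if arg 0 c = 6 then [arg 2 c] else [arg 1 c])
    (\<lambda>c vs. if arg 0 c = 0 then Glob (BIff (Now (sub_class c) 0) (Now 0 (arg 1 c)))
      else if arg 0 c = 1 then Glob (BIff (Now (sub_class c) 0) (Now (mu_class (arg 1 c)) 0))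
      else if arg 0 c = 2 then MsEx (sub_class (arg 1 c)) (MsAnd (nth_opt undefined vs 0)
        (Glob (BIff (Now (sub_class c) 0) (BNot (Now (sub_class (arg 1 c)) 0)))))
      else if arg 0 c = 3 then MsEx (sub_class (arg 1 c)) (MsEx (sub_class (arg 2 c)) (MsAnd (nth_opt undefined vs 0)
        (MsAnd (nth_opt undefined vs 1) (Glob (BIff (Now (sub_class c) 0)
          (BAnd (Now (sub_class (arg 1 c)) 0) (Now (sub_class (arg 2 c)) 0)))))))
      else if arg 0 c = 4 then MsEx (sub_class (arg 1 c)) (MsAnd (nth_opt undefined vs 0)
        (Glob (BIff (Now (sub_class c) 0) (Next (sub_class (arg 1 c)) 0))))
      else if arg 0 c = 5 then MsEx (sub_class (arg 1 c)) (MsAnd (nth_opt undefined vs 0)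
        (Glob (BAnd (BImp First (BNot (Now (sub_class c) 0))) (BIff (Next (sub_class c) 0) (Now (sub_class (arg 1 c)) 0)))))
      else mso_mu (sub_class c) (mu_class (arg 1 c)) (sub_class (arg 2 c)) (nth_opt undefined vs 0)) (\<lambda>c. c)"

lemma computable_mu_mso_code [comp]: "computable c \<Longrightarrow> computable (\<lambda>x. mu_mso_code (c x))"
  unfolding mu_mso_code_def mso_mu_def sub_class_def mu_class_def by (intro computable_measure_rec comp)

lemma mu_mso_code: "mu_mso_code (mu_atom_code \<phi>) = mu_mso \<phi>"
  unfolding mu_mso_code_def
  by (rule measure_rec_eq[where r = mu_atom_code and ok = "\<lambda>_. True"
        and ch = "\<lambda>\<phi>. case \<phi> of MNot \<phi> \<Rightarrow> [\<phi>] | MAnd \<phi> \<psi> \<Rightarrow> [\<phi>, \<psi>] | MNext \<phi> \<Rightarrow> [\<phi>] | MPrev \<phi> \<Rightarrow> [\<phi>] | MMu z \<phi> \<Rightarrow> [\<phi>] | _ \<Rightarrow> []"])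
    (auto simp: less_list_encode simp del: list_encode.simps split: mutl.split)

subsection \<open>Extended temporal logic\<close>

definition bconj :: "'a bform list \<Rightarrow> 'a bform" where "bconj fs = foldr BAnd fs BTrue"
definition bdisj :: "'a bform list \<Rightarrow> 'a bform" where "bdisj fs = foldr BOr fs (BNot BTrue)"

lemma bf_sat_bconj [simp]: "bf_sat V (bconj fs) \<longleftrightarrow> (\<forall>f \<in> set fs. bf_sat V f)"
  unfolding bconj_def by (induction fs) auto

lemma bf_sat_bdisj [simp]: "bf_sat V (bdisj fs) \<longleftrightarrow> (\<exists>f \<in> set fs. bf_sat V f)"
  unfolding bdisj_def by (induction fs) auto

lemma computable_bconj [comp]: "computable l \<Longrightarrow> computable (\<lambda>x. bconj (l x))"
  unfolding bconj_def by (rule computable_foldr) (intro comp, assumption, intro comp)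

lemma computable_bdisj [comp]: "computable l \<Longrightarrow> computable (\<lambda>x. bdisj (l x))"
  unfolding bdisj_def by (rule computable_foldr) (intro comp, assumption, intro comp)

definition set_list :: "nat \<Rightarrow> nat list" where
  "set_list c = filter (\<lambda>n. n \<in> set_decode c) [0..<c]"

lemma computable_set_list [comp]:
  assumes "computable c"
  shows "computable (\<lambda>x. set_list (c x))"
  unfolding set_list_def by (intro comp assms computable_compose[OF assms])

lemma set_decode_less: "n \<in> set_decode c \<Longrightarrow> n < c"
proof -
  assume "n \<in> set_decode c"
  then have "c div 2 ^ n \<noteq> 0"
    by (cases "c div 2 ^ n = 0") (simp_all add: set_decode_def)
  then have "2 ^ n \<le> c"
    using div_less[of c "2 ^ n"] by (metis not_less)
  then show ?thesis
    using less_exp[of n] by linarith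
qed

lemma set_set_list [simp]: "set (set_list c) = set_decode c"
  using set_decode_less by (auto simp: set_list_def)

lemma set_decode_set_code [simp]: "finite A \<Longrightarrow> set_decode (set_code f A) = f ` A"
  by (simp add: set_code_def)

lemma computable_sub_class [comp]: "computable c \<Longrightarrow> computable (\<lambda>x. sub_class (c x))"
  unfolding sub_class_def by (intro comp)

lemma computable_mu_class [comp]: "computable c \<Longrightarrow> computable (\<lambda>x. mu_class (c x))"
  unfolding mu_class_def by (intro comp)

text \<open>Acceptance as an inductive relation between states and positions: a least family of sets
  closed under local clauses, hence expressible by set quantification.\<close>

inductive nfa_reach :: "(nat \<times> nat \<times> nat) set \<Rightarrow> nat set \<Rightarrow> (nat \<Rightarrow> nat \<Rightarrow> bool) \<Rightarrow> nat \<Rightarrow> nat \<Rightarrow> bool"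
  for D F P where
  nfa_final: "t \<in> F \<Longrightarrow> nfa_reach D F P t i"
| nfa_step: "(t, m, t') \<in> D \<Longrightarrow> P m i \<Longrightarrow> nfa_reach D F P t' (Suc i) \<Longrightarrow> nfa_reach D F P t i"

lemma nfa_reach_iff:
  "nfa_reach D F P t i \<longleftrightarrow> (\<exists>ks r. r 0 = t \<and> (\<forall>j < length ks. (r j, ks ! j, r (Suc j)) \<in> D) \<and>
    r (length ks) \<in> F \<and> (\<forall>j < length ks. P (ks ! j) (i + j)))" (is "_ \<longleftrightarrow> (\<exists>ks r. ?Q ks r t i)")
proof
  assume "nfa_reach D F P t i"
  then show "\<exists>ks r. ?Q ks r t i"
  proof induction
    case (nfa_final t i)
    then show ?case
      by (intro exI[of _ "[]"] exI[of _ "\<lambda>_. t"]) simp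
  next
    case (nfa_step t m t' i)
    then obtain ks r where *: "?Q ks r t' (Suc i)"
      by blast
    have "?Q (m # ks) (case_nat t r) t i"
      using * nfa_step.hyps by (auto simp: less_Suc_eq_0_disj)
    then show ?case
      by blast
  qed
next
  assume "\<exists>ks r. ?Q ks r t i"
  then obtain ks r where "?Q ks r t i"
    by blast
  then show "nfa_reach D F P t i"
  proof (induction ks arbitrary: r t i)
    case Nil
    then show ?case
      by (auto intro: nfa_reach.nfa_final)
  next
    case (Cons m ks)
    have "nfa_reach D F P (r 1) (Suc i)"
      by (rule Cons.IH[of "\<lambda>j. r (Suc j)"]) (use Cons.prems in \<open>auto simp: nth_Cons split: nat.splits\<close>)
    moreover have "(t, m, r 1) \<in> D" "P m i"
      using Cons.prems by (auto dest: spec[of _ 0])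
    ultimately show ?case
      by (intro nfa_reach.nfa_step[of t m "r 1"])
  qed
qed

lemma etl_sat_EAut:
  "etl_sat (EAut M \<phi>s) w i \<longleftrightarrow>
    (\<exists>t \<in> nfa_init M. nfa_reach (nfa_trans M) (nfa_final M) (\<lambda>m. (map etl_sat \<phi>s ! m) w) t i)"
  unfolding nfa_reach_iff etl_sat.simps nfa_accepts_def by blast

text \<open>The set \<open>Z\<^sub>t\<close> of positions from which the automaton accepts when started in state \<open>t\<close> is
  variable \<open>(z, t)\<close>; these sets are the least ones satisfying the clauses in \<open>etl_clauses\<close>.\<close>

definition etl_clauses :: "nat \<Rightarrow> nat \<Rightarrow> nat \<Rightarrow> mso" where
  "etl_clauses s z M = Glob (bconj (map (\<lambda>t. Now z t) (set_list (arg 3 M)) @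
     map (\<lambda>e. BImp (BAnd (Now s (arg 1 e)) (Next z (arg 2 e))) (Now z (arg 0 e))) (set_list (arg 1 M))))"

definition etl_init :: "nat \<Rightarrow> nat \<Rightarrow> (nat \<times> nat \<times> nat) bform" where
  "etl_init z M = bdisj (map (\<lambda>t. Now z t) (set_list (arg 2 M)))"

definition etl_aut :: "nat \<Rightarrow> nat \<Rightarrow> nat \<Rightarrow> nat \<Rightarrow> nat \<Rightarrow> mso" where
  "etl_aut k j s z M = MsAnd
     (MsEx z (MsAnd (etl_clauses s z M) (Glob (BIff (Now k j) (etl_init z M)))))
     (MsNot (MsEx z (MsAnd (etl_clauses s z M) (MsNot (Glob (BImp (Now k j) (etl_init z M)))))))"

text \<open>The formula asks that the set be obtained from some closed family and be contained in
  what every closed family yields. Since the least closed family is among them, this determines the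
  set without stating minimality of a family.\<close>

lemma msat_etl_aut:
  assumes M: "is_nfa m M" and z: "z \<noteq> k" "z \<noteq> s"
    and P: "\<And>l i. l < m \<Longrightarrow> i \<in> track W s l \<longleftrightarrow> P l i"
  shows "msat W (etl_aut k j s z (nfa_code M)) \<longleftrightarrow>
    track W k j = {i. \<exists>t \<in> nfa_init M. nfa_reach (nfa_trans M) (nfa_final M) P t i}"
proof -
  have fin: "finite (nfa_states M)" "finite (nfa_init M)" "finite (nfa_final M)" "finite (nfa_trans M)"
    using M by (auto simp: is_nfa_def intro: finite_subset)
  define A where "A t = {i. nfa_reach (nfa_trans M) (nfa_final M) P t i}" for t
  define closed where "closed Z \<longleftrightarrow> (\<forall>t \<in> nfa_final M. \<forall>i. i \<in> Z t) \<and>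
    (\<forall>(t, l, t') \<in> nfa_trans M. \<forall>i. P l i \<longrightarrow> Suc i \<in> Z t' \<longrightarrow> i \<in> Z t)" for Z
  have l: "l < m" if "(t, l, t') \<in> nfa_trans M" for t l t'
    using M that by (auto simp: is_nfa_def)
  have 1: "msat (upd_class z Z W) (etl_clauses s z (nfa_code M)) \<longleftrightarrow> closed Z" for Z
  proof -
    have "msat (upd_class z Z W) (etl_clauses s z (nfa_code M)) \<longleftrightarrow>
      (\<forall>i. (\<forall>t \<in> nfa_final M. i \<in> Z t) \<and> (\<forall>e \<in> nfa_trans M. i \<in> track W s (fst (snd e)) \<longrightarrow> Suc i \<in> Z (snd (snd e)) \<longrightarrow> i \<in> Z (fst e)))"
      using fin z unfolding etl_clauses_def nfa_code_def
      by (simp add: mem_track ball_Un case_prod_beta del: list_encode.simps)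
    also have "\<dots> \<longleftrightarrow> closed Z"
    proof -
      have "i \<in> track W s (fst (snd e)) \<longleftrightarrow> P (fst (snd e)) i" if "e \<in> nfa_trans M" for e i
        using that P l by (cases e) auto
      then show ?thesis
        unfolding closed_def case_prod_beta by blast
    qed
    finally show ?thesis .
  qed
  have 2: "bf_sat (lit_holds f (upd_class z Z W i) b) (etl_init z (nfa_code M)) \<longleftrightarrow> i \<in> (\<Union>t \<in> nfa_init M. Z t)" for f Z i b
    using fin unfolding etl_init_def nfa_code_def by (simp add: mem_track del: list_encode.simps)
  have 3: "msat (upd_class z Z W) (Glob (BIff (Now k j) (etl_init z (nfa_code M)))) \<longleftrightarrow> track W k j = (\<Union>t \<in> nfa_init M. Z t)"
    "msat (upd_class z Z W) (Glob (BImp (Now k j) (etl_init z (nfa_code M)))) \<longleftrightarrow> track W k j \<subseteq> (\<Union>t \<in> nfa_init M. Z t)" for Z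
    using z unfolding msat.simps bf_sat.simps 2 by (auto simp: mem_track)
  have least: "A t \<subseteq> Z t" if "closed Z" for Z t
  proof -
    have "i \<in> Z t" if "nfa_reach (nfa_trans M) (nfa_final M) P t i" for t i
      using that by induction (use \<open>closed Z\<close> in \<open>auto simp: closed_def\<close>)
    then show ?thesis
      by (auto simp: A_def)
  qed
  have A: "closed A"
    unfolding closed_def A_def by (auto intro: nfa_reach.intros)
  have "msat W (etl_aut k j s z (nfa_code M)) \<longleftrightarrow> (\<exists>Z. closed Z \<and> track W k j = (\<Union>t \<in> nfa_init M. Z t)) \<and>
      (\<forall>Z. closed Z \<longrightarrow> track W k j \<subseteq> (\<Union>t \<in> nfa_init M. Z t))"
    unfolding etl_aut_def msat.simps(2,3) msat_MsEx_upd_class 1 3 by blast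
  also have "\<dots> \<longleftrightarrow> track W k j = (\<Union>t \<in> nfa_init M. A t)"
  proof (intro iffI conjI)
    assume *: "(\<exists>Z. closed Z \<and> track W k j = (\<Union>t \<in> nfa_init M. Z t)) \<and>
      (\<forall>Z. closed Z \<longrightarrow> track W k j \<subseteq> (\<Union>t \<in> nfa_init M. Z t))"
    then obtain Z where "closed Z" "track W k j = (\<Union>t \<in> nfa_init M. Z t)"
      by blast
    then have "(\<Union>t \<in> nfa_init M. A t) \<subseteq> track W k j"
      using least by blast
    then show "track W k j = (\<Union>t \<in> nfa_init M. A t)"
      using * A by blast
  next
    assume *: "track W k j = (\<Union>t \<in> nfa_init M. A t)"
    then show "\<exists>Z. closed Z \<and> track W k j = (\<Union>t \<in> nfa_init M. Z t)"
      using A by blast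
    show "\<forall>Z. closed Z \<longrightarrow> track W k j \<subseteq> (\<Union>t \<in> nfa_init M. Z t)"
      unfolding * using least by blast
  qed
  also have "(\<Union>t \<in> nfa_init M. A t) = {i. \<exists>t \<in> nfa_init M. nfa_reach (nfa_trans M) (nfa_final M) P t i}"
    by (auto simp: A_def)
  finally show ?thesis .
qed

abbreviation etl_atom_code :: "atom etl \<Rightarrow> nat" where "etl_atom_code \<equiv> etl_code atom_code"

text \<open>\<open>etl_mso \<phi> k j\<close> states that the variable \<open>(k, j)\<close> is the set of positions satisfying \<open>\<phi>\<close>. The
  immediate subformulas of \<open>\<phi>\<close> are denoted by the variables of the class of the code of \<open>\<phi>\<close>.\<close>

primrec etl_mso :: "atom etl \<Rightarrow> nat \<Rightarrow> nat \<Rightarrow> mso" where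
  "etl_mso (EAtom x) k j = Glob (BIff (Now k j) (Now 0 (atom_code x)))"
| "etl_mso (ENot \<phi>) k j = MsEx (sub_class (etl_atom_code (ENot \<phi>)))
     (MsAnd (etl_mso \<phi> (sub_class (etl_atom_code (ENot \<phi>))) 0)
       (Glob (BIff (Now k j) (BNot (Now (sub_class (etl_atom_code (ENot \<phi>))) 0)))))"
| "etl_mso (EAnd \<phi> \<psi>) k j = MsEx (sub_class (etl_atom_code (EAnd \<phi> \<psi>)))
     (MsAnd (etl_mso \<phi> (sub_class (etl_atom_code (EAnd \<phi> \<psi>))) 0)
       (MsAnd (etl_mso \<psi> (sub_class (etl_atom_code (EAnd \<phi> \<psi>))) 1)
         (Glob (BIff (Now k j) (BAnd (Now (sub_class (etl_atom_code (EAnd \<phi> \<psi>))) 0)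
            (Now (sub_class (etl_atom_code (EAnd \<phi> \<psi>))) 1))))))"
| "etl_mso (EAut M \<phi>s) k j = MsEx (sub_class (etl_atom_code (EAut M \<phi>s)))
     (foldr MsAnd (map (\<lambda>(i, f). f (sub_class (etl_atom_code (EAut M \<phi>s))) i) (zip [0..<length \<phi>s] (map etl_mso \<phi>s)))
       (etl_aut k j (sub_class (etl_atom_code (EAut M \<phi>s))) (mu_class (etl_atom_code (EAut M \<phi>s))) (nfa_code M)))"

lemma msat_foldr_MsAnd: "msat W (foldr MsAnd \<phi>s \<phi>) \<longleftrightarrow> (\<forall>\<psi> \<in> set \<phi>s. msat W \<psi>) \<and> msat W \<phi>"
  by (induction \<phi>s) auto

lemma etl_code_less [simp]:
  "etl_code c \<phi> < etl_code c (ENot \<phi>)" "etl_code c \<phi> < etl_code c (EAnd \<phi> \<psi>)" "etl_code c \<psi> < etl_code c (EAnd \<phi> \<psi>)"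
  by (simp_all add: less_list_encode del: list_encode.simps)

lemma etl_code_less_EAut:
  assumes "\<phi> \<in> set \<phi>s"
  shows "etl_code c \<phi> < etl_code c (EAut M \<phi>s)"
proof -
  have "etl_code c \<phi> < list_encode (map (etl_code c) \<phi>s)"
    using assms by (intro less_list_encode) auto
  also have "\<dots> < etl_code c (EAut M \<phi>s)"
    unfolding etl_code.simps by (rule less_list_encode) simp
  finally show ?thesis .
qed

lemma sub_class_less: "c < c' \<Longrightarrow> sub_class c < sub_class c'"
  by (simp add: sub_class_def)

lemma map_zip_etl_mso:
  "map (\<lambda>(i, f). f s i) (zip [0..<length \<phi>s] (map etl_mso \<phi>s)) = map (\<lambda>i. etl_mso (\<phi>s ! i) s i) [0..<length \<phi>s]"
  by (rule nth_equalityI) auto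

text \<open>The bound on \<open>k\<close> keeps \<open>(k, j)\<close> out of reach of the inner
  quantifiers, whose classes are at most \<open>sub_class\<close> of the code.\<close>

lemma etl_mso:
  "represents W w \<Longrightarrow> etl_wf \<phi> \<Longrightarrow> sub_class (etl_atom_code \<phi>) < k \<Longrightarrow>
    msat W (etl_mso \<phi> k j) \<longleftrightarrow> track W k j = {i. etl_sat \<phi> w i}"
proof (induction \<phi> arbitrary: W k j)
  case (EAtom x)
  then show ?case
    unfolding etl_mso.simps Glob_iff_track by (simp add: represents_def track_def)
next
  case (ENot \<phi>)
  let ?s = "sub_class (etl_atom_code (ENot \<phi>))"
  have s: "sub_class (etl_atom_code \<phi>) < ?s" "k \<noteq> ?s"
    using ENot.prems(3) by (auto intro!: sub_class_less simp del: etl_code.simps)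
  have IH: "msat (upd_class ?s X W) (etl_mso \<phi> ?s 0) \<longleftrightarrow> X 0 = {i. etl_sat \<phi> w i}" for X
    using ENot.IH[of "upd_class ?s X W" ?s 0] ENot.prems s by (simp del: etl_code.simps)
  have G: "msat (upd_class ?s X W) (Glob (BIff (Now k j) (BNot (Now ?s 0)))) \<longleftrightarrow> track W k j = - X 0" for X
    using s by (auto simp: mem_track simp del: etl_code.simps)
  show ?case
    unfolding etl_mso.simps msat_MsEx_upd_class msat.simps(3) IH G
    by (auto intro!: exI[of _ "\<lambda>_. {i. etl_sat \<phi> w i}"])
next
  case (EAnd \<phi> \<psi>)
  let ?s = "sub_class (etl_atom_code (EAnd \<phi> \<psi>))"
  have s: "sub_class (etl_atom_code \<phi>) < ?s" "sub_class (etl_atom_code \<psi>) < ?s" "k \<noteq> ?s"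
    using EAnd.prems(3) by (auto intro!: sub_class_less simp del: etl_code.simps)
  have IH: "msat (upd_class ?s X W) (etl_mso \<phi> ?s 0) \<longleftrightarrow> X 0 = {i. etl_sat \<phi> w i}"
    "msat (upd_class ?s X W) (etl_mso \<psi> ?s 1) \<longleftrightarrow> X 1 = {i. etl_sat \<psi> w i}" for X
    using EAnd.IH(1)[of "upd_class ?s X W" ?s 0] EAnd.IH(2)[of "upd_class ?s X W" ?s 1] EAnd.prems s
    by (simp_all del: etl_code.simps)
  have G: "msat (upd_class ?s X W) (Glob (BIff (Now k j) (BAnd (Now ?s 0) (Now ?s 1)))) \<longleftrightarrow> track W k j = X 0 \<inter> X 1" for X
    using s by (auto simp: mem_track simp del: etl_code.simps)
  show ?case
    unfolding etl_mso.simps msat_MsEx_upd_class msat.simps(3) IH G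
  proof
    assume "track W k j = {i. etl_sat (EAnd \<phi> \<psi>) w i}"
    then show "\<exists>X :: nat \<Rightarrow> nat set. X 0 = {i. etl_sat \<phi> w i} \<and> X 1 = {i. etl_sat \<psi> w i} \<and> track W k j = X 0 \<inter> X 1"
      by (intro exI[of _ "\<lambda>l. if l = 0 then {i. etl_sat \<phi> w i} else {i. etl_sat \<psi> w i}"]) auto
  next
    assume "\<exists>X :: nat \<Rightarrow> nat set. X 0 = {i. etl_sat \<phi> w i} \<and> X 1 = {i. etl_sat \<psi> w i} \<and> track W k j = X 0 \<inter> X 1"
    then obtain X :: "nat \<Rightarrow> nat set" where "X 0 = {i. etl_sat \<phi> w i}" "X 1 = {i. etl_sat \<psi> w i}" "track W k j = X 0 \<inter> X 1"
      by blast
    then show "track W k j = {i. etl_sat (EAnd \<phi> \<psi>) w i}"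
      by auto
  qed
next
  case (EAut M \<phi>s)
  let ?s = "sub_class (etl_atom_code (EAut M \<phi>s))" and ?z = "mu_class (etl_atom_code (EAut M \<phi>s))"
  let ?R = "{i. etl_sat (EAut M \<phi>s) w i}"
  have s: "sub_class (etl_atom_code \<phi>) < ?s" if "\<phi> \<in> set \<phi>s" for \<phi>
    using that by (intro sub_class_less etl_code_less_EAut)
  have k: "k \<noteq> ?s" "?z \<noteq> k"
    using EAut.prems(3) by (auto simp: sub_class_def mu_class_def simp del: etl_code.simps)
  have IH: "msat (upd_class ?s X W) (etl_mso (\<phi>s ! l) ?s l) \<longleftrightarrow> X l = {i. etl_sat (\<phi>s ! l) w i}" if "l < length \<phi>s" for X l
    using EAut.IH[of "\<phi>s ! l" "upd_class ?s X W" ?s l] EAut.prems s that by (simp del: etl_code.simps)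
  have body: "msat (upd_class ?s X W) (etl_aut k j ?s ?z (nfa_code M)) \<longleftrightarrow> track W k j = ?R"
    if X: "\<And>l. l < length \<phi>s \<Longrightarrow> X l = {i. etl_sat (\<phi>s ! l) w i}" for X
  proof -
    have "msat (upd_class ?s X W) (etl_aut k j ?s ?z (nfa_code M)) \<longleftrightarrow> track (upd_class ?s X W) k j =
        {i. \<exists>t \<in> nfa_init M. nfa_reach (nfa_trans M) (nfa_final M) (\<lambda>m. (map etl_sat \<phi>s ! m) w) t i}"
      by (rule msat_etl_aut[of "length \<phi>s"]) (use EAut.prems(2) k X in auto)
    then show ?thesis
      unfolding etl_sat_EAut using k by (simp del: etl_code.simps)
  qed
  have "msat W (etl_mso (EAut M \<phi>s) k j) \<longleftrightarrow> (\<exists>X. (\<forall>l < length \<phi>s. X l = {i. etl_sat (\<phi>s ! l) w i}) \<and>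
      msat (upd_class ?s X W) (etl_aut k j ?s ?z (nfa_code M)))"
  proof -
    have "(\<forall>\<psi> \<in> set (map (\<lambda>i. etl_mso (\<phi>s ! i) ?s i) [0..<length \<phi>s]). msat (upd_class ?s X W) \<psi>) \<longleftrightarrow>
        (\<forall>l < length \<phi>s. X l = {i. etl_sat (\<phi>s ! l) w i})" for X
    proof -
      have "(\<forall>\<psi> \<in> set (map (\<lambda>i. etl_mso (\<phi>s ! i) ?s i) [0..<length \<phi>s]). msat (upd_class ?s X W) \<psi>) \<longleftrightarrow>
          (\<forall>l < length \<phi>s. msat (upd_class ?s X W) (etl_mso (\<phi>s ! l) ?s l))"
        by (auto simp del: etl_code.simps)
      then show ?thesis
        using IH by simp
    qed
    then show ?thesis
      unfolding etl_mso.simps msat_MsEx_upd_class msat_foldr_MsAnd map_zip_etl_mso by simp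
  qed
  also have "\<dots> \<longleftrightarrow> (\<exists>X. (\<forall>l < length \<phi>s. X l = {i. etl_sat (\<phi>s ! l) w i}) \<and> track W k j = ?R)"
    using body by (intro ex_cong1 conj_cong refl) blast
  also have "\<dots> \<longleftrightarrow> track W k j = ?R"
    by (auto intro!: exI[of _ "\<lambda>l. {i. etl_sat (\<phi>s ! l) w i}"])
  finally show ?case .
qed

definition etl_mso_code :: "nat \<times> nat \<times> nat \<Rightarrow> mso" where
  "etl_mso_code = measure_rec
    (\<lambda>z. let c = snd (snd z); s = sub_class c in
      if arg 0 c = 0 then [] else if arg 0 c = 1 then [(s, 0, arg 1 c)]
      else if arg 0 c = 2 then [(s, 0, arg 1 c), (s, 1, arg 2 c)]
      else map (\<lambda>i. (s, i, nth_opt 0 (list_decode (arg 2 c)) i)) [0..<length (list_decode (arg 2 c))])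
    (\<lambda>z vs. let k = fst z; j = fst (snd z); c = snd (snd z); s = sub_class c in
      if arg 0 c = 0 then Glob (BIff (Now k j) (Now 0 (arg 1 c)))
      else if arg 0 c = 1 then MsEx s (MsAnd (nth_opt undefined vs 0) (Glob (BIff (Now k j) (BNot (Now s 0)))))
      else if arg 0 c = 2 then MsEx s (MsAnd (nth_opt undefined vs 0) (MsAnd (nth_opt undefined vs 1)
        (Glob (BIff (Now k j) (BAnd (Now s 0) (Now s 1))))))
      else MsEx s (foldr MsAnd vs (etl_aut k j s (mu_class c) (arg 1 c)))) (\<lambda>z. snd (snd z))"

lemma computable_etl_mso_code [comp]: "computable z \<Longrightarrow> computable (\<lambda>x. etl_mso_code (z x))"
  unfolding etl_mso_code_def etl_aut_def etl_clauses_def etl_init_def Let_def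
  by (intro computable_measure_rec comp)

lemma etl_mso_code: "etl_mso_code (k, j, etl_atom_code \<phi>) = etl_mso \<phi> k j"
proof -
  let ?r = "\<lambda>(k, j, \<phi>). (k, j, etl_atom_code \<phi>)" and ?F = "\<lambda>(k, j, \<phi>). etl_mso \<phi> k j"
  let ?ch = "\<lambda>(k, j, \<phi>). let s = sub_class (etl_atom_code \<phi>) in case \<phi> of EAtom x \<Rightarrow> [] | ENot \<phi> \<Rightarrow> [(s, 0, \<phi>)]
    | EAnd \<phi> \<psi> \<Rightarrow> [(s, 0, \<phi>), (s, 1, \<psi>)] | EAut M \<phi>s \<Rightarrow> map (\<lambda>i. (s, i, \<phi>s ! i)) [0..<length \<phi>s]"
  have "etl_mso_code (?r (k, j, \<phi>)) = ?F (k, j, \<phi>)"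
    unfolding etl_mso_code_def
  proof (rule measure_rec_eq[where r = ?r and ch = ?ch and F = ?F and ok = "\<lambda>_. True"], goal_cases)
    case (1 d)
    obtain k j \<chi> where d: "d = (k, j, \<chi>)"
      by (cases d)
    show ?case
    proof (cases \<chi>)
      case (EAut M \<phi>s)
      have "etl_atom_code (\<phi>s ! i) < etl_atom_code \<chi>" if "i < length \<phi>s" for i
        using etl_code_less_EAut[of "\<phi>s ! i" \<phi>s] that by (simp add: EAut del: etl_code.simps)
      then show ?thesis
        unfolding d EAut by (auto simp: map_zip_etl_mso nth_opt_def Let_def EAut o_def simp del: list_encode.simps)
    qed (auto simp: d Let_def less_list_encode simp del: list_encode.simps)
  qed simp
  then show ?thesis
    by simp
qed

subsection \<open>Automata\<close>

text \<open>The greatest fixed point \<open>X\<close> of a least fixed point \<open>Y\<close>: from a state in \<open>X\<close>, the automaton can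
  force a visit to a final state in \<open>X\<close>, over and over.\<close>

definition buchi_fixpoint ::
    "'t automaton \<Rightarrow> ('t \<Rightarrow> (nat \<Rightarrow> bool) \<Rightarrow> bool) \<Rightarrow> (nat \<Rightarrow> letter) \<Rightarrow> bool" where
  "buchi_fixpoint A tsat w \<longleftrightarrow> (\<exists>X. 0 \<in> X (au_init A) \<and>
     (\<forall>Y. (\<forall>i. \<forall>(q, \<psi>, t) \<in> au_edges A. letter_sat (w i) \<psi> \<longrightarrow>
            tsat t (\<lambda>q'. if q' \<in> au_final A then Suc i \<in> X q' else Suc i \<in> Y q') \<longrightarrow> i \<in> Y q) \<longrightarrow>
          (\<forall>q \<in> au_states A. X q \<subseteq> Y q)))"

section \<open>Alternating automata and the nested fixed point\<close>

lemma pbf_sat_mono: "(\<And>x. x \<in> pbf_atoms t \<Longrightarrow> V x \<Longrightarrow> V' x) \<Longrightarrow> pbf_sat V t \<Longrightarrow> pbf_sat V' t"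
  by (induction t) auto

text \<open>Dependent choice along growing lists, with the limit collected into one
  sequence.\<close>

lemma infinite_branch:
  assumes "P x" "\<And>y. P y \<Longrightarrow> \<exists>k. P (y @ [k])"
  obtains \<beta> :: "nat \<Rightarrow> 'a" where "map \<beta> [0..<length x] = x" "\<And>n. length x \<le> n \<Longrightarrow> P (map \<beta> [0..<n])"
proof -
  define nxt where "nxt y = y @ [SOME k. P (y @ [k])]" for y
  define s where "s n = (nxt ^^ n) x" for n
  have P: "P (s n)" for n
  proof (induction n)
    case (Suc n)
    then show ?case
      using someI_ex[OF assms(2)] by (simp add: s_def nxt_def)
  qed (use assms(1) in \<open>simp add: s_def\<close>)
  have len: "length (s n) = length x + n" for n
    by (induction n) (simp_all add: s_def nxt_def)
  have prefix: "s (n + m) ! i = s n ! i" if "i < length x + n" for n m i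
    by (induction m) (use that len[unfolded s_def] in \<open>simp_all add: s_def nxt_def nth_append\<close>)
  define \<beta> where "\<beta> i = s (Suc i) ! i" for i
  have \<beta>: "map \<beta> [0..<length x + n] = s n" for n
  proof (rule nth_equalityI)
    fix i
    assume i: "i < length (map \<beta> [0..<length x + n])"
    then have nth: "map \<beta> [0..<length x + n] ! i = \<beta> i"
      by (simp del: upt_Suc)
    have "\<beta> i = s n ! i"
    proof (cases "Suc i \<le> n")
      case True
      then obtain m where "n = Suc i + m"
        using le_Suc_ex by blast
      then show ?thesis
        using prefix[of i "Suc i" m] by (simp add: \<beta>_def)
    next
      case False
      then obtain m where "Suc i = n + m"
        using le_Suc_ex[of n "Suc i"] by auto
      then show ?thesis
        using prefix[of i n m] i by (simp add: \<beta>_def)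
    qed
    then show "map \<beta> [0..<length x + n] ! i = s n ! i"
      using nth by simp
  qed (simp add: len)
  show thesis
  proof
    show "map \<beta> [0..<length x] = x"
      using \<beta>[of 0] by (simp add: s_def)
    show "P (map \<beta> [0..<n])" if "length x \<le> n" for n
      using \<beta>[of "n - length x"] P[of "n - length x"] that by simp
  qed
qed

lemma aba_run_prefix:
  assumes "\<forall>x k. x @ [k] \<in> T \<longrightarrow> x \<in> T" "x @ y \<in> T"
  shows "x \<in> T"
  using assms(2)
proof (induction y rule: rev_induct)
  case (snoc k y)
  then show ?case
    using assms(1) by (metis append_assoc)
qed simp

text \<open>Take for \<open>X\<close> the levels at which a state occurs in the run. If some node
  escaped a closed \<open>Y\<close>, one of its children would escape \<open>Y\<close> and be
  nonfinal, again and again, which gives a branch with only finitely many visits to final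
  states.\<close>

lemma aba_accepts_imp_fixpoint:
  assumes "aba_accepts A w"
  shows "buchi_fixpoint A (\<lambda>t V. pbf_sat V t) w"
proof -
  obtain T r where run: "aba_run A w T r"
    and acc: "\<And>\<beta>. (\<forall>i. map \<beta> [0..<i] \<in> T) \<Longrightarrow> \<exists>\<^sub>\<infinity>i. r (map \<beta> [0..<i]) \<in> au_final A"
    using assms unfolding aba_accepts_def by blast
  define X where "X q = {length x | x. x \<in> T \<and> r x = q}" for q
  have "X q \<subseteq> Y q"
    if Y: "\<forall>i. \<forall>(q, \<psi>, t) \<in> au_edges A. letter_sat (w i) \<psi> \<longrightarrow>
      pbf_sat (\<lambda>q'. if q' \<in> au_final A then Suc i \<in> X q' else Suc i \<in> Y q') t \<longrightarrow> i \<in> Y q" for Y q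
  proof (rule ccontr)
    assume "\<not> X q \<subseteq> Y q"
    then obtain x where x: "x \<in> T" "length x \<notin> Y (r x)"
      unfolding X_def by blast
    define bad where "bad y \<longleftrightarrow> y \<in> T \<and> length y \<notin> Y (r y) \<and> (length x < length y \<longrightarrow> r y \<notin> au_final A)" for y
    have step: "\<exists>k. y @ [k] \<in> T \<and> length (y @ [k]) \<notin> Y (r (y @ [k])) \<and> r (y @ [k]) \<notin> au_final A"
      if y: "y \<in> T" "length y \<notin> Y (r y)" for y
    proof (rule ccontr)
      assume no: "\<not> ?thesis"
      obtain \<psi> t where t: "(r y, \<psi>, t) \<in> au_edges A" "letter_sat (w (length y)) \<psi>"
        "pbf_sat (\<lambda>z. z \<in> {r (y @ [k]) | k. y @ [k] \<in> T}) t"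
        using run y(1) unfolding aba_run_def aba_delta_sat_def by blast
      have "pbf_sat (\<lambda>q'. if q' \<in> au_final A then Suc (length y) \<in> X q' else Suc (length y) \<in> Y q') t"
      proof (rule pbf_sat_mono[OF _ t(3)])
        fix z
        assume "z \<in> {r (y @ [k]) | k. y @ [k] \<in> T}"
        then obtain k where k: "z = r (y @ [k])" "y @ [k] \<in> T"
          by blast
        then have "Suc (length y) \<in> X z"
          unfolding X_def by (intro CollectI exI[of _ "y @ [k]"]) simp
        then show "if z \<in> au_final A then Suc (length y) \<in> X z else Suc (length y) \<in> Y z"
          using no k by auto
      qed
      then show False
        using Y t(1,2) y(2) by fastforce
    qed
    have "bad x"
      using x by (simp add: bad_def)
    moreover have "\<exists>k. bad (y @ [k])" if "bad y" for y
      using step[of y] that by (auto simp: bad_def)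
    ultimately obtain \<beta> where \<beta>: "map \<beta> [0..<length x] = x" "\<And>n. length x \<le> n \<Longrightarrow> bad (map \<beta> [0..<n])"
      using infinite_branch[of bad x] by blast
    have "map \<beta> [0..<i] \<in> T" for i
    proof -
      have "map \<beta> [0..<i + length x] \<in> T"
        using \<beta>(2)[of "i + length x"] by (simp add: bad_def)
      moreover have "map \<beta> [0..<i + length x] = map \<beta> [0..<i] @ map \<beta> [i..<i + length x]"
        by (simp flip: map_append add: upt_append)
      ultimately show ?thesis
        using aba_run_prefix[of T] run unfolding aba_run_def by metis
    qed
    then have "\<exists>\<^sub>\<infinity>i. r (map \<beta> [0..<i]) \<in> au_final A"
      using acc by blast
    then obtain n where n: "length x < n" "r (map \<beta> [0..<n]) \<in> au_final A"
      unfolding INFM_nat by blast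
    then show False
      using \<beta>(2)[of n] by (simp add: bad_def)
  qed
  moreover have "0 \<in> X (au_init A)"
    using run unfolding X_def aba_run_def by (auto intro!: exI[of _ "[]"])
  ultimately show ?thesis
    unfolding buchi_fixpoint_def by blast
qed

text \<open>A target formula mentions finitely many states, so if it holds in the limit of
  increasing stages it already holds at one stage.\<close>

lemma finite_uniform_index:
  assumes "finite Q" "\<And>q m n. P m q \<Longrightarrow> m \<le> n \<Longrightarrow> P n q"
  shows "\<exists>N :: nat. \<forall>q \<in> Q. (\<exists>n. P n q) \<longrightarrow> P N q"
  using assms(1)
proof induction
  case (insert q Q)
  then obtain N where N: "\<forall>q \<in> Q. (\<exists>n. P n q) \<longrightarrow> P N q"
    by blast
  show ?case
  proof (cases "\<exists>n. P n q")
    case True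
    then obtain n where "P n q"
      by blast
    then have "P (max N n) q"
      by (rule assms(2)) simp
    moreover have "P (max N n) q'" if "q' \<in> Q" "P n' q'" for q' n'
    proof (rule assms(2))
      show "P N q'"
        using N that by blast
    qed simp
    ultimately show ?thesis
      by blast
  qed (use N in auto)
qed simp

lemma fixpoint_imp_aba_accepts:
  assumes A: "is_aba Al A" and "buchi_fixpoint A (\<lambda>t V. pbf_sat V t) w"
  shows "aba_accepts A w"
proof -
  let ?Q = "au_states A" and ?F = "au_final A"
  have Q: "finite ?Q" "au_init A \<in> ?Q"
    and edges: "\<And>q \<psi> t. (q, \<psi>, t) \<in> au_edges A \<Longrightarrow> q \<in> ?Q \<and> pbf_atoms t \<subseteq> ?Q"
    using A unfolding is_aba_def is_automaton_def by blast+
  obtain X where X0: "0 \<in> X (au_init A)"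
    and X: "\<And>Y. (\<forall>i. \<forall>(q, \<psi>, t) \<in> au_edges A. letter_sat (w i) \<psi> \<longrightarrow>
      pbf_sat (\<lambda>q'. if q' \<in> ?F then Suc i \<in> X q' else Suc i \<in> Y q') t \<longrightarrow> i \<in> Y q) \<Longrightarrow> \<forall>q \<in> ?Q. X q \<subseteq> Y q"
    using assms(2) unfolding buchi_fixpoint_def by blast
  define V where "V Y i q' \<longleftrightarrow> (if q' \<in> ?F then Suc i \<in> X q' else Suc i \<in> Y q')" for Y :: "nat \<Rightarrow> nat set" and i q'
  define Z where "Z n = rec_nat (\<lambda>_. {}) (\<lambda>_ Y q. {i. \<exists>\<psi> t. (q, \<psi>, t) \<in> au_edges A \<and> letter_sat (w i) \<psi> \<and> pbf_sat (V Y i) t}) n" for n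
  have Z_simps: "Z 0 q = {}" "Z (Suc n) q = {i. \<exists>\<psi> t. (q, \<psi>, t) \<in> au_edges A \<and> letter_sat (w i) \<psi> \<and> pbf_sat (V (Z n) i) t}" for n q
    by (simp_all add: Z_def)
  have V_mono: "V Y i q \<Longrightarrow> (\<And>q. Y q \<subseteq> Y' q) \<Longrightarrow> V Y' i q" for Y Y' i q
    by (auto simp: V_def split: if_splits)
  have Z_Suc: "Z n q \<subseteq> Z (Suc n) q" for n q
  proof (induction n arbitrary: q)
    case (Suc n)
    have "V (Z n) i q' \<Longrightarrow> V (Z (Suc n)) i q'" for i q'
      using V_mono[of "Z n" i q' "Z (Suc n)"] Suc by blast
    then have "pbf_sat (V (Z n) i) t \<Longrightarrow> pbf_sat (V (Z (Suc n)) i) t" for i t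
      using pbf_sat_mono[of t "V (Z n) i" "V (Z (Suc n)) i"] by blast
    then show ?case
      using Z_simps(2)[of n] Z_simps(2)[of "Suc n"] by blast
  qed (simp add: Z_simps)
  have Z_mono: "i \<in> Z m q \<Longrightarrow> m \<le> n \<Longrightarrow> i \<in> Z n q" for i m n q
    using lift_Suc_mono_le[of "\<lambda>n. Z n q"] Z_Suc by blast
  have in_Z: "\<forall>q \<in> ?Q. X q \<subseteq> (\<Union>n. Z n q)"
  proof (rule X, intro allI ballI, clarify)
    fix i q \<psi> t
    assume e: "(q, \<psi>, t) \<in> au_edges A" "letter_sat (w i) \<psi>"
      "pbf_sat (\<lambda>q'. if q' \<in> ?F then Suc i \<in> X q' else Suc i \<in> (\<Union>n. Z n q')) t"
    obtain N where N: "\<And>q'. q' \<in> ?Q \<Longrightarrow> (\<exists>n. Suc i \<in> Z n q') \<Longrightarrow> Suc i \<in> Z N q'"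
      using finite_uniform_index[OF Q(1), of "\<lambda>n q'. Suc i \<in> Z n q'"] Z_mono by blast
    have "pbf_sat (V (Z N) i) t"
      by (rule pbf_sat_mono[OF _ e(3)]) (use N edges[OF e(1)] in \<open>auto simp: V_def split: if_splits\<close>)
    then have "i \<in> Z (Suc N) q"
      unfolding Z_simps using e by blast
    then show "i \<in> (\<Union>n. Z n q)"
      by blast
  qed
  define rank where "rank i q = (LEAST n. i \<in> Z n q)" for i q
  have rank: "i \<in> Z (rank i q) q" "0 < rank i q" if "i \<in> (\<Union>n. Z n q)" for i q
  proof -
    show "i \<in> Z (rank i q) q"
      unfolding rank_def by (rule LeastI_ex) (use that in blast)
    then show "0 < rank i q"
      by (cases "rank i q") (auto simp: Z_simps)
  qed
  have rank_le: "rank i q \<le> n" if "i \<in> Z n q" for i q n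
    unfolding rank_def by (rule Least_le) (rule that)
  define C where "C i q = {q' \<in> ?Q. V (Z (rank i q - 1)) i q'}" for i q
  \<comment> \<open>An address is the sequence of the states visited after the root, so the label of
    a node is its last entry.\<close>
  define lab where "lab x = (if x = [] then au_init A else last x)" for x
  define T where "T = {x. \<forall>m < length x. x ! m \<in> C m (lab (take m x))}"
  have T_snoc: "x @ [k] \<in> T \<longleftrightarrow> x \<in> T \<and> k \<in> C (length x) (lab x)" for x k
    unfolding T_def by (auto simp: nth_append less_Suc_eq)
  have lab_snoc: "lab (x @ [k]) = k" for x k
    by (simp add: lab_def)
  have T_good: "lab x \<in> ?Q \<and> length x \<in> (\<Union>n. Z n (lab x))" if "x \<in> T" for x
    using that
  proof (induction x rule: rev_induct)
    case Nil
    then show ?case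
      using Q(2) X0 in_Z by (auto simp: lab_def)
  next
    case (snoc k x)
    then have k: "k \<in> C (length x) (lab x)"
      by (simp add: T_snoc)
    then show ?case
      using in_Z unfolding lab_snoc by (auto simp: C_def V_def split: if_splits)
  qed
  have "aba_run A w T lab"
    unfolding aba_run_def
  proof (intro conjI allI ballI impI)
    show "[] \<in> T"
      by (simp add: T_def)
    show "x \<in> T" if "x @ [k] \<in> T" for x k
      using that by (simp add: T_snoc)
    show "lab x \<in> ?Q" if "x \<in> T" for x
      using T_good[OF that] by blast
    show "lab [] = au_init A"
      by (simp add: lab_def)
    fix x
    assume x: "x \<in> T"
    let ?i = "length x" and ?q = "lab x"
    obtain n where n: "rank ?i ?q = Suc n"
      using rank(2)[of ?i ?q] T_good[OF x] gr0_implies_Suc by blast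
    have "?i \<in> Z (Suc n) ?q"
      using rank(1)[of ?i ?q] T_good[OF x] n by simp
    then obtain \<psi> t where t: "(?q, \<psi>, t) \<in> au_edges A" "letter_sat (w ?i) \<psi>" "pbf_sat (V (Z n) ?i) t"
      unfolding Z_simps by blast
    have "{lab (x @ [k]) | k. x @ [k] \<in> T} = C ?i ?q"
      using x by (auto simp: T_snoc lab_snoc)
    moreover have "pbf_sat (\<lambda>y. y \<in> C ?i ?q) t"
      by (rule pbf_sat_mono[OF _ t(3)]) (use edges[OF t(1)] n in \<open>auto simp: C_def\<close>)
    ultimately show "aba_delta_sat A ?q (w ?i) {lab (x @ [k]) | k. x @ [k] \<in> T}"
      unfolding aba_delta_sat_def using t by auto
  qed
  moreover have "\<exists>\<^sub>\<infinity>i. lab (map \<beta> [0..<i]) \<in> ?F" if \<beta>: "\<forall>i. map \<beta> [0..<i] \<in> T" for \<beta>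
  proof (rule ccontr)
    assume "\<not> (\<exists>\<^sub>\<infinity>i. lab (map \<beta> [0..<i]) \<in> ?F)"
    then obtain N where N: "\<And>i. N < i \<Longrightarrow> lab (map \<beta> [0..<i]) \<notin> ?F"
      unfolding INFM_nat by blast
    let ?f = "\<lambda>i. rank i (lab (map \<beta> [0..<i]))"
    have desc: "?f (Suc i) < ?f i" if "N \<le> i" for i
    proof -
      have "map \<beta> [0..<i] @ [\<beta> i] \<in> T"
        using \<beta>[rule_format, of "Suc i"] by simp
      then have C: "\<beta> i \<in> C i (lab (map \<beta> [0..<i]))"
        unfolding T_snoc by simp
      have "lab (map \<beta> [0..<Suc i]) = \<beta> i"
        by (simp add: lab_def)
      moreover have "\<beta> i \<notin> ?F"
        using N[of "Suc i"] that by (simp add: lab_def)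
      ultimately have "?f (Suc i) \<le> ?f i - 1"
        using C by (auto intro!: rank_le simp: C_def V_def)
      moreover have "0 < ?f i"
        using rank(2)[of i "lab (map \<beta> [0..<i])"] T_good[OF \<beta>[rule_format, of i]] by simp
      ultimately show ?thesis
        by linarith
    qed
    have "?f (N + i) + i \<le> ?f N" for i
    proof (induction i)
      case (Suc i)
      then show ?case
        using desc[of "N + i"] by simp
    qed simp
    from this[of "Suc (?f N)"] show False
      by simp
  qed
  ultimately show ?thesis
    unfolding aba_accepts_def by blast
qed

section \<open>Nondeterministic automata as alternating ones\<close>

definition ba_to_aba :: "ba \<Rightarrow> aba" where
  "ba_to_aba A = \<lparr>au_states = au_states A, au_edges = (\<lambda>(q, \<psi>, t). (q, \<psi>, PBAtom t)) ` au_edges A,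
     au_init = au_init A, au_final = au_final A\<rparr>"

lemma is_aba_ba_to_aba: "is_ba Al A \<Longrightarrow> is_aba Al (ba_to_aba A)"
  unfolding is_ba_def is_aba_def is_automaton_def ba_to_aba_def by fastforce

lemma ba_edge: "(q, \<psi>, t) \<in> au_edges (ba_to_aba A) \<longleftrightarrow> (\<exists>t'. t = PBAtom t' \<and> (q, \<psi>, t') \<in> au_edges A)"
  unfolding ba_to_aba_def by force

text \<open>A run is a tree with a single branch. Conversely, an accepting tree may have children
  that no edge asks for, so a branch is selected along which every step follows an edge.\<close>

lemma ba_accepts_iff:
  assumes "is_ba Al A"
  shows "ba_accepts A w \<longleftrightarrow> aba_accepts (ba_to_aba A) w"
proof
  assume "ba_accepts A w"
  then obtain r where r0: "r 0 = au_init A" "\<forall>i. \<exists>\<psi>. (r i, \<psi>, r (Suc i)) \<in> au_edges A \<and> letter_sat (w i) \<psi>"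
    "\<exists>\<^sub>\<infinity>i. r i \<in> au_final A"
    unfolding ba_accepts_def by (elim exE conjE)
  note r = r0(1) r0(2)[rule_format] r0(3)
  define T :: "nat list set" where "T = {x. \<forall>k \<in> set x. k = 0}"
  have "r i \<in> au_states A" for i
    using r(2)[of i] assms unfolding is_ba_def is_automaton_def by blast
  moreover have "aba_delta_sat (ba_to_aba A) (r (length x)) (w (length x)) {r (length (x @ [k])) | k. x @ [k] \<in> T}"
    if "x \<in> T" for x
  proof -
    obtain \<psi> where \<psi>: "(r (length x), \<psi>, r (Suc (length x))) \<in> au_edges A" "letter_sat (w (length x)) \<psi>"
      using r(2) by blast
    have "x @ [0] \<in> T"
      using that by (simp add: T_def)
    then have "pbf_sat (\<lambda>y. y \<in> {r (length (x @ [k])) | k. x @ [k] \<in> T}) (PBAtom (r (Suc (length x))))"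
      by auto
    moreover have "(r (length x), \<psi>, PBAtom (r (Suc (length x)))) \<in> au_edges (ba_to_aba A)"
      using \<psi>(1) ba_edge by blast
    ultimately show ?thesis
      unfolding aba_delta_sat_def using \<psi>(2) by blast
  qed
  ultimately have "aba_run (ba_to_aba A) w T (\<lambda>x. r (length x))"
    unfolding aba_run_def using r(1) by (auto simp: T_def ba_to_aba_def)
  moreover have "r (length (map \<beta> [0..<i])) \<in> au_final (ba_to_aba A) \<longleftrightarrow> r i \<in> au_final A" for \<beta> i
    by (simp add: ba_to_aba_def)
  ultimately show "aba_accepts (ba_to_aba A) w"
    unfolding aba_accepts_def using r(3) by (intro exI[of _ T] exI[of _ "\<lambda>x. r (length x)"]) simp
next
  assume "aba_accepts (ba_to_aba A) w"
  then obtain T r where run: "aba_run (ba_to_aba A) w T r"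
    and acc: "\<And>\<beta>. (\<forall>i. map \<beta> [0..<i] \<in> T) \<Longrightarrow> \<exists>\<^sub>\<infinity>i. r (map \<beta> [0..<i]) \<in> au_final A"
    unfolding aba_accepts_def by (auto simp: ba_to_aba_def)
  let ?E = "\<lambda>x y. \<exists>\<psi>. (r x, \<psi>, r y) \<in> au_edges A \<and> letter_sat (w (length x)) \<psi>"
  have step: "\<exists>k. x @ [k] \<in> T \<and> ?E x (x @ [k])" if xT: "x \<in> T" for x
  proof -
    obtain \<psi> t where "(r x, \<psi>, t) \<in> au_edges (ba_to_aba A)" "letter_sat (w (length x)) \<psi>"
      "pbf_sat (\<lambda>y. y \<in> {r (x @ [k]) | k. x @ [k] \<in> T}) t"
    proof -
      have "aba_delta_sat (ba_to_aba A) (r x) (w (length x)) {r (x @ [k]) | k. x @ [k] \<in> T}"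
        using run xT unfolding aba_run_def by blast
      then show thesis
        using that unfolding aba_delta_sat_def by blast
    qed
    then obtain k where "x @ [k] \<in> T" "(r x, \<psi>, r (x @ [k])) \<in> au_edges A" "letter_sat (w (length x)) \<psi>"
      unfolding ba_edge by auto
    then show ?thesis
      by blast
  qed
  define P where "P x \<longleftrightarrow> x \<in> T \<and> (x \<noteq> [] \<longrightarrow> ?E (butlast x) x)" for x
  have "P []"
    using run by (simp add: P_def aba_run_def)
  moreover have "\<exists>k. P (x @ [k])" if "P x" for x
    using step[of x] that by (auto simp: P_def)
  ultimately obtain \<beta> where \<beta>: "\<And>n. P (map \<beta> [0..<n])"
    using infinite_branch[of P "[]"] by (metis le0 list.size(3))
  define r' where "r' i = r (map \<beta> [0..<i])" for i
  have "r' 0 = au_init A"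
    using run by (simp add: r'_def aba_run_def ba_to_aba_def)
  moreover have "\<exists>\<psi>. (r' i, \<psi>, r' (Suc i)) \<in> au_edges A \<and> letter_sat (w i) \<psi>" for i
    using \<beta>[of "Suc i"] by (auto simp: P_def r'_def)
  moreover have "\<exists>\<^sub>\<infinity>i. r' i \<in> au_final A"
    unfolding r'_def by (rule acc) (use \<beta> in \<open>simp add: P_def\<close>)
  ultimately show "ba_accepts A w"
    unfolding ba_accepts_def by blast
qed

text \<open>State \<open>q\<close> becomes the variables \<open>(1, q)\<close> and \<open>(2, q)\<close> for the sets \<open>X\<close> and \<open>Y\<close> of
  \<open>buchi_fixpoint\<close>.\<close>

primrec lift_form :: "atom bform \<Rightarrow> (nat \<times> nat \<times> nat) bform" where
  "lift_form BTrue = BTrue"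
| "lift_form (BAtom x) = Now 0 (atom_code x)"
| "lift_form (BNot f) = BNot (lift_form f)"
| "lift_form (BAnd f g) = BAnd (lift_form f) (lift_form g)"
| "lift_form (BOr f g) = BOr (lift_form f) (lift_form g)"

lemma lift_form: "represents W w \<Longrightarrow> bf_sat (lit_holds b (W i) a) (lift_form f) \<longleftrightarrow> letter_sat (w i) f"
  by (induction f) (auto simp: represents_def)

section \<open>The fixed point condition as a formula on codes\<close>

definition lift_code :: "nat \<Rightarrow> (nat \<times> nat \<times> nat) bform" where
  "lift_code = measure_rec
    (\<lambda>c. if arg 0 c \<le> 1 then [] else if arg 0 c = 2 then [arg 1 c] else [arg 1 c, arg 2 c])
    (\<lambda>c vs. if arg 0 c = 0 then BTrue else if arg 0 c = 1 then Now 0 (arg 1 c)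
      else if arg 0 c = 2 then BNot (nth_opt BTrue vs 0)
      else if arg 0 c = 3 then BAnd (nth_opt BTrue vs 0) (nth_opt BTrue vs 1)
      else BOr (nth_opt BTrue vs 0) (nth_opt BTrue vs 1)) (\<lambda>c. c)"

lemma computable_lift_code [comp]: "computable c \<Longrightarrow> computable (\<lambda>x. lift_code (c x))"
  unfolding lift_code_def by (intro computable_measure_rec comp)

lemma lift_code: "lift_code (bform_code atom_code f) = lift_form f"
  unfolding lift_code_def
  by (rule measure_rec_eq[where r = "bform_code atom_code" and ok = "\<lambda>_. True"
        and ch = "\<lambda>f. case f of BNot f \<Rightarrow> [f] | BAnd f g \<Rightarrow> [f, g] | BOr f g \<Rightarrow> [f, g] | _ \<Rightarrow> []"])
    (auto simp: less_list_encode simp del: list_encode.simps split: bform.split)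

definition ba_target :: "nat \<times> nat \<Rightarrow> (nat \<times> nat \<times> nat) bform" where
  "ba_target z = (if snd z \<in> set_decode (fst z) then Next 1 (snd z) else Next 2 (snd z))"

definition aba_target :: "nat \<times> nat \<Rightarrow> (nat \<times> nat \<times> nat) bform" where
  "aba_target = measure_rec
    (\<lambda>z. if arg 0 (snd z) \<le> 2 then [] else [(fst z, arg 1 (snd z)), (fst z, arg 2 (snd z))])
    (\<lambda>z vs. if arg 0 (snd z) = 0 then BTrue else if arg 0 (snd z) = 1 then BNot BTrue
      else if arg 0 (snd z) = 2 then ba_target (fst z, arg 1 (snd z))
      else if arg 0 (snd z) = 3 then BAnd (nth_opt BTrue vs 0) (nth_opt BTrue vs 1)
      else BOr (nth_opt BTrue vs 0) (nth_opt BTrue vs 1)) snd"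

lemma computable_ba_target [comp]: "computable z \<Longrightarrow> computable (\<lambda>x. ba_target (z x))"
  unfolding ba_target_def by (intro comp)

lemma computable_aba_target [comp]: "computable z \<Longrightarrow> computable (\<lambda>x. aba_target (z x))"
  unfolding aba_target_def by (intro computable_measure_rec comp)

primrec target_form :: "nat \<Rightarrow> nat pbform \<Rightarrow> (nat \<times> nat \<times> nat) bform" where
  "target_form F PBTrue = BTrue"
| "target_form F PBFalse = BNot BTrue"
| "target_form F (PBAtom q) = ba_target (F, q)"
| "target_form F (PBAnd f g) = BAnd (target_form F f) (target_form F g)"
| "target_form F (PBOr f g) = BOr (target_form F f) (target_form F g)"

lemma aba_target: "aba_target (F, pbform_code id f) = target_form F f"
  unfolding aba_target_def
  by (rule measure_rec_eq[where r = "\<lambda>f. (F, pbform_code id f)" and ok = "\<lambda>_. True"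
        and ch = "\<lambda>f. case f of PBAnd f g \<Rightarrow> [f, g] | PBOr f g \<Rightarrow> [f, g] | _ \<Rightarrow> []"])
    (auto simp: less_list_encode simp del: list_encode.simps split: pbform.split)

lemma target_form:
  "bf_sat (lit_holds b a W) (target_form F f) \<longleftrightarrow> pbf_sat (\<lambda>q. if q \<in> set_decode F then (1, q) \<in> W else (2, q) \<in> W) f"
  by (induction f) (auto simp: ba_target_def)

definition aut_mso :: "(nat \<times> nat \<Rightarrow> (nat \<times> nat \<times> nat) bform) \<Rightarrow> nat \<Rightarrow> mso" where
  "aut_mso tc c = MsEx 1 (MsAnd (Glob (BImp First (Now 1 (arg 2 c))))
     (MsNot (MsEx 2 (MsAnd
       (Glob (bconj (map (\<lambda>e. BImp (BAnd (lift_code (arg 1 e)) (tc (arg 3 c, arg 2 e))) (Now 2 (arg 0 e))) (set_list (arg 1 c)))))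
       (MsNot (Glob (bconj (map (\<lambda>q. BImp (Now 1 q) (Now 2 q)) (set_list (arg 0 c))))))))))"

lemma computable_aut_mso:
  assumes tc: "computable tc" and "computable c"
  shows "computable (\<lambda>x. aut_mso tc (c x))"
  unfolding aut_mso_def by (intro comp assms assms[THEN computable_compose])

lemma all_pos_or [simp]: "(\<forall>i::nat. 0 < i \<or> P i) \<longleftrightarrow> P 0"
  by (metis neq0_conv)

lemma msat_aut_mso:
  assumes fin: "finite (au_states A)" "finite (au_edges A)" "finite (au_final A)" and W: "represents W w"
    and tc: "\<And>t b a V. bf_sat (lit_holds b a V) (tc (set_code id (au_final A), ct t)) \<longleftrightarrow>
      tsat t (\<lambda>q. if q \<in> au_final A then (1, q) \<in> V else (2, q) \<in> V)"
  shows "msat W (aut_mso tc (automaton_code ct A)) \<longleftrightarrow> buchi_fixpoint A tsat w"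
proof -
  let ?c = "automaton_code ct A"
  have 1: "msat (upd_class 1 X W) (Glob (BImp First (Now 1 (arg 2 ?c)))) \<longleftrightarrow> 0 \<in> X (au_init A)" for X
    by (simp add: automaton_code_def mem_track del: list_encode.simps)
  have 2: "msat (upd_class 2 Y (upd_class 1 X W))
      (Glob (bconj (map (\<lambda>e. BImp (BAnd (lift_code (arg 1 e)) (tc (arg 3 ?c, arg 2 e))) (Now 2 (arg 0 e))) (set_list (arg 1 ?c))))) \<longleftrightarrow>
    (\<forall>i. \<forall>(q, \<psi>, t) \<in> au_edges A. letter_sat (w i) \<psi> \<longrightarrow>
        tsat t (\<lambda>q'. if q' \<in> au_final A then Suc i \<in> X q' else Suc i \<in> Y q') \<longrightarrow> i \<in> Y q)" for X Y
  proof -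
    have rep: "represents (upd_class 2 Y (upd_class 1 X W)) w"
      using W by simp
    let ?U = "upd_class 2 Y (upd_class 1 X W)"
    let ?g = "\<lambda>e. BImp (BAnd (lift_code (arg 1 e)) (tc (arg 3 ?c, arg 2 e))) (Now 2 (arg 0 e))"
    have edges: "set (set_list (arg 1 ?c)) = (\<lambda>(q, \<psi>, t). list_encode [q, bform_code atom_code \<psi>, ct t]) ` au_edges A"
      and final: "arg 3 ?c = set_code id (au_final A)"
      using fin by (simp_all add: automaton_code_def del: list_encode.simps)
    have V: "(\<lambda>q. if q \<in> au_final A then (1, q) \<in> ?U j else (2, q) \<in> ?U j) =
        (\<lambda>q. if q \<in> au_final A then j \<in> X q else j \<in> Y q)" for j
      by (simp add: mem_track)
    have g: "bf_sat (lit_holds f (?U i) (?U (Suc i))) (?g (list_encode [q, bform_code atom_code \<psi>, ct t])) \<longleftrightarrow>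
        (letter_sat (w i) \<psi> \<longrightarrow> tsat t (\<lambda>q. if q \<in> au_final A then Suc i \<in> X q else Suc i \<in> Y q) \<longrightarrow> i \<in> Y q)" for f i q \<psi> t
    proof -
      have args: "arg 0 (list_encode [q, bform_code atom_code \<psi>, ct t]) = q"
        "arg 1 (list_encode [q, bform_code atom_code \<psi>, ct t]) = bform_code atom_code \<psi>"
        "arg 2 (list_encode [q, bform_code atom_code \<psi>, ct t]) = ct t"
        by (simp_all del: list_encode.simps)
      show ?thesis
        unfolding bf_sat.simps final args lift_code lift_form[OF rep] tc V by (auto simp: mem_track)
    qed
    show ?thesis
      unfolding msat.simps bf_sat_bconj set_map edges ball_simps(9) case_prod_beta g by (simp add: case_prod_beta)
  qed
  have 3: "msat (upd_class 2 Y (upd_class 1 X W)) (Glob (bconj (map (\<lambda>q. BImp (Now 1 q) (Now 2 q)) (set_list (arg 0 ?c))))) \<longleftrightarrow>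
      (\<forall>q \<in> au_states A. X q \<subseteq> Y q)" for X Y
    using fin by (auto simp: automaton_code_def mem_track simp del: list_encode.simps)
  show ?thesis
    unfolding aut_mso_def msat_MsEx_upd_class msat.simps(2,3) 1 2 3 buchi_fixpoint_def
    by (simp only: not_ex de_Morgan_conj not_not imp_conv_disj)
qed

subsection \<open>All languages\<close>

text \<open>The translations of ETL and of the mu-calculus denote sets of positions, so membership
  of position 0 is asserted at the end. For ETL the outermost class is one above
  \<open>sub_class\<close>, as the bound on \<open>k\<close> in \<open>etl_mso\<close>
  demands.\<close>

definition spec_mso :: "nat \<Rightarrow> mso" where
  "spec_mso c = (if arg 0 c = 0 then fo_mso_code (arg 1 c)
     else if arg 0 c = 1 then aut_mso ba_target (arg 1 c)
     else if arg 0 c = 2 then aut_mso aba_target (arg 1 c)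
     else if arg 0 c = 3 then MsEx (Suc (sub_class (arg 1 c))) (MsAnd (etl_mso_code (Suc (sub_class (arg 1 c)), 0, arg 1 c))
       (Glob (BImp First (Now (Suc (sub_class (arg 1 c))) 0))))
     else MsEx (sub_class (arg 1 c)) (MsAnd (mu_mso_code (arg 1 c)) (Glob (BImp First (Now (sub_class (arg 1 c)) 0)))))"

lemma computable_spec_mso [comp]: "computable c \<Longrightarrow> computable (\<lambda>x. spec_mso (c x))"
  unfolding spec_mso_def
  by (intro comp computable_aut_mso)

lemma msat_spec_mso:
  assumes A: "A \<in> specifications L Al" and W: "represents W w"
  shows "msat W (spec_mso (spec_code A)) \<longleftrightarrow> spec_accepts A w"
proof (cases A)
  case (SpecFO \<phi>)
  have "fo_fv \<phi> = {}"
    using A SpecFO by (cases L) auto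
  then show ?thesis
    using fo_mso[OF W, of \<phi> "\<lambda>_. 0"] by (simp add: SpecFO spec_mso_def fo_mso_code del: list_encode.simps)
next
  case (SpecBA B)
  have B: "is_ba Al B"
    using A SpecBA by (cases L) auto
  then have fin: "finite (au_states B)" "finite (au_edges B)" "finite (au_final B)"
    by (auto simp: is_ba_def is_automaton_def intro: finite_subset)
  have "msat W (spec_mso (spec_code A)) \<longleftrightarrow> buchi_fixpoint B (\<lambda>t V. V t) w"
    unfolding SpecBA spec_mso_def
    using msat_aut_mso[OF fin W, of ba_target id "\<lambda>t V. V t"] fin by (simp add: ba_target_def del: list_encode.simps)
  also have "\<dots> \<longleftrightarrow> buchi_fixpoint (ba_to_aba B) (\<lambda>t V. pbf_sat V t) w"
    unfolding buchi_fixpoint_def ba_to_aba_def by (simp add: case_prod_beta)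
  also have "\<dots> \<longleftrightarrow> ba_accepts B w"
    using ba_accepts_iff[OF B] aba_accepts_imp_fixpoint fixpoint_imp_aba_accepts[OF is_aba_ba_to_aba[OF B]] by blast
  finally show ?thesis
    by (simp add: SpecBA)
next
  case (SpecABA B)
  have B: "is_aba Al B"
    using A SpecABA by (cases L) auto
  then have fin: "finite (au_states B)" "finite (au_edges B)" "finite (au_final B)"
    by (auto simp: is_aba_def is_automaton_def intro: finite_subset)
  have "msat W (spec_mso (spec_code A)) \<longleftrightarrow> buchi_fixpoint B (\<lambda>t V. pbf_sat V t) w"
    unfolding SpecABA spec_mso_def
    using msat_aut_mso[OF fin W, of aba_target "pbform_code id" "\<lambda>t V. pbf_sat V t"] fin
    by (simp add: aba_target target_form del: list_encode.simps)
  then show ?thesis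
    using aba_accepts_imp_fixpoint fixpoint_imp_aba_accepts[OF B] by (auto simp: SpecABA)
next
  case (SpecETL \<phi>)
  have wf: "etl_wf \<phi>"
    using A SpecETL by (cases L) auto
  let ?k = "Suc (sub_class (etl_atom_code \<phi>))"
  have "msat W (spec_mso (spec_code A)) \<longleftrightarrow> (\<exists>X. track (upd_class ?k X W) ?k 0 = {i. etl_sat \<phi> w i} \<and> 0 \<in> X 0)"
    unfolding SpecETL spec_mso_def
    using etl_mso[of _ w \<phi> ?k 0] W wf
    by (simp add: etl_mso_code msat_MsEx_upd_class mem_track del: list_encode.simps msat.simps(4))
  also have "\<dots> \<longleftrightarrow> etl_sat \<phi> w 0"
    by (auto intro!: exI[of _ "\<lambda>_. {i. etl_sat \<phi> w i}"])
  finally show ?thesis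
    by (simp add: SpecETL)
next
  case (SpecMuTL \<phi>)
  have "mu_wf \<phi> \<and> mu_fv \<phi> = {}"
    using A SpecMuTL by (cases L) simp_all
  then have wf: "mu_wf \<phi>" "mu_fv \<phi> = {}"
    by simp_all
  \<comment> \<open>The translation reads fixed-point variables from \<open>W\<close>, whereas the
    specification uses the empty valuation; closedness makes the two agree.\<close>
  have cong: "(\<forall>z \<in> mu_fv \<psi>. e z = e' z) \<Longrightarrow> mu_sem w e \<psi> = mu_sem w e' \<psi>" for e e' and \<psi> :: "atom mutl"
  proof (induction \<psi> arbitrary: e e')
    case (MMu z \<psi>)
    have "mu_sem w (e(z := M)) \<psi> = mu_sem w (e'(z := M)) \<psi>" for M
      by (rule MMu.IH) (use MMu.prems in auto)
    then show ?case
      by simp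
  next
    case (MAnd \<psi> \<chi>)
    have "mu_sem w e \<psi> = mu_sem w e' \<psi>" "mu_sem w e \<chi> = mu_sem w e' \<chi>"
      by (rule MAnd.IH; use MAnd.prems in simp)+
    then show ?case
      by simp
  next
    case (MNot \<psi>)
    have "mu_sem w e \<psi> = mu_sem w e' \<psi>"
      by (rule MNot.IH) (use MNot.prems in simp)
    then show ?case
      by simp
  next
    case (MNext \<psi>)
    have "mu_sem w e \<psi> = mu_sem w e' \<psi>"
      by (rule MNext.IH) (use MNext.prems in simp)
    then show ?case
      by simp
  next
    case (MPrev \<psi>)
    have "mu_sem w e \<psi> = mu_sem w e' \<psi>"
      by (rule MPrev.IH) (use MPrev.prems in simp)
    then show ?case
      by simp
  qed simp_all
  let ?k = "sub_class (mu_atom_code \<phi>)" and ?S = "mu_sem w (\<lambda>_. {}) \<phi>"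
  have "mu_sem w (\<lambda>z. track (upd_class ?k X W) (mu_class z) 0) \<phi> = ?S" for X
    by (rule cong) (use wf in simp)
  then have "msat W (spec_mso (spec_code A)) \<longleftrightarrow> (\<exists>X. track (upd_class ?k X W) ?k 0 = ?S \<and> 0 \<in> X 0)"
    unfolding SpecMuTL spec_mso_def
    using mu_mso[of _ w \<phi>] W wf
    by (simp add: mu_mso_code msat_MsEx_upd_class mem_track del: list_encode.simps msat.simps(4) mu_code.simps)
  also have "\<dots> \<longleftrightarrow> 0 \<in> ?S"
    by (auto intro!: exI[of _ "\<lambda>_. ?S"])
  finally show ?thesis
    by (simp add: SpecMuTL)
qed

section \<open>Runs of flat systems\<close>

definition conc :: "'a list \<Rightarrow> (nat \<Rightarrow> 'a) \<Rightarrow> nat \<Rightarrow> 'a" where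
  "conc u w i = (if i < length u then u ! i else w (i - length u))"

lemma conc_append: "conc (u @ v) w = conc u (conc v w)"
  by (auto simp: conc_def fun_eq_iff nth_append)

lemma conc_prefix: "conc (map w [0..<n]) (\<lambda>i. w (n + i)) = w"
  by (auto simp: conc_def fun_eq_iff)

lemma upword_conc: "upword (u @ v) x = conc u (upword v x)"
  by (auto simp: conc_def upword_def fun_eq_iff nth_append)

lemma upword_eq_conc: "upword u x = conc u (upword [] x)"
  using upword_conc[of u "[]" x] by simp

section \<open>First returns in flat systems\<close>

definition walk :: "counter_system \<Rightarrow> transition list \<Rightarrow> bool" where
  "walk S es \<longleftrightarrow> set es \<subseteq> cs_trans S \<and> (\<forall>i. Suc i < length es \<longrightarrow> tgt (es ! i) = src (es ! Suc i))"

definition first_return :: "counter_system \<Rightarrow> nat \<Rightarrow> transition list \<Rightarrow> bool" where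
  "first_return S q es \<longleftrightarrow> es \<noteq> [] \<and> walk S es \<and> src (hd es) = q \<and> tgt (last es) = q \<and>
     (\<forall>i. 0 < i \<longrightarrow> i < length es \<longrightarrow> src (es ! i) \<noteq> q)"

lemma first_return_simple:
  assumes "first_return S q es" "distinct (map src es)"
  shows "simple_cycle S es"
  unfolding simple_cycle_def
proof (intro conjI allI impI)
  show "es \<noteq> []" "set es \<subseteq> cs_trans S" "distinct es"
    using assms by (auto simp: first_return_def walk_def distinct_map)
  fix i
  assume i: "i < length es"
  show "tgt (es ! i) = src (es ! (Suc i mod length es))"
  proof (cases "Suc i < length es")
    case True
    then show ?thesis
      using assms(1) by (simp add: first_return_def walk_def)
  next
    case False
    then have "Suc i = length es"
      using i by simp
    moreover from this have "i = length es - 1"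
      by simp
    moreover have "es \<noteq> []" "tgt (last es) = src (hd es)"
      using assms(1) by (simp_all add: first_return_def)
    ultimately show ?thesis
      by (simp add: last_conv_nth hd_conv_nth)
  qed
qed

lemma walk_take_drop:
  assumes "walk S es" "a < b" "b \<le> length es"
  shows "walk S (drop a (take b es))"
  using assms unfolding walk_def by (auto dest!: in_set_dropD in_set_takeD)

lemma walk_cut:
  assumes "walk S es" "0 < a" "a < b" "b < length es" "src (es ! a) = src (es ! b)"
  shows "walk S (take a es @ drop b es)"
  unfolding walk_def
proof (intro conjI allI impI)
  show "set (take a es @ drop b es) \<subseteq> cs_trans S"
    using assms(1) by (auto simp: walk_def dest!: in_set_dropD in_set_takeD)
  fix i
  assume i: "Suc i < length (take a es @ drop b es)"
  consider "Suc i < a" | "Suc i = a" | "a \<le> i"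
    by linarith
  then show "tgt ((take a es @ drop b es) ! i) = src ((take a es @ drop b es) ! Suc i)"
  proof cases
    case 1
    then show ?thesis
      using assms by (simp add: walk_def nth_append)
  next
    case 2
    then have "tgt (es ! i) = src (es ! a)"
      using assms by (auto simp: walk_def)
    then show ?thesis
      using 2 assms by (auto simp: nth_append)
  next
    case 3
    then show ?thesis
      using i assms by (auto simp: walk_def nth_append Suc_diff_le)
  qed
qed

text \<open>If a state is repeated inside a first return to \<open>q\<close>, choose a shortest
  repetition. The loop between its two visits is a simple cycle, and by induction so is the walk
  with this loop cut out. They share the repeated state, so flatness identifies their edges; but the
  outer walk starts at \<open>q\<close> while the inner loop avoids \<open>q\<close>.\<close>

lemma first_return_distinct:
  assumes S: "flat S" "cs_trans S \<subseteq> UNIV" and states: "\<And>t. t \<in> cs_trans S \<Longrightarrow> src t \<in> cs_states S"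
  shows "first_return S q es \<Longrightarrow> distinct (map src es)"
proof (induction "length es" arbitrary: es rule: less_induct)
  case less
  have fr: "es \<noteq> []" "walk S es" "src (hd es) = q" "tgt (last es) = q" "\<And>i. 0 < i \<Longrightarrow> i < length es \<Longrightarrow> src (es ! i) \<noteq> q"
    using less.prems by (auto simp: first_return_def)
  show ?case
  proof (rule ccontr)
    assume "\<not> distinct (map src es)"
    then obtain i j where ij: "i < length es" "j < length es" "i \<noteq> j" "src (es ! i) = src (es ! j)"
      by (auto simp: distinct_conv_nth)
    obtain a0 b0 where ab0: "a0 < b0" "b0 < length es" "src (es ! a0) = src (es ! b0)"
    proof (cases "i < j")
      case True
      then show thesis
        using that[of i j] ij by simp
    next
      case False
      then show thesis
        using that[of j i] ij by simp
    qed
    define P where "P d \<longleftrightarrow> (\<exists>a b. a < b \<and> b < length es \<and> src (es ! a) = src (es ! b) \<and> b - a = d)" for d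
    have "P (b0 - a0)"
      using ab0 by (auto simp: P_def)
    define d where "d = (LEAST d. P d)"
    have "P d" "\<And>d'. P d' \<Longrightarrow> d \<le> d'"
      unfolding d_def using \<open>P (b0 - a0)\<close> by (auto intro: LeastI Least_le)
    then obtain a b where ab: "a < b" "b < length es" "src (es ! a) = src (es ! b)" "b - a = d"
      unfolding P_def by blast
    have minimal: "src (es ! i) \<noteq> src (es ! j)" if "a \<le> i" "i < j" "j < b" for i j
    proof
      assume "src (es ! i) = src (es ! j)"
      then have "P (j - i)"
        unfolding P_def using that ab by (intro exI[of _ i] exI[of _ j]) simp
      then show False
        using \<open>\<And>d'. P d' \<Longrightarrow> d \<le> d'\<close>[of "j - i"] that ab by simp
    qed
    have "0 < a"
    proof (rule ccontr)
      assume "\<not> 0 < a"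
      then have "src (es ! b) = q"
        using ab(3) fr(1,3) by (simp add: hd_conv_nth)
      then show False
        using fr(5)[of b] ab by simp
    qed
    let ?in = "drop a (take b es)" and ?out = "take a es @ drop b es"
    have in_nth: "?in ! i = es ! (a + i)" if "i < b - a" for i
      using that ab by simp
    have len_in: "length ?in = b - a"
      using ab by simp
    have "distinct (map src ?in)"
      unfolding distinct_conv_nth
    proof (intro allI impI)
      fix i j
      assume ij: "i < length (map src ?in)" "j < length (map src ?in)" "i \<noteq> j"
      then have "i < b - a" "j < b - a"
        using len_in by simp_all
      moreover from this have "a + i < b" "a + j < b"
        by linarith+
      ultimately show "map src ?in ! i \<noteq> map src ?in ! j"
        using minimal[of "a + i" "a + j"] minimal[of "a + j" "a + i"] ij(3) len_in
        by (cases "i < j") (auto simp: in_nth)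
    qed
    moreover have in_fr: "first_return S (src (es ! a)) ?in"
      unfolding first_return_def
    proof (intro conjI allI impI)
      show "?in \<noteq> []"
        using len_in ab by (metis list.size(3) zero_less_diff less_irrefl)
      show "walk S ?in"
        using fr(2) ab by (intro walk_take_drop) auto
      show "src (hd ?in) = src (es ! a)"
        using \<open>?in \<noteq> []\<close> in_nth[of 0] ab by (simp add: hd_conv_nth)
      have "last ?in = es ! (b - 1)"
        using \<open>?in \<noteq> []\<close> in_nth[of "b - a - 1"] len_in ab(1,2) by (simp add: last_conv_nth)
      moreover have "tgt (es ! (b - 1)) = src (es ! b)"
        using fr(2) ab unfolding walk_def by (cases b) auto
      ultimately show "tgt (last ?in) = src (es ! a)"
        using ab by simp
      show "src (?in ! i) \<noteq> src (es ! a)" if "0 < i" "i < length ?in" for i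
      proof -
        have "i < b - a" "a + i < b"
          using that len_in by linarith+
        then show ?thesis
          using minimal[of a "a + i", THEN not_sym] in_nth[of i] that(1) by simp
      qed
    qed
    ultimately have in_cycle: "simple_cycle S ?in"
      using first_return_simple by blast
    have out_fr: "first_return S q ?out"
      unfolding first_return_def
    proof (intro conjI allI impI)
      show "?out \<noteq> []"
        using ab by simp
      show "walk S ?out"
        using walk_cut[OF fr(2) \<open>0 < a\<close> ab(1,2,3)] .
      show "src (hd ?out) = q"
        using fr(1,3) \<open>0 < a\<close> by simp
      show "tgt (last ?out) = q"
        using fr(4) ab by simp
      show "src (?out ! i) \<noteq> q" if "0 < i" "i < length ?out" for i
      proof (cases "i < a")
        case True
        then show ?thesis
          using fr(5)[of i] that ab by (simp add: nth_append)
      next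
        case False
        have "i < a + (length es - b)"
          using that ab by simp
        then have "0 < b + (i - a)" "b + (i - a) < length es"
          using False ab by linarith+
        then show ?thesis
          using fr(5)[of "b + (i - a)"] False ab by (simp add: nth_append)
      qed
    qed
    moreover have "length ?out < length es"
      using ab by simp
    ultimately have "distinct (map src ?out)"
      using less.hyps by blast
    then have out_cycle: "simple_cycle S ?out"
      using first_return_simple[OF out_fr] by blast
    let ?p = "src (es ! a)"
    have "?p \<in> src ` set ?in"
      using in_nth[of 0] len_in ab by (intro image_eqI[of _ _ "?in ! 0"] nth_mem) auto
    moreover have "?p \<in> src ` set ?out"
    proof -
      have "drop b es ! 0 = es ! b" "drop b es \<noteq> []"
        using ab by simp_all
      then have "es ! b \<in> set (drop b es)"
        by (metis length_greater_0_conv nth_mem)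
      then show ?thesis
        using ab(3) by auto
    qed
    moreover have "?p \<in> cs_states S"
      using states fr(2) ab unfolding walk_def by (meson less_trans nth_mem subsetD)
    ultimately obtain k where "?in = rotate k ?out"
      using S(1) in_cycle out_cycle unfolding flat_def by blast
    then have "set ?in = set ?out"
      by simp
    moreover have "hd es \<in> set ?out"
      using fr(1) \<open>0 < a\<close> by (cases es; cases a) auto
    ultimately obtain i where "i < length ?in" "?in ! i = hd es"
      by (metis in_set_conv_nth)
    then have "src (es ! (a + i)) = q"
      using in_nth[of i] len_in fr(3) by simp
    then show False
      using fr(5)[of "a + i"] \<open>0 < a\<close> \<open>i < length ?in\<close> len_in ab by simp
  qed
qed

text \<open>Two first returns are simple cycles through \<open>q\<close> and hence rotations of each
  other. The source \<open>q\<close> occurs only at their start, so the rotation is trivial.\<close>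

lemma first_return_unique:
  assumes S: "flat S" and states: "\<And>t. t \<in> cs_trans S \<Longrightarrow> src t \<in> cs_states S"
    and es: "first_return S q es" and es': "first_return S q es'"
  shows "es' = es"
proof -
  have d: "distinct (map src es)" "distinct (map src es')"
    using first_return_distinct[OF S _ states] es es' by blast+
  have ne: "es \<noteq> []" "es' \<noteq> []" and q: "src (hd es) = q" "src (hd es') = q"
    using es es' by (auto simp: first_return_def)
  have "q \<in> src ` set es" "q \<in> src ` set es'"
    using ne q by (metis hd_in_set image_eqI)+
  moreover have "q \<in> cs_states S"
    using q(1) ne(1) states es unfolding first_return_def walk_def by (metis hd_in_set subsetD)
  ultimately obtain k where k: "es' = rotate k es"
    using S first_return_simple[OF es d(1)] first_return_simple[OF es' d(2)] unfolding flat_def by blast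
  have "hd es' = es ! (k mod length es)"
    using k ne by (simp add: hd_rotate_conv_nth)
  then have "src (es ! (k mod length es)) = q"
    using q(2) by simp
  moreover have "k mod length es < length es"
    using ne by simp
  ultimately have "k mod length es = 0"
    using es unfolding first_return_def by (metis neq0_conv)
  then show ?thesis
    using k by (simp add: rotate_conv_mod[of k])
qed

section \<open>Decomposition of runs into powers of loops\<close>

definition unblock :: "('a list \<times> nat) list \<Rightarrow> 'a list" where
  "unblock bs = concat (map (\<lambda>b. pow (snd b) (fst b)) bs)"

lemma unblock_append [simp]: "unblock (bs @ bs') = unblock bs @ unblock bs'"
  and unblock_Nil [simp]: "unblock [] = []"
  and unblock_Cons: "unblock (b # bs) = pow (snd b) (fst b) @ unblock bs"
  by (simp_all add: unblock_def)

lemma pow_1 [simp]: "pow (Suc 0) u = u"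
  by (simp add: pow_Suc)

text \<open>Between two visits to a state \<open>q\<close>, a run can only iterate the unique first-return walk at \<open>q\<close>, so
  that a run leaves \<open>q\<close> for good after a power of this walk or iterates it forever.\<close>

lemma flat_run_blocks:
  assumes S: "flat S" "finite (cs_trans S)" and states: "\<And>t. t \<in> cs_trans S \<Longrightarrow> src t \<in> cs_states S"
    and "\<And>i. \<tau> i \<in> cs_trans S" "\<And>i. tgt (\<tau> i) = src (\<tau> (Suc i))"
    and "finite Q" "\<And>i. src (\<tau> i) \<in> Q"
  shows "\<exists>bs u. \<tau> = upword (unblock bs) u \<and> length bs \<le> 2 * card Q \<and> u \<noteq> [] \<and> length u \<le> card (cs_trans S) \<and>
    (\<forall>b \<in> set bs. fst b \<noteq> [] \<and> length (fst b) \<le> card (cs_trans S))"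
  using assms(4-7)
proof (induction "card Q" arbitrary: Q \<tau>)
  case 0
  then show ?case
    by auto
next
  case (Suc n)
  let ?q = "src (\<tau> 0)"
  have walk: "walk S (map \<tau> [i..<j])" for i j
    using Suc.prems(1,2) by (auto simp: walk_def)
  have return: "first_return S ?q (map \<tau> [i..<j])"
    if "i < j" "src (\<tau> i) = ?q" "src (\<tau> j) = ?q" "\<And>k. i < k \<Longrightarrow> k < j \<Longrightarrow> src (\<tau> k) \<noteq> ?q" for i j
    unfolding first_return_def
  proof (intro conjI allI impI)
    show "map \<tau> [i..<j] \<noteq> []" "src (hd (map \<tau> [i..<j])) = ?q"
      using that by (auto simp: hd_map)
    show "tgt (last (map \<tau> [i..<j])) = ?q"
      using that Suc.prems(2)[of "j - 1"] by (simp add: last_map)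
  qed (use walk that in auto)
  have len: "length es \<le> card (cs_trans S)" if "first_return S ?q es" for es
  proof -
    have "distinct es" "set es \<subseteq> cs_trans S"
      using first_return_distinct[OF S(1) _ states that] that by (auto simp: distinct_map first_return_def walk_def)
    then show ?thesis
      using S(2) by (metis card_mono distinct_card)
  qed
  \<comment> \<open>Cutting the prefix at its visits to \<open>?q\<close> yields first returns only,
    and these all equal \<open>l\<close>.\<close>
  have chain: "\<exists>m. map \<tau> [0..<j] = pow m l"
    if l: "\<And>es. first_return S ?q es \<Longrightarrow> es = l" and "src (\<tau> j) = ?q" for j l
    using that(2)
  proof (induction j rule: less_induct)
    case (less j)
    show ?case
    proof (cases "j = 0")
      case True
      then show ?thesis
        by (intro exI[of _ 0]) simp
    next
      case False
      define i where "i = Max {i. i < j \<and> src (\<tau> i) = ?q}"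
      have fin: "finite {i. i < j \<and> src (\<tau> i) = ?q}" "0 \<in> {i. i < j \<and> src (\<tau> i) = ?q}"
        using False by auto
      have i: "i < j" "src (\<tau> i) = ?q"
        using Max_in[OF fin(1)] fin(2) unfolding i_def by blast+
      have "src (\<tau> k) \<noteq> ?q" if "i < k" "k < j" for k
        using Max_ge[OF fin(1), of k] that unfolding i_def[symmetric] by auto
      then have "map \<tau> [i..<j] = l"
        using return[OF i(1,2) less.prems] l by blast
      moreover obtain m where "map \<tau> [0..<i] = pow m l"
        using less.IH[OF i] by blast
      moreover have "map \<tau> [0..<j] = map \<tau> [0..<i] @ map \<tau> [i..<j]"
        using i by (simp flip: map_append add: upt_append)
      ultimately have "map \<tau> [0..<j] = pow (m + 1) l"
        unfolding pow_add by simp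
      then show ?thesis ..
    qed
  qed
  show ?case
  proof (cases "\<exists>\<^sub>\<infinity>i. src (\<tau> i) = ?q")
    case True
    have next_visit: "\<exists>j. i < j \<and> src (\<tau> j) = ?q \<and> (\<forall>k. i < k \<longrightarrow> k < j \<longrightarrow> src (\<tau> k) \<noteq> ?q)" for i
    proof -
      obtain j where j: "i < j \<and> src (\<tau> j) = ?q"
        using True unfolding INFM_nat by blast
      define j' where "j' = (LEAST j. i < j \<and> src (\<tau> j) = ?q)"
      have "i < j' \<and> src (\<tau> j') = ?q"
        unfolding j'_def by (rule LeastI[of _ j]) (rule j)
      moreover have "src (\<tau> k) \<noteq> ?q" if "i < k" "k < j'" for k
        using not_less_Least[of k "\<lambda>j. i < j \<and> src (\<tau> j) = ?q"] that unfolding j'_def by blast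
      ultimately show ?thesis
        by blast
    qed
    then obtain j where j: "0 < j" "src (\<tau> j) = ?q" "\<And>k. 0 < k \<Longrightarrow> k < j \<Longrightarrow> src (\<tau> k) \<noteq> ?q"
      by blast
    define l where "l = map \<tau> [0..<j]"
    have l: "first_return S ?q l"
      unfolding l_def by (rule return) (use j in auto)
    then have ne: "l \<noteq> []"
      by (simp add: first_return_def)
    \<comment> \<open>A later visit to \<open>?q\<close> puts position \<open>i\<close> inside a
      power of \<open>l\<close>.\<close>
    have "\<tau> i = upword [] l i" for i
    proof -
      obtain k where k: "i < k" "src (\<tau> k) = ?q"
        using True unfolding INFM_nat by blast
      then obtain m where m: "map \<tau> [0..<k] = pow m l"
        using chain[of l k] first_return_unique[OF S(1) states l] by blast
      have "i < m * length l"
        using arg_cong[OF m, of length] k by simp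
      then have "pow m l ! i = l ! (i mod length l)"
        by (rule nth_pow)
      then show ?thesis
        using m k by (metis (no_types, lifting) add_0 diff_zero length_upt list.size(3) not_less_zero nth_map nth_upt upword_def)
    qed
    then show ?thesis
      using len[OF l] ne by (intro exI[of _ "[]"] exI[of _ l]) (auto simp: fun_eq_iff)
  next
    case False
    then obtain N where N: "\<And>i. N < i \<Longrightarrow> src (\<tau> i) \<noteq> ?q"
      unfolding INFM_nat by blast
    define j where "j = Max {i. src (\<tau> i) = ?q}"
    have "{i. src (\<tau> i) = ?q} \<subseteq> {..N}"
      using N by (auto simp: not_less[symmetric])
    then have fin: "finite {i. src (\<tau> i) = ?q}"
      using finite_subset by blast
    have j: "src (\<tau> j) = ?q"
      using Max_in[OF fin] unfolding j_def by blast
    have after: "src (\<tau> i) \<noteq> ?q" if "j < i" for i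
      using Max_ge[OF fin, of i] that unfolding j_def[symmetric] by auto
    obtain l m where l: "map \<tau> [0..<j] = pow m l" "l \<noteq> []" "length l \<le> card (cs_trans S)"
    proof (cases "\<exists>es. first_return S ?q es")
      case True
      then obtain l where l: "first_return S ?q l" ..
      have "l \<noteq> []"
        using l by (simp add: first_return_def)
      moreover obtain m where "map \<tau> [0..<j] = pow m l"
        using chain[of l j] first_return_unique[OF S(1) states l] j by blast
      ultimately show ?thesis
        using that[of m l] len[OF l] by blast
    next
      case False
      have "j = 0"
      proof (rule ccontr)
        assume "j \<noteq> 0"
        \<comment> \<open>Without any first return the premise of \<open>chain\<close> holds
          vacuously for the empty list, all of whose powers are empty.\<close>
        moreover obtain m where m: "map \<tau> [0..<j] = pow m ([] :: transition list)"
          using chain[of "[]" j] False j by blast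
        ultimately show False
          using m by (simp add: pow_def)
      qed
      moreover have "card {\<tau> 0} \<le> card (cs_trans S)"
        using Suc.prems(1) S(2) by (intro card_mono) auto
      ultimately show ?thesis
        \<comment> \<open>A nonempty block with exponent 0 keeps the shape of the decomposition
          uniform.\<close>
        using that[of 0 "[\<tau> 0]"] by simp
    qed
    define \<tau>' where "\<tau>' i = \<tau> (Suc j + i)" for i
    have "\<exists>bs u. \<tau>' = upword (unblock bs) u \<and> length bs \<le> 2 * card (Q - {?q}) \<and> u \<noteq> [] \<and>
      length u \<le> card (cs_trans S) \<and> (\<forall>b \<in> set bs. fst b \<noteq> [] \<and> length (fst b) \<le> card (cs_trans S))"
    proof (rule Suc.hyps(1))
      show "n = card (Q - {?q})"
        using Suc.hyps(2) Suc.prems(3,4) by simp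
      show "\<tau>' i \<in> cs_trans S" "tgt (\<tau>' i) = src (\<tau>' (Suc i))" "src (\<tau>' i) \<in> Q - {?q}" for i
        using Suc.prems(1,4) Suc.prems(2)[of "Suc j + i"] after[of "Suc j + i"] by (auto simp: \<tau>'_def)
    qed (use Suc.prems(3) in simp)
    then obtain bs u where bs: "\<tau>' = upword (unblock bs) u" "length bs \<le> 2 * card (Q - {?q})" "u \<noteq> []"
      "length u \<le> card (cs_trans S)" "\<forall>b \<in> set bs. fst b \<noteq> [] \<and> length (fst b) \<le> card (cs_trans S)"
      by blast
    \<comment> \<open>Each state of \<open>Q\<close> costs two blocks: its iterated first return and
      the transition that leaves it for good.\<close>
    let ?bs = "(l, m) # ([\<tau> j], 1) # bs"
    have "\<tau> = conc (map \<tau> [0..<Suc j]) \<tau>'"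
      using conc_prefix[of \<tau> "Suc j"] by (simp add: \<tau>'_def[abs_def])
    also have "map \<tau> [0..<Suc j] = pow m l @ [\<tau> j]"
      using l(1) by simp
    also have "conc (pow m l @ [\<tau> j]) \<tau>' = upword (unblock ?bs) u"
      unfolding bs(1) using upword_conc[of "[\<tau> j]" "unblock bs" u]
      by (simp add: unblock_Cons upword_conc conc_append)
    finally have "\<tau> = upword (unblock ?bs) u" .
    moreover have "length ?bs \<le> 2 * card Q"
    proof -
      have "card (Q - {?q}) = n" "card Q = Suc n"
        using Suc.hyps(2) Suc.prems(3,4) by simp_all
      then show ?thesis
        using bs(2) by simp
    qed
    moreover have "card {\<tau> j} \<le> card (cs_trans S)"
      using Suc.prems(1) S(2) by (intro card_mono) auto
    ultimately show ?thesis
      using bs l by (intro exI[of _ ?bs] exI[of _ u]) auto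
  qed
qed

section \<open>Counter values along block decompositions\<close>

text \<open>Atomic guards and transitions are handled through their codes. A step is a
  transition together with the list of the signs, \<open>0\<close> for negative, \<open>1\<close> for zero, \<open>2\<close> for positive,
  of the linear terms of all guards with code below a bound \<open>X\<close>.\<close>

definition guard_coeff :: "nat \<Rightarrow> nat \<Rightarrow> int" where
  "guard_coeff g i = int_decode (nth_opt 0 (list_decode (arg 0 g)) i)"

definition dot :: "nat \<Rightarrow> (nat \<Rightarrow> int) \<Rightarrow> (nat \<Rightarrow> int) \<Rightarrow> int" where
  "dot n a x = (\<Sum>i\<leftarrow>[0..<n]. a i * x i)"

definition sign :: "int \<Rightarrow> nat" where
  "sign z = (if z < 0 then 0 else if z = 0 then 1 else 2)"

definition guard_sign :: "nat \<Rightarrow> nat \<Rightarrow> (nat \<Rightarrow> int) \<Rightarrow> nat" where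
  "guard_sign n g x = sign (dot n (guard_coeff g) x - int (arg 2 g))"

definition effect :: "nat \<Rightarrow> nat \<Rightarrow> int" where
  "effect t i = int_decode (nth_opt 0 (list_decode (arg 2 t)) i)"

definition total_effect :: "nat list \<Rightarrow> nat \<Rightarrow> int" where
  "total_effect ts i = (\<Sum>t\<leftarrow>ts. effect t i)"

type_synonym sstep = "nat \<times> nat list"

abbreviation seffect :: "sstep list \<Rightarrow> nat \<Rightarrow> int" where
  "seffect u \<equiv> total_effect (map fst u)"

definition vadd :: "(nat \<Rightarrow> int) \<Rightarrow> int \<Rightarrow> (nat \<Rightarrow> int) \<Rightarrow> nat \<Rightarrow> int" where
  "vadd x t d i = x i + t * d i"

definition step_ok :: "nat \<Rightarrow> nat \<Rightarrow> (nat \<Rightarrow> int) \<Rightarrow> sstep \<Rightarrow> bool" where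
  "step_ok n X x s \<longleftrightarrow> (\<forall>i < n. 0 \<le> x i) \<and> (\<forall>g < X. guard_sign n g x = nth_opt 0 (snd s) g)"

text \<open>Vectors are checked before each step; the vector after the last step is left to whatever
  follows the list.\<close>

definition valid_list :: "nat \<Rightarrow> nat \<Rightarrow> (nat \<Rightarrow> int) \<Rightarrow> sstep list \<Rightarrow> bool" where
  "valid_list n X x u \<longleftrightarrow> (\<forall>k < length u. step_ok n X (vadd x 1 (seffect (take k u))) (u ! k))"

definition valid_word :: "nat \<Rightarrow> nat \<Rightarrow> (nat \<Rightarrow> int) \<Rightarrow> (nat \<Rightarrow> sstep) \<Rightarrow> bool" where
  "valid_word n X x w \<longleftrightarrow> (\<forall>k. step_ok n X (vadd x 1 (seffect (map w [0..<k]))) (w k))"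

lemma total_effect_append: "total_effect (ts @ ts') i = total_effect ts i + total_effect ts' i"
  by (simp add: total_effect_def)

lemma total_effect_Nil [simp]: "total_effect [] i = 0"
  by (simp add: total_effect_def)

lemma seffect_pow: "seffect (pow m u) i = int m * seffect u i"
  by (induction m) (simp_all add: pow_Suc total_effect_append algebra_simps)

lemma vadd_total_effect_Nil [simp]: "vadd x t (total_effect []) = x"
  by (simp add: vadd_def fun_eq_iff)

lemma vadd_0 [simp]: "vadd x 0 d = x"
  by (simp add: vadd_def fun_eq_iff)

lemma vadd_append: "vadd x 1 (total_effect (ts @ ts')) = vadd (vadd x 1 (total_effect ts)) 1 (total_effect ts')"
  by (simp add: vadd_def fun_eq_iff total_effect_append)

lemma vadd_pow: "vadd x 1 (seffect (pow m u)) = vadd x (int m) (seffect u)"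
  by (simp add: vadd_def fun_eq_iff seffect_pow)

lemma vadd_vadd: "vadd (vadd x s d) t d = vadd x (s + t) d"
  by (simp add: vadd_def fun_eq_iff algebra_simps)

lemma vadd_commute: "vadd (vadd x s d) t e = vadd (vadd x t e) s d"
  by (simp add: vadd_def fun_eq_iff)

lemma valid_list_append:
  "valid_list n X x (u @ v) \<longleftrightarrow> valid_list n X x u \<and> valid_list n X (vadd x 1 (seffect u)) v"
proof -
  have "valid_list n X x (u @ v) \<longleftrightarrow>
      (\<forall>k < length u. step_ok n X (vadd x 1 (seffect (take k (u @ v)))) ((u @ v) ! k)) \<and>
      (\<forall>k < length v. step_ok n X (vadd x 1 (seffect (take (length u + k) (u @ v)))) ((u @ v) ! (length u + k)))"
  proof -
    have "(\<forall>k < a + b. P k) \<longleftrightarrow> (\<forall>k < a. P k) \<and> (\<forall>k < b. P (a + k))" for a b :: nat and P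
      by (metis add_less_cancel_left le_add_diff_inverse linorder_not_less trans_less_add1)
    then show ?thesis
      by (simp add: valid_list_def)
  qed
  then show ?thesis
    by (simp add: valid_list_def nth_append vadd_append)
qed

lemma valid_word_conc:
  "valid_word n X x (conc u w) \<longleftrightarrow> valid_list n X x u \<and> valid_word n X (vadd x 1 (seffect u)) w"
proof -
  define Q where "Q k \<longleftrightarrow> step_ok n X (vadd x 1 (seffect (map (conc u w) [0..<k]))) (conc u w k)" for k
  have pre: "map (conc u w) [0..<k] = take k u" if "k < length u" for k
    by (rule nth_equalityI) (use that in \<open>auto simp: conc_def\<close>)
  have post: "map (conc u w) [0..<length u + k] = u @ map w [0..<k]" for k
    by (rule nth_equalityI) (auto simp: conc_def nth_append)
  have "(\<forall>k. Q k) \<longleftrightarrow> (\<forall>k < length u. Q k) \<and> (\<forall>k. Q (length u + k))"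
    by (metis le_Suc_ex linorder_not_less)
  moreover have "Q k \<longleftrightarrow> step_ok n X (vadd x 1 (seffect (take k u))) (u ! k)" if "k < length u" for k
    unfolding Q_def pre[OF that] using that by (simp add: conc_def)
  moreover have "Q (length u + k) \<longleftrightarrow> step_ok n X (vadd (vadd x 1 (seffect u)) 1 (seffect (map w [0..<k]))) (w k)" for k
    unfolding Q_def post map_append vadd_append by (simp add: conc_def)
  ultimately show ?thesis
    unfolding valid_word_def valid_list_def Q_def by simp
qed

lemma valid_list_pow: "valid_list n X x (pow m u) \<longleftrightarrow> (\<forall>t < m. valid_list n X (vadd x (int t) (seffect u)) u)"
proof (induction m)
  case (Suc m)
  have "pow (Suc m) u = pow m u @ u"
    using pow_add[of m 1 u] by simp
  then show ?case
    using Suc by (auto simp: valid_list_append vadd_pow less_Suc_eq)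
qed (simp add: valid_list_def)

lemma upword_unroll:
  assumes "v \<noteq> []"
  shows "upword [] v = conc (pow m v) (upword [] v)"
proof
  show "upword [] v i = conc (pow m v) (upword [] v) i" for i
  proof (cases "i < m * length v")
    case True
    then show ?thesis
      by (simp add: conc_def upword_def nth_pow)
  next
    case False
    then obtain r where "i = m * length v + r"
      using le_Suc_ex[of "m * length v" i] by auto
    then show ?thesis
      by (simp add: conc_def upword_def)
  qed
qed

lemma valid_word_upword:
  assumes "u \<noteq> []"
  shows "valid_word n X x (upword [] u) \<longleftrightarrow> (\<forall>t. valid_list n X (vadd x (int t) (seffect u)) u)"
proof
  assume *: "valid_word n X x (upword [] u)"
  show "\<forall>t. valid_list n X (vadd x (int t) (seffect u)) u"
  proof
    fix t
    have "valid_list n X x (pow (Suc t) u)"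
      using * upword_unroll[OF assms, of "Suc t"] valid_word_conc by metis
    then show "valid_list n X (vadd x (int t) (seffect u)) u"
      unfolding valid_list_pow by blast
  qed
next
  assume *: "\<forall>t. valid_list n X (vadd x (int t) (seffect u)) u"
  show "valid_word n X x (upword [] u)"
    unfolding valid_word_def
  proof
    fix k
    let ?p = "pow (Suc k) u"
    have k: "k < length ?p"
      using assms by (cases u) auto
    have "upword [] u k = ?p ! k" "map (upword [] u) [0..<k] = take k ?p"
    proof -
      have nth: "upword [] u j = ?p ! j" if "j < length ?p" for j
        using that by (simp add: upword_def nth_pow)
      then show "upword [] u k = ?p ! k"
        using k by blast
      show "map (upword [] u) [0..<k] = take k ?p"
        by (rule nth_equalityI) (use k nth in auto)
    qed
    moreover have "valid_list n X x ?p"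
      unfolding valid_list_pow using * by blast
    ultimately show "step_ok n X (vadd x 1 (seffect (map (upword [] u) [0..<k]))) (upword [] u k)"
      unfolding valid_list_def using k by metis
  qed
qed

section \<open>Convexity and long-term behaviour of signs\<close>

lemma dot_vadd: "dot n a (vadd x t d) = dot n a x + t * dot n a d"
  unfolding dot_def vadd_def by (induction n) (simp_all add: algebra_simps)

lemma guard_sign_vadd:
  "guard_sign n g (vadd x t d) = sign (dot n (guard_coeff g) x - int (arg 2 g) + t * dot n (guard_coeff g) d)"
  by (simp add: guard_sign_def dot_vadd algebra_simps)

text \<open>The value is monotone or antitone in \<open>t\<close>, and each sign describes a convex
  set of integers.\<close>

lemma sign_convex:
  assumes "sign a = s" "sign (a + T * d) = s" "0 \<le> t" "t \<le> T"
  shows "sign (a + t * d) = s"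
proof (cases "0 \<le> d")
  case True
  then have "0 \<le> t * d" "t * d \<le> T * d"
    using assms by (simp_all add: mult_right_mono)
  then show ?thesis
    using assms(1,2) by (auto simp: sign_def split: if_splits)
next
  case False
  then have "t * d \<le> 0" "T * d \<le> t * d"
    using assms by (simp_all add: mult_right_mono_neg mult_nonneg_nonpos)
  then show ?thesis
    using assms(1,2) by (auto simp: sign_def split: if_splits)
qed

lemma nonneg_convex:
  fixes a d t T :: int
  assumes "0 \<le> a" "0 \<le> a + T * d" "0 \<le> t" "t \<le> T"
  shows "0 \<le> a + t * d"
proof (cases "0 \<le> d")
  case False
  then have "T * d \<le> t * d"
    using assms by (simp add: mult_right_mono_neg)
  then show ?thesis
    using assms by linarith
qed (use assms in simp)

lemma step_ok_convex:
  assumes "step_ok n X x s" "step_ok n X (vadd x T d) s" "0 \<le> t" "t \<le> T"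
  shows "step_ok n X (vadd x t d) s"
  using assms sign_convex[of _ _ T _ t] nonneg_convex[of _ T _ t]
  unfolding step_ok_def guard_sign_vadd by (simp add: guard_sign_def) (auto simp: vadd_def)

text \<open>By convexity the first and the last iteration speak for all. This removes the quantifier
  over iterations, so that the final formula stays existential.\<close>

lemma valid_list_pow_Suc:
  "valid_list n X x (pow (Suc t) u) \<longleftrightarrow> valid_list n X x u \<and> valid_list n X (vadd x (int t) (seffect u)) u"
proof
  assume *: "valid_list n X x u \<and> valid_list n X (vadd x (int t) (seffect u)) u"
  show "valid_list n X x (pow (Suc t) u)"
    unfolding valid_list_pow
    unfolding valid_list_def
  proof (intro allI impI)
    fix r k
    assume r: "r < Suc t" and k: "k < length u"
    let ?y = "vadd x 1 (seffect (take k u))"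
    have "step_ok n X ?y (u ! k)" "step_ok n X (vadd ?y (int t) (seffect u)) (u ! k)"
      using * k unfolding valid_list_def by (simp_all add: vadd_commute[of x 1])
    then have "step_ok n X (vadd ?y (int r) (seffect u)) (u ! k)"
      by (rule step_ok_convex) (use r in simp_all)
    then show "step_ok n X (vadd (vadd x (int r) (seffect u)) 1 (seffect (take k u))) (u ! k)"
      by (simp add: vadd_commute[of x 1])
  qed
next
  assume "valid_list n X x (pow (Suc t) u)"
  then have "valid_list n X (vadd x (int r) (seffect u)) u" if "r \<le> t" for r
    using that unfolding valid_list_pow by simp
  from this[of 0] this[of t] show "valid_list n X x u \<and> valid_list n X (vadd x (int t) (seffect u)) u"
    by simp
qed

definition sign_stable :: "nat \<Rightarrow> int \<Rightarrow> bool" where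
  "sign_stable s d \<longleftrightarrow> (if s = 0 then d \<le> 0 else if s = 1 then d = 0 else 0 \<le> d)"

lemma sign_forever: "(\<forall>t::nat. sign (a + int t * d) = s) \<longleftrightarrow> sign a = s \<and> sign_stable s d"
proof
  assume *: "\<forall>t::nat. sign (a + int t * d) = s"
  have a: "sign a = s" and 1: "sign (a + d) = s"
    using *[rule_format, of 0] *[rule_format, of 1] by simp_all
  have "sign_stable s d"
  proof (rule ccontr)
    assume ns: "\<not> sign_stable s d"
    \<comment> \<open>An effect of at least one per iteration in the wrong direction has brought a
      nonzero value to zero or beyond after \<open>\<bar>a\<bar>\<close> iterations. For
      \<open>a = 0\<close> a single iteration already shows the change.\<close>
    let ?t = "nat \<bar>a\<bar>"
    have t: "sign (a + \<bar>a\<bar> * d) = s"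
      using *[rule_format, of ?t] by simp
    show False
    proof (cases "0 \<le> d")
      case True
      then have "0 < d" "a < 0"
        using ns a 1 by (auto simp: sign_stable_def sign_def split: if_splits)
      then have "\<bar>a\<bar> \<le> \<bar>a\<bar> * d"
        by (simp add: mult_le_cancel_left1)
      then show False
        using t a \<open>a < 0\<close> by (auto simp: sign_def split: if_splits)
    next
      case False
      then have "d < 0" "0 < a"
        using ns a 1 by (auto simp: sign_stable_def sign_def split: if_splits)
      then have "\<bar>a\<bar> * d \<le> \<bar>a\<bar> * (- 1)"
        by (intro mult_left_mono) auto
      then show False
        using t a \<open>0 < a\<close> by (auto simp: sign_def split: if_splits)
    qed
  qed
  then show "sign a = s \<and> sign_stable s d"
    using a by blast
next
  assume *: "sign a = s \<and> sign_stable s d"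
  show "\<forall>t::nat. sign (a + int t * d) = s"
  proof
    fix t :: nat
    have t: "d \<le> 0 \<Longrightarrow> int t * d \<le> 0" "0 \<le> d \<Longrightarrow> 0 \<le> int t * d"
      by (simp_all add: mult_nonneg_nonpos)
    consider "a < 0" "s = 0" | "a = 0" "s = 1" | "0 < a" "s = 2"
      using * by (auto simp: sign_def split: if_splits)
    then show "sign (a + int t * d) = s"
    proof cases
      case 1
      then have "int t * d \<le> 0"
        using * t(1) by (simp add: sign_stable_def)
      then show ?thesis
        using 1 by (simp add: sign_def)
    next
      case 2
      then show ?thesis
        using * by (simp add: sign_stable_def sign_def)
    next
      case 3
      then have "0 \<le> int t * d"
        using * t(2) by (simp add: sign_stable_def)
      then show ?thesis
        using 3 by (simp add: sign_def)
    qed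
  qed
qed

lemma nonneg_forever: "(\<forall>t::nat. 0 \<le> a + int t * (d::int)) \<longleftrightarrow> 0 \<le> a \<and> 0 \<le> d"
proof
  assume *: "\<forall>t::nat. 0 \<le> a + int t * d"
  have "0 \<le> d"
  proof (rule ccontr)
    assume "\<not> 0 \<le> d"
    then have "int (nat (a + 1)) * d \<le> int (nat (a + 1)) * (- 1)"
      by (intro mult_left_mono) auto
    then show False
      using *[rule_format, of "nat (a + 1)"] *[rule_format, of 0] by simp
  qed
  then show "0 \<le> a \<and> 0 \<le> d"
    using *[rule_format, of 0] by simp
qed simp

definition loop_stable :: "nat \<Rightarrow> nat \<Rightarrow> sstep list \<Rightarrow> bool" where
  "loop_stable n X u \<longleftrightarrow> (\<forall>i \<in> set [0..<n]. 0 \<le> seffect u i) \<and>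
    (\<forall>s \<in> set u. \<forall>g \<in> set [0..<X]. sign_stable (nth_opt 0 (snd s) g) (dot n (guard_coeff g) (seffect u)))"

lemma step_ok_forever:
  "(\<forall>t::nat. step_ok n X (vadd x (int t) d) s) \<longleftrightarrow> step_ok n X x s \<and> (\<forall>i < n. 0 \<le> d i) \<and>
    (\<forall>g < X. sign_stable (nth_opt 0 (snd s) g) (dot n (guard_coeff g) d))"
proof -
  have "(\<forall>t::nat. step_ok n X (vadd x (int t) d) s) \<longleftrightarrow> (\<forall>i < n. \<forall>t::nat. 0 \<le> x i + int t * d i) \<and>
      (\<forall>g < X. \<forall>t::nat. sign (dot n (guard_coeff g) x - int (arg 2 g) + int t * dot n (guard_coeff g) d) = nth_opt 0 (snd s) g)"
    unfolding step_ok_def guard_sign_vadd vadd_def by blast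
  then show ?thesis
    unfolding nonneg_forever sign_forever step_ok_def guard_sign_def by blast
qed

text \<open>The starting vector matters only for the first iteration. The rest is a condition on the
  effect of the loop, which can be decided while the formula is built.\<close>

lemma valid_word_loop:
  assumes "u \<noteq> []"
  shows "valid_word n X x (upword [] u) \<longleftrightarrow> valid_list n X x u \<and> loop_stable n X u"
proof -
  have "valid_word n X x (upword [] u) \<longleftrightarrow>
      (\<forall>k < length u. \<forall>t::nat. step_ok n X (vadd (vadd x 1 (seffect (take k u))) (int t) (seffect u)) (u ! k))"
    unfolding valid_word_upword[OF assms] valid_list_def by (auto simp: vadd_commute[of x 1])
  also have "\<dots> \<longleftrightarrow> valid_list n X x u \<and> (\<forall>k < length u. (\<forall>i < n. 0 \<le> seffect u i) \<and>
      (\<forall>g < X. sign_stable (nth_opt 0 (snd (u ! k)) g) (dot n (guard_coeff g) (seffect u))))"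
    unfolding step_ok_forever valid_list_def by blast
  also have "\<dots> \<longleftrightarrow> valid_list n X x u \<and> loop_stable n X u"
  proof -
    have "0 < length u"
      using assms by simp
    then show ?thesis
      unfolding loop_stable_def all_set_conv_all_nth[of u] by auto
  qed
  finally show ?thesis .
qed

subsection \<open>Splitting loops into blocks of constant signs\<close>

text \<open>A monotone function with values up to 2 is injective on its points of change and below 2
  there. For an antitone function the same holds for the values after the change.\<close>

lemma card_changes:
  fixes f :: "nat \<Rightarrow> nat"
  assumes f: "mono f \<or> antimono f" and le: "\<And>t. f t \<le> 2"
  shows "finite {t. f t \<noteq> f (Suc t)} \<and> card {t. f t \<noteq> f (Suc t)} \<le> 2"
  using f
proof
  assume m: "mono f"
  have lt: "f t < f (Suc t)" if "f t \<noteq> f (Suc t)" for t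
    using that monoD[OF m, of t "Suc t"] by simp
  have "inj_on f {t. f t \<noteq> f (Suc t)}"
  proof (rule linorder_inj_onI)
    show "f t \<noteq> f t'" if "t < t'" "t \<in> {t. f t \<noteq> f (Suc t)}" for t t'
      using lt[of t] that monoD[OF m, of "Suc t" t'] by simp
  qed auto
  moreover have "f ` {t. f t \<noteq> f (Suc t)} \<subseteq> {..<2}"
    using lt le by (fastforce intro: less_le_trans)
  ultimately show ?thesis
    using inj_on_finite[of f "{t. f t \<noteq> f (Suc t)}" "{..<2}"]
      card_inj_on_le[of f "{t. f t \<noteq> f (Suc t)}" "{..<2}"] by simp
next
  assume m: "antimono f"
  have lt: "f (Suc t) < f t" if "f t \<noteq> f (Suc t)" for t
    using that antimonoD[OF m, of t "Suc t"] by simp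
  have "inj_on (\<lambda>t. f (Suc t)) {t. f t \<noteq> f (Suc t)}"
  proof (rule linorder_inj_onI)
    show "f (Suc t) \<noteq> f (Suc t')" if "t < t'" "t' \<in> {t. f t \<noteq> f (Suc t)}" for t t'
      using lt[of t'] that antimonoD[OF m, of "Suc t" t'] by simp
  qed auto
  moreover have "(\<lambda>t. f (Suc t)) ` {t. f t \<noteq> f (Suc t)} \<subseteq> {..<2}"
    using lt le by (fastforce intro: less_le_trans)
  ultimately show ?thesis
    using inj_on_finite[of "\<lambda>t. f (Suc t)" "{t. f t \<noteq> f (Suc t)}" "{..<2}"]
      card_inj_on_le[of "\<lambda>t. f (Suc t)" "{t. f t \<noteq> f (Suc t)}" "{..<2}"] by simp
qed

lemma sign_mono: "a \<le> b \<Longrightarrow> sign a \<le> sign b"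
  by (simp add: sign_def)

lemma card_sign_changes:
  "finite {t::nat. sign (a + int t * d) \<noteq> sign (a + int (Suc t) * d)} \<and>
   card {t::nat. sign (a + int t * d) \<noteq> sign (a + int (Suc t) * d)} \<le> 2"
proof (rule card_changes[of "\<lambda>t. sign (a + int t * d)"])
  show "mono (\<lambda>t. sign (a + int t * d)) \<or> antimono (\<lambda>t. sign (a + int t * d))"
  proof (cases "0 \<le> d")
    case True
    then show ?thesis
      by (auto intro!: monoI sign_mono mult_right_mono)
  next
    case False
    then show ?thesis
      by (auto intro!: antimonoI sign_mono mult_right_mono_neg)
  qed
qed (simp add: sign_def)

text \<open>Equal consecutive blocks are merged into a power; the induction remembers the last block
  in order to decide whether the next one extends it.\<close>

lemma compress_blocks:
  fixes B :: "nat \<Rightarrow> 'a list"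
  assumes fin: "finite {t. B t \<noteq> B (Suc t)}"
  shows "\<exists>bs. concat (map B [0..<m]) = unblock bs \<and>
    length bs \<le> Suc (card {t. B t \<noteq> B (Suc t)}) \<and> (\<forall>b \<in> set bs. fst b \<in> range B \<and> snd b \<noteq> 0)"
proof -
  have "\<exists>bs. concat (map B [0..<m]) = unblock bs \<and> length bs \<le> Suc (card {t. Suc t < m \<and> B t \<noteq> B (Suc t)}) \<and>
    (\<forall>b \<in> set bs. fst b \<in> range B \<and> snd b \<noteq> 0) \<and> (bs = [] \<longleftrightarrow> m = 0) \<and> (bs \<noteq> [] \<longrightarrow> fst (last bs) = B (m - 1))"
  proof (induction m)
    case (Suc m)
    then obtain bs where bs: "concat (map B [0..<m]) = unblock bs"
      "length bs \<le> Suc (card {t. Suc t < m \<and> B t \<noteq> B (Suc t)})"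
      "\<forall>b \<in> set bs. fst b \<in> range B \<and> snd b \<noteq> 0" "bs = [] \<longleftrightarrow> m = 0" "bs \<noteq> [] \<longrightarrow> fst (last bs) = B (m - 1)"
      by blast
    have fin': "finite {t. Suc t < k \<and> B t \<noteq> B (Suc t)}" for k
      by (rule finite_subset[OF _ fin]) auto
    show ?case
    proof (cases "bs = []")
      case True
      then show ?thesis
        using bs(1,4) by (intro exI[of _ "[(B m, 1)]"]) (auto simp: unblock_Cons)
    next
      case False
      then obtain k where m: "m = Suc k"
        using bs(4) by (cases m) auto
      define cs b where "cs = butlast bs" and "b = last bs"
      have bs_eq: "bs = cs @ [b]"
        using False by (simp add: cs_def b_def)
      have b: "fst b = B k"
        using bs(5) False m by (simp add: b_def)
      show ?thesis
      proof (cases "B k = B (Suc k)")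
        case True
        have "card {t. Suc t < m \<and> B t \<noteq> B (Suc t)} \<le> card {t. Suc t < Suc m \<and> B t \<noteq> B (Suc t)}"
          by (rule card_mono[OF fin']) auto
        moreover have "pow (Suc (snd b)) (fst b) = pow (snd b) (fst b) @ B m"
          using pow_add[of "snd b" 1 "fst b"] b True m by simp
        ultimately show ?thesis
          using bs(1-3) True b m by (intro exI[of _ "cs @ [(fst b, Suc (snd b))]"]) (auto simp: bs_eq unblock_Cons)
      next
        case change: False
        have "{t. Suc t < Suc m \<and> B t \<noteq> B (Suc t)} = insert k {t. Suc t < m \<and> B t \<noteq> B (Suc t)}"
          using change m by (auto simp: less_Suc_eq)
        then have "card {t. Suc t < Suc m \<and> B t \<noteq> B (Suc t)} = Suc (card {t. Suc t < m \<and> B t \<noteq> B (Suc t)})"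
          using fin'[of m] m by simp
        then show ?thesis
          using bs(1-3) by (intro exI[of _ "bs @ [(B m, 1)]"]) (auto simp: unblock_Cons)
      qed
    qed
  qed (auto intro!: exI[of _ "[]"])
  then obtain bs where bs: "concat (map B [0..<m]) = unblock bs"
    "length bs \<le> Suc (card {t. Suc t < m \<and> B t \<noteq> B (Suc t)})" "\<forall>b \<in> set bs. fst b \<in> range B \<and> snd b \<noteq> 0"
    by blast
  moreover have "card {t. Suc t < m \<and> B t \<noteq> B (Suc t)} \<le> card {t. B t \<noteq> B (Suc t)}"
    by (rule card_mono[OF fin]) auto
  ultimately show ?thesis
    by (intro exI[of _ bs]) auto
qed

section \<open>Words annotated with signs\<close>

definition signs :: "nat \<Rightarrow> nat \<Rightarrow> (nat \<Rightarrow> int) \<Rightarrow> nat list" where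
  "signs n X x = map (\<lambda>g. guard_sign n g x) [0..<X]"

definition annotate :: "nat \<Rightarrow> nat \<Rightarrow> (nat \<Rightarrow> int) \<Rightarrow> nat list \<Rightarrow> sstep list" where
  "annotate n X x u = map (\<lambda>k. (u ! k, signs n X (vadd x 1 (total_effect (take k u))))) [0..<length u]"

definition annotate_word :: "nat \<Rightarrow> nat \<Rightarrow> (nat \<Rightarrow> int) \<Rightarrow> (nat \<Rightarrow> nat) \<Rightarrow> nat \<Rightarrow> sstep" where
  "annotate_word n X x w k = (w k, signs n X (vadd x 1 (total_effect (map w [0..<k]))))"

lemma length_annotate [simp]: "length (annotate n X x u) = length u"
  by (simp add: annotate_def)

lemma annotate_Nil_iff [simp]: "annotate n X x u = [] \<longleftrightarrow> u = []"
  by (simp add: annotate_def)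

lemma annotate_append:
  "annotate n X x (u @ v) = annotate n X x u @ annotate n X (vadd x 1 (total_effect u)) v"
  by (rule nth_equalityI) (auto simp: annotate_def nth_append vadd_append)

lemma annotate_word_conc:
  "annotate_word n X x (conc u w) = conc (annotate n X x u) (annotate_word n X (vadd x 1 (total_effect u)) w)"
proof
  fix k
  show "annotate_word n X x (conc u w) k = conc (annotate n X x u) (annotate_word n X (vadd x 1 (total_effect u)) w) k"
  proof (cases "k < length u")
    case True
    then have "map (conc u w) [0..<k] = take k u"
      by (intro nth_equalityI) (auto simp: conc_def)
    then show ?thesis
      using True by (simp add: annotate_word_def conc_def annotate_def)
  next
    case False
    then have "map (conc u w) [0..<k] = u @ map w [0..<k - length u]"
      by (intro nth_equalityI) (auto simp: conc_def nth_append)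
    then show ?thesis
      using False by (simp add: annotate_word_def conc_def vadd_append)
  qed
qed

lemma total_effect_pow: "vadd x 1 (total_effect (pow m u)) = vadd x (int m) (total_effect u)"
proof -
  have "total_effect (pow m u) i = int m * total_effect u i" for i
    by (induction m) (simp_all add: pow_Suc total_effect_append algebra_simps)
  then show ?thesis
    by (simp add: vadd_def fun_eq_iff)
qed

lemma annotate_pow:
  "annotate n X x (pow m u) = concat (map (\<lambda>t. annotate n X (vadd x (int t) (total_effect u)) u) [0..<m])"
proof (induction m)
  case (Suc m)
  have "pow (Suc m) u = pow m u @ u"
    using pow_add[of m 1 u] by simp
  then show ?case
    using Suc by (simp add: annotate_append total_effect_pow)
qed (simp add: annotate_def)

text \<open>Each pair of one of the \<open>length u\<close> positions and one of the
  \<open>X\<close> guards contributes at most two changes, as its value is affine in the number of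
  the iteration.\<close>

lemma card_annotate_changes:
  fixes n X :: nat and x :: "nat \<Rightarrow> int" and u :: "nat list"
  defines "B \<equiv> \<lambda>t. annotate n X (vadd x (int t) (total_effect u)) u"
  shows "finite {t. B t \<noteq> B (Suc t)} \<and> card {t. B t \<noteq> B (Suc t)} \<le> 2 * X * length u"
proof -
  define a where "a k g = dot n (guard_coeff g) (vadd x 1 (total_effect (take k u))) - int (arg 2 g)" for k g
  define d where "d g = dot n (guard_coeff g) (total_effect u)" for g
  define C where "C k g = {t::nat. sign (a k g + int t * d g) \<noteq> sign (a k g + int (Suc t) * d g)}" for k g
  have C: "finite (C k g)" "card (C k g) \<le> 2" for k g
    using card_sign_changes[of "a k g" "d g"] by (auto simp: C_def)
  have sub: "{t. B t \<noteq> B (Suc t)} \<subseteq> (\<Union>k<length u. \<Union>g<X. C k g)"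
  proof
    fix t
    assume "t \<in> {t. B t \<noteq> B (Suc t)}"
    then obtain k where k: "k < length u" "B t ! k \<noteq> B (Suc t) ! k"
      by (auto simp: B_def list_eq_iff_nth_eq)
    have "\<exists>g < X. guard_sign n g (vadd (vadd x (int t) (total_effect u)) 1 (total_effect (take k u))) \<noteq>
        guard_sign n g (vadd (vadd x (int (Suc t)) (total_effect u)) 1 (total_effect (take k u)))"
      using k by (auto simp: B_def annotate_def signs_def)
    then have "\<exists>g < X. t \<in> C k g"
      unfolding vadd_commute[of x _ _ 1] guard_sign_vadd C_def a_def d_def by auto
    then show "t \<in> (\<Union>k<length u. \<Union>g<X. C k g)"
      using k by blast
  qed
  have fin: "finite (\<Union>k<length u. \<Union>g<X. C k g)"
    using C(1) by blast
  have "card (\<Union>g<X. C k g) \<le> X * 2" for k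
    using card_UN_le[of "{..<X}" "C k"] sum_mono[of "{..<X}" "\<lambda>g. card (C k g)" "\<lambda>_. 2"] C(2) by simp
  then have card: "card (\<Union>k<length u. \<Union>g<X. C k g) \<le> length u * (X * 2)"
    using card_UN_le[of "{..<length u}" "\<lambda>k. \<Union>g<X. C k g"]
      sum_mono[of "{..<length u}" "\<lambda>k. card (\<Union>g<X. C k g)" "\<lambda>_. X * 2"] by simp
  have eq: "length u * (X * 2) = 2 * X * length u"
    by simp
  show ?thesis
    using finite_subset[OF sub fin] order.trans[OF card_mono[OF fin sub] card] unfolding eq by blast
qed

text \<open>Each block splits into at most \<open>Suc (2 * X * l)\<close> blocks, and so does the
  stretch of the final loop before its annotation becomes constant; the latter accounts for the
  \<open>Suc\<close> in \<open>Suc (length bs)\<close>.\<close>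

lemma annotate_blocks:
  assumes u: "u \<noteq> []" "length u \<le> l" and "\<forall>b \<in> set bs. fst b \<noteq> [] \<and> length (fst b) \<le> l"
  shows "\<exists>bs' u'. annotate_word n X x (upword (unblock bs) u) = upword (unblock bs') u' \<and> u' \<noteq> [] \<and> length u' \<le> l \<and>
    length bs' \<le> Suc (length bs) * Suc (2 * X * l) \<and> (\<forall>b \<in> set bs'. fst b \<noteq> [] \<and> length (fst b) \<le> l \<and> snd b \<noteq> 0)"
  using assms(3)
proof (induction bs arbitrary: x)
  case Nil
  let ?B = "\<lambda>t. annotate n X (vadd x (int t) (total_effect u)) u"
  have fin: "finite {t. ?B t \<noteq> ?B (Suc t)}" and card: "card {t. ?B t \<noteq> ?B (Suc t)} \<le> 2 * X * l"
    using card_annotate_changes[of n X x u] u(2) by (auto intro: order.trans)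
  \<comment> \<open>From iteration \<open>T\<close> on no sign along the final loop changes any
    more, so \<open>?B T\<close> becomes the loop of the annotated word.\<close>
  obtain T where T: "\<And>t. t \<in> {t. ?B t \<noteq> ?B (Suc t)} \<Longrightarrow> t < T"
    using fin unfolding finite_nat_set_iff_bounded by blast
  have B: "?B (T + t) = ?B T" for t
  proof (induction t)
    case (Suc t)
    have "?B (T + t) = ?B (Suc (T + t))"
      using T[of "T + t"] by auto
    then show ?case
      using Suc by simp
  qed simp
  obtain bs' where bs': "concat (map ?B [0..<T]) = unblock bs'" "length bs' \<le> Suc (card {t. ?B t \<noteq> ?B (Suc t)})"
    "\<forall>b \<in> set bs'. fst b \<in> range ?B \<and> snd b \<noteq> 0"
    using compress_blocks[OF fin, of T] by blast
  let ?y = "vadd x (int T) (total_effect u)"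
  have "annotate_word n X x (upword [] u) = conc (annotate n X x (pow T u)) (annotate_word n X ?y (upword [] u))"
    using annotate_word_conc[of n X x "pow T u" "upword [] u"] upword_unroll[OF u(1), of T] by (simp add: total_effect_pow)
  also have "annotate_word n X ?y (upword [] u) = upword [] (?B T)"
  proof
    fix k
    let ?m = "Suc k"
    have k: "k < length (pow ?m u)" "k < ?m * length u"
      using u(1) by (cases u; auto)+
    have "annotate n X ?y (pow ?m u) = concat (map (\<lambda>t. annotate n X (vadd ?y (int t) (total_effect u)) u) [0..<?m])"
      by (rule annotate_pow)
    also have "(\<lambda>t. annotate n X (vadd ?y (int t) (total_effect u)) u) = (\<lambda>_. ?B T)"
      using B by (simp add: vadd_vadd)
    finally have ann: "annotate n X ?y (pow ?m u) = pow ?m (?B T)"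
      by (simp add: pow_def map_replicate_const)
    have "annotate_word n X ?y (upword [] u) k = annotate n X ?y (pow ?m u) ! k"
      using annotate_word_conc[of n X ?y "pow ?m u" "upword [] u"] upword_unroll[OF u(1), of ?m] k
      by (metis conc_def length_annotate)
    also have "\<dots> = upword [] (?B T) k"
      unfolding ann using k by (subst nth_pow) (simp_all add: upword_def)
    finally show "annotate_word n X ?y (upword [] u) k = upword [] (?B T) k" .
  qed
  finally have "annotate_word n X x (upword (unblock []) u) = upword (unblock bs') (?B T)"
    using upword_conc[of "unblock bs'" "[]" "?B T"] bs'(1) by (simp add: annotate_pow)
  moreover have "?B T \<noteq> []" "length (?B T) \<le> l"
    using u by simp_all
  moreover have "fst b \<noteq> [] \<and> length (fst b) \<le> l \<and> snd b \<noteq> 0" if "b \<in> set bs'" for b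
    using bs'(3) that u by auto
  ultimately show ?case
    using bs'(2) card by (intro exI[of _ bs'] exI[of _ "?B T"]) auto
next
  case (Cons b bs)
  obtain v m where b: "b = (v, m)"
    by (cases b)
  have v: "v \<noteq> []" "length v \<le> l"
    using Cons.prems b by auto
  let ?B = "\<lambda>t. annotate n X (vadd x (int t) (total_effect v)) v"
  have fin: "finite {t. ?B t \<noteq> ?B (Suc t)}" and card: "card {t. ?B t \<noteq> ?B (Suc t)} \<le> 2 * X * l"
    using card_annotate_changes[of n X x v] v(2) by (auto intro: order.trans)
  obtain cs where cs: "concat (map ?B [0..<m]) = unblock cs" "length cs \<le> Suc (card {t. ?B t \<noteq> ?B (Suc t)})"
    "\<forall>b \<in> set cs. fst b \<in> range ?B \<and> snd b \<noteq> 0"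
    using compress_blocks[OF fin, of m] by blast
  let ?y = "vadd x 1 (total_effect (pow m v))"
  obtain bs' u' where bs': "annotate_word n X ?y (upword (unblock bs) u) = upword (unblock bs') u'" "u' \<noteq> []" "length u' \<le> l"
    "length bs' \<le> Suc (length bs) * Suc (2 * X * l)" "\<forall>b \<in> set bs'. fst b \<noteq> [] \<and> length (fst b) \<le> l \<and> snd b \<noteq> 0"
    using Cons.IH[of ?y] Cons.prems by auto
  have "annotate_word n X x (upword (unblock (b # bs)) u) = conc (annotate n X x (pow m v)) (annotate_word n X ?y (upword (unblock bs) u))"
    by (simp add: b unblock_Cons upword_conc annotate_word_conc)
  also have "\<dots> = upword (unblock (cs @ bs')) u'"
    by (simp add: bs'(1) annotate_pow cs(1) upword_conc)
  finally have "annotate_word n X x (upword (unblock (b # bs)) u) = upword (unblock (cs @ bs')) u'" .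
  moreover have "fst b \<noteq> [] \<and> length (fst b) \<le> l \<and> snd b \<noteq> 0" if "b \<in> set cs" for b
    using cs(3) that v by auto
  moreover have "length (cs @ bs') \<le> Suc (length (b # bs)) * Suc (2 * X * l)"
  proof -
    have "length cs \<le> Suc (2 * X * l)"
      using cs(2) card by simp
    then show ?thesis
      using bs'(4) by simp
  qed
  ultimately show ?case
    using bs'(2,3,5) by (intro exI[of _ "cs @ bs'"] exI[of _ u'] conjI ballI) auto
qed

section \<open>Presburger formulas of block decompositions\<close>

instantiation pterm :: enc begin
definition enc_pterm :: "pterm \<Rightarrow> nat" where "enc_pterm = pterm_code"
instance ..
end

instantiation pform :: enc begin
definition enc_pform :: "pform \<Rightarrow> nat" where "enc_pform = pform_code"
instance ..
end

lemma computable_TVar [comp]: "computable a \<Longrightarrow> computable (\<lambda>x. TVar (a x))"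
  by (rule computable_same_enc[where a = "\<lambda>x. list_encode [0, a x]"])
    (intro comp, assumption, simp add: enc_pterm_def enc_nat_def)

lemma computable_TAdd [comp]: "computable s \<Longrightarrow> computable t \<Longrightarrow> computable (\<lambda>x. TAdd (s x) (t x))"
  by (rule computable_same_enc[where a = "\<lambda>x. list_encode [3, enc (s x), enc (t x)]"])
    (intro comp, assumption+, simp add: enc_pterm_def enc_nat_def)

lemma computable_PEq [comp]: "computable s \<Longrightarrow> computable t \<Longrightarrow> computable (\<lambda>x. PEq (s x) (t x))"
  by (rule computable_same_enc[where a = "\<lambda>x. list_encode [0, enc (s x), enc (t x)]"])
    (intro comp, assumption+, simp add: enc_pterm_def enc_pform_def enc_nat_def)

lemma computable_PLe [comp]: "computable s \<Longrightarrow> computable t \<Longrightarrow> computable (\<lambda>x. PLe (s x) (t x))"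
  by (rule computable_same_enc[where a = "\<lambda>x. list_encode [1, enc (s x), enc (t x)]"])
    (intro comp, assumption+, simp add: enc_pterm_def enc_pform_def enc_nat_def)

lemma computable_PNot [comp]: "computable s \<Longrightarrow> computable (\<lambda>x. PNot (s x))"
  by (rule computable_same_enc[where a = "\<lambda>x. list_encode [2, enc (s x)]"])
    (intro comp, assumption, simp add: enc_pform_def enc_nat_def)

lemma computable_PAnd [comp]: "computable s \<Longrightarrow> computable t \<Longrightarrow> computable (\<lambda>x. PAnd (s x) (t x))"
  by (rule computable_same_enc[where a = "\<lambda>x. list_encode [3, enc (s x), enc (t x)]"])
    (intro comp, assumption+, simp add: enc_pform_def enc_nat_def)

lemma computable_POr [comp]: "computable s \<Longrightarrow> computable t \<Longrightarrow> computable (\<lambda>x. POr (s x) (t x))"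
  by (rule computable_same_enc[where a = "\<lambda>x. list_encode [4, enc (s x), enc (t x)]"])
    (intro comp, assumption+, simp add: enc_pform_def enc_nat_def)

lemma computable_PEx [comp]: "computable k \<Longrightarrow> computable t \<Longrightarrow> computable (\<lambda>x. PEx (k x) (t x))"
  by (rule computable_same_enc[where a = "\<lambda>x. list_encode [5, k x, enc (t x)]"])
    (intro comp, assumption+, simp add: enc_pform_def enc_nat_def)

section \<open>Linear forms with integer coefficients as Presburger terms\<close>

definition times_term :: "nat \<Rightarrow> pterm \<Rightarrow> pterm" where
  "times_term m t = rec_nat TZero (\<lambda>_ r. TAdd t r) m"

text \<open>Terms have neither subtraction nor negative constants. An integer linear form is
  therefore the difference of \<open>pos_term\<close> and \<open>neg_term\<close>, where
  \<open>nat\<close> discards the coefficients of the other sign.\<close>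

definition pos_term :: "int list \<Rightarrow> int \<Rightarrow> pterm" where
  "pos_term cs c = foldr (\<lambda>j r. TAdd (times_term (nat (nth_opt 0 cs j)) (TVar j)) r) [0..<length cs] (times_term (nat c) TOne)"

definition neg_term :: "int list \<Rightarrow> int \<Rightarrow> pterm" where
  "neg_term cs c = pos_term (map (\<lambda>c. - c) cs) (- c)"

text \<open>The sign code \<open>3\<close> stands for \<open>\<ge> 0\<close>.\<close>

definition constraint :: "nat \<Rightarrow> int list \<Rightarrow> int \<Rightarrow> pform" where
  "constraint s cs c = (if s = 0 then PNot (PLe (neg_term cs c) (pos_term cs c))
     else if s = 1 then PEq (pos_term cs c) (neg_term cs c)
     else if s = 2 then PNot (PLe (pos_term cs c) (neg_term cs c))
     else PLe (neg_term cs c) (pos_term cs c))"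

definition lin_value :: "int list \<Rightarrow> int \<Rightarrow> (nat \<Rightarrow> nat) \<Rightarrow> int" where
  "lin_value cs c e = (\<Sum>j\<leftarrow>[0..<length cs]. nth_opt 0 cs j * int (e j)) + c"

lemma pt_val_times_term: "pt_val e (times_term m t) = m * pt_val e t"
  by (induction m) (simp_all add: times_term_def)

lemma pt_val_pos_term:
  "int (pt_val e (pos_term cs c)) = (\<Sum>j\<leftarrow>[0..<length cs]. int (nat (nth_opt 0 cs j)) * int (e j)) + int (nat c)"
proof -
  have "int (pt_val e (foldr (\<lambda>j r. TAdd (times_term (nat (nth_opt 0 cs j)) (TVar j)) r) js t)) =
      (\<Sum>j\<leftarrow>js. int (nat (nth_opt 0 cs j)) * int (e j)) + int (pt_val e t)" for js t
    by (induction js) (simp_all add: pt_val_times_term)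
  then show ?thesis
    unfolding pos_term_def by (simp add: pt_val_times_term)
qed

lemma pt_val_diff: "int (pt_val e (pos_term cs c)) - int (pt_val e (neg_term cs c)) = lin_value cs c e"
proof -
  have part: "int (nat a) * b = a * b + int (nat (- a)) * b" for a b
    by (cases "0 \<le> a") (simp_all add: algebra_simps)
  have neg: "nth_opt 0 (map (\<lambda>c. - c) cs) j = - nth_opt 0 cs j" for j
    by (simp add: nth_opt_def)
  have "(\<Sum>j\<leftarrow>js. int (nat (a j)) * b j) = (\<Sum>j\<leftarrow>js. a j * b j) + (\<Sum>j\<leftarrow>js. int (nat (- a j)) * b j)"
    for js :: "nat list" and a b
  proof (induction js)
    case (Cons j js)
    then show ?case
      using part[of "a j" "b j"] by simp
  qed simp
  from this[of "\<lambda>j. nth_opt 0 cs j" "\<lambda>j. int (e j)" "[0..<length cs]"] show ?thesis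
    using part[of c 1] unfolding neg_term_def pt_val_pos_term lin_value_def neg length_map by simp
qed

lemma pf_sat_constraint:
  "s \<le> 2 \<Longrightarrow> pf_sat e (constraint s cs c) \<longleftrightarrow> sign (lin_value cs c e) = s"
  "pf_sat e (constraint 3 cs c) \<longleftrightarrow> 0 \<le> lin_value cs c e"
proof -
  let ?p = "pt_val e (pos_term cs c)" and ?m = "pt_val e (neg_term cs c)"
  have d: "int ?p - int ?m = lin_value cs c e"
    by (rule pt_val_diff)
  have "?m \<le> ?p \<longleftrightarrow> 0 \<le> lin_value cs c e" "?p \<le> ?m \<longleftrightarrow> lin_value cs c e \<le> 0" "?p = ?m \<longleftrightarrow> lin_value cs c e = 0"
    using d by linarith+
  then show "s \<le> 2 \<Longrightarrow> pf_sat e (constraint s cs c) \<longleftrightarrow> sign (lin_value cs c e) = s"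
    "pf_sat e (constraint 3 cs c) \<longleftrightarrow> 0 \<le> lin_value cs c e"
    by (auto simp: constraint_def sign_def)
qed

lemma pt_vars_pos_term: "pt_vars (pos_term cs c) \<subseteq> {..<length cs}"
proof -
  have times: "pt_vars (times_term m t) \<subseteq> pt_vars t" for m t
    by (induction m) (auto simp: times_term_def)
  have "pt_vars (foldr (\<lambda>j r. TAdd (times_term (nat (nth_opt 0 cs j)) (TVar j)) r) js (times_term m TOne)) \<subseteq> set js" for js m
  proof (induction js)
    case (Cons j js)
    then show ?case
      using times[of "nat (nth_opt 0 cs j)" "TVar j"] by auto
  qed (use times[of m TOne] in simp)
  from this[of "[0..<length cs]" "nat c"] show ?thesis
    unfolding pos_term_def by auto
qed

lemma constraint_vars: "pf_fv (constraint s cs c) \<subseteq> {..<length cs}" "pf_qfree (constraint s cs c)"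
  using pt_vars_pos_term[of cs c] pt_vars_pos_term[of "map (\<lambda>c. - c) cs" "- c"]
  by (auto simp: constraint_def neg_term_def)

lemma computable_constraint [comp]:
  "computable s \<Longrightarrow> computable cs \<Longrightarrow> computable c \<Longrightarrow> computable (\<lambda>x. constraint (s x) (cs x) (c x))"
proof -
  have pos: "computable (\<lambda>x. pos_term (cs x) (c x))" if "computable cs" "computable c" for cs :: "'b::enc \<Rightarrow> _" and c
    unfolding pos_term_def times_term_def by (intro comp that that[THEN computable_compose])
  assume *: "computable s" "computable cs" "computable c"
  then show ?thesis
    unfolding constraint_def neg_term_def by (intro comp pos *)
qed

text \<open>A descriptor is a list of triples \<open>(u, c, p)\<close>, standing for the powers \<open>u\<^bsup>c + p j + 1\<^esup>\<close>; the variable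
  \<open>j\<close> of the \<open>k\<close>-th triple has index \<open>n + k\<close>.\<close>

type_synonym desc = "(sstep list \<times> nat \<times> nat) list"

definition seg_word :: "desc \<Rightarrow> nat \<Rightarrow> sstep list" where "seg_word D k = fst (nth_opt ([], 0, 0) D k)"
definition seg_base :: "desc \<Rightarrow> nat \<Rightarrow> nat" where "seg_base D k = fst (snd (nth_opt ([], 0, 0) D k))"
definition seg_period :: "desc \<Rightarrow> nat \<Rightarrow> nat" where "seg_period D k = snd (snd (nth_opt ([], 0, 0) D k))"

definition seg_times :: "nat \<Rightarrow> desc \<Rightarrow> (nat \<Rightarrow> nat) \<Rightarrow> nat \<Rightarrow> nat" where
  "seg_times n D e k = seg_base D k + seg_period D k * e (n + k)"

primrec seg_start :: "nat \<Rightarrow> desc \<Rightarrow> (nat \<Rightarrow> nat) \<Rightarrow> nat \<Rightarrow> nat \<Rightarrow> int" where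
  "seg_start n D e 0 = (\<lambda>i. int (e i))"
| "seg_start n D e (Suc k) = vadd (seg_start n D e k) (int (Suc (seg_times n D e k))) (seffect (seg_word D k))"

definition seg_dot :: "nat \<Rightarrow> int list \<Rightarrow> desc \<Rightarrow> nat \<Rightarrow> int" where
  "seg_dot n a D k = dot n (\<lambda>i. nth_opt 0 a i) (seffect (seg_word D k))"

text \<open>Coefficients of the value of the form \<open>a\<close> inside block \<open>k\<close>, in
  its first iteration for \<open>b = 0\<close> and in its last for \<open>b = 1\<close>. The initial
  counters come first, then one variable per block; blocks before \<open>k\<close> count in full,
  later ones not at all.\<close>

definition lin_coeffs :: "nat \<Rightarrow> int list \<Rightarrow> desc \<Rightarrow> nat \<Rightarrow> nat \<Rightarrow> int list" where
  "lin_coeffs n a D k b = map (\<lambda>j. if j < n then nth_opt 0 a j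
     else if j - n < k then int (seg_period D (j - n)) * seg_dot n a D (j - n)
     else if j - n = k then int (b * seg_period D k) * seg_dot n a D k else 0) [0..<n + length D]"

definition lin_const :: "nat \<Rightarrow> int list \<Rightarrow> desc \<Rightarrow> nat \<Rightarrow> nat \<Rightarrow> nat \<Rightarrow> int" where
  "lin_const n a D k pos b = (\<Sum>l\<leftarrow>[0..<k]. int (Suc (seg_base D l)) * seg_dot n a D l) +
     int (b * seg_base D k) * seg_dot n a D k + dot n (\<lambda>i. nth_opt 0 a i) (seffect (take pos (seg_word D k)))"

definition seg_point :: "nat \<Rightarrow> desc \<Rightarrow> (nat \<Rightarrow> nat) \<Rightarrow> nat \<Rightarrow> nat \<Rightarrow> nat \<Rightarrow> nat \<Rightarrow> int" where
  "seg_point n D e k pos b = vadd (vadd (seg_start n D e k) (int (b * seg_times n D e k)) (seffect (seg_word D k)))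
     1 (seffect (take pos (seg_word D k)))"

text \<open>The value is affine because a variable enters the number of iterations of its block with
  a constant factor, and the effect of one iteration is constant.\<close>

lemma lin_value_eq:
  assumes k: "k < length D"
  shows "lin_value (lin_coeffs n a D k b) (lin_const n a D k pos b + c) e = dot n (\<lambda>i. nth_opt 0 a i) (seg_point n D e k pos b) + c"
proof -
  let ?a = "\<lambda>i. nth_opt 0 a i" and ?d = "seg_dot n a D" and ?t = "seg_times n D e"
  let ?f = "\<lambda>l. if l < k then int (seg_period D l) * ?d l else if l = k then int (b * seg_period D k) * ?d k else 0"
  have start: "dot n ?a (seg_start n D e k) = (\<Sum>i\<leftarrow>[0..<n]. ?a i * int (e i)) + (\<Sum>l\<leftarrow>[0..<k]. int (Suc (?t l)) * ?d l)" for k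
    by (induction k) (simp_all add: dot_vadd seg_dot_def, simp_all add: dot_def)
  have point: "dot n ?a (seg_point n D e k pos b) = (\<Sum>i\<leftarrow>[0..<n]. ?a i * int (e i)) + (\<Sum>l\<leftarrow>[0..<k]. int (Suc (?t l)) * ?d l) +
      int (b * ?t k) * ?d k + dot n ?a (seffect (take pos (seg_word D k)))"
    unfolding seg_point_def dot_vadd start by (simp add: seg_dot_def)
  have split: "[0..<n + length D] = [0..<n] @ map (\<lambda>l. n + l) [0..<length D]"
    by (rule nth_equalityI) (auto simp: nth_append)
  have "lin_value (lin_coeffs n a D k b) (lin_const n a D k pos b + c) e =
      (\<Sum>j\<leftarrow>[0..<n + length D]. (if j < n then ?a j else ?f (j - n)) * int (e j)) + (lin_const n a D k pos b + c)"
  proof -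
    have "nth_opt 0 (lin_coeffs n a D k b) j = (if j < n then ?a j else ?f (j - n))" if "j < n + length D" for j
      using that by (simp add: lin_coeffs_def nth_opt_def)
    then have "map (\<lambda>j. nth_opt 0 (lin_coeffs n a D k b) j * int (e j)) [0..<n + length D] =
        map (\<lambda>j. (if j < n then ?a j else ?f (j - n)) * int (e j)) [0..<n + length D]"
      by (intro map_cong refl) simp
    moreover have "length (lin_coeffs n a D k b) = n + length D"
      by (simp add: lin_coeffs_def)
    ultimately show ?thesis
      unfolding lin_value_def by (simp only:)
  qed
  also have "(\<Sum>j\<leftarrow>[0..<n + length D]. (if j < n then ?a j else ?f (j - n)) * int (e j)) =
      (\<Sum>i\<leftarrow>[0..<n]. ?a i * int (e i)) + (\<Sum>l\<leftarrow>[0..<length D]. ?f l * int (e (n + l)))"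
  proof -
    have "map (\<lambda>j. (if j < n then ?a j else ?f (j - n)) * int (e j)) [0..<n] = map (\<lambda>i. ?a i * int (e i)) [0..<n]"
      by (intro map_cong refl) simp
    moreover have "map ((\<lambda>j. (if j < n then ?a j else ?f (j - n)) * int (e j)) \<circ> (\<lambda>l. n + l)) [0..<length D] =
        map (\<lambda>l. ?f l * int (e (n + l))) [0..<length D]"
      by (intro map_cong refl) simp
    ultimately show ?thesis
      unfolding split map_append map_map sum_list_append by (simp only:)
  qed
  also have "(\<Sum>l\<leftarrow>[0..<length D]. ?f l * int (e (n + l))) =
      (\<Sum>l\<leftarrow>[0..<k]. int (seg_period D l) * ?d l * int (e (n + l))) + int (b * seg_period D k) * ?d k * int (e (n + k))"
  proof -
    have e3: "[0..<length D] = [0..<k] @ k # [Suc k..<length D]"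
      using k by (metis le0 less_imp_le upt_append upt_conv_Cons)
    have e1: "map (\<lambda>l. ?f l * int (e (n + l))) [0..<k] = map (\<lambda>l. int (seg_period D l) * ?d l * int (e (n + l))) [0..<k]"
      by (intro map_cong refl) simp
    have e2: "map (\<lambda>l. ?f l * int (e (n + l))) [Suc k..<length D] = map (\<lambda>l. 0) [Suc k..<length D]"
      by (intro map_cong refl) simp
    show ?thesis
      unfolding e3 map_append list.map sum_list_append sum_list.Cons e1 e2 by (simp add: sum_list_triv del: upt_Suc)
  qed
  also have "(\<Sum>l\<leftarrow>[0..<k]. int (seg_period D l) * ?d l * int (e (n + l))) =
      (\<Sum>l\<leftarrow>[0..<k]. int (Suc (?t l)) * ?d l) - (\<Sum>l\<leftarrow>[0..<k]. int (Suc (seg_base D l)) * ?d l)"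
    unfolding seg_times_def sum_list_subtractf[symmetric] by (simp add: algebra_simps)
  finally show ?thesis
    unfolding point lin_const_def seg_times_def by (simp add: algebra_simps)
qed

section \<open>Constraints attached to a descriptor\<close>

definition unit_list :: "nat \<Rightarrow> nat \<Rightarrow> int list" where
  "unit_list n i = map (\<lambda>j. if j = i then 1 else 0) [0..<n]"

definition guard_list :: "nat \<Rightarrow> nat \<Rightarrow> int list" where
  "guard_list n g = map (\<lambda>j. guard_coeff g j) [0..<n]"

lemma dot_cong: "(\<And>i. i < n \<Longrightarrow> a i * x i = b i * y i) \<Longrightarrow> dot n a x = dot n b y"
  unfolding dot_def by (rule arg_cong[where f = sum_list]) simp

lemma dot_unit_list: "i < n \<Longrightarrow> dot n (\<lambda>j. nth_opt 0 (unit_list n i) j) x = x i"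
proof -
  assume i: "i < n"
  have "dot n (\<lambda>j. nth_opt 0 (unit_list n i) j) x = dot n (\<lambda>j. if j = i then 1 else 0) x"
    by (rule dot_cong) (simp add: unit_list_def nth_opt_def)
  also have "\<dots> = x i"
    using i unfolding dot_def interv_sum_list_conv_sum_set_nat
    by (simp add: if_distrib[where f = "\<lambda>c. c * _"] sum.delta cong: if_cong)
  finally show ?thesis .
qed

lemma dot_guard_list: "dot n (\<lambda>j. nth_opt 0 (guard_list n g) j) x = dot n (guard_coeff g) x"
  by (rule dot_cong) (simp add: guard_list_def nth_opt_def)

definition point_forms :: "nat \<Rightarrow> nat \<Rightarrow> desc \<Rightarrow> nat \<Rightarrow> nat \<Rightarrow> nat \<Rightarrow> pform list" where
  "point_forms n X D k pos b =
     map (\<lambda>i. constraint 3 (lin_coeffs n (unit_list n i) D k b) (lin_const n (unit_list n i) D k pos b + 0)) [0..<n] @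
     map (\<lambda>g. constraint (nth_opt 0 (snd (nth_opt (0, []) (seg_word D k) pos)) g) (lin_coeffs n (guard_list n g) D k b)
       (lin_const n (guard_list n g) D k pos b + (- int (arg 2 g)))) [0..<X]"

definition desc_form :: "nat \<Rightarrow> nat \<Rightarrow> desc \<Rightarrow> pform" where
  "desc_form n X D = foldr PAnd (concat (map (\<lambda>k. concat (map (\<lambda>pos.
     point_forms n X D k pos 0 @ point_forms n X D k pos 1) [0..<length (seg_word D k)])) [0..<length D])) (PEq TZero TZero)"

lemma pf_sat_point_forms:
  assumes k: "k < length D" and pos: "pos < length (seg_word D k)"
    and s: "\<And>g. g < X \<Longrightarrow> nth_opt 0 (snd (seg_word D k ! pos)) g \<le> 2"
  shows "(\<forall>f \<in> set (point_forms n X D k pos b). pf_sat e f) \<longleftrightarrow> step_ok n X (seg_point n D e k pos b) (seg_word D k ! pos)"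
proof -
  have nth: "nth_opt (0, []) (seg_word D k) pos = seg_word D k ! pos"
    using pos by (simp add: nth_opt_def)
  have "(\<forall>f \<in> set (point_forms n X D k pos b). pf_sat e f) \<longleftrightarrow>
      (\<forall>i < n. 0 \<le> dot n (\<lambda>j. nth_opt 0 (unit_list n i) j) (seg_point n D e k pos b) + 0) \<and>
      (\<forall>g < X. sign (dot n (\<lambda>j. nth_opt 0 (guard_list n g) j) (seg_point n D e k pos b) + (- int (arg 2 g))) =
        nth_opt 0 (snd (seg_word D k ! pos)) g)"
  proof -
    have "(\<forall>f \<in> set (point_forms n X D k pos b). pf_sat e f) \<longleftrightarrow>
      (\<forall>i < n. pf_sat e (constraint 3 (lin_coeffs n (unit_list n i) D k b) (lin_const n (unit_list n i) D k pos b + 0))) \<and>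
      (\<forall>g < X. pf_sat e (constraint (nth_opt 0 (snd (seg_word D k ! pos)) g) (lin_coeffs n (guard_list n g) D k b)
       (lin_const n (guard_list n g) D k pos b + (- int (arg 2 g)))))"
    proof -
      have ball: "(\<forall>f \<in> set (map h [0..<m]). P f) \<longleftrightarrow> (\<forall>i < m. P (h i))" for h :: "nat \<Rightarrow> pform" and m P
        by auto
      show ?thesis
        unfolding point_forms_def nth set_append ball_Un ball ..
    qed
    moreover have "pf_sat e (constraint (nth_opt 0 (snd (seg_word D k ! pos)) g) (lin_coeffs n (guard_list n g) D k b)
        (lin_const n (guard_list n g) D k pos b + (- int (arg 2 g)))) \<longleftrightarrow>
      sign (dot n (\<lambda>j. nth_opt 0 (guard_list n g) j) (seg_point n D e k pos b) + (- int (arg 2 g))) =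
        nth_opt 0 (snd (seg_word D k ! pos)) g" if "g < X" for g
      unfolding pf_sat_constraint(1)[OF s[OF that]] lin_value_eq[OF k] ..
    ultimately show ?thesis
      unfolding pf_sat_constraint(2) lin_value_eq[OF k] by simp
  qed
  then show ?thesis
    unfolding step_ok_def guard_sign_def by (simp add: dot_unit_list dot_guard_list)
qed

lemma foldr_PAnd: "pf_sat e (foldr PAnd fs (PEq TZero TZero)) \<longleftrightarrow> (\<forall>f \<in> set fs. pf_sat e f)"
  by (induction fs) auto

lemma pf_sat_desc_form:
  assumes s: "\<And>k s g. k < length D \<Longrightarrow> s \<in> set (seg_word D k) \<Longrightarrow> g < X \<Longrightarrow> nth_opt 0 (snd s) g \<le> 2"
  shows "pf_sat e (desc_form n X D) \<longleftrightarrow> (\<forall>k < length D. valid_list n X (seg_start n D e k) (seg_word D k) \<and>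
    valid_list n X (vadd (seg_start n D e k) (int (seg_times n D e k)) (seffect (seg_word D k))) (seg_word D k))"
proof -
  have "pf_sat e (desc_form n X D) \<longleftrightarrow> (\<forall>k < length D. \<forall>pos < length (seg_word D k).
      (\<forall>f \<in> set (point_forms n X D k pos 0). pf_sat e f) \<and> (\<forall>f \<in> set (point_forms n X D k pos 1). pf_sat e f))"
    unfolding desc_form_def foldr_PAnd by (auto simp del: upt_Suc)
  also have "\<dots> \<longleftrightarrow> (\<forall>k < length D. \<forall>pos < length (seg_word D k).
      step_ok n X (seg_point n D e k pos 0) (seg_word D k ! pos) \<and> step_ok n X (seg_point n D e k pos 1) (seg_word D k ! pos))"
    using pf_sat_point_forms s by (intro all_cong) (simp add: nth_mem)
  finally show ?thesis
    unfolding valid_list_def seg_point_def by auto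
qed

lemma desc_form_vars: "pf_fv (desc_form n X D) \<subseteq> {..<n + length D}" "pf_qfree (desc_form n X D)"
proof -
  have "pf_fv f \<subseteq> {..<n + length D} \<and> pf_qfree f" if "f \<in> set (point_forms n X D k pos b)" for f k pos b
  proof -
    have len: "length (lin_coeffs n a D k b) = n + length D" for a
      by (simp add: lin_coeffs_def)
    have "\<exists>s a c. f = constraint s (lin_coeffs n a D k b) c"
      using that unfolding point_forms_def set_append set_map Un_iff by (elim disjE imageE) (intro exI, assumption)+
    then obtain s a c where "f = constraint s (lin_coeffs n a D k b) c"
      by (elim exE)
    then show ?thesis
      using constraint_vars[of s "lin_coeffs n a D k b" c] unfolding len by simp
  qed
  moreover have "pf_fv (foldr PAnd fs (PEq TZero TZero)) = (\<Union>f \<in> set fs. pf_fv f)"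
    "pf_qfree (foldr PAnd fs (PEq TZero TZero)) \<longleftrightarrow> (\<forall>f \<in> set fs. pf_qfree f)" for fs
    by (induction fs) auto
  ultimately show "pf_fv (desc_form n X D) \<subseteq> {..<n + length D}" "pf_qfree (desc_form n X D)"
    unfolding desc_form_def by (auto simp del: upt_Suc simp: subset_iff)
qed

definition desc_blocks :: "nat \<Rightarrow> desc \<Rightarrow> (nat \<Rightarrow> nat) \<Rightarrow> nat \<Rightarrow> (sstep list \<times> nat) list" where
  "desc_blocks n D e m = map (\<lambda>k. (seg_word D k, Suc (seg_times n D e k))) [0..<m]"

lemma desc_blocks_Suc: "desc_blocks n D e (Suc m) = desc_blocks n D e m @ [(seg_word D m, Suc (seg_times n D e m))]"
  by (simp add: desc_blocks_def)

text \<open>The final loop joins the descriptor as \<open>(u, 0, 0)\<close>, a block iterated once,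
  so that \<open>desc_form\<close> covers its first iteration. By \<open>valid_word_loop\<close>
  only \<open>loop_stable\<close> remains, which does not depend on \<open>e\<close>.\<close>

lemma valid_word_desc:
  assumes "D = ss @ [(u, 0, 0)]" and u: "u \<noteq> []"
    and s: "\<And>k s g. k < length D \<Longrightarrow> s \<in> set (seg_word D k) \<Longrightarrow> g < X \<Longrightarrow> nth_opt 0 (snd s) g \<le> 2"
  shows "valid_word n X (\<lambda>i. int (e i)) (upword (unblock (desc_blocks n D e (length ss))) u) \<longleftrightarrow>
    pf_sat e (desc_form n X D) \<and> loop_stable n X u"
proof -
  let ?P = "\<lambda>k. valid_list n X (seg_start n D e k) (seg_word D k) \<and>
    valid_list n X (vadd (seg_start n D e k) (int (seg_times n D e k)) (seffect (seg_word D k))) (seg_word D k)"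
  let ?m = "length ss"
  have last: "seg_word D ?m = u" "seg_times n D e ?m = 0" and len: "length D = Suc ?m"
    by (simp_all add: assms(1) seg_word_def seg_times_def seg_base_def seg_period_def nth_opt_def)
  have "(valid_list n X (\<lambda>i. int (e i)) (unblock (desc_blocks n D e m)) \<longleftrightarrow> (\<forall>k < m. ?P k)) \<and>
    vadd (\<lambda>i. int (e i)) 1 (seffect (unblock (desc_blocks n D e m))) = seg_start n D e m" for m
  proof (induction m)
    case 0
    then show ?case
      by (simp add: desc_blocks_def valid_list_def vadd_def)
  next
    case (Suc m)
    have "unblock (desc_blocks n D e (Suc m)) = unblock (desc_blocks n D e m) @ pow (Suc (seg_times n D e m)) (seg_word D m)"
      by (simp add: desc_blocks_Suc unblock_Cons)
    moreover have "vadd (\<lambda>i. int (e i)) 1 (seffect (unblock (desc_blocks n D e m))) = seg_start n D e m"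
      using Suc by blast
    ultimately show ?case
      using Suc by (simp add: valid_list_append valid_list_pow_Suc vadd_append vadd_pow less_Suc_eq del: of_nat_Suc) blast
  qed
  from this[of ?m] have "valid_word n X (\<lambda>i. int (e i)) (upword (unblock (desc_blocks n D e ?m)) u) \<longleftrightarrow>
      (\<forall>k < ?m. ?P k) \<and> valid_list n X (seg_start n D e ?m) u \<and> loop_stable n X u"
    unfolding upword_eq_conc[of "unblock (desc_blocks n D e ?m)"] valid_word_conc valid_word_loop[OF u] by simp
  also have "\<dots> \<longleftrightarrow> (\<forall>k < length D. ?P k) \<and> loop_stable n X u"
    unfolding len less_Suc_eq using last by auto
  also have "(\<forall>k < length D. ?P k) \<longleftrightarrow> pf_sat e (desc_form n X D)"
    by (rule pf_sat_desc_form[symmetric]) (rule s)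
  finally show ?thesis .
qed

lemma pf_sat_foldr_PEx:
  "pf_sat e (foldr PEx xs \<psi>) \<longleftrightarrow> (\<exists>e'. (\<forall>y. y \<notin> set xs \<longrightarrow> e' y = e y) \<and> pf_sat e' \<psi>)"
proof (induction xs arbitrary: e)
  case Nil
  have "(\<forall>y. e' y = e y) \<longleftrightarrow> e' = e" for e' :: "nat \<Rightarrow> nat"
    by auto
  then show ?case
    by simp
next
  case (Cons x xs)
  show ?case
  proof
    assume "pf_sat e (foldr PEx (x # xs) \<psi>)"
    then obtain k e' where "\<forall>y. y \<notin> set xs \<longrightarrow> e' y = (e(x := k)) y" "pf_sat e' \<psi>"
      unfolding foldr.simps o_apply pf_sat.simps Cons by (elim exE conjE)
    then show "\<exists>e'. (\<forall>y. y \<notin> set (x # xs) \<longrightarrow> e' y = e y) \<and> pf_sat e' \<psi>"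
      by (intro exI[of _ e']) simp
  next
    assume "\<exists>e'. (\<forall>y. y \<notin> set (x # xs) \<longrightarrow> e' y = e y) \<and> pf_sat e' \<psi>"
    then obtain e' where "\<forall>y. y \<notin> set (x # xs) \<longrightarrow> e' y = e y" "pf_sat e' \<psi>"
      by blast
    then have "pf_sat (e(x := e' x)) (foldr PEx xs \<psi>)"
      unfolding Cons by (intro exI[of _ e'] conjI) simp_all
    then show "pf_sat e (foldr PEx (x # xs) \<psi>)"
      unfolding foldr.simps o_apply pf_sat.simps by (rule exI)
  qed
qed

section \<open>Computability of the constraint formulas\<close>

lemma computable_guard_coeff [comp]: "computable g \<Longrightarrow> computable i \<Longrightarrow> computable (\<lambda>x. guard_coeff (g x) (i x))"
  unfolding guard_coeff_def by (intro comp)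

lemma computable_effect [comp]: "computable t \<Longrightarrow> computable i \<Longrightarrow> computable (\<lambda>x. effect (t x) (i x))"
  unfolding effect_def by (intro comp)

lemma computable_total_effect [comp]:
  assumes "computable l" "computable i"
  shows "computable (\<lambda>x. total_effect (l x) (i x))"
  unfolding total_effect_def by (intro comp assms assms[THEN computable_compose])

lemma computable_dot [comp]:
  fixes a d :: "'c::enc \<Rightarrow> nat \<Rightarrow> int"
  assumes "computable n" "computable (\<lambda>p. a (fst p) (snd p))" "computable (\<lambda>p. d (fst p) (snd p))"
  shows "computable (\<lambda>x. dot (n x) (\<lambda>i. a x i) (\<lambda>i. d x i))"
  unfolding dot_def by (intro comp assms)

lemma computable_seg [comp]:
  assumes "computable D" "computable k"
  shows "computable (\<lambda>x. seg_word (D x) (k x))" "computable (\<lambda>x. seg_base (D x) (k x))" "computable (\<lambda>x. seg_period (D x) (k x))"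
  unfolding seg_word_def seg_base_def seg_period_def by (intro comp assms)+

lemma computable_seg_dot [comp]:
  assumes "computable n" "computable a" "computable D" "computable k"
  shows "computable (\<lambda>x. seg_dot (n x) (a x) (D x) (k x))"
  unfolding seg_dot_def by (intro comp assms assms[THEN computable_compose])

lemma computable_lin_coeffs [comp]:
  assumes "computable n" "computable a" "computable D" "computable k" "computable b"
  shows "computable (\<lambda>x. lin_coeffs (n x) (a x) (D x) (k x) (b x))"
  unfolding lin_coeffs_def by (intro comp assms assms[THEN computable_compose])

lemma computable_lin_const [comp]:
  assumes "computable n" "computable a" "computable D" "computable k" "computable pos" "computable b"
  shows "computable (\<lambda>x. lin_const (n x) (a x) (D x) (k x) (pos x) (b x))"
  unfolding lin_const_def by (intro comp assms assms[THEN computable_compose])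

lemma computable_unit_list [comp]:
  assumes "computable n" "computable i"
  shows "computable (\<lambda>x. unit_list (n x) (i x))"
  unfolding unit_list_def by (intro comp assms assms[THEN computable_compose])

lemma computable_guard_list [comp]:
  assumes "computable n" "computable g"
  shows "computable (\<lambda>x. guard_list (n x) (g x))"
  unfolding guard_list_def by (intro comp assms assms[THEN computable_compose])

lemma computable_point_forms [comp]:
  assumes "computable n" "computable X" "computable D" "computable k" "computable pos" "computable b"
  shows "computable (\<lambda>x. point_forms (n x) (X x) (D x) (k x) (pos x) (b x))"
  unfolding point_forms_def by (intro comp assms assms[THEN computable_compose])

lemma computable_desc_form [comp]:
  assumes "computable n" "computable X" "computable D"
  shows "computable (\<lambda>x. desc_form (n x) (X x) (D x))"
  unfolding desc_form_def by (intro comp assms assms[THEN computable_compose])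

section \<open>Runs as annotated words\<close>

definition rel_holds :: "nat \<Rightarrow> nat \<Rightarrow> bool" where
  "rel_holds r s \<longleftrightarrow> (if r = 0 then s = 1 else if r = 1 then s \<le> 1 else if r = 2 then 1 \<le> s else if r = 3 then s = 0 else s = 2)"

definition aguard_holds :: "nat list \<times> nat \<Rightarrow> bool" where
  "aguard_holds p \<longleftrightarrow> rel_holds (arg 1 (snd p)) (nth_opt 0 (fst p) (snd p))"

text \<open>A computable form of \<open>set_encode\<close> on lists; the test keeps repeated
  elements from being added twice.\<close>

definition set_enc :: "nat list \<Rightarrow> nat" where
  "set_enc l = foldr (\<lambda>a r. if a \<in> set_decode r then r else 2 ^ a + r) l 0"

lemma set_enc: "set_enc l = set_encode (set l)"
proof (induction l)
  case (Cons a l)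
  have "set_enc (a # l) = (if a \<in> set_decode (set_enc l) then set_enc l else 2 ^ a + set_enc l)"
    by (simp add: set_enc_def)
  then show ?case
    unfolding Cons by (simp add: insert_absorb)
qed (simp add: set_enc_def)

abbreviation trans_list :: "nat \<Rightarrow> nat list" where
  "trans_list x \<equiv> set_list (arg 2 (arg 1 x))"

definition step_atoms :: "nat \<Rightarrow> sstep \<Rightarrow> nat list" where
  "step_atoms x s =
     map (\<lambda>p. list_encode [0, p]) (filter (\<lambda>p. prod_encode (arg 0 (fst s), p) \<in> set_decode (arg 1 (arg 1 x))) (set_list (arg 0 (arg 3 x)))) @
     map (\<lambda>g. list_encode [1, g]) (filter (\<lambda>g. aguard_holds (snd s, g)) (set_list (arg 1 (arg 3 x))))"

definition letter_of :: "nat \<Rightarrow> sstep \<Rightarrow> nat" where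
  "letter_of x s = set_enc (map (\<lambda>a. prod_encode (0, a)) (step_atoms x s))"

definition step_fine :: "nat \<Rightarrow> sstep \<Rightarrow> bool" where
  "step_fine x s \<longleftrightarrow> bform_eval aguard_holds (snd s, arg 1 (fst s)) \<and> set_enc (step_atoms x s) \<in> set_decode (arg 2 (arg 3 x))"

definition steps :: "nat \<Rightarrow> sstep list" where
  "steps x = List.product (trans_list x) (List.n_lists x [0, 1, 2])"

abbreviation linked :: "sstep \<Rightarrow> sstep \<Rightarrow> bool" where
  "linked s s' \<equiv> arg 3 (fst s) = arg 0 (fst s')"

text \<open>Collects what can be judged without counter values. The remaining condition
  \<open>valid_word\<close>, nonnegative counters and correct signs, is left to the Presburger
  formula and \<open>loop_stable\<close>.\<close>

definition good_word :: "nat \<Rightarrow> (nat \<Rightarrow> sstep) \<Rightarrow> bool" where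
  "good_word x s \<longleftrightarrow> arg 0 (fst (s 0)) = arg 2 x \<and> (\<forall>i. linked (s i) (s (Suc i))) \<and>
     (\<forall>i. s i \<in> set (steps x) \<and> step_fine x (s i)) \<and> msat (\<lambda>i. letter_vars (letter_of x (s i))) (spec_mso (arg 4 x))"

lemma letter_vars_letter_of: "(0, a) \<in> letter_vars (letter_of x s) \<longleftrightarrow> a \<in> set (step_atoms x s)"
  by (auto simp: letter_vars_def letter_of_def set_enc prod_encode_eq)

lemma bf_atoms_less: "a \<in> bf_atoms f \<Longrightarrow> c a < bform_code c f"
proof (induction f)
  case (BNot f)
  then show ?case
    using less_list_encode[of "bform_code c f" "[2, bform_code c f]"] by (simp del: list_encode.simps)
next
  case (BAnd f g)
  then show ?case
    using less_list_encode[of "bform_code c f" "[3, bform_code c f, bform_code c g]"]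
      less_list_encode[of "bform_code c g" "[3, bform_code c f, bform_code c g]"] by (auto simp del: list_encode.simps)
next
  case (BOr f g)
  then show ?case
    using less_list_encode[of "bform_code c f" "[4, bform_code c f, bform_code c g]"]
      less_list_encode[of "bform_code c g" "[4, bform_code c f, bform_code c g]"] by (auto simp del: list_encode.simps)
qed (simp_all add: less_list_encode del: list_encode.simps)

lemma aguard_code_args [simp]: "arg 1 (aguard_code g) = cmp_code (rel g)" "arg 2 (aguard_code g) = bound g"
  "arg 0 (aguard_code g) = vec_code (coeffs g)"
  by (simp_all add: aguard_code_def nth_opt_def del: list_encode.simps)

lemma trans_code_args [simp]: "arg 0 (trans_code t) = src t" "arg 1 (trans_code t) = bform_code aguard_code (fst (snd t))"
  "arg 2 (trans_code t) = vec_code (fst (snd (snd t)))" "arg 3 (trans_code t) = tgt t"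
  by (simp_all add: trans_code_def nth_opt_def split: prod.split del: list_encode.simps)

lemma nth_opt_vec_code: "i < length u \<Longrightarrow> int_decode (nth_opt 0 (list_decode (vec_code u)) i) = u ! i"
  by (simp add: vec_code_def nth_opt_def)

lemma rel_holds_sign: "rel_holds (cmp_code r) (sign (a - b)) \<longleftrightarrow> cmp_sat r a b"
  by (cases r) (auto simp: rel_holds_def sign_def)

lemma rel_holds_guard_sign:
  assumes "length (coeffs g) = n" "\<And>i. i < n \<Longrightarrow> int (v ! i) = y i"
  shows "rel_holds (cmp_code (rel g)) (guard_sign n (aguard_code g) y) \<longleftrightarrow> aguard_sat v g"
proof -
  have "dot n (guard_coeff (aguard_code g)) y = (\<Sum>i<n. coeffs g ! i * int (v ! i))"
    unfolding dot_def interv_sum_list_conv_sum_set_nat atLeast0LessThan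
    by (rule sum.cong) (simp_all add: guard_coeff_def nth_opt_vec_code assms lessThan_atLeast0)
  then show ?thesis
    unfolding guard_sign_def aguard_sat_def rel_holds_sign assms(1)[symmetric] by (simp add: rel_holds_sign)
qed

section \<open>Runs of a given input\<close>

locale input =
  fixes n S q Al A L x
  assumes S: "is_counter_system n S" "flat S" and Al: "is_calphabet n Al" and A: "A \<in> specifications L Al"
    and x: "x = input_code n S q Al A"
begin

lemma args: "arg 0 x = n" "arg 1 x = system_code Al S" "arg 2 x = q" "arg 3 x = calphabet_code Al" "arg 4 x = spec_code A"
  by (simp_all add: x input_code_def nth_opt_def del: list_encode.simps)

lemma codes_less: "system_code Al S < x" "calphabet_code Al < x"
  by (simp_all add: x input_code_def less_list_encode del: list_encode.simps)

lemma finites: "finite (cs_states S)" "finite (cs_trans S)" "finite (ca_props Al)" "finite (ca_guards Al)"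
  "finite (ca_atoms Al)" "finite (ca_letters Al)"
proof -
  show "finite (cs_states S)" "finite (cs_trans S)" "finite (ca_props Al)" "finite (ca_guards Al)"
    using S Al by (simp_all add: is_counter_system_def is_calphabet_def)
  then show "finite (ca_atoms Al)"
    by (simp add: ca_atoms_def)
  then show "finite (ca_letters Al)"
    using Al finite_subset[of "ca_letters Al" "Pow (ca_atoms Al)"] by (simp add: is_calphabet_def)
qed

lemma set_trans_list: "set (trans_list x) = trans_code ` cs_trans S"
  unfolding args system_code_def using finites by (simp add: nth_opt_def del: list_encode.simps)

lemma trans_code_less: "t \<in> cs_trans S \<Longrightarrow> trans_code t < x"
proof -
  assume "t \<in> cs_trans S"
  then have "trans_code t < set_code trans_code (cs_trans S)"
    using finites by (intro set_decode_less) simp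
  also have "\<dots> < system_code Al S"
    by (simp add: system_code_def less_list_encode del: list_encode.simps)
  finally show ?thesis
    using codes_less by simp
qed

lemma guard_code_less: "g \<in> ca_guards Al \<Longrightarrow> aguard_code g < x"
proof -
  assume "g \<in> ca_guards Al"
  then have "aguard_code g < set_code aguard_code (ca_guards Al)"
    using finites by (intro set_decode_less) simp
  also have "\<dots> < calphabet_code Al"
    by (simp add: calphabet_code_def less_list_encode del: list_encode.simps)
  finally show ?thesis
    using codes_less by simp
qed

text \<open>Shows that signs for all numbers below \<open>x\<close> cover the guards in transitions,
  however deep they occur.\<close>

lemma trans_guard_code_less:
  assumes "t \<in> cs_trans S" "g \<in> bf_atoms (fst (snd t))"
  shows "aguard_code g < x"
proof -
  have "aguard_code g < bform_code aguard_code (fst (snd t))"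
    by (rule bf_atoms_less) (rule assms)
  also have "\<dots> < trans_code t"
    by (cases t) (simp add: trans_code_def less_list_encode del: list_encode.simps)
  finally show ?thesis
    using trans_code_less[OF assms(1)] by simp
qed

lemma transD:
  assumes "t \<in> cs_trans S"
  shows "src t \<in> cs_states S" "tgt t \<in> cs_states S" "length (fst (snd (snd t))) = n"
    "g \<in> bf_atoms (fst (snd t)) \<Longrightarrow> length (coeffs g) = n"
  using assms S(1) unfolding is_counter_system_def guards_def aguards_def by (auto simp: split_beta)

lemma effect_trans: "t \<in> cs_trans S \<Longrightarrow> i < n \<Longrightarrow> effect (trans_code t) i = fst (snd (snd t)) ! i"
  by (simp add: effect_def nth_opt_vec_code transD)

definition point_letter :: "nat \<Rightarrow> nat list \<Rightarrow> letter" where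
  "point_letter p v = Prop ` (ca_props Al \<inter> cs_label S p) \<union> Grd ` {g \<in> ca_guards Al. aguard_sat v g}"

lemma point_letter_subset: "point_letter p v \<subseteq> ca_atoms Al"
  by (auto simp: point_letter_def ca_atoms_def)

lemma finite_point_letter: "finite (point_letter p v)"
  using finite_subset[OF point_letter_subset] finites by blast

text \<open>Letters contain atoms of the alphabet only, so a run determines the word that it
  satisfies.\<close>

lemma run_sat_iff:
  "run_sat S Al \<rho> A \<longleftrightarrow> (\<forall>i. point_letter (fst (\<rho> i)) (snd (\<rho> i)) \<in> ca_letters Al) \<and>
     spec_accepts A (\<lambda>i. point_letter (fst (\<rho> i)) (snd (\<rho> i)))" (is "_ \<longleftrightarrow> ?R")
proof -
  let ?w = "\<lambda>i. point_letter (fst (\<rho> i)) (snd (\<rho> i))"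
  have sat: "run_sat_word S Al \<rho> ?w"
    by (auto simp: run_sat_word_def point_letter_def)
  have unique: "w = ?w" if "run_sat_word S Al \<rho> w" "range w \<subseteq> ca_letters Al" for w
  proof
    fix i
    have "w i \<subseteq> ca_atoms Al"
      using that(2) Al unfolding is_calphabet_def by blast
    then show "w i = ?w i"
      using that(1) unfolding run_sat_word_def point_letter_def ca_atoms_def by blast
  qed
  have "run_sat S Al \<rho> A \<longleftrightarrow> (\<exists>w. range w \<subseteq> ca_letters Al \<and> spec_accepts A w \<and> run_sat_word S Al \<rho> w)"
    by (auto simp: run_sat_def lang_def)
  also have "\<dots> \<longleftrightarrow> range ?w \<subseteq> ca_letters Al \<and> spec_accepts A ?w"
    using sat unique by metis
  finally show ?thesis
    by (auto simp: image_subset_iff)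
qed

text \<open>Correct signs determine the truth of every guard with code below \<open>x\<close>, hence
  both whether the transition is enabled and which letter is read.\<close>

lemma step_semantics:
  assumes t: "t \<in> cs_trans S" and v: "\<And>i. i < n \<Longrightarrow> int (v ! i) = y i" and ok: "step_ok n x y (trans_code t, \<sigma>)"
  shows "set (step_atoms x (trans_code t, \<sigma>)) = atom_code ` point_letter (src t) v"
    and "step_fine x (trans_code t, \<sigma>) \<longleftrightarrow> guard_sat v (fst (snd t)) \<and> point_letter (src t) v \<in> ca_letters Al"
proof -
  have holds: "aguard_holds (\<sigma>, aguard_code g) \<longleftrightarrow> aguard_sat v g" if "aguard_code g < x" "length (coeffs g) = n" for g
  proof -
    have "nth_opt 0 \<sigma> (aguard_code g) = guard_sign n (aguard_code g) y"
      using ok that(1) by (simp add: step_ok_def)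
    then show ?thesis
      unfolding aguard_holds_def fst_conv snd_conv aguard_code_args using rel_holds_guard_sign[OF that(2) v] by simp
  qed
  have eval: "bform_eval aguard_holds (\<sigma>, bform_code aguard_code (fst (snd t))) \<longleftrightarrow> guard_sat v (fst (snd t))"
    unfolding bform_eval guard_sat_def
    by (rule bf_sat_cong, rule holds) (use t transD trans_guard_code_less in auto)
  have fin: "finite {(q, p). q \<in> cs_states S \<and> p \<in> cs_label S q \<inter> ca_props Al}"
    by (rule finite_subset[of _ "cs_states S \<times> ca_props Al"]) (use finites in auto)
  have props: "set (filter (\<lambda>p. prod_encode (src t, p) \<in> set_decode (arg 1 (arg 1 x))) (set_list (arg 0 (arg 3 x)))) =
      ca_props Al \<inter> cs_label S (src t)"
    unfolding args system_code_def calphabet_code_def using finites fin transD(1)[OF t]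
    by (auto simp: nth_opt_def prod_encode_eq simp del: list_encode.simps)
  have guards: "set (filter (\<lambda>g. aguard_holds (\<sigma>, g)) (set_list (arg 1 (arg 3 x)))) =
      aguard_code ` {g \<in> ca_guards Al. aguard_sat v g}"
  proof -
    have "set (set_list (arg 1 (arg 3 x))) = aguard_code ` ca_guards Al"
      using finites by (simp add: args calphabet_code_def nth_opt_def del: list_encode.simps)
    moreover have "length (coeffs g) = n" if "g \<in> ca_guards Al" for g
      using Al that unfolding is_calphabet_def aguards_def by auto
    ultimately show ?thesis
      using holds guard_code_less by auto
  qed
  show atoms: "set (step_atoms x (trans_code t, \<sigma>)) = atom_code ` point_letter (src t) v"
    unfolding step_atoms_def set_append set_map fst_conv snd_conv trans_code_args props guards point_letter_def image_Un image_image
    by simp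
  have "set_decode (arg 2 (arg 3 x)) = set_code atom_code ` ca_letters Al"
    using finites by (simp add: args calphabet_code_def nth_opt_def del: list_encode.simps)
  \<comment> \<open>Codes of finite sets of atoms determine the sets, so the test on codes decides
    membership in the alphabet.\<close>
  moreover have "set_code atom_code (point_letter (src t) v) = set_code atom_code l \<longleftrightarrow> point_letter (src t) v = l"
    if "l \<in> ca_letters Al" for l
  proof -
    have "finite l"
      using that Al finites(5) finite_subset unfolding is_calphabet_def by blast
    moreover have "inj atom_code"
      by (simp add: inj_def atom_code_eq_iff)
    ultimately show ?thesis
      unfolding set_code_def using finite_point_letter[of "src t" v]
      by (metis finite_imageI inj_image_eq_iff set_encode_inverse)
  qed
  moreover have "set_enc (step_atoms x (trans_code t, \<sigma>)) = set_code atom_code (point_letter (src t) v)"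
    unfolding set_enc atoms set_code_def ..
  ultimately have "set_enc (step_atoms x (trans_code t, \<sigma>)) \<in> set_decode (arg 2 (arg 3 x)) \<longleftrightarrow> point_letter (src t) v \<in> ca_letters Al"
    by auto
  then show "step_fine x (trans_code t, \<sigma>) \<longleftrightarrow> guard_sat v (fst (snd t)) \<and> point_letter (src t) v \<in> ca_letters Al"
    unfolding step_fine_def fst_conv snd_conv trans_code_args eval by simp
qed

lemma run_iff_good_word:
  assumes \<rho>: "\<And>k. fst (\<rho> k) = src (\<tau> k)" "\<And>k. length (snd (\<rho> k)) = n"
      "\<And>k i. i < n \<Longrightarrow> int (snd (\<rho> k) ! i) = vadd y 1 (seffect (map s [0..<k])) i"
    and s: "\<And>k. s k = (trans_code (\<tau> k), \<sigma> k)" "\<And>k. \<tau> k \<in> cs_trans S" "\<And>k. \<sigma> k \<in> set (List.n_lists x [0, 1, 2])"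
    and valid: "valid_word n x y s"
  shows "(\<forall>k. tgt (\<tau> k) = src (\<tau> (Suc k)) \<and> guard_sat (snd (\<rho> k)) (fst (snd (\<tau> k)))) \<and> src (\<tau> 0) = q \<and> run_sat S Al \<rho> A
    \<longleftrightarrow> good_word x s"
proof -
  have ok: "step_ok n x (vadd y 1 (seffect (map s [0..<k]))) (trans_code (\<tau> k), \<sigma> k)" for k
    using valid unfolding valid_word_def s(1)[symmetric] by blast
  have atoms: "set (step_atoms x (trans_code (\<tau> k), \<sigma> k)) = atom_code ` point_letter (src (\<tau> k)) (snd (\<rho> k))" for k
    by (rule step_semantics(1)[OF s(2) _ ok]) (rule \<rho>(3))
  have fine: "step_fine x (trans_code (\<tau> k), \<sigma> k) \<longleftrightarrow>
      guard_sat (snd (\<rho> k)) (fst (snd (\<tau> k))) \<and> point_letter (src (\<tau> k)) (snd (\<rho> k)) \<in> ca_letters Al" for k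
    by (rule step_semantics(2)[OF s(2) _ ok]) (rule \<rho>(3))
  have "represents (\<lambda>i. letter_vars (letter_of x (s i))) (\<lambda>i. point_letter (fst (\<rho> i)) (snd (\<rho> i)))"
    unfolding represents_def letter_vars_letter_of s(1) atoms \<rho>(1) by (auto simp: atom_code_eq_iff)
  then have accepts: "msat (\<lambda>i. letter_vars (letter_of x (s i))) (spec_mso (arg 4 x)) \<longleftrightarrow>
      spec_accepts A (\<lambda>i. point_letter (fst (\<rho> i)) (snd (\<rho> i)))"
    unfolding args by (rule msat_spec_mso[OF A])
  have "s k \<in> set (steps x)" for k
    unfolding s(1) steps_def set_product set_trans_list using s(2,3) by simp
  moreover have "step_fine x (s k) \<longleftrightarrow> guard_sat (snd (\<rho> k)) (fst (snd (\<tau> k))) \<and> point_letter (fst (\<rho> k)) (snd (\<rho> k)) \<in> ca_letters Al" for k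
    unfolding s(1) fine \<rho>(1) ..
  ultimately show ?thesis
    unfolding good_word_def accepts unfolding run_sat_iff args(3) s(1) fst_conv trans_code_args by auto
qed

lemma run_imp_good_word:
  assumes run: "is_run n S (q, v) \<rho>" "run_sat S Al \<rho> A" and y: "\<And>i. y i = int (v ! i)"
  shows "\<exists>\<tau>. (\<forall>i. \<tau> i \<in> cs_trans S) \<and> (\<forall>i. tgt (\<tau> i) = src (\<tau> (Suc i))) \<and>
    good_word x (annotate_word n x y (\<lambda>i. trans_code (\<tau> i))) \<and> valid_word n x y (annotate_word n x y (\<lambda>i. trans_code (\<tau> i)))"
proof -
  have "\<exists>t. t \<in> cs_trans S \<and> src t = fst (\<rho> k) \<and> tgt t = fst (\<rho> (Suc k)) \<and> guard_sat (snd (\<rho> k)) (fst (snd t)) \<and>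
      (\<forall>i < n. int (snd (\<rho> (Suc k)) ! i) = int (snd (\<rho> k) ! i) + fst (snd (snd t)) ! i)" for k
  proof -
    have "step n S (\<rho> k) (\<rho> (Suc k))"
      using run(1) by (simp add: is_run_def)
    then obtain g u where "(fst (\<rho> k), g, u, fst (\<rho> (Suc k))) \<in> cs_trans S" "guard_sat (snd (\<rho> k)) g"
      "\<forall>i < n. int (snd (\<rho> (Suc k)) ! i) = int (snd (\<rho> k) ! i) + u ! i"
      unfolding step_def by (auto split: prod.splits)
    then show ?thesis
      by (intro exI[of _ "(fst (\<rho> k), g, u, fst (\<rho> (Suc k)))"]) simp
  qed
  then obtain \<tau> where \<tau>: "\<And>k. \<tau> k \<in> cs_trans S" "\<And>k. src (\<tau> k) = fst (\<rho> k)" "\<And>k. tgt (\<tau> k) = fst (\<rho> (Suc k))"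
      "\<And>k. guard_sat (snd (\<rho> k)) (fst (snd (\<tau> k)))"
      "\<And>k i. i < n \<Longrightarrow> int (snd (\<rho> (Suc k)) ! i) = int (snd (\<rho> k) ! i) + fst (snd (snd (\<tau> k))) ! i"
    by metis
  let ?s = "annotate_word n x y (\<lambda>i. trans_code (\<tau> i))"
  have len: "length (snd (\<rho> k)) = n" for k
  proof -
    have "step n S (\<rho> k) (\<rho> (Suc k))"
      using run(1) by (simp add: is_run_def)
    then show ?thesis
      unfolding step_def by (auto split: prod.splits)
  qed
  have fst_s: "map fst (map ?s [0..<k]) = map (\<lambda>i. trans_code (\<tau> i)) [0..<k]" for k
    by (simp add: annotate_word_def)
  have val: "int (snd (\<rho> k) ! i) = vadd y 1 (seffect (map ?s [0..<k])) i" if i: "i < n" for k i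
    unfolding fst_s
  proof (induction k)
    case 0
    then show ?case
      using run(1) by (simp add: is_run_def y vadd_def)
  next
    case (Suc k)
    then show ?case
      using \<tau>(5)[OF i] effect_trans[OF \<tau>(1) i] by (simp add: vadd_def total_effect_def)
  qed
  have valid: "valid_word n x y ?s"
    unfolding valid_word_def
  proof
    fix k
    have "\<forall>i < n. 0 \<le> vadd y 1 (seffect (map ?s [0..<k])) i"
      using val[of _ k] by (metis of_nat_0_le_iff)
    then show "step_ok n x (vadd y 1 (seffect (map ?s [0..<k]))) (?s k)"
      unfolding step_ok_def fst_s by (simp add: annotate_word_def signs_def nth_opt_def)
  qed
  have sgn: "signs n x z \<in> set (List.n_lists x [0, 1, 2])" for z
    by (auto simp: set_n_lists signs_def guard_sign_def sign_def)
  have \<rho>0: "fst (\<rho> 0) = q"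
    using run(1) by (simp add: is_run_def)
  have "good_word x ?s"
    by (rule iffD1[OF run_iff_good_word[OF \<tau>(2)[symmetric] len val annotate_word_def \<tau>(1) sgn valid]])
      (use \<tau> \<rho>0 run(2) in simp_all)
  then show ?thesis
    using \<tau> valid by (intro exI[of _ \<tau>]) simp
qed

lemma good_word_imp_run:
  assumes good: "good_word x s" and valid: "valid_word n x y s" and y: "\<And>i. y i = int (v ! i)" and v: "length v = n"
  shows "\<exists>\<rho>. is_run n S (q, v) \<rho> \<and> run_sat S Al \<rho> A"
proof -
  have "\<exists>t. t \<in> cs_trans S \<and> fst (s k) = trans_code t" for k
  proof -
    have "s k \<in> set (trans_list x) \<times> set (List.n_lists x [0, 1, 2])"
      using good unfolding good_word_def steps_def set_product by blast
    then show ?thesis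
      unfolding set_trans_list by (auto simp: mem_Times_iff)
  qed
  then obtain \<tau> where \<tau>: "\<And>k. \<tau> k \<in> cs_trans S" "\<And>k. fst (s k) = trans_code (\<tau> k)"
    by metis
  \<comment> \<open>\<open>nat\<close> loses nothing, since \<open>valid_word\<close> makes the
    counters nonnegative.\<close>
  define \<rho> where "\<rho> k = (src (\<tau> k), map (\<lambda>i. nat (vadd y 1 (seffect (map s [0..<k])) i)) [0..<n])" for k
  have \<rho>: "fst (\<rho> k) = src (\<tau> k)" "length (snd (\<rho> k)) = n" for k
    by (simp_all add: \<rho>_def)
  have val: "int (snd (\<rho> k) ! i) = vadd y 1 (seffect (map s [0..<k])) i" if "i < n" for k i
    using valid that by (simp add: \<rho>_def valid_word_def step_ok_def)
  have s: "s k = (trans_code (\<tau> k), snd (s k))" for k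
    by (simp add: \<tau>(2)[symmetric])
  have sgn: "snd (s k) \<in> set (List.n_lists x [0, 1, 2])" for k
  proof -
    have "s k \<in> set (trans_list x) \<times> set (List.n_lists x [0, 1, 2])"
      using good unfolding good_word_def steps_def set_product by blast
    then show ?thesis
      by (simp add: mem_Times_iff)
  qed
  have run: "(\<forall>k. tgt (\<tau> k) = src (\<tau> (Suc k)) \<and> guard_sat (snd (\<rho> k)) (fst (snd (\<tau> k)))) \<and> src (\<tau> 0) = q \<and> run_sat S Al \<rho> A"
    by (rule iffD2[OF run_iff_good_word[OF \<rho> val s \<tau>(1) sgn valid] good])
  have "step n S (\<rho> k) (\<rho> (Suc k))" for k
  proof -
    have "(fst (\<rho> k), fst (snd (\<tau> k)), fst (snd (snd (\<tau> k))), fst (\<rho> (Suc k))) \<in> cs_trans S"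
      using \<tau>(1)[of k] run \<rho>(1) by (metis prod.collapse)
    moreover have "int (snd (\<rho> (Suc k)) ! i) = int (snd (\<rho> k) ! i) + fst (snd (snd (\<tau> k))) ! i" if "i < n" for i
      unfolding val[OF that] using effect_trans[OF \<tau>(1) that, of k] by (simp add: vadd_def total_effect_def \<tau>(2))
    ultimately have "\<exists>g u. (fst (\<rho> k), g, u, fst (\<rho> (Suc k))) \<in> cs_trans S \<and> guard_sat (snd (\<rho> k)) g \<and>
        (\<forall>i < n. int (snd (\<rho> (Suc k)) ! i) = int (snd (\<rho> k) ! i) + u ! i)"
      using run by blast
    then show ?thesis
      unfolding step_def using \<rho>(2) by (simp add: split_beta)
  qed
  moreover have "\<rho> 0 = (q, v)"
    using run v by (auto simp: \<rho>_def y intro: nth_equalityI)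
  ultimately show ?thesis
    using run by (auto simp: is_run_def)
qed

end

section \<open>Descriptors of runs\<close>

lemma successively_pow_Suc:
  assumes "u \<noteq> []" "y \<noteq> []"
  shows "successively R (pow (Suc m) u @ y) \<longleftrightarrow>
    successively R u \<and> (0 < m \<longrightarrow> R (last u) (hd u)) \<and> R (last u) (hd y) \<and> successively R y"
proof (induction m)
  case 0
  then show ?case
    using assms by (auto simp: pow_Suc successively_append_iff)
next
  case (Suc m)
  have "hd (pow (Suc m) u @ y) = hd u"
    using assms by (simp add: pow_Suc)
  then have "successively R (pow (Suc (Suc m)) u @ y) \<longleftrightarrow> successively R u \<and> R (last u) (hd u) \<and> successively R (pow (Suc m) u @ y)"
    using assms by (subst pow_Suc) (auto simp: successively_append_iff pow_Suc)
  then show ?case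
    unfolding Suc by auto
qed

text \<open>Whether consecutive steps fit depends on a positive exponent only through being 1 or at
  least 2, because of the link from the end of a block back to its start.\<close>

lemma unblock_links:
  assumes "list_all2 (\<lambda>b b'. fst b' = fst b \<and> fst b \<noteq> [] \<and> snd b \<noteq> 0 \<and> snd b' \<noteq> 0 \<and> (snd b' = snd b \<or> 2 \<le> snd b \<and> 2 \<le> snd b')) bs bs'"
    and z: "z \<noteq> []"
  shows "(successively R (unblock bs @ z) \<longleftrightarrow> successively R (unblock bs' @ z)) \<and>
    hd (unblock bs @ z) = hd (unblock bs' @ z) \<and> set (unblock bs) = set (unblock bs')"
  using assms(1)
proof (induction rule: list_all2_induct)
  case (Cons b bs b' bs')
  obtain m m' where m: "snd b = Suc m" "snd b' = Suc m'"
    using Cons(1) by (metis not0_implies_Suc)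
  have b: "fst b' = fst b" "fst b \<noteq> []" "0 < m \<longleftrightarrow> 0 < m'"
    using Cons(1) m by auto
  have hd_eq: "hd (unblock bs @ z) = hd (unblock bs' @ z)"
    and succ_eq: "successively R (unblock bs @ z) \<longleftrightarrow> successively R (unblock bs' @ z)"
    and set_eq: "set (unblock bs) = set (unblock bs')"
    using Cons(3) by simp_all
  have set_pow: "set (pow (Suc k) u) = set u" for k and u :: "'a list"
    by (induction k) (simp_all add: pow_Suc)
  have ne: "unblock bs @ z \<noteq> []" "unblock bs' @ z \<noteq> []"
    using z by simp_all
  have "successively R (unblock (b # bs) @ z) \<longleftrightarrow> successively R (unblock (b' # bs') @ z)"
    unfolding unblock_Cons append_assoc m b(1) successively_pow_Suc[OF b(2) ne(1)] successively_pow_Suc[OF b(2) ne(2)] b(3) hd_eq succ_eq ..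
  moreover have "hd (unblock (b # bs) @ z) = hd (unblock (b' # bs') @ z)"
    using b(2) by (simp add: unblock_Cons m b(1) pow_Suc)
  moreover have "set (unblock (b # bs)) = set (unblock (b' # bs'))"
    unfolding unblock_Cons m b(1) set_append set_pow set_eq ..
  ultimately show ?case
    by blast
qed simp

lemma upword_0: "u \<noteq> [] \<Longrightarrow> upword r u 0 = hd (r @ u)"
  by (simp add: upword_def hd_append hd_conv_nth)

lemma upword_Cons: "upword (a # r) u i = (case i of 0 \<Rightarrow> a | Suc i \<Rightarrow> upword r u i)"
  by (simp add: upword_def split: nat.split)

lemma upword_all:
  assumes "u \<noteq> []"
  shows "(\<forall>i. P (upword r u i)) \<longleftrightarrow> (\<forall>s \<in> set (r @ u). P s)"
proof (induction r)
  case Nil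
  have "\<exists>i. s = upword [] u i" if "s \<in> set u" for s
  proof -
    obtain i where "i < length u" "u ! i = s"
      using \<open>s \<in> set u\<close> unfolding in_set_conv_nth by (elim exE conjE)
    then show ?thesis
      by (intro exI[of _ i]) (simp add: upword_def)
  qed
  then show ?case
    using assms by (auto simp: upword_def)
next
  case (Cons a r)
  have "(\<forall>i. P (upword (a # r) u i)) \<longleftrightarrow> P a \<and> (\<forall>i. P (upword r u i))"
    unfolding upword_Cons by (auto split: nat.split)
  then show ?case
    unfolding Cons by simp
qed

text \<open>\<open>take 1 u\<close> adds the link that closes the loop.\<close>

lemma upword_links:
  assumes "u \<noteq> []"
  shows "(\<forall>i. R (upword r u i) (upword r u (Suc i))) \<longleftrightarrow> successively R (r @ u @ take 1 u)"
proof (induction r)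
  case Nil
  have u: "u @ take 1 u = u @ [u ! 0]" "0 < length u"
    using assms by (cases u; simp)+
  have nth: "(u @ [u ! 0]) ! i = u ! (i mod length u)" if "i \<le> length u" for i
    using that by (cases "i = length u") (simp_all add: nth_append)
  have "successively R (u @ take 1 u) \<longleftrightarrow> (\<forall>i < length u. R (u ! (i mod length u)) (u ! (Suc i mod length u)))"
    unfolding u(1) successively_conv_nth using nth by (auto simp: Suc_le_eq)
  also have "\<dots> \<longleftrightarrow> (\<forall>i. R (u ! (i mod length u)) (u ! (Suc i mod length u)))"
  proof
    assume *: "\<forall>i < length u. R (u ! (i mod length u)) (u ! (Suc i mod length u))"
    show "\<forall>i. R (u ! (i mod length u)) (u ! (Suc i mod length u))"
    proof
      fix i
      have "R (u ! (i mod length u mod length u)) (u ! (Suc (i mod length u) mod length u))"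
        using * u(2) by simp
      then show "R (u ! (i mod length u)) (u ! (Suc i mod length u))"
        by (simp add: mod_Suc_eq)
    qed
  next
    assume "\<forall>i. R (u ! (i mod length u)) (u ! (Suc i mod length u))"
    then show "\<forall>i < length u. R (u ! (i mod length u)) (u ! (Suc i mod length u))"
      by blast
  qed
  finally show ?case
    by (simp add: upword_def)
next
  case (Cons a r)
  have "(\<forall>i. R (upword (a # r) u i) (upword (a # r) u (Suc i))) \<longleftrightarrow>
      R a (upword r u 0) \<and> (\<forall>i. R (upword r u i) (upword r u (Suc i)))"
    unfolding upword_Cons by (auto split: nat.split)
  moreover have "successively R ((a # r) @ u @ take 1 u) \<longleftrightarrow> R a (hd (r @ u)) \<and> successively R (r @ u @ take 1 u)"
    using assms by (cases r; cases u) auto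
  ultimately show ?case
    unfolding Cons upword_0[OF assms] by simp
qed

lemma upword_map: "u \<noteq> [] \<Longrightarrow> f (upword r u i) = upword (map f r) (map f u) i"
  by (simp add: upword_def)

lemma map_unblock: "map f (unblock bs) = concat (map (\<lambda>s. pow (snd s) (fst s)) (map (\<lambda>b. (map f (fst b), snd b)) bs))"
proof -
  have "map f (pow m u) = pow m (map f u)" for m u
    by (induction m) (simp_all add: pow_Suc)
  then show ?thesis
    by (simp add: unblock_def map_concat o_def)
qed

section \<open>Bounds and the finite set of descriptors\<close>

definition letter_bound :: "nat \<Rightarrow> nat" where
  "letter_bound x = enc (spec_mso (arg 4 x)) + (\<Sum>a\<leftarrow>map (\<lambda>p. list_encode [0, p]) (set_list (arg 0 (arg 3 x))) @
     map (\<lambda>g. list_encode [1, g]) (set_list (arg 1 (arg 3 x))). Suc (prod_encode (0, a)))"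

text \<open>In \<open>letter_bound\<close> the sum stands in for a maximum over the atoms of the
  alphabet; the added code of the formula covers the variables of the formula.\<close>

lemma letter_of_less: "letter_of x s < 2 ^ letter_bound x"
proof -
  let ?atoms = "map (\<lambda>p. list_encode [0, p]) (set_list (arg 0 (arg 3 x))) @ map (\<lambda>g. list_encode [1, g]) (set_list (arg 1 (arg 3 x)))"
  have "prod_encode (0, a) < letter_bound x" if "a \<in> set (step_atoms x s)" for a
  proof -
    have "Suc (prod_encode (0, a)) \<le> (\<Sum>a\<leftarrow>l. Suc (prod_encode (0, a)))" if "a \<in> set l" for l
      using that by (intro member_le_sum_list) auto
    moreover have "a \<in> set ?atoms"
      using that unfolding step_atoms_def set_append set_map set_filter by blast
    ultimately have "Suc (prod_encode (0, a)) \<le> (\<Sum>a\<leftarrow>?atoms. Suc (prod_encode (0, a)))"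
      by blast
    then show ?thesis
      unfolding letter_bound_def by linarith
  qed
  then have "set (map (\<lambda>a. prod_encode (0, a)) (step_atoms x s)) \<subseteq> {..<letter_bound x}"
    by auto
  then show ?thesis
    unfolding letter_of_def set_enc by (rule set_encode_less)
qed

lemma spec_vars_bound: "prod_encode ` mso_vars (spec_mso (arg 4 x)) \<subseteq> {..<letter_bound x}"
  using mso_vars_less[of _ "spec_mso (arg 4 x)"] by (auto simp: letter_bound_def enc_mso_def intro: trans_less_add1)

definition spec_index :: "nat \<Rightarrow> nat" where
  "spec_index x = index_code (2 ^ letter_bound x, enc (spec_mso (arg 4 x)))"

lemma spec_index: "spec_index x = mso_index (2 ^ letter_bound x) (spec_mso (arg 4 x))"
  by (simp add: spec_index_def enc_mso_def index_code)

text \<open>Ensures that exponents which vary exceed 1, as \<open>unblock_links\<close>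
  demands.\<close>

lemma spec_index_pos: "0 < spec_index x"
proof -
  have "0 < mso_index c \<phi>" for c \<phi>
    by (induction \<phi>) simp_all
  then show ?thesis
    unfolding spec_index .
qed

text \<open>Pairs of base and period for exponents diminished by one: period 0 stands for a single
  value, the factorial for a residue class above the threshold.\<close>

definition exps :: "nat \<Rightarrow> (nat \<times> nat) list" where
  "exps x = map (\<lambda>c. (c, 0)) [0..<spec_index x + fact (spec_index x)] @
     map (\<lambda>c. (c, fact (spec_index x))) [spec_index x..<spec_index x + fact (spec_index x)]"

lemma exps_cover: "\<exists>d j. d \<in> set (exps x) \<and> t = fst d + snd d * j"
proof (cases "t < spec_index x")
  case True
  then show ?thesis
    by (intro exI[of _ "(t, 0)"]) (auto simp: exps_def)
next
  case False
  let ?P = "fact (spec_index x) :: nat"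
  let ?c = "spec_index x + (t - spec_index x) mod ?P"
  have "(?c, ?P) \<in> set (exps x)"
    by (auto simp: exps_def)
  moreover have "t = ?c + ?P * ((t - spec_index x) div ?P)"
    using False by simp
  ultimately show ?thesis
    by (intro exI[of _ "(?c, ?P)"] exI[of _ "(t - spec_index x) div ?P"]) simp
qed

definition word_lists :: "nat \<Rightarrow> sstep list list" where
  "word_lists x = concat (map (\<lambda>l. List.n_lists l (steps x)) [1..<Suc x])"

lemma word_lists: "u \<in> set (word_lists x) \<longleftrightarrow> u \<noteq> [] \<and> length u \<le> x \<and> set u \<subseteq> set (steps x)"
  by (cases u) (auto simp: word_lists_def set_n_lists Suc_le_eq simp del: upt_Suc)

text \<open>\<open>Suc (2 * x)\<close> counts two blocks per state and the final loop. The other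
  factor comes from \<open>annotate_blocks\<close>, with the lengths of loops and the codes of
  guards bounded by \<open>x\<close>.\<close>

definition block_bound :: "nat \<Rightarrow> nat" where
  "block_bound x = Suc (2 * x) * Suc (2 * x * x)"

definition descs :: "nat \<Rightarrow> (desc \<times> sstep list) list" where
  "descs x = List.product (concat (map (\<lambda>m. List.n_lists m (List.product (word_lists x) (exps x))) [0..<Suc (block_bound x)]))
     (word_lists x)"

lemma descs:
  "(ss, u) \<in> set (descs x) \<longleftrightarrow>
     length ss \<le> block_bound x \<and> (\<forall>d \<in> set ss. fst d \<in> set (word_lists x) \<and> snd d \<in> set (exps x)) \<and> u \<in> set (word_lists x)"
  by (auto simp: descs_def set_n_lists subset_iff less_Suc_eq_le simp del: upt_Suc)

definition least_word :: "desc \<Rightarrow> sstep list" where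
  "least_word ss = unblock (map (\<lambda>d. (fst d, Suc (fst (snd d)))) ss)"

text \<open>Tests one representative, with all variables 0; by \<open>good_word_instance\<close> it
  speaks for every choice of exponents in the descriptor.\<close>

definition check :: "nat \<Rightarrow> desc \<times> sstep list \<Rightarrow> bool" where
  "check x p \<longleftrightarrow> (let r = least_word (fst p); u = snd p; w = r @ u @ take 1 u in
     arg 0 (fst (hd_opt (0, []) w)) = arg 2 x \<and>
     (\<forall>i \<in> set [0..<length r + length u]. linked (nth_opt (0, []) w i) (nth_opt (0, []) w (Suc i))) \<and>
     (\<forall>s \<in> set w. step_fine x s) \<and> loop_stable (arg 0 x) x u \<and>
     mso_decide (letter_bound x, enc (spec_mso (arg 4 x)), map (\<lambda>s. letter_of x s) r, map (\<lambda>s. letter_of x s) u))"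

lemma good_word_upword:
  assumes u: "u \<noteq> []"
  shows "good_word x (upword r u) \<longleftrightarrow> arg 0 (fst (hd (r @ u))) = arg 2 x \<and> successively linked (r @ u @ take 1 u) \<and>
    (\<forall>s \<in> set (r @ u). s \<in> set (steps x) \<and> step_fine x s) \<and>
    msat (\<lambda>i. letter_vars (upword (map (letter_of x) r) (map (letter_of x) u) i)) (spec_mso (arg 4 x))"
  unfolding good_word_def upword_links[OF u, where R = linked] upword_all[OF u, where P = "\<lambda>s. s \<in> set (steps x) \<and> step_fine x s"]
    upword_0[OF u] upword_map[OF u, of "letter_of x"] ..

lemma check_iff:
  assumes u: "u \<noteq> []" "set (least_word ss @ u) \<subseteq> set (steps x)"
  shows "check x (ss, u) \<longleftrightarrow> good_word x (upword (least_word ss) u) \<and> loop_stable (arg 0 x) x u"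
proof -
  let ?r = "least_word ss"
  let ?w = "?r @ u @ take 1 u"
  have len: "length ?w = Suc (length ?r + length u)"
    using u(1) by (cases u) simp_all
  have "hd_opt (0, []) ?w = hd (?r @ u)"
    using u(1) by (cases ?r; cases u) (simp_all add: hd_opt_def)
  moreover have "(\<forall>i \<in> set [0..<length ?r + length u]. linked (nth_opt (0, []) ?w i) (nth_opt (0, []) ?w (Suc i))) \<longleftrightarrow>
      successively linked ?w"
    unfolding successively_conv_nth nth_opt_def len by (simp add: Ball_def)
  moreover have "(\<forall>s \<in> set ?w. step_fine x s) \<longleftrightarrow> (\<forall>s \<in> set (?r @ u). s \<in> set (steps x) \<and> step_fine x s)"
    using u(2) set_take_subset[of 1 u] by auto
  moreover have "mso_decide (letter_bound x, enc (spec_mso (arg 4 x)), map (letter_of x) ?r, map (letter_of x) u) \<longleftrightarrow>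
      msat (\<lambda>i. letter_vars (upword (map (letter_of x) ?r) (map (letter_of x) u) i)) (spec_mso (arg 4 x))"
    unfolding enc_mso_def mso_decide using u(1) by (intro mso_check_correct[OF spec_vars_bound]) simp
  ultimately show ?thesis
    unfolding check_def Let_def good_word_upword[OF u(1)] fst_conv snd_conv by auto
qed

definition instance_of :: "nat \<Rightarrow> sstep list \<times> nat \<times> nat \<Rightarrow> sstep list \<times> nat \<Rightarrow> bool" where
  "instance_of x d b \<longleftrightarrow> fst b = fst d \<and> fst d \<in> set (word_lists x) \<and> snd d \<in> set (exps x) \<and>
     (\<exists>j. snd b = Suc (fst (snd d) + snd (snd d) * j))"

text \<open>Exponents that differ do so by multiples of the factorial above the index, so the
  formula cannot tell the words apart. The links agree by \<open>unblock_links\<close>, and the same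
  steps occur.\<close>

lemma good_word_instance:
  assumes inst: "list_all2 (instance_of x) ss bs" and u: "u \<noteq> []"
  shows "good_word x (upword (unblock bs) u) \<longleftrightarrow> good_word x (upword (least_word ss) u)"
    "set (unblock bs) = set (least_word ss)"
proof -
  let ?ls = "map (\<lambda>d. (fst d, Suc (fst (snd d)))) ss"
  let ?K = "spec_index x"
  have exps: "snd b = Suc (fst (snd d)) \<or> ?K \<le> fst (snd d) \<and> (\<exists>j. snd b = Suc (fst (snd d)) + fact ?K * j)"
    if "instance_of x d b" for d b
    using that unfolding instance_of_def exps_def by auto
  have "list_all2 (\<lambda>b b'. fst b' = fst b \<and> fst b \<noteq> [] \<and> snd b \<noteq> 0 \<and> snd b' \<noteq> 0 \<and>
      (snd b' = snd b \<or> 2 \<le> snd b \<and> 2 \<le> snd b')) ?ls bs"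
    unfolding list_all2_map1
  proof (rule list_all2_mono[OF inst])
    fix d b
    assume db: "instance_of x d b"
    then have "fst b = fst d" "fst d \<noteq> []" "snd b \<noteq> 0"
      by (auto simp: instance_of_def word_lists)
    then show "fst b = fst (fst d, Suc (fst (snd d))) \<and> fst (fst d, Suc (fst (snd d))) \<noteq> [] \<and> snd (fst d, Suc (fst (snd d))) \<noteq> 0 \<and>
        snd b \<noteq> 0 \<and> (snd b = snd (fst d, Suc (fst (snd d))) \<or> 2 \<le> snd (fst d, Suc (fst (snd d))) \<and> 2 \<le> snd b)"
      using exps[OF db] spec_index_pos[of x] by auto
  qed
  note links = unblock_links[OF this]
  have "u @ take 1 u \<noteq> []"
    using u by simp
  note links_u = links[OF u] links[OF this, of linked]
  have "list_all2 (\<lambda>s s'. fst s' = fst s \<and> fst s \<in> lists {..<2 ^ letter_bound x} \<and>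
      (snd s' = snd s \<or> mso_index (2 ^ letter_bound x) (spec_mso (arg 4 x)) \<le> snd s \<and>
        (\<exists>j. snd s' = snd s + fact (mso_index (2 ^ letter_bound x) (spec_mso (arg 4 x))) * j)))
      (map (\<lambda>b. (map (letter_of x) (fst b), snd b)) ?ls) (map (\<lambda>b. (map (letter_of x) (fst b), snd b)) bs)"
    unfolding list_all2_map1 list_all2_map2 spec_index[symmetric]
  proof (rule list_all2_mono[OF inst])
    fix d b
    assume db: "instance_of x d b"
    then have "fst b = fst d"
      by (simp add: instance_of_def)
    moreover have "map (letter_of x) (fst d) \<in> lists {..<2 ^ letter_bound x}"
      using letter_of_less by auto
    ultimately show "fst (map (letter_of x) (fst b), snd b) = fst (map (letter_of x) (fst (fst d, Suc (fst (snd d)))), snd (fst d, Suc (fst (snd d)))) \<and>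
        fst (map (letter_of x) (fst (fst d, Suc (fst (snd d)))), snd (fst d, Suc (fst (snd d)))) \<in> lists {..<2 ^ letter_bound x} \<and>
        (snd (map (letter_of x) (fst b), snd b) = snd (map (letter_of x) (fst (fst d, Suc (fst (snd d)))), snd (fst d, Suc (fst (snd d)))) \<or>
         ?K \<le> snd (map (letter_of x) (fst (fst d, Suc (fst (snd d)))), snd (fst d, Suc (fst (snd d)))) \<and>
         (\<exists>j. snd (map (letter_of x) (fst b), snd b) = snd (map (letter_of x) (fst (fst d, Suc (fst (snd d)))), snd (fst d, Suc (fst (snd d)))) + fact ?K * j))"
      using exps[OF db] by (simp only: fst_conv snd_conv) (metis le_SucI)
  qed
  moreover have "map (letter_of x) u \<in> lists {..<2 ^ letter_bound x}" "map (letter_of x) u \<noteq> []"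
    using u letter_of_less by auto
  ultimately have "msat (\<lambda>i. letter_vars (upword (map (letter_of x) (least_word ss)) (map (letter_of x) u) i)) (spec_mso (arg 4 x)) =
      msat (\<lambda>i. letter_vars (upword (map (letter_of x) (unblock bs)) (map (letter_of x) u) i)) (spec_mso (arg 4 x))"
    unfolding map_unblock least_word_def by (intro msat_pow_segments[OF spec_vars_bound])
  then show "good_word x (upword (unblock bs) u) \<longleftrightarrow> good_word x (upword (least_word ss) u)"
    unfolding good_word_upword[OF u] using links_u unfolding least_word_def by simp
  show "set (unblock bs) = set (least_word ss)"
    using links_u unfolding least_word_def by simp
qed

text \<open>One quantifier prefix serves all disjuncts, so it is sized for the longest descriptor:
  \<open>block_bound x\<close> blocks and the final loop.\<close>

definition final_form :: "nat \<Rightarrow> pform" where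
  "final_form x = foldr PEx [arg 0 x..<arg 0 x + Suc (block_bound x)]
     (foldr POr (map (\<lambda>p. desc_form (arg 0 x) x (fst p @ [(snd p, 0, 0)])) (filter (\<lambda>p. check x p) (descs x))) (PNot (PEq TZero TZero)))"

lemma foldr_POr:
  "pf_sat e (foldr POr fs (PNot (PEq TZero TZero))) \<longleftrightarrow> (\<exists>f \<in> set fs. pf_sat e f)"
  "pf_qfree (foldr POr fs (PNot (PEq TZero TZero))) \<longleftrightarrow> (\<forall>f \<in> set fs. pf_qfree f)"
  "pf_fv (foldr POr fs (PNot (PEq TZero TZero))) = (\<Union>f \<in> set fs. pf_fv f)"
  by (induction fs) auto

lemma existential_final_form: "existential_presburger (final_form x)"
  unfolding existential_presburger_def final_form_def
  by (intro exI conjI refl) (auto simp: foldr_POr desc_form_vars simp del: upt_Suc)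

lemma final_form_vars: "pf_fv (final_form x) \<subseteq> {..<arg 0 x}"
proof -
  have "pf_fv (foldr PEx xs \<psi>) = pf_fv \<psi> - set xs" for xs \<psi>
    by (induction xs) auto
  moreover have "pf_fv (desc_form (arg 0 x) x (fst p @ [(snd p, 0, 0)])) \<subseteq> {..<arg 0 x + Suc (block_bound x)}"
    if "p \<in> set (descs x)" for p
    using desc_form_vars(1)[of "arg 0 x" x "fst p @ [(snd p, 0, 0)]"] that descs[of "fst p" "snd p" x] by force
  ultimately show ?thesis
    unfolding final_form_def by (auto simp: foldr_POr simp del: upt_Suc) (meson in_mono lessThan_iff not_le)
qed

section \<open>Correctness of the final formula\<close>

lemma pf_sat_final_form:
  "pf_sat e (final_form x) \<longleftrightarrow> (\<exists>e' ss u. (\<forall>y. y \<notin> {arg 0 x..<arg 0 x + Suc (block_bound x)} \<longrightarrow> e' y = e y) \<and>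
     (ss, u) \<in> set (descs x) \<and> check x (ss, u) \<and> pf_sat e' (desc_form (arg 0 x) x (ss @ [(u, 0, 0)])))"
  unfolding final_form_def pf_sat_foldr_PEx foldr_POr(1) set_upt set_map set_filter by force

lemma valid_word_cong: "(\<And>i. i < n \<Longrightarrow> y i = z i) \<Longrightarrow> valid_word n X y w \<longleftrightarrow> valid_word n X z w"
proof -
  assume yz: "\<And>i. i < n \<Longrightarrow> y i = z i"
  have "vadd y 1 d i = vadd z 1 d i" if "i < n" for d i
    using yz[OF that] by (simp add: vadd_def)
  moreover have "dot n a (vadd y 1 d) = dot n a (vadd z 1 d)" for a d
    by (rule dot_cong) (simp add: vadd_def yz)
  ultimately show ?thesis
    unfolding valid_word_def step_ok_def guard_sign_def by simp
qed

lemma step_signs: "s \<in> set (steps x) \<Longrightarrow> nth_opt 0 (snd s) g \<le> 2"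
proof -
  assume "s \<in> set (steps x)"
  then have "set (snd s) \<subseteq> {0, 1, 2}"
    by (auto simp: steps_def set_n_lists)
  then show ?thesis
    unfolding nth_opt_def by (cases "g < length (snd s)") (use nth_mem in fastforce)+
qed

lemma valid_word_instance:
  assumes ss: "\<forall>d \<in> set ss. fst d \<in> set (word_lists x)" and u: "u \<in> set (word_lists x)"
  shows "valid_word n x (\<lambda>i. int (e i)) (upword (unblock (desc_blocks n (ss @ [(u, 0, 0)]) e (length ss))) u) \<longleftrightarrow>
    pf_sat e (desc_form n x (ss @ [(u, 0, 0)])) \<and> loop_stable n x u"
proof (rule valid_word_desc[OF refl])
  show "u \<noteq> []"
    using u by (simp add: word_lists)
next
  fix k s g
  assume k: "k < length (ss @ [(u, 0, 0)])" and s: "s \<in> set (seg_word (ss @ [(u, 0, 0)]) k)"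
  have "fst ((ss @ [(u, 0, 0)]) ! k) \<in> set (word_lists x)"
    using ss u k by (auto simp: nth_append)
  then have "s \<in> set (steps x)"
    using s k unfolding seg_word_def nth_opt_def word_lists by auto
  then show "nth_opt 0 (snd s) g \<le> 2"
    by (rule step_signs)
qed

lemma desc_blocks_instance:
  assumes "\<forall>d \<in> set ss. fst d \<in> set (word_lists x) \<and> snd d \<in> set (exps x)"
  shows "list_all2 (instance_of x) ss (desc_blocks n (ss @ [(u, 0, 0)]) e (length ss))"
proof (rule list_all2_all_nthI)
  fix k
  assume k: "k < length ss"
  then have "nth_opt ([], 0, 0) (ss @ [(u, 0, 0)]) k = ss ! k"
    by (simp add: nth_opt_def nth_append)
  then have "desc_blocks n (ss @ [(u, 0, 0)]) e (length ss) ! k =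
      (fst (ss ! k), Suc (fst (snd (ss ! k)) + snd (snd (ss ! k)) * e (n + k)))"
    using k by (simp add: desc_blocks_def seg_word_def seg_times_def seg_base_def seg_period_def)
  then show "instance_of x (ss ! k) (desc_blocks n (ss @ [(u, 0, 0)]) e (length ss) ! k)"
    unfolding instance_of_def using assms k by auto
qed (simp add: desc_blocks_def)

lemma final_form_imp_good_word:
  assumes "pf_sat e (final_form x)"
  shows "\<exists>w. good_word x w \<and> valid_word (arg 0 x) x (\<lambda>i. int (e i)) w"
proof -
  let ?n = "arg 0 x"
  obtain e' ss u where e': "\<And>y. y \<notin> {?n..<?n + Suc (block_bound x)} \<Longrightarrow> e' y = e y"
    and d: "(ss, u) \<in> set (descs x)" "check x (ss, u)" and sat: "pf_sat e' (desc_form ?n x (ss @ [(u, 0, 0)]))"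
    using assms unfolding pf_sat_final_form by blast
  let ?bs = "desc_blocks ?n (ss @ [(u, 0, 0)]) e' (length ss)"
  have ss: "\<forall>d \<in> set ss. fst d \<in> set (word_lists x) \<and> snd d \<in> set (exps x)" and u: "u \<in> set (word_lists x)"
    using d(1) unfolding descs by simp_all
  have u0: "u \<noteq> []" "set u \<subseteq> set (steps x)"
    using u by (simp_all add: word_lists)
  have "set (unblock ?bs) \<subseteq> set (steps x)"
  proof
    fix s
    assume "s \<in> set (unblock ?bs)"
    then obtain b where b: "b \<in> set ?bs" "s \<in> set (fst b)"
      by (auto simp: unblock_def pow_def)
    have "fst b \<in> set (word_lists x)"
      using b(1) desc_blocks_instance[OF ss, of ?n u e'] unfolding list_all2_conv_all_nth in_set_conv_nth instance_of_def by metis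
    then show "s \<in> set (steps x)"
      using b(2) by (auto simp: word_lists)
  qed
  then have "set (least_word ss @ u) \<subseteq> set (steps x)"
    using u0 good_word_instance(2)[OF desc_blocks_instance[OF ss, of ?n u e'] u0(1)] by simp
  then have "good_word x (upword (least_word ss) u) \<and> loop_stable ?n x u"
    using check_iff[OF u0(1)] d(2) by blast
  then have "good_word x (upword (unblock ?bs) u)" "valid_word ?n x (\<lambda>i. int (e' i)) (upword (unblock ?bs) u)"
    using good_word_instance(1)[OF desc_blocks_instance[OF ss, of ?n u e'] u0(1)] valid_word_instance[of ss x u ?n e'] ss u sat
    by simp_all
  moreover have "valid_word ?n x (\<lambda>i. int (e i)) w \<longleftrightarrow> valid_word ?n x (\<lambda>i. int (e' i)) w" for w
    by (rule valid_word_cong) (simp add: e')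
  ultimately show ?thesis
    by blast
qed

lemma good_word_imp_final_form:
  assumes bs: "length bs \<le> block_bound x" "\<forall>b \<in> set bs. fst b \<noteq> [] \<and> length (fst b) \<le> x \<and> snd b \<noteq> 0"
    and u: "u \<noteq> []" "length u \<le> x"
    and good: "good_word x (upword (unblock bs) u)" and valid: "valid_word (arg 0 x) x (\<lambda>i. int (e i)) (upword (unblock bs) u)"
  shows "pf_sat e (final_form x)"
proof -
  let ?n = "arg 0 x"
  have in_steps: "set (unblock bs @ u) \<subseteq> set (steps x)"
    using good unfolding good_word_upword[OF u(1)] by blast
  \<comment> \<open>A positive exponent puts every step of the block into the word, where
    \<open>good_word\<close> vouches for it.\<close>
  have words: "fst b \<in> set (word_lists x)" if "b \<in> set bs" for b
  proof -
    have "snd b \<noteq> 0"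
      using bs(2) that by blast
    then obtain m where "snd b = Suc m"
      by (cases "snd b") simp_all
    then have "set (fst b) \<subseteq> set (pow (snd b) (fst b))"
      by (simp add: pow_Suc)
    also have "\<dots> \<subseteq> set (unblock bs)"
      using that unfolding unblock_def by auto
    finally show ?thesis
      using in_steps bs(2) that unfolding word_lists by auto
  qed
  have u_word: "u \<in> set (word_lists x)"
    using u in_steps by (simp add: word_lists)
  \<comment> \<open>Descriptors count from exponent 1, hence the predecessor.\<close>
  have "\<exists>d j. d \<in> set (exps x) \<and> snd b - 1 = fst d + snd d * j" for b :: "sstep list \<times> nat"
    by (rule exps_cover)
  then obtain d j where dj: "\<And>b :: sstep list \<times> nat. d b \<in> set (exps x)" "\<And>b :: sstep list \<times> nat. snd b - 1 = fst (d b) + snd (d b) * j b"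
    by metis
  define ss where "ss = map (\<lambda>b. (fst b, d b)) bs"
  \<comment> \<open>The variable of each block receives the multiplicity of its period; everything
    else, in particular the counters, keeps its value.\<close>
  define e' where "e' y = (if ?n \<le> y \<and> y < ?n + length bs then j (bs ! (y - ?n)) else e y)" for y
  have ss: "\<forall>d \<in> set ss. fst d \<in> set (word_lists x) \<and> snd d \<in> set (exps x)" "length ss = length bs"
    using words dj by (auto simp: ss_def)
  have blocks: "desc_blocks ?n (ss @ [(u, 0, 0)]) e' (length ss) = bs"
  proof (rule nth_equalityI)
    fix k
    assume "k < length (desc_blocks ?n (ss @ [(u, 0, 0)]) e' (length ss))"
    then have k: "k < length bs"
      by (simp add: desc_blocks_def ss(2))
    then have seg: "nth_opt ([], 0, 0) (ss @ [(u, 0, 0)]) k = (fst (bs ! k), d (bs ! k))"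
      by (simp add: nth_opt_def nth_append ss(2)) (simp add: ss_def)
    have "snd (bs ! k) \<noteq> 0"
      using bs(2) k by simp
    then have "Suc (fst (d (bs ! k)) + snd (d (bs ! k)) * j (bs ! k)) = snd (bs ! k)"
      using dj(2)[of "bs ! k"] by simp
    then show "desc_blocks ?n (ss @ [(u, 0, 0)]) e' (length ss) ! k = bs ! k"
      using k by (simp add: desc_blocks_def seg_word_def seg_times_def seg_base_def seg_period_def seg e'_def ss(2) prod_eq_iff)
  qed (simp add: desc_blocks_def ss(2))
  have "valid_word ?n x (\<lambda>i. int (e' i)) (upword (unblock bs) u)"
    using valid valid_word_cong[of ?n "\<lambda>i. int (e i)" "\<lambda>i. int (e' i)"] by (simp add: e'_def)
  then have sat: "pf_sat e' (desc_form ?n x (ss @ [(u, 0, 0)])) \<and> loop_stable ?n x u"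
    using valid_word_instance[of ss x u ?n e'] ss(1) u_word unfolding blocks by blast
  have inst: "list_all2 (instance_of x) ss bs"
    using desc_blocks_instance[OF ss(1), of ?n u e'] unfolding blocks .
  have "set (least_word ss @ u) \<subseteq> set (steps x)"
    using in_steps good_word_instance(2)[OF inst u(1)] by simp
  then have "check x (ss, u)"
    using check_iff[OF u(1)] good sat unfolding good_word_instance(1)[OF inst u(1)] by blast
  moreover have "(ss, u) \<in> set (descs x)"
    unfolding descs using ss u_word bs(1) by simp
  moreover have "e' y = e y" if "y \<notin> {?n..<?n + Suc (block_bound x)}" for y
    using that bs(1) by (auto simp: e'_def)
  ultimately show ?thesis
    unfolding pf_sat_final_form using sat by (intro exI[of _ e'] exI[of _ ss] exI[of _ u]) simp
qed

lemma inj_bform_code: "inj c \<Longrightarrow> bform_code c f = bform_code c g \<longleftrightarrow> f = g"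
  by (induction f arbitrary: g; case_tac g) (auto simp: list_encode_eq inj_eq simp del: list_encode.simps)

text \<open>Needed to bound the number of transitions by the number of codes below
  \<open>x\<close>.\<close>

lemma inj_trans_code: "inj trans_code"
proof -
  have "aguard_code g = aguard_code h \<longleftrightarrow> g = h" for g h
    using atom_code_eq_iff[of "Grd g" "Grd h"] by (simp add: list_encode_eq del: list_encode.simps)
  then have "inj aguard_code"
    by (simp add: inj_def)
  moreover have "vec_code u = vec_code u' \<longleftrightarrow> u = u'" for u u'
    by (simp add: vec_code_def list_encode_eq inj_map_eq_map inj_int_encode)
  ultimately show ?thesis
    by (auto simp: inj_def trans_code_def list_encode_eq inj_bform_code simp del: list_encode.simps)
qed

context input
begin

lemma card_trans: "card (cs_trans S) \<le> x"
proof -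
  have "trans_code ` cs_trans S \<subseteq> {..<x}"
    using trans_code_less by auto
  then have "card (trans_code ` cs_trans S) \<le> x"
    using card_mono[of "{..<x}"] by simp
  then show ?thesis
    using card_image[OF inj_on_subset[OF inj_trans_code subset_UNIV]] by simp
qed

lemma card_states: "card (cs_states S) \<le> x"
proof -
  have "p < x" if "p \<in> cs_states S" for p
  proof -
    have "p < set_code id (cs_states S)"
      using that finites by (intro set_decode_less) simp
    also have "\<dots> < system_code Al S"
      by (simp add: system_code_def less_list_encode del: list_encode.simps)
    finally show ?thesis
      using codes_less by simp
  qed
  then have "cs_states S \<subseteq> {..<x}"
    by auto
  then show ?thesis
    using card_mono[of "{..<x}"] by simp
qed

text \<open>Flatness enters here: through \<open>flat_run_blocks\<close> it guarantees that the
  blocks of the annotated run fit into \<open>block_bound x\<close>.\<close>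

lemma run_imp_final_form:
  assumes "is_run n S (q, v) \<rho>" "run_sat S Al \<rho> A"
  shows "presburger_sat v (final_form x)"
proof -
  let ?y = "\<lambda>i. int (v ! i)"
  obtain \<tau> where \<tau>: "\<And>i. \<tau> i \<in> cs_trans S" "\<And>i. tgt (\<tau> i) = src (\<tau> (Suc i))"
    and good: "good_word x (annotate_word n x ?y (\<lambda>i. trans_code (\<tau> i)))"
    and valid: "valid_word n x ?y (annotate_word n x ?y (\<lambda>i. trans_code (\<tau> i)))"
    using run_imp_good_word[OF assms, of ?y] by blast
  obtain bs u where bs: "\<tau> = upword (unblock bs) u" "length bs \<le> 2 * card (cs_states S)" "u \<noteq> []"
      "length u \<le> card (cs_trans S)" "\<forall>b \<in> set bs. fst b \<noteq> [] \<and> length (fst b) \<le> card (cs_trans S)"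
    using flat_run_blocks[where S = S and \<tau> = \<tau> and Q = "cs_states S", OF S(2) finites(2) transD(1) \<tau> finites(1) transD(1)[OF \<tau>(1)]]
    by blast
  let ?bs = "map (\<lambda>b. (map trans_code (fst b), snd b)) bs"
  have "trans_code (\<tau> i) = upword (unblock ?bs) (map trans_code u) i" for i
    unfolding bs(1) upword_map[OF bs(3), of trans_code] map_unblock unfolding unblock_def ..
  then have eq: "annotate_word n x ?y (\<lambda>i. trans_code (\<tau> i)) = annotate_word n x ?y (upword (unblock ?bs) (map trans_code u))"
    by simp
  have "map trans_code u \<noteq> []" "length (map trans_code u) \<le> x" "\<forall>b \<in> set ?bs. fst b \<noteq> [] \<and> length (fst b) \<le> x"
    using bs card_trans by auto
  from annotate_blocks[OF this, of n x ?y] obtain bs' u' where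
    bs': "annotate_word n x ?y (upword (unblock ?bs) (map trans_code u)) = upword (unblock bs') u'" "u' \<noteq> []" "length u' \<le> x"
      "length bs' \<le> Suc (length ?bs) * Suc (2 * x * x)" "\<forall>b \<in> set bs'. fst b \<noteq> [] \<and> length (fst b) \<le> x \<and> snd b \<noteq> 0"
    by blast
  have "Suc (length ?bs) * Suc (2 * x * x) \<le> block_bound x"
    unfolding block_bound_def using bs(2) card_states by (intro mult_right_mono) simp_all
  then show ?thesis
    unfolding presburger_sat_def
    using good_word_imp_final_form[of bs' x u' "\<lambda>i. v ! i"] bs' good valid unfolding eq args by simp
qed

lemma final_form_imp_run:
  assumes "presburger_sat v (final_form x)" "length v = n"
  shows "\<exists>\<rho>. is_run n S (q, v) \<rho> \<and> run_sat S Al \<rho> A"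
proof -
  obtain w where "good_word x w" "valid_word n x (\<lambda>i. int (v ! i)) w"
    using final_form_imp_good_word[of "\<lambda>i. v ! i" x] assms(1) unfolding presburger_sat_def args by blast
  then show ?thesis
    using good_word_imp_run[of w "\<lambda>i. int (v ! i)" v] assms(2) by blast
qed

end

section \<open>Computability of the final formula\<close>

lemma computable_aguard_holds: "computable aguard_holds"
  unfolding aguard_holds_def rel_holds_def by (intro comp)

lemma computable_set_enc [comp]: "computable l \<Longrightarrow> computable (\<lambda>x. set_enc (l x))"
  unfolding set_enc_def by (intro comp)

lemma computable_step_atoms [comp]:
  assumes "computable x" "computable s"
  shows "computable (\<lambda>p. step_atoms (x p) (s p))"
  unfolding step_atoms_def
  by (intro comp assms assms[THEN computable_compose] computable_compose[OF computable_aguard_holds])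

lemma computable_letter_of [comp]:
  assumes "computable x" "computable s"
  shows "computable (\<lambda>p. letter_of (x p) (s p))"
  unfolding letter_of_def by (intro comp assms)

lemma computable_step_fine [comp]:
  assumes "computable x" "computable s"
  shows "computable (\<lambda>p. step_fine (x p) (s p))"
  unfolding step_fine_def by (intro comp assms computable_bform_eval computable_aguard_holds)

lemma computable_steps [comp]:
  assumes "computable x"
  shows "computable (\<lambda>p. steps (x p))"
  unfolding steps_def by (intro comp assms)

lemma computable_letter_bound [comp]:
  assumes "computable x"
  shows "computable (\<lambda>p. letter_bound (x p))"
  unfolding letter_bound_def by (intro comp assms)

lemma computable_spec_index [comp]:
  assumes "computable x"
  shows "computable (\<lambda>p. spec_index (x p))"
  unfolding spec_index_def by (intro comp assms)

lemma computable_exps [comp]: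
  assumes "computable x"
  shows "computable (\<lambda>p. exps (x p))"
  unfolding exps_def by (intro comp assms assms[THEN computable_compose])

lemma computable_word_lists [comp]:
  assumes "computable x"
  shows "computable (\<lambda>p. word_lists (x p))"
  unfolding word_lists_def by (intro comp assms assms[THEN computable_compose])

lemma computable_block_bound [comp]:
  assumes "computable x"
  shows "computable (\<lambda>p. block_bound (x p))"
  unfolding block_bound_def by (intro comp assms)

lemma computable_descs [comp]:
  assumes "computable x"
  shows "computable (\<lambda>p. descs (x p))"
  unfolding descs_def by (intro comp assms assms[THEN computable_compose])

lemma computable_unblock [comp]:
  assumes "computable bs"
  shows "computable (\<lambda>p. unblock (bs p))"
  unfolding unblock_def by (intro comp assms)

lemma computable_least_word [comp]:
  assumes "computable ss"
  shows "computable (\<lambda>p. least_word (ss p))"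
  unfolding least_word_def by (intro comp assms)

lemma computable_sign_stable [comp]:
  assumes "computable s" "computable d"
  shows "computable (\<lambda>p. sign_stable (s p) (d p))"
  \<comment> \<open>Integer equality is replaced by two inequalities, whose computability is
    known.\<close>
  unfolding sign_stable_def order.eq_iff[of "_ :: int"] by (intro comp assms)

lemma computable_loop_stable [comp]:
  assumes "computable n" "computable x" "computable u"
  shows "computable (\<lambda>p. loop_stable (n p) (x p) (u p))"
  unfolding loop_stable_def by (intro comp assms assms[THEN computable_compose])

lemma computable_check [comp]:
  assumes "computable x" "computable d"
  shows "computable (\<lambda>p. check (x p) (d p))"
  unfolding check_def Let_def by (intro comp assms assms[THEN computable_compose])

lemma computable_final_form: "computable final_form"
  unfolding final_form_def by (intro comp)

text \<open>The function constructed is the same for every \<open>L\<close>, since the code of a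
  specification carries a tag for its language.\<close>

theorem corollary16:
  fixes L :: language
  shows "\<exists>f. general_recursive 1 f \<and>
    (\<forall>n S q Al A.
       is_counter_system n S \<and> flat S \<and> q \<in> cs_states S \<and>
       is_calphabet n Al \<and> A \<in> specifications L Al \<longrightarrow>
       (\<exists>\<phi>. f [input_code n S q Al A] = pform_code \<phi> \<and>
            existential_presburger \<phi> \<and> pf_fv \<phi> \<subseteq> {..<n} \<and>
            (\<forall>v :: nat list. length v = n \<longrightarrow>
               (presburger_sat v \<phi> \<longleftrightarrow>
                (\<exists>\<rho>. is_run n S (q, v) \<rho> \<and> run_sat S Al \<rho> A)))))"
proof -
  obtain f where f: "general_recursive 1 f" "\<And>x. f [x] = pform_code (final_form x)"
  proof -
    obtain g where g: "recursive_fun 1 g" "\<And>x. g [x] = pform_code (final_form x)"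
      using computable_final_form unfolding computable_def enc_nat_def enc_pform_def by blast
    then obtain f where "general_recursive 1 f" "\<And>xs. length xs = 1 \<Longrightarrow> f xs = g xs"
      unfolding recursive_fun_def by blast
    then show ?thesis
      using that[of f] g(2) by simp
  qed
  show ?thesis
  proof (intro exI[of _ f] conjI f(1) allI impI)
    fix n S q Al A
    assume *: "is_counter_system n S \<and> flat S \<and> q \<in> cs_states S \<and> is_calphabet n Al \<and> A \<in> specifications L Al"
    let ?x = "input_code n S q Al A"
    have "input n S q Al A L ?x"
      using * unfolding input_def by blast
    then interpret input n S q Al A L ?x .
    show "\<exists>\<phi>. f [?x] = pform_code \<phi> \<and> existential_presburger \<phi> \<and> pf_fv \<phi> \<subseteq> {..<n} \<and>
        (\<forall>v :: nat list. length v = n \<longrightarrow>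
           (presburger_sat v \<phi> \<longleftrightarrow> (\<exists>\<rho>. is_run n S (q, v) \<rho> \<and> run_sat S Al \<rho> A)))"
    proof (intro exI[of _ "final_form ?x"] conjI allI impI iffI)
      show "pf_fv (final_form ?x) \<subseteq> {..<n}"
        using final_form_vars[of ?x] unfolding args .
    next
      fix v :: "nat list"
      assume "presburger_sat v (final_form ?x)" "length v = n"
      then show "\<exists>\<rho>. is_run n S (q, v) \<rho> \<and> run_sat S Al \<rho> A"
        by (rule final_form_imp_run)
    next
      fix v :: "nat list"
      assume "\<exists>\<rho>. is_run n S (q, v) \<rho> \<and> run_sat S Al \<rho> A"
      then show "presburger_sat v (final_form ?x)"
        using run_imp_final_form by blast
    qed (rule f(2) existential_final_form)+
  qed
qed

end
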